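(* The following assignment, with the central element $c$ acting as $1$, defines a $\mathrm{DY}_\hbar(\mathfrak o_{2n+1})$-module structure on the Fock space $\mathcal F$ described in the context. For $1\le j\le n-2$, $$E_j(u)\mapsto \exp\Big[\sum_{k>0}\tfrac{a_{j,-k}}k\{(u-\tfrac14\hbar)^k+(u+\tfrac34\hbar)^k\}-\sum_{k>0}\tfrac{a_{j+1,-k}+a_{j-1,-k}}k(u+\tfrac14\hbar)^k\Big]\exp\Big[-\sum_{k>0}\tfrac{a_{j,k}}k(u-\tfrac14\hbar)^{-k}\Big]e^{\alpha_j}[(-1)^{j-1}(u-\tfrac14\hbar)]^{\partial\alpha_j},$$ $$F_j(u)\mapsto \exp\Big[-\sum_{k>0}\tfrac{a_{j,-k}}k\{(u+\tfrac14\hbar)^k+(u-\tfrac34\hbar)^k\}+\sum_{k>0}\tfrac{a_{j+1,-k}+a_{j-1,-k}}k(u-\tfrac14\hbar)^k\Big]\exp\Big[\sum_{k>0}\tfrac{a_{j,k}}k(u+\tfrac14\hbar)^{-k}\Big]e^{-\alpha_j}[(-1)^{j-1}(u+\tfrac14\hbar)]^{-\partial\alpha_j},$$ $$H_j^+(u)\mapsto \exp\Big[-\sum_{k>0}\tfrac{a_{j,k}}k\{(u-\tfrac12\hbar)^{-k}-(u+\tfrac12\hbar)^{-k}\}\Big]\Big(\tfrac{u+\frac12\hbar}{u-\frac12\hbar}\Big)^{-\partial\alpha_j},$$ $$H_j^-(u)\mapsto \exp\Big[-\sum_{k>0}\tfrac{a_{j,-k}}k\{(u-\hbar)^k-(u+\hbar)^k\}+\sum_{k>0}\tfrac{a_{j+1,-k}+a_{j-1,-k}}k\{(u-\tfrac12\hbar)^k-(u+\tfrac12\hbar)^k\}\Big];$$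 further $$E_{n-1}(u)\mapsto \exp\Big[\sum_{k>0}\tfrac{a_{n-1,-k}}k\{(u-\tfrac14\hbar)^k+(u+\tfrac34\hbar)^k\}-\sum_{k>0}\tfrac{a_{n-2,-k}+a_{n,-k}}k(u+\tfrac14\hbar)^k\Big]\exp\Big[-\sum_{k>0}\tfrac{a_{n-1,k}}k(u-\tfrac14\hbar)^{-k}\Big]e^{\alpha_{n-1}}[(-1)^{n-2}(u-\tfrac14\hbar)]^{\partial\alpha_{n-1}+\partial\beta_1},$$ $$F_{n-1}(u)\mapsto \exp\Big[-\sum_{k>0}\tfrac{a_{n-1,-k}}k\{(u+\tfrac14\hbar)^k+(u-\tfrac34\hbar)^k\}+\sum_{k>0}\tfrac{a_{n-2,-k}+a_{n,-k}}k(u-\tfrac14\hbar)^k\Big]\exp\Big[\sum_{k>0}\tfrac{a_{n-1,k}}k(u+\tfrac14\hbar)^{-k}\Big]e^{-\alpha_{n-1}}[(-1)^{n-2}(u+\tfrac14\hbar)]^{-\partial\alpha_{n-1}-\partial\beta_1},$$ $$E_n(u)\mapsto \exp\Big[-\sum_{k>0}\tfrac{a_{n-1,-k}}k(u+\tfrac14\hbar)^k+\sum_{k>0}\tfrac{a_{n+1,-k}}k\{(u-\tfrac14\hbar)^k+(u+\tfrac34\hbar)^k\}+\sum_{k>0}\tfrac{a_{n+2,-k}}k\{(u-\tfrac34\hbar)^k+(u+\tfrac34\hbar)^k\}\Big]$$ $$\cdot\exp\Big[-\sum_{k>0}\tfrac{a_{n,k}+a_{n+1,k}}k(u-\tfrac14\hbar)^{-k}-\sum_{k>0}\tfrac{a_{n+2,k}}k(u+\tfrac14\hbar)^{-k}\Big]e^{-\beta_1}[(-1)^{n-1}(u-\tfrac14\hbar)]^{\partial\alpha_n}e^{\beta_2+\beta_3}(u-\tfrac14\hbar)^{\partial\beta_2}(u+\tfrac14\hbar)^{\partial\beta_3},$$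 $$F_n(u)\mapsto \exp\Big[\sum_{k>0}\tfrac{a_{n-1,-k}}k(u-\tfrac14\hbar)^k-\sum_{k>0}\tfrac{a_{n+1,-k}}k\{(u+\tfrac14\hbar)^k+(u-\tfrac34\hbar)^k\}-\sum_{k>0}\tfrac{a_{n+3,-k}}k\{(u-\tfrac34\hbar)^k+(u+\tfrac34\hbar)^k\}\Big]$$ $$\cdot\exp\Big[\sum_{k>0}\tfrac{a_{n,k}+a_{n+1,k}}k(u+\tfrac14\hbar)^{-k}+\sum_{k>0}\tfrac{a_{n+3,k}}k(u-\tfrac14\hbar)^{-k}\Big]e^{\beta_1}[(-1)^{n-1}(u+\tfrac14\hbar)]^{-\partial\alpha_n}e^{-\beta_2+\beta_4}(u+\tfrac14\hbar)^{-\partial\beta_2}(u-\tfrac14\hbar)^{\partial\beta_4},$$ $$H_{n-1}^+(u)\mapsto \exp\Big[-\sum_{k>0}\tfrac{a_{n-1,k}}k\{(u-\tfrac12\hbar)^{-k}-(u+\tfrac12\hbar)^{-k}\}\Big]\Big(\tfrac{u+\frac12\hbar}{u-\frac12\hbar}\Big)^{-\partial\alpha_{n-1}-\partial\beta_1},$$ $$H_{n-1}^-(u)\mapsto \exp\Big[-\sum_{k>0}\tfrac{a_{n-1,-k}}k\{(u-\hbar)^k-(u+\hbar)^k\}+\sum_{k>0}\tfrac{a_{n-2,-k}+a_{n,-k}}k\{(u-\tfrac12\hbar)^k-(u+\tfrac12\hbar)^k\}\Big],$$ $$H_n^+(u)\mapsto \exp\Big[\sum_{k>0}\tfrac{a_{n+2,-k}}k\{(u-\hbar)^k+(u+\tfrac12\hbar)^k\}-\sum_{k>0}\tfrac{a_{n+3,-k}}k\{(u+\hbar)^k+(u-\tfrac12\hbar)^k\}\Big]$$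 $$\cdot\exp\Big[\sum_{k>0}\tfrac{a_{n,k}+a_{n+1,k}}k\{(u+\tfrac12\hbar)^{-k}-(u-\tfrac12\hbar)^{-k}\}+\sum_{k>0}\tfrac{a_{n+3,k}-a_{n+2,k}}ku^{-k}\Big]\Big(\tfrac{u+\frac12\hbar}{u-\frac12\hbar}\Big)^{-\partial\alpha_n-\partial\beta_2}e^{\beta_3+\beta_4}u^{\partial\beta_3+\partial\beta_4},$$ $$H_n^-(u)\mapsto \exp\Big[\sum_{k>0}\tfrac{a_{n-1,-k}}k\{(u-\tfrac12\hbar)^k-(u+\tfrac12\hbar)^k\}-\sum_{k>0}\tfrac{a_{n+1,-k}}k\{(u-\hbar)^k-(u+\hbar)^k\}$$ $$+\sum_{k>0}\tfrac{a_{n+2,-k}}k\{(u-\tfrac12\hbar)^k+(u+\hbar)^k\}-\sum_{k>0}\tfrac{a_{n+3,-k}}k\{(u+\tfrac12\hbar)^k+(u-\hbar)^k\}\Big]$$ $$\cdot\exp\Big[-\sum_{k>0}\tfrac{a_{n+2,k}}k(u+\tfrac12\hbar)^{-k}+\sum_{k>0}\tfrac{a_{n+3,k}}k(u-\tfrac12\hbar)^{-k}\Big]e^{\beta_3+\beta_4}(u+\tfrac12\hbar)^{\partial\beta_3}(u-\tfrac12\hbar)^{\partial\beta_4}.$$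
   Context: $\mathcal A=\mathbb C[[\hbar]]$, $n\ge2$. Bosons $a_{i,k}$ ($k\in\mathbb Z\setminus\{0\}$) satisfy $[a_{i,k},a_{j,l}]=k\delta_{ij}\delta_{k+l,0}$; set $a_{0,k}=0$. Let $\epsilon_1,\dots,\epsilon_{n+4}$ be orthonormal, $\alpha_j=\epsilon_j-\epsilon_{j+1}$ ($1\le j\le n-1$), $\alpha_n=\epsilon_n$, $\beta_1=\epsilon_{n+1}$, $\beta_i=\sqrt2\,\epsilon_{n+i}$ ($i=2,3,4$), $Q=\bigoplus_{i=1}^n\mathbb Z\alpha_i\oplus\bigoplus_{j=1}^4\mathbb Z\beta_j$. The Fock space is the $\hbar$-adically completed tensor product $\mathcal F=\mathcal A[a_{j,-k}\ (1\le j\le n+3,\ k>0)]\,\widetilde\otimes\,\mathcal A[Q]$, $\mathcal A[Q]$ being the group algebra with basis $e^\beta$. Operators: $a_{i,k}(f\otimes e^\beta)=a_{i,k}f\otimes e^\beta$ for $k<0$ and $[a_{i,k},f]\otimes e^\beta$ for $k>0$; $\partial\epsilon_j(f\otimes e^\beta)=(\epsilon_j,\beta)f\otimes e^\beta$ and $e^{\epsilon_j}(f\otimes e^\beta)=f\otimes e^{\epsilon_j+\beta}$, extended so that $\partial\gamma$ acts by $(\gamma,\beta)$ and $e^\gamma$ by $e^\beta\mapsto e^{\gamma+\beta}$ for $\gamma\in Q$. Negative powers $(u+a\hbar)^{-k}$ are expanded in powers of $\hbar$. $\mathrm{DY}_\hbar(\mathfrak o_{2n+1})$ is the $\mathcal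 A$-algebra topologically generated by $h_{ir},\xi^\pm_{ir}$ ($1\le i\le n$, $r\in\mathbb Z$) and a central $c$; with $H_i^+(u)=1+\hbar\sum_{r\ge0}h_{ir}u^{-r-1}$, $H_i^-(u)=1-\hbar\sum_{r\ge1}h_{i,-r}u^{r-1}$, $E_i(u)=\sum_{r\in\mathbb Z}\xi^+_{ir}u^{-r-1}$, $F_i(u)=\sum_{r\in\mathbb Z}\xi^-_{ir}u^{-r-1}$, $u_\pm=u\pm\frac14\hbar c$, $\delta(u-v)=\sum_{k\in\mathbb Z}u^{-k-1}v^k$, $B_{ij}=\frac12(\alpha_i,\alpha_j)$, $(a_{ij})$ the Cartan matrix of type $B_n$, the relations are: $[H_i^\pm(u),H_j^\pm(v)]=0$; $(u_\pm-v_\mp-B_{ij}\hbar)(u_\mp-v_\pm+B_{ij}\hbar)H_i^\pm(u)H_j^\mp(v)=(u_\pm-v_\mp+B_{ij}\hbar)(u_\mp-v_\pm-B_{ij}\hbar)H_j^\mp(v)H_i^\pm(u)$; $H_i^\pm(u)^{-1}E_j(v)H_i^\pm(u)=\frac{u_\mp-v+B_{ij}\hbar}{u_\mp-v-B_{ij}\hbar}E_j(v)$; $H_i^\pm(u)F_j(v)H_i^\pm(u)^{-1}=\frac{u_\pm-v+B_{ij}\hbar}{u_\pm-v-B_{ij}\hbar}F_j(v)$; $(u-v+B_{ij}\hbar)E_i(u)E_j(v)=(u-v-B_{ij}\hbar)E_j(v)E_i(u)$; $(u-v-B_{ij}\hbar)F_i(u)F_j(v)=(u-v+B_{ij}\hbar)F_j(v)F_i(u)$;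 $\sum_{\sigma\in\mathfrak S_m}[E_i(u_{\sigma(1)}),\cdots,[E_i(u_{\sigma(m)}),E_j(v)]\cdots]=0$ and likewise for $F$, for $i\ne j$, $m=1-a_{ij}$; $[E_i(u),F_j(v)]=\frac1\hbar\delta_{ij}\{\delta(u_--v_+)H_i^-(v_+)-\delta(u_+-v_-)H_i^+(u_+)\}$.
   Formalization: The given H_n^±(u) contain e^{β_3+β_4}, so they cannot have the form 1+ħ(…); H_n^± are taken as plain operator series, the normalization defining h_{ir} is claimed only for i<n, and the H–E, H–F relations are stated without inverses (EH=gHE, HF=gFH). *)

theory Defs
  imports
    Complex_Main
    "HOL-Library.Function_Algebras"
    "HOL-Library.Product_Plus"
    "HOL-Library.Groups_Big_Fun"
    "HOL-Library.Poly_Mapping"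
    "HOL-Combinatorics.Permutations"
    "HOL-Computational_Algebra.Formal_Power_Series"
begin

section \<open>The lattice\<close>

text \<open>Vectors in the span of $\epsilon_1,\dots,\epsilon_{n+4}$ are given by their coordinates.\<close>

type_synonym vec = "nat \<Rightarrow> real"

definition ip :: "nat \<Rightarrow> vec \<Rightarrow> vec \<Rightarrow> real" where
  "ip n x y = (\<Sum>k = 1..n + 4. x k * y k)"

definition eps :: "nat \<Rightarrow> vec" where
  "eps j = (\<lambda>k. if k = j then 1 else 0)"

definition alpha :: "nat \<Rightarrow> nat \<Rightarrow> vec" where
  "alpha n j = (if j < n then eps j - eps (j + 1) else eps n)"

definition beta :: "nat \<Rightarrow> nat \<Rightarrow> vec" where
  "beta n j = (if j = 1 then eps (n + 1) else (\<lambda>k. sqrt 2 * eps (n + j) k))"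

definition Q :: "nat \<Rightarrow> vec set" where
  "Q n = {(\<lambda>k. (\<Sum>i = 1..n. of_int (a i) * alpha n i k) + (\<Sum>j = 1..4. of_int (b j) * beta n j k))
          | (a :: nat \<Rightarrow> int) (b :: nat \<Rightarrow> int). True}"

text \<open>$B_{ij}=\frac12(\alpha_i,\alpha_j)$, and the Cartan matrix of type $B_n$ with
  $a_{ij}=2(\alpha_i,\alpha_j)/(\alpha_i,\alpha_i)$; the short root is $\alpha_n$, so
  $a_{n,n-1}=-2$ and $a_{n-1,n}=-1$.\<close>

definition B :: "nat \<Rightarrow> nat \<Rightarrow> nat \<Rightarrow> complex" where
  "B n i j = of_real (ip n (alpha n i) (alpha n j) / 2)"

definition cartan :: "nat \<Rightarrow> nat \<Rightarrow> nat \<Rightarrow> int" where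
  "cartan n i j =
    (if i = j then 2
     else if j = i + 1 \<or> i = j + 1 then (if i = n then -2 else -1)
     else 0)"


section \<open>The Fock space\<close>

text \<open>A basis element is a monomial in the $a_{i,-k}$ (the exponent of $a_{i,-k}$ is the value at
  \<open>(i, k)\<close>) paired with the exponent $\beta$ of $e^\beta$.  Poly_Mapping makes the finite
  combinations of basis elements into the commutative ring
  $\mathbb C[a_{i,-k}]\otimes\mathbb C[\beta]$, and the $\hbar$-adic completion of
  $\mathcal A[a_{i,-k}]\otimes\mathcal A[\beta]$ is the ring of power series in $\hbar$ over it:
  modulo each power of $\hbar$ an element is a finite combination.\<close>

type_synonym basis = "((nat \<times> nat) \<Rightarrow>\<^sub>0 nat) \<times> vec"
type_synonym fock = "(basis \<Rightarrow>\<^sub>0 complex) fps"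

definition Fock :: "nat \<Rightarrow> fock set" where
  "Fock n = {f. \<forall>N. \<forall>(m, \<beta>) \<in> Poly_Mapping.keys (fps_nth f N).
      (\<forall>(i, k) \<in> Poly_Mapping.keys m. 1 \<le> i \<and> i \<le> n + 3 \<and> k > 0) \<and> \<beta> \<in> Q n}"

definition scal :: "complex fps \<Rightarrow> fock \<Rightarrow> fock" where
  "scal c f = Abs_fps (\<lambda>N. Poly_Mapping.single 0 (fps_nth c N)) * f"

text \<open>Sums in the $\hbar$-adic topology: each coefficient of $\hbar^N$ is a finite sum.
  (\<open>Sum_any\<close> is 0 if infinitely many terms are nonzero.)\<close>

definition hsummable :: "('i \<Rightarrow> fock) \<Rightarrow> bool" where
  "hsummable g \<longleftrightarrow> (\<forall>N. finite {i. fps_nth (g i) N \<noteq> 0})"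

definition hsum :: "('i \<Rightarrow> fock) \<Rightarrow> fock" where
  "hsum g = Abs_fps (\<lambda>N. Sum_any (\<lambda>i. fps_nth (g i) N))"

definition A_endo :: "fock set \<Rightarrow> (fock \<Rightarrow> fock) \<Rightarrow> bool" where
  "A_endo S T \<longleftrightarrow> (\<forall>f\<in>S. T f \<in> S) \<and> (\<forall>f\<in>S. \<forall>g\<in>S. T (f + g) = T f + T g) \<and>
     (\<forall>c. \<forall>f\<in>S. T (scal c f) = scal c (T f))"

text \<open>For $k>0$ the operator $a_{i,k}$ is $[a_{i,k},\cdot]$, that is, the derivation
  $k\,\partial/\partial a_{i,-k}$.\<close>

definition boson_deriv :: "nat \<Rightarrow> nat \<Rightarrow> (basis \<Rightarrow>\<^sub>0 complex) \<Rightarrow> (basis \<Rightarrow>\<^sub>0 complex)" where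
  "boson_deriv i k x = (\<Sum>(m, \<beta>) \<in> Poly_Mapping.keys x.
     Poly_Mapping.single (m - Poly_Mapping.single (i, k) 1, \<beta>)
       (of_nat k * of_nat (Poly_Mapping.lookup m (i, k)) * Poly_Mapping.lookup x (m, \<beta>)))"

definition boson :: "nat \<Rightarrow> int \<Rightarrow> fock \<Rightarrow> fock" where
  "boson i k f =
    (if i = 0 \<or> k = 0 then 0
     else if k < 0 then
       fps_const (Poly_Mapping.single (Poly_Mapping.single (i, nat (- k)) 1, 0) 1) * f
     else Abs_fps (\<lambda>N. boson_deriv i (nat k) (fps_nth f N)))"

definition exp_lat :: "vec \<Rightarrow> fock \<Rightarrow> fock" where
  "exp_lat \<gamma> f = fps_const (Poly_Mapping.single (0, \<gamma>) 1) * f"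

text \<open>The $\mathcal A$-linear operator $f\otimes e^\beta\mapsto g(\beta)\,f\otimes e^\beta$.\<close>

definition diag :: "(vec \<Rightarrow> complex fps) \<Rightarrow> fock \<Rightarrow> fock" where
  "diag g f = Abs_fps (\<lambda>N. \<Sum>q\<le>N. \<Sum>b \<in> Poly_Mapping.keys (fps_nth f (N - q)).
     Poly_Mapping.single b (fps_nth (g (snd b)) q * Poly_Mapping.lookup (fps_nth f (N - q)) b))"


section \<open>Operator-valued formal series\<close>

text \<open>\<open>X p\<close> is the coefficient of $u^p$ in $X(u)$.  Sums and differences of series are those of
  Function_Algebras; the product of series in the same variable is \<open>\<star>\<close>.\<close>

type_synonym series = "int \<Rightarrow> fock \<Rightarrow> fock"

definition smult :: "series \<Rightarrow> series \<Rightarrow> series"  (infixr "\<star>" 70) where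
  "(X \<star> Y) p f = hsum (\<lambda>s :: int. X s (Y (p - s) f))"

definition const_series :: "(fock \<Rightarrow> fock) \<Rightarrow> series" where
  "const_series T p f = (if p = 0 then T f else 0)"

primrec spow :: "series \<Rightarrow> nat \<Rightarrow> series" where
  "spow X 0 = const_series id"
| "spow X (Suc m) = X \<star> spow X m"

definition sexp :: "series \<Rightarrow> series" where
  "sexp X p f = hsum (\<lambda>m. scal (fps_const (1 / fact m)) (spow X m p f))"

text \<open>The coefficient of $u^p$ in $(u+a\hbar)^k$, $k\in\mathbb Z$, expanded in powers of $\hbar$.\<close>

definition upow :: "complex \<Rightarrow> int \<Rightarrow> int \<Rightarrow> complex fps" where
  "upow a k p =
    (if p \<le> k then fps_const ((of_int k gchoose nat (k - p)) * a ^ nat (k - p)) * fps_X ^ nat (k - p)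
     else 0)"

text \<open>\<open>cr i a\<close> is $\sum_{k>0}\frac{a_{i,-k}}k(u+a\hbar)^k$ and
  \<open>an i a\<close> is $\sum_{k>0}\frac{a_{i,k}}k(u+a\hbar)^{-k}$.\<close>

definition cr :: "nat \<Rightarrow> complex \<Rightarrow> series" where
  "cr i a p f = hsum (\<lambda>k :: nat. if k = 0 then 0
     else scal (fps_const (1 / of_nat k) * upow a (int k) p) (boson i (- int k) f))"

definition an :: "nat \<Rightarrow> complex \<Rightarrow> series" where
  "an i a p f = hsum (\<lambda>k :: nat. if k = 0 then 0
     else scal (fps_const (1 / of_nat k) * upow a (- int k) p) (boson i (int k) f))"

abbreviation ee :: "vec \<Rightarrow> series" where
  "ee \<gamma> \<equiv> const_series (exp_lat \<gamma>)"

text \<open>\<open>zpow n s a \<gamma>\<close> is $[s(u+a\hbar)]^{\partial\gamma}$.  All exponents $(\gamma,\beta)$ that occur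
  are integers, so the floor only changes the type.\<close>

definition zpow :: "nat \<Rightarrow> complex \<Rightarrow> complex \<Rightarrow> vec \<Rightarrow> series" where
  "zpow n s a \<gamma> p =
     diag (\<lambda>\<beta>. fps_const (s powi \<lfloor>ip n \<gamma> \<beta>\<rfloor>) * upow a \<lfloor>ip n \<gamma> \<beta>\<rfloor> p)"

text \<open>$\Big(\frac{u+\frac12\hbar}{u-\frac12\hbar}\Big)^{\partial\gamma}$\<close>

definition zquot :: "nat \<Rightarrow> vec \<Rightarrow> series" where
  "zquot n \<gamma> = zpow n 1 (1/2) \<gamma> \<star> zpow n 1 (-1/2) (- \<gamma>)"


section \<open>The assignment\<close>

definition Ecur :: "nat \<Rightarrow> nat \<Rightarrow> series" where
  "Ecur n j =
    (if j = n then
       sexp (- cr (n-1) (1/4)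
             + (cr (n+1) (-1/4) + cr (n+1) (3/4))
             + (cr (n+2) (-3/4) + cr (n+2) (3/4)))
       \<star> sexp (- (an n (-1/4) + an (n+1) (-1/4)) - an (n+2) (1/4))
       \<star> ee (- beta n 1) \<star> zpow n ((-1)^(n-1)) (-1/4) (alpha n n)
       \<star> ee (beta n 2 + beta n 3) \<star> zpow n 1 (-1/4) (beta n 2) \<star> zpow n 1 (1/4) (beta n 3)
     else
       sexp ((cr j (-1/4) + cr j (3/4)) - (cr (j+1) (1/4) + cr (j-1) (1/4)))
       \<star> sexp (- an j (-1/4))
       \<star> ee (alpha n j)
       \<star> zpow n ((-1)^(j-1)) (-1/4) (if j = n - 1 then alpha n j + beta n 1 else alpha n j))"

definition Fcur :: "nat \<Rightarrow> nat \<Rightarrow> series" where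
  "Fcur n j =
    (if j = n then
       sexp (cr (n-1) (-1/4)
             - (cr (n+1) (1/4) + cr (n+1) (-3/4))
             - (cr (n+3) (-3/4) + cr (n+3) (3/4)))
       \<star> sexp ((an n (1/4) + an (n+1) (1/4)) + an (n+3) (-1/4))
       \<star> ee (beta n 1) \<star> zpow n ((-1)^(n-1)) (1/4) (- alpha n n)
       \<star> ee (- beta n 2 + beta n 4) \<star> zpow n 1 (1/4) (- beta n 2) \<star> zpow n 1 (-1/4) (beta n 4)
     else
       sexp (- (cr j (1/4) + cr j (-3/4)) + (cr (j+1) (-1/4) + cr (j-1) (-1/4)))
       \<star> sexp (an j (1/4))
       \<star> ee (- alpha n j)
       \<star> zpow n ((-1)^(j-1)) (1/4) (if j = n - 1 then - alpha n j - beta n 1 else - alpha n j))"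

definition Hpcur :: "nat \<Rightarrow> nat \<Rightarrow> series" where
  "Hpcur n j =
    (if j = n then
       sexp ((cr (n+2) (-1) + cr (n+2) (1/2)) - (cr (n+3) 1 + cr (n+3) (-1/2)))
       \<star> sexp ((an n (1/2) + an (n+1) (1/2)) - (an n (-1/2) + an (n+1) (-1/2))
               + (an (n+3) 0 - an (n+2) 0))
       \<star> zquot n (- alpha n n - beta n 2)
       \<star> ee (beta n 3 + beta n 4) \<star> zpow n 1 0 (beta n 3 + beta n 4)
     else
       sexp (- (an j (-1/2) - an j (1/2)))
       \<star> zquot n (if j = n - 1 then - alpha n j - beta n 1 else - alpha n j))"

definition Hmcur :: "nat \<Rightarrow> nat \<Rightarrow> series" where
  "Hmcur n j =
    (if j = n then
       sexp ((cr (n-1) (-1/2) - cr (n-1) (1/2)) - (cr (n+1) (-1) - cr (n+1) 1)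
             + (cr (n+2) (-1/2) + cr (n+2) 1) - (cr (n+3) (1/2) + cr (n+3) (-1)))
       \<star> sexp (- an (n+2) (1/2) + an (n+3) (-1/2))
       \<star> ee (beta n 3 + beta n 4) \<star> zpow n 1 (1/2) (beta n 3) \<star> zpow n 1 (-1/2) (beta n 4)
     else
       sexp (- (cr j (-1) - cr j 1)
             + ((cr (j+1) (-1/2) + cr (j-1) (-1/2)) - (cr (j+1) (1/2) + cr (j-1) (1/2)))))"


section \<open>The defining relations\<close>

text \<open>Series in $u,v$: \<open>W p q\<close> is the coefficient of $u^pv^q$.  \<open>uv X Y\<close> is $X(u)Y(v)$ and
  \<open>vu X Y\<close> is $Y(v)X(u)$.\<close>

type_synonym dscalar = "int \<Rightarrow> int \<Rightarrow> complex fps"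
type_synonym dseries = "int \<Rightarrow> int \<Rightarrow> fock \<Rightarrow> fock"

definition uv :: "series \<Rightarrow> series \<Rightarrow> dseries" where
  "uv X Y p q f = X p (Y q f)"

definition vu :: "series \<Rightarrow> series \<Rightarrow> dseries" where
  "vu X Y p q f = Y q (X p f)"

definition dmul :: "dscalar \<Rightarrow> dseries \<Rightarrow> dseries"  (infixr "\<odot>" 75) where
  "(g \<odot> W) p q f = hsum (\<lambda>(s, t). scal (g s t) (W (p - s) (q - t) f))"

definition dmul_summable :: "fock set \<Rightarrow> dscalar \<Rightarrow> dseries \<Rightarrow> bool" where
  "dmul_summable S g W \<longleftrightarrow>
     (\<forall>p q. \<forall>f\<in>S. hsummable (\<lambda>(s, t). scal (g s t) (W (p - s) (q - t) f)))"

definition eq_on :: "fock set \<Rightarrow> dseries \<Rightarrow> dseries \<Rightarrow> bool" where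
  "eq_on S W W' \<longleftrightarrow> (\<forall>p q. \<forall>f\<in>S. W p q f = W' p q f)"

text \<open>\<open>lin b\<close> is $u-v+b\hbar$.  Its inverse is expanded in the domain of negative powers of $u$
  (\<open>inv_u\<close>: $\sum_{k\ge0}u^{-k-1}(v-b\hbar)^k$) or of negative powers of $v$
  (\<open>inv_v\<close>: $-\sum_{k\ge0}v^{-k-1}(u+b\hbar)^k$).\<close>

definition lin :: "complex \<Rightarrow> dscalar" where
  "lin b s t = (if s = 1 \<and> t = 0 then 1 else if s = 0 \<and> t = 1 then -1
                else if s = 0 \<and> t = 0 then fps_const b * fps_X else 0)"

definition inv_u :: "complex \<Rightarrow> dscalar" where
  "inv_u b s t = (if s < 0 \<and> 0 \<le> t then upow (- b) (- s - 1) t else 0)"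

definition inv_v :: "complex \<Rightarrow> dscalar" where
  "inv_v b s t = (if t < 0 \<and> 0 \<le> s then - upow b (- t - 1) s else 0)"

text \<open>\<open>delta a b\<close> is
  $\delta((u+a\hbar)-(v+b\hbar))=\sum_{k\in\mathbb Z}(u+a\hbar)^{-k-1}(v+b\hbar)^k$.  For given
  exponents of $u,v$ only finitely many $k$ contribute.  \<open>shift a X\<close> is $X(u+a\hbar)$.\<close>

definition delta :: "complex \<Rightarrow> complex \<Rightarrow> dscalar" where
  "delta a b s t = Sum_any (\<lambda>k :: int. upow a (- k - 1) s * upow b k t)"

definition shift :: "complex \<Rightarrow> series \<Rightarrow> series" where
  "shift a X p f = hsum (\<lambda>r. scal (upow a r p) (X r f))"

definition in_u :: "series \<Rightarrow> dseries" where
  "in_u X = uv X (const_series id)"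

definition in_v :: "series \<Rightarrow> dseries" where
  "in_v X = uv (const_series id) X"

definition comm :: "(fock \<Rightarrow> fock) \<Rightarrow> (fock \<Rightarrow> fock) \<Rightarrow> fock \<Rightarrow> fock" where
  "comm S T f = S (T f) - T (S f)"

text \<open>The coefficient of $u_1^{p_1}\cdots u_m^{p_m}v^q$ in
  $\sum_{\sigma\in\mathfrak S_m}[X(u_{\sigma(1)}),\cdots,[X(u_{\sigma(m)}),Y(v)]\cdots]$.\<close>

definition serre :: "nat \<Rightarrow> series \<Rightarrow> series \<Rightarrow> (nat \<Rightarrow> int) \<Rightarrow> int \<Rightarrow> fock \<Rightarrow> fock" where
  "serre m X Y p q f = (\<Sum>\<sigma> | \<sigma> permutes {1..m}.
     foldr (\<lambda>k T. comm (X (p (\<sigma> k))) T) [1..<Suc m] (Y q) f)"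

text \<open>The relations of $\mathrm{DY}_\hbar(\mathfrak o_{2n+1})$ for operators on \<open>S\<close> on which $c$
  acts as the scalar \<open>\<kappa>\<close>, so $u_\pm=u\pm\frac14\kappa\hbar$; the modes of \<open>E i\<close>, \<open>F i\<close>,
  \<open>Hp i\<close>, \<open>Hm i\<close> are the coefficients of $E_i$, $F_i$, $H_i^+$, $H_i^-$.  Rational functions are
  expanded in the direction of the series multiplied ($u^{-1}$ with $H_i^+(u)$, $u$ with $H_i^-(u)$).
  \<^item> The relations between $H_i^\pm$ and $E_j$, $F_j$ are multiplied by $H_i^\pm(u)$ on the left,
    resp. on the right, so that no inverse appears: the series of the representation at $i=n$ is a
    product of creation and annihilation parts at the same $u$, and has no inverse as a series of
    operators.
  \<^item> The last relation is multiplied by $\hbar$ (\<open>S\<close> will be $\hbar$-torsion free).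
  \<^item> The normalization of $H_i^\pm$ is the separate predicate \<open>normalized\<close>.\<close>

definition DY_relations ::
  "complex \<Rightarrow> nat \<Rightarrow> fock set \<Rightarrow> (nat \<Rightarrow> series) \<Rightarrow> (nat \<Rightarrow> series) \<Rightarrow>
   (nat \<Rightarrow> series) \<Rightarrow> (nat \<Rightarrow> series) \<Rightarrow> bool" where
  "DY_relations \<kappa> n S E F Hp Hm \<longleftrightarrow>
    (\<forall>i\<in>{1..n}. \<forall>p. A_endo S (E i p) \<and> A_endo S (F i p) \<and> A_endo S (Hp i p) \<and> A_endo S (Hm i p)) \<and>
    (\<forall>i\<in>{1..n}. \<forall>j\<in>{1..n}. let b = B n i j in
      eq_on S (uv (Hp i) (Hp j)) (vu (Hp i) (Hp j)) \<and>
      eq_on S (uv (Hm i) (Hm j)) (vu (Hm i) (Hm j)) \<and>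

      eq_on S (lin (\<kappa>/2 - b) \<odot> lin (- \<kappa>/2 + b) \<odot> uv (Hp i) (Hm j))
              (lin (\<kappa>/2 + b) \<odot> lin (- \<kappa>/2 - b) \<odot> vu (Hp i) (Hm j)) \<and>
      eq_on S (lin (- \<kappa>/2 - b) \<odot> lin (\<kappa>/2 + b) \<odot> uv (Hm i) (Hp j))
              (lin (- \<kappa>/2 + b) \<odot> lin (\<kappa>/2 - b) \<odot> vu (Hm i) (Hp j)) \<and>

      dmul_summable S (inv_u (- \<kappa>/4 - b)) (uv (Hp i) (E j)) \<and>
      eq_on S (vu (Hp i) (E j)) (lin (- \<kappa>/4 + b) \<odot> inv_u (- \<kappa>/4 - b) \<odot> uv (Hp i) (E j)) \<and>
      dmul_summable S (inv_v (\<kappa>/4 - b)) (uv (Hm i) (E j)) \<and>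
      eq_on S (vu (Hm i) (E j)) (lin (\<kappa>/4 + b) \<odot> inv_v (\<kappa>/4 - b) \<odot> uv (Hm i) (E j)) \<and>

      dmul_summable S (inv_u (\<kappa>/4 - b)) (vu (Hp i) (F j)) \<and>
      eq_on S (uv (Hp i) (F j)) (lin (\<kappa>/4 + b) \<odot> inv_u (\<kappa>/4 - b) \<odot> vu (Hp i) (F j)) \<and>
      dmul_summable S (inv_v (- \<kappa>/4 - b)) (vu (Hm i) (F j)) \<and>
      eq_on S (uv (Hm i) (F j)) (lin (- \<kappa>/4 + b) \<odot> inv_v (- \<kappa>/4 - b) \<odot> vu (Hm i) (F j)) \<and>

      eq_on S (lin b \<odot> uv (E i) (E j)) (lin (- b) \<odot> vu (E i) (E j)) \<and>
      eq_on S (lin (- b) \<odot> uv (F i) (F j)) (lin b \<odot> vu (F i) (F j)) \<and>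

      (i \<noteq> j \<longrightarrow> (let m = nat (1 - cartan n i j) in
         \<forall>p q. \<forall>f\<in>S. serre m (E i) (E j) p q f = 0 \<and> serre m (F i) (F j) p q f = 0)) \<and>

      eq_on S (\<lambda>p q f. scal fps_X (comm (E i p) (F j q) f))
        (if i = j then
           delta (- \<kappa>/4) (\<kappa>/4) \<odot> in_v (shift (\<kappa>/4) (Hm i))
           - delta (\<kappa>/4) (- \<kappa>/4) \<odot> in_u (shift (\<kappa>/4) (Hp i))
         else 0))"

text \<open>$H_i^+(u)=1+\hbar\sum_{r\ge0}h_{ir}u^{-r-1}$ and
  $H_i^-(u)=1-\hbar\sum_{r\ge1}h_{i,-r}u^{r-1}$ on \<open>S\<close>, for some operators $h_{ir}$.
  The series \<open>Hpcur n n\<close> and \<open>Hmcur n n\<close> cannot have this form: all their coefficients map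
  $f\otimes e^\beta$ into the sector of $e^{\beta+\beta_3+\beta_4}$.\<close>

definition normalized :: "fock set \<Rightarrow> series \<Rightarrow> series \<Rightarrow> bool" where
  "normalized S Hp Hm \<longleftrightarrow>
    (\<exists>h :: int \<Rightarrow> fock \<Rightarrow> fock. (\<forall>r. A_endo S (h r)) \<and>
      (\<forall>p. \<forall>f\<in>S.
        Hp p f = (if p = 0 then f else 0) + (if p < 0 then scal fps_X (h (- p - 1) f) else 0) \<and>
        Hm p f = (if p = 0 then f else 0) - (if p \<ge> 0 then scal fps_X (h (- p - 1) f) else 0)))"

end

(* Every current is, on the sector of e^beta, a series of multiplication operators followed by an
   annihilation part whose coefficients are determined by a Newton recursion (the logarithmic
   derivative of the exponential).  Moving the annihilation part of one current past another current
   produces linear factors u - v + c hbar, so products of two currents agree, up to such factors, with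
   a normally ordered product that is small for very negative powers of u and of v; the quadratic
   relations follow because a linear factor is injective on families that are bounded in one of the two
   variables.  For E_i, F_i the partial fraction expansion in the two directions differs by delta
   functions, which restrict the normally ordered product to the diagonals, where it becomes H_i^-
   resp. H_i^+.  For the Serre relations the product of the factors u_k - v -/+ hbar/2 annihilates the sum
   of words; the factors are removed one at a time, since words with E_j to the left of E_i(u_k) are
   bounded in v after multiplication by a single factor. *)
theory Submission
  imports Defs
begin

section \<open>Sums in the $\hbar$-adic topology\<close>

text \<open>The obstacle is that division is almost never available. A rational function of u and v
  has two expansions that differ by delta functions, and the series \<open>Hpcur n n\<close> and
  \<open>Hmcur n n\<close> have no inverse. So factors are kept as Laurent polynomials acting on
  families of coefficients, and division is replaced by uniqueness among families that start
  somewhere in one variable. \<open>H\<close> is never contracted directly. For c = 1 the delta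
  functions of the commutator sit at u - v = hbar/2 and u - v = -hbar/2, which forces H^-(u) to be
  the normally ordered product of E at u + hbar/4 and F at u - hbar/4, and H^+(u) the one with both
  signs exchanged. Contractions are additive over such products, so every quadratic relation reduces
  to the few contractions among E and F. At the index n the boson a_{n+1} alone would behave like a
  root of norm 2. The bosons a_{n+2} in E_n and a_{n+3} in F_n correct this to the short root, and
  they do not contract with each other.\<close>

lemma hsum_nth:
  assumes "finite I" "\<And>i. i \<notin> I \<Longrightarrow> fps_nth (g i) N = 0"
  shows "fps_nth (hsum g) N = (\<Sum>i\<in>I. fps_nth (g i) N)"
  unfolding hsum_def using assms by (auto intro!: Sum_any.expand_superset)

lemma hsummableI:
  assumes "\<And>N. \<exists>I. finite I \<and> (\<forall>i. i \<notin> I \<longrightarrow> fps_nth (g i) N = 0)"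
  shows "hsummable g"
  unfolding hsummable_def
proof
  fix N
  from assms obtain I where "finite I" "\<forall>i. i \<notin> I \<longrightarrow> fps_nth (g i) N = 0" by blast
  then show "finite {i. fps_nth (g i) N \<noteq> 0}" by (auto intro: finite_subset[of _ I])
qed

lemma hsummable_upto:
  assumes "hsummable g"
  shows "finite {i. \<exists>m\<le>N. fps_nth (g i) m \<noteq> 0}"
proof -
  have "{i. \<exists>m\<le>N. fps_nth (g i) m \<noteq> 0} = (\<Union>m\<le>N. {i. fps_nth (g i) m \<noteq> 0})" by auto
  then show ?thesis using assms by (auto simp: hsummable_def)
qed

text \<open>The bound m <= N in place of m = N is what products need: a coefficient of a product may
  come from any lower coefficient of a factor.\<close>

lemma hsummable_mono:
  assumes "hsummable g" "\<And>i N. fps_nth (h i) N \<noteq> 0 \<Longrightarrow> \<exists>m\<le>N. fps_nth (g i) m \<noteq> 0"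
  shows "hsummable h"
  unfolding hsummable_def
proof
  fix N
  show "finite {i. fps_nth (h i) N \<noteq> 0}"
    by (rule finite_subset[OF _ hsummable_upto[OF assms(1), of N]]) (use assms(2) in blast)
qed

lemma hsum_add:
  assumes "hsummable g" "hsummable h"
  shows "hsummable (\<lambda>i. g i + h i)" "hsum (\<lambda>i. g i + h i) = hsum g + hsum h"
proof -
  have fin: "finite ({i. fps_nth (g i) N \<noteq> 0} \<union> {i. fps_nth (h i) N \<noteq> 0})" for N
    using assms by (auto simp: hsummable_def)
  then show "hsummable (\<lambda>i. g i + h i)"
    unfolding hsummable_def
  proof (intro allI)
    fix N
    show "finite {i. fps_nth (g i + h i) N \<noteq> 0}" by (rule finite_subset[OF _ fin[of N]]) auto
  qed
  show "hsum (\<lambda>i. g i + h i) = hsum g + hsum h"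
  proof (rule fps_ext)
    fix N
    note n = hsum_nth[OF fin[of N], where N = N]
    show "fps_nth (hsum (\<lambda>i. g i + h i)) N = fps_nth (hsum g + hsum h) N"
      unfolding fps_add_nth by (subst (1 2 3) n) (auto simp: sum.distrib)
  qed
qed

lemma hsum_zero [simp]: "hsum (\<lambda>i. 0) = 0" "hsummable (\<lambda>i. 0)"
  by (auto simp: hsum_def hsummable_def fps_eq_iff)

lemma fps_mult_nth_nonzero:
  fixes f g :: "'a::comm_ring_1 fps"
  assumes "fps_nth (f * g) N \<noteq> 0"
  obtains i where "i \<le> N" "fps_nth f i \<noteq> 0" "fps_nth g (N - i) \<noteq> 0"
proof -
  have "\<exists>i\<in>{0..N}. fps_nth f i * fps_nth g (N - i) \<noteq> 0"
    using assms unfolding fps_mult_nth by (meson sum.neutral)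
  then obtain i where "i \<le> N" "fps_nth f i * fps_nth g (N - i) \<noteq> 0" by auto
  then show ?thesis using that[of i] by (metis mult_zero_left mult_zero_right)
qed

lemma hsum_mult:
  assumes "hsummable g"
  shows "hsummable (\<lambda>i. c * g i)" "hsum (\<lambda>i. c * g i) = c * hsum g"
proof -
  show "hsummable (\<lambda>i. c * g i)"
    by (rule hsummable_mono[OF assms]) (meson diff_le_self fps_mult_nth_nonzero)
  show "hsum (\<lambda>i. c * g i) = c * hsum g"
  proof (rule fps_ext)
    fix N
    let ?I = "{i. \<exists>m\<le>N. fps_nth (g i) m \<noteq> 0}"
    have fin: "finite ?I" by (rule hsummable_upto[OF assms])
    have "fps_nth (hsum (\<lambda>i. c * g i)) N = (\<Sum>i\<in>?I. fps_nth (c * g i) N)"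
    proof (rule hsum_nth[OF fin])
      fix i assume i: "i \<notin> ?I"
      show "fps_nth (c * g i) N = 0"
        unfolding fps_mult_nth by (rule sum.neutral) (use i in auto)
    qed
    also have "\<dots> = (\<Sum>i\<in>?I. \<Sum>k=0..N. fps_nth c k * fps_nth (g i) (N - k))"
      by (simp add: fps_mult_nth)
    also have "\<dots> = (\<Sum>k=0..N. fps_nth c k * (\<Sum>i\<in>?I. fps_nth (g i) (N - k)))"
      by (subst sum.swap) (simp add: sum_distrib_left)
    also have "\<dots> = (\<Sum>k=0..N. fps_nth c k * fps_nth (hsum g) (N - k))"
      by (intro sum.cong refl arg_cong[where f="(*) _"] hsum_nth[OF fin, symmetric]) auto
    finally show "fps_nth (hsum (\<lambda>i. c * g i)) N = fps_nth (c * hsum g) N"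
      by (simp add: fps_mult_nth)
  qed
qed

lemma hsum_uminus:
  assumes "hsummable g"
  shows "hsummable (\<lambda>i. - g i)" "hsum (\<lambda>i. - g i) = - hsum g"
  using hsum_mult[OF assms, of "-1"] by simp_all

lemma hsum_diff:
  assumes "hsummable g" "hsummable h"
  shows "hsummable (\<lambda>i. g i - h i)" "hsum (\<lambda>i. g i - h i) = hsum g - hsum h"
  using hsum_add[OF assms(1) hsum_uminus(1)[OF assms(2)]] hsum_uminus(2)[OF assms(2)] by simp_all

lemma hsum_finite:
  assumes "finite I" "\<And>i. i \<notin> I \<Longrightarrow> g i = 0"
  shows "hsummable g" "hsum g = sum g I"
proof -
  show "hsummable g" using assms by (auto intro!: hsummableI exI[of _ I])
  show "hsum g = sum g I"
    by (rule fps_ext) (simp add: hsum_nth[OF assms(1)] assms(2) fps_sum_nth)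
qed

lemma hsum_single:
  assumes "\<And>i. i \<noteq> k \<Longrightarrow> g i = 0"
  shows "hsummable g" "hsum g = g k"
  using hsum_finite[of "{k}" g] assms by auto

lemma hsummable_inj:
  assumes "hsummable g" "inj h"
  shows "hsummable (\<lambda>i. g (h i))"
  unfolding hsummable_def
proof
  fix N
  have "finite (h -` {i. fps_nth (g i) N \<noteq> 0})"
    using assms by (intro finite_vimageI) (simp_all add: hsummable_def)
  then show "finite {i. fps_nth (g (h i)) N \<noteq> 0}" by (simp add: vimage_def)
qed

lemma hsum_reindex:
  assumes "bij h"
  shows "hsummable (\<lambda>i. g (h i)) \<longleftrightarrow> hsummable g" "hsum (\<lambda>i. g (h i)) = hsum g"
proof -
  have inj: "inj h" "inj (inv h)" and inv: "h (inv h i) = i" for i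
    using assms by (auto simp: bij_is_inj bij_is_surj surj_imp_inj_inv surj_f_inv_f)
  show "hsummable (\<lambda>i. g (h i)) \<longleftrightarrow> hsummable g"
    using hsummable_inj[OF _ inj(1), of g] hsummable_inj[OF _ inj(2), of "\<lambda>i. g (h i)"]
    by (auto simp: inv)
  have "Sum_any (\<lambda>i. fps_nth (g (h i)) N) = Sum_any (\<lambda>i. fps_nth (g i) N)" for N
    by (rule Sum_any.reindex_cong[of h, symmetric]) (use assms in \<open>auto simp: fun_eq_iff\<close>)
  then show "hsum (\<lambda>i. g (h i)) = hsum g" by (simp add: hsum_def)
qed

text \<open>Fubini for hbar-adic sums. At each order N only finitely many pairs matter, and both
  iterated sums run over the projections of that finite set.\<close>

lemma hsum_Sigma:
  assumes "hsummable (\<lambda>(i, j). g i j)"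
  shows "\<And>i. hsummable (g i)" "hsummable (\<lambda>i. hsum (g i))"
    "hsum (\<lambda>i. hsum (g i)) = hsum (\<lambda>(i, j). g i j)"
proof -
  have inj: "inj (\<lambda>j. (i, j))" for i by (auto simp: inj_on_def)
  show s: "hsummable (g i)" for i
    using hsummable_inj[OF assms inj, of i] by simp
  define P where "P N = {x. fps_nth (case x of (i, j) \<Rightarrow> g i j) N \<noteq> 0}" for N
  have finP: "finite (P N)" for N using assms by (simp add: P_def hsummable_def)
  have z: "fps_nth (hsum (g i)) N = (\<Sum>j\<in>snd ` P N. fps_nth (g i j) N)" for i N
  proof (rule hsum_nth)
    show "finite (snd ` P N)" using finP by simp
    show "fps_nth (g i j) N = 0" if "j \<notin> snd ` P N" for j
    proof (rule ccontr)
      assume "fps_nth (g i j) N \<noteq> 0"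
      then have "(i, j) \<in> P N" by (simp add: P_def)
      then show False using that by force
    qed
  qed
  have z0: "fps_nth (hsum (g i)) N = 0" if "i \<notin> fst ` P N" for i N
  proof -
    have "fps_nth (g i j) N = 0" for j
    proof (rule ccontr)
      assume "fps_nth (g i j) N \<noteq> 0"
      then have "(i, j) \<in> P N" by (simp add: P_def)
      then show False using that by force
    qed
    then show ?thesis unfolding z by simp
  qed
  show "hsummable (\<lambda>i. hsum (g i))"
    by (rule hsummableI) (use finP z0 in blast)
  show "hsum (\<lambda>i. hsum (g i)) = hsum (\<lambda>(i, j). g i j)"
  proof (rule fps_ext)
    fix N
    have "fps_nth (hsum (\<lambda>i. hsum (g i))) N = (\<Sum>i\<in>fst ` P N. fps_nth (hsum (g i)) N)"
      by (rule hsum_nth) (use finP z0 in auto)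
    also have "\<dots> = (\<Sum>(i,j)\<in>fst ` P N \<times> snd ` P N. fps_nth (g i j) N)"
      unfolding z by (simp add: sum.cartesian_product)
    also have "\<dots> = (\<Sum>x\<in>fst ` P N \<times> snd ` P N. fps_nth (case x of (i, j) \<Rightarrow> g i j) N)"
      by (simp add: case_prod_beta)
    also have "\<dots> = fps_nth (hsum (\<lambda>(i, j). g i j)) N"
    proof (rule hsum_nth[symmetric])
      show "finite (fst ` P N \<times> snd ` P N)" using finP by simp
      show "fps_nth (case x of (i, j) \<Rightarrow> g i j) N = 0" if "x \<notin> fst ` P N \<times> snd ` P N" for x
      proof (rule ccontr)
        assume "fps_nth (case x of (i, j) \<Rightarrow> g i j) N \<noteq> 0"
        then have "x \<in> P N" by (simp add: P_def)
        then show False using that by (metis imageI mem_Times_iff)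
      qed
    qed
    finally show "fps_nth (hsum (\<lambda>i. hsum (g i))) N = fps_nth (hsum (\<lambda>(i, j). g i j)) N" .
  qed
qed

lemma hsum_swap:
  assumes "hsummable (\<lambda>(i, j). g i j)"
  shows "hsummable (\<lambda>(j, i). g i j)" "hsum (\<lambda>i. hsum (\<lambda>j. g i j)) = hsum (\<lambda>j. hsum (\<lambda>i. g i j))"
proof -
  have b: "bij (\<lambda>(j, i). (i, j))" by (auto simp: bij_def inj_on_def surj_def)
  have e: "(\<lambda>x. case (case x of (j, i) \<Rightarrow> (i, j)) of (i, j) \<Rightarrow> g i j) = (\<lambda>(j, i). g i j)"
    by auto
  show s: "hsummable (\<lambda>(j, i). g i j)"
    using hsum_reindex(1)[OF b, of "\<lambda>(i, j). g i j"] assms unfolding e by blast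
  show "hsum (\<lambda>i. hsum (\<lambda>j. g i j)) = hsum (\<lambda>j. hsum (\<lambda>i. g i j))"
    using hsum_Sigma(3)[OF assms] hsum_Sigma(3)[OF s] hsum_reindex(2)[OF b, of "\<lambda>(i, j). g i j"]
    unfolding e by simp
qed

lemma hsum_sum:
  assumes "finite A" "\<And>a. a \<in> A \<Longrightarrow> hsummable (g a)"
  shows "hsummable (\<lambda>i. \<Sum>a\<in>A. g a i)" "hsum (\<lambda>i. \<Sum>a\<in>A. g a i) = (\<Sum>a\<in>A. hsum (g a))"
  using assms by (induction A rule: finite_induct) (simp_all add: hsum_add)


section \<open>Subspaces and linear operators\<close>

text \<open>The complex numbers (\<open>cc\<close>) and the ring A (\<open>sc\<close>) as multiples
  of 1 in the Fock space. Through \<open>scal_sc\<close> the module action becomes a product in one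
  commutative ring, so that ring normalisation applies to it.\<close>

definition cc :: "complex \<Rightarrow> fock" where
  "cc z = fps_const (Poly_Mapping.single 0 z)"

definition sc :: "complex fps \<Rightarrow> fock" where
  "sc c = Abs_fps (\<lambda>N. Poly_Mapping.single 0 (fps_nth c N))"

abbreviation hb :: fock where "hb \<equiv> fps_X"

lemma scal_sc: "scal c f = sc c * f"
  by (simp add: scal_def sc_def)

lemma single0_mult: "Poly_Mapping.single (0::'a::monoid_add) (a::'b::semiring_0) * Poly_Mapping.single 0 b = Poly_Mapping.single 0 (a * b)"
  by (simp add: mult_single)

lemma single0_sum: "Poly_Mapping.single k (sum f A) = (\<Sum>a\<in>A. Poly_Mapping.single k (f a))"
  by (induction A rule: infinite_finite_induct) (simp_all add: single_add)

lemma cc_simps [simp]: "cc 0 = 0" "cc 1 = 1"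
  by (simp_all add: cc_def single_one)

lemma cc_add: "cc (a + b) = cc a + cc b"
  by (simp add: cc_def single_add)

lemma cc_uminus: "cc (- a) = - cc a"
  by (simp add: cc_def single_uminus)

lemma cc_diff: "cc (a - b) = cc a - cc b"
  by (simp add: cc_def single_diff)

lemma cc_mult: "cc (a * b) = cc a * cc b"
  by (simp add: cc_def single0_mult)

lemma cc_power: "cc (a ^ k) = cc a ^ k"
  by (induction k) (simp_all add: cc_mult)

lemma cc_of_nat [simp]: "cc (of_nat k) = of_nat k"
  by (induction k) (simp_all add: cc_add)

lemma cc_of_int [simp]: "cc (of_int k) = of_int k"
  by (cases k) (simp_all add: cc_uminus cc_add cc_diff)

lemma cc_numeral [simp]: "cc (numeral k) = numeral k"
  using cc_of_nat[of "numeral k"] by simp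

lemma cc_sum: "cc (sum f A) = (\<Sum>a\<in>A. cc (f a))"
  by (induction A rule: infinite_finite_induct) (simp_all add: cc_add)

lemma sc_simps [simp]: "sc 0 = 0" "sc 1 = 1" "sc fps_X = hb" "sc (fps_const z) = cc z"
  by (auto simp: sc_def cc_def fps_eq_iff single_one fps_one_nth fps_X_nth)

lemma sc_add: "sc (a + b) = sc a + sc b"
  by (simp add: sc_def fps_eq_iff single_add)

lemma sc_uminus: "sc (- a) = - sc a"
  by (simp add: sc_def fps_eq_iff single_uminus)

lemma sc_diff: "sc (a - b) = sc a - sc b"
  by (simp add: sc_def fps_eq_iff single_diff)

lemma sc_mult: "sc (a * b) = sc a * sc b"
  by (simp add: sc_def fps_eq_iff fps_mult_nth single0_sum single0_mult)

lemma sc_power: "sc (a ^ k) = sc a ^ k"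
  by (induction k) (simp_all add: sc_mult)

lemma sc_sum: "sc (sum f A) = (\<Sum>a\<in>A. sc (f a))"
  by (induction A rule: infinite_finite_induct) (simp_all add: sc_add)

text \<open>Characteristic zero enters here: Newton recursions only determine r times the r-th
  coefficient.\<close>

lemma of_nat_cancel:
  fixes x :: fock
  assumes "of_nat r * x = of_nat r * y" "r > 0"
  shows "x = y"
proof -
  have "cc (1 / of_nat r) * of_nat r = (1 :: fock)"
    using assms(2) by (simp flip: cc_of_nat cc_mult)
  moreover have "cc (1 / of_nat r) * (of_nat r * x) = cc (1 / of_nat r) * (of_nat r * y)"
    using assms(1) by simp
  ultimately show ?thesis by (simp flip: mult.assoc)
qed

section \<open>Closed A-submodules and their A-linear operators\<close>

definition csub :: "(basis \<Rightarrow>\<^sub>0 complex) set \<Rightarrow> bool" where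
  "csub R \<longleftrightarrow> 0 \<in> R \<and> (\<forall>x\<in>R. \<forall>y\<in>R. x + y \<in> R) \<and> (\<forall>c. \<forall>x\<in>R. Poly_Mapping.single 0 c * x \<in> R)"

text \<open>This is R[[hbar]]. The whole space, \<open>Fock n\<close> and the single lattice sectors
  are instances, so that facts on operators are proved once for all of them.\<close>

definition cset :: "(basis \<Rightarrow>\<^sub>0 complex) set \<Rightarrow> fock set" where
  "cset R = {f. \<forall>N. fps_nth f N \<in> R}"

lemma csub_UNIV [simp]: "csub UNIV"
  by (simp add: csub_def)

lemma cset_UNIV [simp]: "cset UNIV = UNIV"
  by (simp add: cset_def)

lemma csubD:
  assumes "csub R"
  shows "0 \<in> R" "x \<in> R \<Longrightarrow> y \<in> R \<Longrightarrow> x + y \<in> R" "x \<in> R \<Longrightarrow> Poly_Mapping.single 0 c * x \<in> R"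
  using assms unfolding csub_def by blast+

lemma csub_sum:
  assumes "csub R" "\<And>a. a \<in> A \<Longrightarrow> f a \<in> R"
  shows "sum f A \<in> R"
  using assms(2)
  by (induction A rule: infinite_finite_induct) (simp_all add: csubD[OF assms(1)])

lemma cset_0: "csub R \<Longrightarrow> 0 \<in> cset R"
  by (simp add: csubD(1) cset_def)

lemma cset_add: "csub R \<Longrightarrow> f \<in> cset R \<Longrightarrow> g \<in> cset R \<Longrightarrow> f + g \<in> cset R"
  by (simp add: csubD(2) cset_def)

lemma cset_sc: "csub R \<Longrightarrow> f \<in> cset R \<Longrightarrow> sc c * f \<in> cset R"
  by (auto simp: cset_def fps_mult_nth sc_def intro!: csub_sum csubD(3))

lemma cset_hb: "csub R \<Longrightarrow> f \<in> cset R \<Longrightarrow> hb * f \<in> cset R"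
  by (metis cset_sc sc_simps(3))

lemma cset_cc: "csub R \<Longrightarrow> f \<in> cset R \<Longrightarrow> cc c * f \<in> cset R"
  by (metis cset_sc sc_simps(4))

lemma cset_uminus: "csub R \<Longrightarrow> f \<in> cset R \<Longrightarrow> - f \<in> cset R"
  by (metis cset_cc cc_uminus cc_simps(2) mult_minus1)

lemma cset_diff: "csub R \<Longrightarrow> f \<in> cset R \<Longrightarrow> g \<in> cset R \<Longrightarrow> f - g \<in> cset R"
  by (metis cset_add cset_uminus diff_conv_add_uminus)

lemma cset_sum: "csub R \<Longrightarrow> (\<And>a. a \<in> A \<Longrightarrow> f a \<in> cset R) \<Longrightarrow> sum f A \<in> cset R"
  by (induction A rule: infinite_finite_induct) (simp_all add: cset_add cset_0)

lemma cset_hsum: "csub R \<Longrightarrow> (\<And>i. g i \<in> cset R) \<Longrightarrow> hsum g \<in> cset R"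
  unfolding cset_def hsum_def Sum_any.expand_set by (auto intro: csub_sum)

lemma cset_const: "csub R \<Longrightarrow> x \<in> R \<Longrightarrow> fps_const x \<in> cset R"
  by (simp add: cset_def csubD(1))

lemma A_endoI:
  assumes "\<And>f. f \<in> S \<Longrightarrow> T f \<in> S" "\<And>f g. f \<in> S \<Longrightarrow> g \<in> S \<Longrightarrow> T (f + g) = T f + T g"
    "\<And>c f. f \<in> S \<Longrightarrow> T (sc c * f) = sc c * T f"
  shows "A_endo S T"
  using assms by (simp add: A_endo_def scal_sc)

lemma A_endoD:
  assumes "A_endo S T"
  shows "f \<in> S \<Longrightarrow> T f \<in> S" "f \<in> S \<Longrightarrow> g \<in> S \<Longrightarrow> T (f + g) = T f + T g"
    "f \<in> S \<Longrightarrow> T (sc c * f) = sc c * T f" "f \<in> S \<Longrightarrow> T (cc z * f) = cc z * T f"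
    "f \<in> S \<Longrightarrow> T (hb * f) = hb * T f" "f \<in> S \<Longrightarrow> T 0 = 0" "f \<in> S \<Longrightarrow> T (- f) = - T f"
proof -
  have a: "f \<in> S \<Longrightarrow> T f \<in> S" "f \<in> S \<Longrightarrow> g \<in> S \<Longrightarrow> T (f + g) = T f + T g"
    and c: "f \<in> S \<Longrightarrow> T (sc c * f) = sc c * T f" for f g c
    using assms by (simp_all add: A_endo_def scal_sc)
  show "f \<in> S \<Longrightarrow> T f \<in> S" "f \<in> S \<Longrightarrow> g \<in> S \<Longrightarrow> T (f + g) = T f + T g"
    "f \<in> S \<Longrightarrow> T (sc c * f) = sc c * T f" by (fact a c)+
  show "f \<in> S \<Longrightarrow> T (cc z * f) = cc z * T f" using c[of f "fps_const z"] by simp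
  show "f \<in> S \<Longrightarrow> T (hb * f) = hb * T f" using c[of f fps_X] by simp
  show "f \<in> S \<Longrightarrow> T 0 = 0" using c[of f 0] by simp
  show "f \<in> S \<Longrightarrow> T (- f) = - T f" using c[of f "-1"] by (simp add: sc_uminus)
qed

lemma A_endo_diff:
  assumes "A_endo (cset R) T" "csub R" "f \<in> cset R" "g \<in> cset R"
  shows "T (f - g) = T f - T g"
  using A_endoD(2)[OF assms(1,3) cset_uminus[OF assms(2,4)]] A_endoD(7)[OF assms(1,4)] by simp

lemma A_endo_0: "A_endo (cset R) T \<Longrightarrow> csub R \<Longrightarrow> T 0 = 0"
  using A_endoD(6)[of "cset R" T 0] by (simp add: cset_0)

lemma A_endo_sum:
  assumes "A_endo (cset R) T" "csub R" "\<And>a. a \<in> A \<Longrightarrow> f a \<in> cset R"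
  shows "T (sum f A) = (\<Sum>a\<in>A. T (f a))"
  using assms(3)
  by (induction A rule: infinite_finite_induct)
     (simp_all add: A_endo_0[OF assms(1,2)] A_endoD(2)[OF assms(1)] cset_sum[OF assms(2)])

text \<open>A-linearity alone gives hbar-adic continuity: an f of order N is hbar^N times an element
  that again lies in \<open>cset R\<close>.\<close>

lemma A_endo_small:
  assumes "A_endo (cset R) T" "csub R" "f \<in> cset R" "\<And>k. k < N \<Longrightarrow> fps_nth f k = 0" "k < N"
  shows "fps_nth (T f) k = 0"
proof -
  have 1: "f = sc (fps_X ^ N) * fps_shift N f"
    by (rule fps_ext) (use assms(4) in \<open>auto simp: sc_power fps_X_power_mult_nth\<close>)
  have "fps_shift N f \<in> cset R" using assms(3) by (simp add: cset_def)
  then have "T f = sc (fps_X ^ N) * T (fps_shift N f)"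
    by (rule trans[OF arg_cong[OF 1, of T] A_endoD(3)[OF assms(1)]])
  then show ?thesis using assms(5) by (simp add: sc_power fps_X_power_mult_nth)
qed

lemma A_endo_nth_cong:
  assumes "A_endo (cset R) T" "csub R" "f \<in> cset R" "g \<in> cset R" "\<And>k. k \<le> N \<Longrightarrow> fps_nth f k = fps_nth g k"
    "k \<le> N"
  shows "fps_nth (T f) k = fps_nth (T g) k"
  using A_endo_small[OF assms(1,2) cset_diff[OF assms(2,3,4)], of "Suc N" k] assms(5,6)
  by (simp add: A_endo_diff[OF assms(1,2,3,4)])

text \<open>Modulo hbar^(N+1) the family has finitely many nonzero members, and by
  \<open>A_endo_nth_cong\<close> the infinite sum may be replaced by the sum over these.\<close>

lemma A_endo_hsum:
  assumes "A_endo (cset R) T" "csub R" "\<And>i. g i \<in> cset R" "hsummable g"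
  shows "hsummable (\<lambda>i. T (g i))" "T (hsum g) = hsum (\<lambda>i. T (g i))"
proof -
  have z: "fps_nth (T (g i)) N = 0" if "i \<notin> {i. \<exists>m\<le>N. fps_nth (g i) m \<noteq> 0}" for i N
    using A_endo_small[OF assms(1,2,3), of "Suc N" i N] that by auto
  show "hsummable (\<lambda>i. T (g i))"
    by (rule hsummableI) (use hsummable_upto[OF assms(4)] z in blast)
  show "T (hsum g) = hsum (\<lambda>i. T (g i))"
  proof (rule fps_ext)
    fix N
    let ?I = "{i. \<exists>m\<le>N. fps_nth (g i) m \<noteq> 0}"
    have fin: "finite ?I" by (rule hsummable_upto[OF assms(4)])
    have "fps_nth (T (hsum g)) N = fps_nth (T (\<Sum>i\<in>?I. g i)) N"
    proof (rule A_endo_nth_cong[OF assms(1,2)])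
      show "hsum g \<in> cset R" by (rule cset_hsum[OF assms(2,3)])
      show "(\<Sum>i\<in>?I. g i) \<in> cset R" by (rule cset_sum[OF assms(2,3)])
      show "fps_nth (hsum g) k = fps_nth (\<Sum>i\<in>?I. g i) k" if "k \<le> N" for k
        by (subst hsum_nth[OF fin]) (use that in \<open>auto simp: fps_sum_nth\<close>)
    qed simp
    also have "\<dots> = (\<Sum>i\<in>?I. fps_nth (T (g i)) N)"
      by (simp add: A_endo_sum[OF assms(1,2,3)] fps_sum_nth)
    also have "\<dots> = fps_nth (hsum (\<lambda>i. T (g i))) N"
      by (rule hsum_nth[OF fin z, symmetric])
    finally show "fps_nth (T (hsum g)) N = fps_nth (hsum (\<lambda>i. T (g i))) N" .
  qed
qed

lemma fock_expand:
  "hsummable (\<lambda>N. sc (fps_X ^ N) * fps_const (fps_nth f N))"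
  "f = hsum (\<lambda>N. sc (fps_X ^ N) * fps_const (fps_nth f N))"
proof -
  let ?g = "\<lambda>N. sc (fps_X ^ N) * fps_const (fps_nth f N)"
  have nth: "fps_nth (?g N) k = (if k = N then fps_nth f N else 0)" for N k
    by (auto simp: sc_power fps_X_power_mult_nth)
  show s: "hsummable ?g"
    by (rule hsummableI) (use nth in \<open>auto intro!: exI[of _ "{_}"]\<close>)
  show "f = hsum ?g"
  proof (rule fps_ext)
    fix N
    show "fps_nth f N = fps_nth (hsum ?g) N"
      by (subst hsum_nth[of "{N}"]) (simp_all only: nth, auto simp: nth)
  qed
qed

text \<open>By linearity and continuity an operator is determined by its values on elements constant
  in hbar.\<close>

lemma A_endo_eqI:
  assumes "A_endo (cset R) T" "A_endo (cset R) T'" "csub R"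
    "\<And>x. x \<in> R \<Longrightarrow> T (fps_const x) = T' (fps_const x)" "f \<in> cset R"
  shows "T f = T' f"
proof -
  let ?g = "\<lambda>N. sc (fps_X ^ N) * fps_const (fps_nth f N)"
  have m: "fps_const (fps_nth f N) \<in> cset R" for N
    using assms(5) by (intro cset_const assms) (simp add: cset_def)
  have g: "?g N \<in> cset R" for N by (rule cset_sc[OF assms(3) m])
  have eq: "T (?g N) = T' (?g N)" for N
    using A_endoD(3)[OF assms(1) m] A_endoD(3)[OF assms(2) m] assms(4,5) by (simp add: cset_def)
  show ?thesis
    using A_endo_hsum(2)[OF assms(1,3) g fock_expand(1)] A_endo_hsum(2)[OF assms(2,3) g fock_expand(1)]
      fock_expand(2)[of f] eq by simp
qed

lemma A_endo_lincomb:
  assumes "csub R"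
  shows "A_endo (cset R) (\<lambda>f. 0)"
    "A_endo (cset R) (\<lambda>f. f)"
    "A_endo (cset R) T \<Longrightarrow> A_endo (cset R) T' \<Longrightarrow> A_endo (cset R) (\<lambda>f. T f + T' f)"
    "A_endo (cset R) T \<Longrightarrow> A_endo (cset R) T' \<Longrightarrow> A_endo (cset R) (\<lambda>f. T f - T' f)"
    "A_endo (cset R) T \<Longrightarrow> A_endo (cset R) (\<lambda>f. - T f)"
    "A_endo (cset R) T \<Longrightarrow> A_endo (cset R) (\<lambda>f. sc c * T f)"
    "A_endo (cset R) T \<Longrightarrow> A_endo (cset R) T' \<Longrightarrow> A_endo (cset R) (\<lambda>f. T (T' f))"
  using assms
  by (auto intro!: A_endoI cset_0 cset_add cset_diff cset_uminus cset_sc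
      simp: A_endoD distrib_left right_diff_distrib mult.left_commute)

lemma A_endo_mult:
  assumes "\<And>f. f \<in> cset R \<Longrightarrow> M * f \<in> cset R"
  shows "A_endo (cset R) (\<lambda>f. M * f)"
  by (rule A_endoI) (use assms in \<open>auto simp: algebra_simps\<close>)

lemma A_endo_family:
  assumes "csub R" "\<And>i. A_endo (cset R) (T i)" "\<And>f. f \<in> cset R \<Longrightarrow> hsummable (\<lambda>i. T i f)"
  shows "A_endo (cset R) (\<lambda>f. hsum (\<lambda>i. T i f))"
  by (rule A_endoI)
     (use assms in \<open>auto intro!: cset_hsum simp: A_endoD[OF assms(2)] hsum_add(2) hsum_mult(2)\<close>)

lemma A_endo_sumI:
  assumes "csub R" "\<And>i. i \<in> A \<Longrightarrow> A_endo (cset R) (T i)"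
  shows "A_endo (cset R) (\<lambda>f. \<Sum>i\<in>A. T i f)"
  using assms(2)
  by (induction A rule: infinite_finite_induct) (simp_all add: A_endo_lincomb[OF assms(1)])

section \<open>Laurent polynomials acting on families\<close>

text \<open>Multiplication of a formal family by a Laurent polynomial; the sum is finite, so it is
  defined for arbitrary families. The exponent group is a parameter: pairs of integers serve for u
  and v, functions on indices for the many variables of the Serre relations.\<close>

definition act :: "('g::ab_group_add \<Rightarrow>\<^sub>0 fock) \<Rightarrow> ('g \<Rightarrow> fock) \<Rightarrow> 'g \<Rightarrow> fock" where
  "act P W e = (\<Sum>k\<in>Poly_Mapping.keys P. Poly_Mapping.lookup P k * W (e - k))"

lemma act_superset:
  assumes "finite K" "Poly_Mapping.keys P \<subseteq> K"
  shows "act P W e = (\<Sum>k\<in>K. Poly_Mapping.lookup P k * W (e - k))"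
  unfolding act_def using assms by (intro sum.mono_neutral_left) (auto simp: in_keys_iff)

lemma poly_mapping_sum_singles:
  "P = (\<Sum>k\<in>Poly_Mapping.keys P. Poly_Mapping.single k (Poly_Mapping.lookup P k))"
proof (rule poly_mapping_eqI)
  fix k
  show "Poly_Mapping.lookup P k = Poly_Mapping.lookup (\<Sum>k\<in>Poly_Mapping.keys P. Poly_Mapping.single k (Poly_Mapping.lookup P k)) k"
    by (simp add: lookup_sum lookup_single when_def in_keys_iff)
qed

lemma act_add: "act (P + P') W e = act P W e + act P' W e"
proof -
  let ?K = "Poly_Mapping.keys P \<union> Poly_Mapping.keys P'"
  have "Poly_Mapping.keys (P + P') \<subseteq> ?K" by (rule keys_add)
  then show ?thesis
    by (subst (1 2 3) act_superset[of ?K]) (auto simp: lookup_add distrib_right sum.distrib)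
qed

lemma act_zero [simp]: "act 0 W e = 0"
  by (simp add: act_def)

lemma act_single: "act (Poly_Mapping.single k c) W e = c * W (e - k)"
  by (subst act_superset[of "{k}"]) auto

lemma act_one [simp]: "act 1 W = W"
  using act_single[of 0 1 W] by (simp add: fun_eq_iff single_one)

lemma act_sum: "act (sum P A) W e = (\<Sum>a\<in>A. act (P a) W e)"
  by (induction A rule: infinite_finite_induct) (simp_all add: act_add)

lemma act_fun_sum: "act P (\<lambda>e. \<Sum>a\<in>A. W a e) e = (\<Sum>a\<in>A. act P (W a) e)"
  unfolding act_def by (simp add: sum_distrib_left) (rule sum.swap)

lemma act_fun_add: "act P (\<lambda>e. W e + W' e) e = act P W e + act P W' e"
  by (simp add: act_def distrib_left sum.distrib)

lemma act_fun_mult: "act P (\<lambda>e. c * W e) e = c * act P W e"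
  by (simp add: act_def sum_distrib_left mult.left_commute)

lemma act_fun_zero [simp]: "act P (\<lambda>e. 0) e = 0"
  by (simp add: act_def)

text \<open>Families form a module over the commutative ring of Laurent polynomials. All later
  rearrangement of linear factors takes place in that ring.\<close>

lemma act_mult: "act (P * P') W = act P (act P' W)"
proof
  fix e
  let ?p = "\<lambda>k. Poly_Mapping.single k (Poly_Mapping.lookup P k)"
  let ?q = "\<lambda>k. Poly_Mapping.single k (Poly_Mapping.lookup P' k)"
  have "act (P * P') W e = act ((\<Sum>k\<in>Poly_Mapping.keys P. ?p k) * (\<Sum>l\<in>Poly_Mapping.keys P'. ?q l)) W e"
    by (simp flip: poly_mapping_sum_singles)
  also have "\<dots> = (\<Sum>k\<in>Poly_Mapping.keys P. \<Sum>l\<in>Poly_Mapping.keys P'. act (?p k * ?q l) W e)"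
    by (simp add: sum_product act_sum)
  also have "\<dots> = (\<Sum>k\<in>Poly_Mapping.keys P. \<Sum>l\<in>Poly_Mapping.keys P'. act (?p k) (act (?q l) W) e)"
    by (simp add: mult_single act_single algebra_simps)
  also have "\<dots> = (\<Sum>k\<in>Poly_Mapping.keys P. act (?p k) (act P' W) e)"
  proof (rule sum.cong[OF refl])
    fix k
    have "act P' W = (\<lambda>e. \<Sum>l\<in>Poly_Mapping.keys P'. act (?q l) W e)"
      by (rule ext) (subst poly_mapping_sum_singles[of P'], rule act_sum)
    then show "(\<Sum>l\<in>Poly_Mapping.keys P'. act (?p k) (act (?q l) W) e) = act (?p k) (act P' W) e"
      by (simp add: act_fun_sum)
  qed
  also have "\<dots> = act P (act P' W) e"
    by (subst poly_mapping_sum_singles[of P], rule act_sum[symmetric])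
  finally show "act (P * P') W e = act P (act P' W) e" .
qed

lemma act_uminus: "act (- P) W e = - act P W e"
  using act_add[of P "- P" W e] by (simp add: add_eq_0_iff)

lemma act_diff: "act (P - P') W e = act P W e - act P' W e"
  using act_add[of P "- P'" W e] by (simp add: act_uminus)

lemma act_fun_diff: "act P (\<lambda>e. W e - W' e) e = act P W e - act P W' e"
  by (simp add: act_def right_diff_distrib sum_subtractf)


section \<open>Bosons on the Fock space\<close>

lemma pm_induct [case_names single add]:
  assumes "\<And>k c. P (Poly_Mapping.single k c)" "\<And>x y. P x \<Longrightarrow> P y \<Longrightarrow> P (x + y)"
  shows "P (x :: 'k \<Rightarrow>\<^sub>0 'c::comm_monoid_add)"
proof -
  have "P (\<Sum>k\<in>A. Poly_Mapping.single k (Poly_Mapping.lookup x k))" if "finite A" for A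
    using that
  proof (induction A rule: finite_induct)
    case empty
    show ?case using assms(1)[of undefined 0] by simp
  qed (simp add: assms)
  then show ?thesis using poly_mapping_sum_singles[of x] by (metis finite_keys)
qed

lemma lookup_boson_deriv:
  "Poly_Mapping.lookup (boson_deriv i k x) (m, \<beta>) =
    of_nat k * of_nat (Poly_Mapping.lookup m (i, k) + 1) *
    Poly_Mapping.lookup x (m + Poly_Mapping.single (i, k) 1, \<beta>)"
proof -
  let ?e = "Poly_Mapping.single (i, k) (1::nat)"
  let ?F = "\<lambda>(m', \<beta>'). of_nat k * of_nat (Poly_Mapping.lookup m' (i, k)) * Poly_Mapping.lookup x (m', \<beta>')"
  \<comment> \<open>Subtraction of exponents is truncated, so the first equation alone would also
    admit \<open>m' = m\<close> when the exponent at \<open>(i, k)\<close> is 0. The nonzero factor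
    excludes this.\<close>
  have iff: "(m' - ?e = m \<and> Poly_Mapping.lookup m' (i, k) \<noteq> 0) \<longleftrightarrow> m' = m + ?e" for m'
  proof
    assume A: "m' - ?e = m \<and> Poly_Mapping.lookup m' (i, k) \<noteq> 0"
    show "m' = m + ?e"
    proof (rule poly_mapping_eqI)
      fix j show "Poly_Mapping.lookup m' j = Poly_Mapping.lookup (m + ?e) j"
        using A by (auto simp: lookup_add lookup_minus lookup_single when_def)
    qed
  qed (auto simp: lookup_add)
  have "Poly_Mapping.lookup (boson_deriv i k x) (m, \<beta>)
      = (\<Sum>(m', \<beta>') \<in> Poly_Mapping.keys x. if m' - ?e = m \<and> \<beta>' = \<beta> then ?F (m', \<beta>') else 0)"
    unfolding boson_deriv_def lookup_sum
    by (rule sum.cong) (auto simp: lookup_single when_def)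
  also have "\<dots> = (\<Sum>b \<in> Poly_Mapping.keys x. if b = (m + ?e, \<beta>) then ?F b else 0)"
  proof (rule sum.cong[OF refl])
    fix b :: basis
    obtain m' \<beta>' where b: "b = (m', \<beta>')" by (cases b)
    show "(case b of (m', \<beta>') \<Rightarrow> if m' - ?e = m \<and> \<beta>' = \<beta> then ?F (m', \<beta>') else 0)
        = (if b = (m + ?e, \<beta>) then ?F b else 0)"
    proof (cases "Poly_Mapping.lookup m' (i, k) = 0")
      case True
      then show ?thesis by (simp add: b)
    next
      case False
      then have "m' - ?e = m \<longleftrightarrow> m' = m + ?e" using iff by blast
      then show ?thesis by (simp only: b prod.case prod.inject)
    qed
  qed
  also have "\<dots> = ?F (m + ?e, \<beta>)"
    by (simp add: in_keys_iff)
  finally show ?thesis by (simp add: lookup_add)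
qed

lemma boson_deriv_add: "boson_deriv i k (x + y) = boson_deriv i k x + boson_deriv i k y"
  by (rule poly_mapping_eqI) (auto simp: lookup_boson_deriv lookup_add algebra_simps)

lemma boson_deriv_single:
  "boson_deriv i k (Poly_Mapping.single (m, \<beta>) c) =
     Poly_Mapping.single (m - Poly_Mapping.single (i, k) 1, \<beta>) (of_nat k * of_nat (Poly_Mapping.lookup m (i, k)) * c)"
  by (cases "c = 0") (simp_all add: boson_deriv_def)

text \<open>Truncated subtraction associates with addition once the exponent is nonzero; in the
  Leibniz rule the other case carries the factor 0.\<close>

lemma pm_nat_diff_add:
  fixes m m' :: "'k \<Rightarrow>\<^sub>0 nat"
  assumes "Poly_Mapping.lookup m j \<noteq> 0"
  shows "m + m' - Poly_Mapping.single j 1 = (m - Poly_Mapping.single j 1) + m'"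
  by (rule poly_mapping_eqI) (use assms in \<open>auto simp: lookup_add lookup_minus lookup_single when_def\<close>)

lemma boson_deriv_mult:
  "boson_deriv i k (x * y) = boson_deriv i k x * y + x * boson_deriv i k y"
proof (induction x rule: pm_induct)
  case (single b c)
  show ?case
  proof (induction y rule: pm_induct)
    case (single b' c')
    obtain m \<beta> m' \<beta>' where b: "b = (m, \<beta>)" "b' = (m', \<beta>')" by (cases b, cases b') auto
    let ?e = "Poly_Mapping.single (i, k) (1::nat)"
    have 1: "Poly_Mapping.single (m + m' - ?e, \<beta> + \<beta>') (of_nat k * of_nat (Poly_Mapping.lookup m (i, k)) * c * c')
      = Poly_Mapping.single ((m - ?e) + m', \<beta> + \<beta>') (of_nat k * of_nat (Poly_Mapping.lookup m (i, k)) * c * c')"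
      by (cases "Poly_Mapping.lookup m (i, k) = 0") (simp_all add: pm_nat_diff_add[unfolded One_nat_def])
    have 2: "Poly_Mapping.single (m + m' - ?e, \<beta> + \<beta>') (of_nat k * of_nat (Poly_Mapping.lookup m' (i, k)) * c * c')
      = Poly_Mapping.single (m + (m' - ?e), \<beta> + \<beta>') (of_nat k * of_nat (Poly_Mapping.lookup m' (i, k)) * c * c')"
      using pm_nat_diff_add[of m' "(i, k)" m, unfolded One_nat_def]
      by (cases "Poly_Mapping.lookup m' (i, k) = 0") (simp_all add: add.commute)
    have "boson_deriv i k (Poly_Mapping.single b c * Poly_Mapping.single b' c')
      = Poly_Mapping.single (m + m' - ?e, \<beta> + \<beta>') (of_nat k * of_nat (Poly_Mapping.lookup m (i, k)) * c * c'
          + of_nat k * of_nat (Poly_Mapping.lookup m' (i, k)) * c * c')"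
      by (simp add: b mult_single boson_deriv_single lookup_add algebra_simps)
    also have "\<dots> = boson_deriv i k (Poly_Mapping.single b c) * Poly_Mapping.single b' c'
       + Poly_Mapping.single b c * boson_deriv i k (Poly_Mapping.single b' c')"
      unfolding single_add 1 2 by (simp add: b mult_single boson_deriv_single mult_ac add_ac)
    finally show ?case .
  next
    case (add y z)
    then show ?case by (simp add: boson_deriv_add algebra_simps)
  qed
next
  case (add x z)
  then show ?case by (simp add: boson_deriv_add algebra_simps)
qed

lemma boson_deriv_commute:
  "boson_deriv i k (boson_deriv j l x) = boson_deriv j l (boson_deriv i k x)"
proof (rule poly_mapping_eqI)
  fix b :: basis
  obtain m \<beta> where b: "b = (m, \<beta>)" by (cases b)
  show "Poly_Mapping.lookup (boson_deriv i k (boson_deriv j l x)) b = Poly_Mapping.lookup (boson_deriv j l (boson_deriv i k x)) b"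
    unfolding b lookup_boson_deriv
    by (cases "(i, k) = (j, l)") (auto simp: lookup_add lookup_single when_def add_ac)
qed

text \<open>The index $0$ is included with $a_{0,k}=0$.\<close>

definition dd :: "nat \<Rightarrow> nat \<Rightarrow> fock \<Rightarrow> fock" where
  "dd i k f = (if i = 0 then 0 else Abs_fps (\<lambda>N. boson_deriv i k (fps_nth f N)))"

definition av :: "nat \<Rightarrow> nat \<Rightarrow> fock" where
  "av i k = (if i = 0 then 0 else fps_const (Poly_Mapping.single (Poly_Mapping.single (i, k) 1, 0) 1))"

definition El :: "vec \<Rightarrow> fock" where
  "El \<gamma> = fps_const (Poly_Mapping.single (0, \<gamma>) 1)"

lemma boson_dd: "k > 0 \<Longrightarrow> boson i (int k) f = dd i k f"
  by (simp add: boson_def dd_def)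

lemma boson_av: "k > 0 \<Longrightarrow> boson i (- int k) f = av i k * f"
  by (simp add: boson_def av_def)

lemma exp_lat_El: "exp_lat \<gamma> f = El \<gamma> * f"
  by (simp add: exp_lat_def El_def)

lemma boson_deriv_0 [simp]: "boson_deriv i k 0 = 0"
  by (simp add: boson_deriv_def)

lemma boson_deriv_sum: "boson_deriv i k (sum f A) = (\<Sum>a\<in>A. boson_deriv i k (f a))"
  by (induction A rule: infinite_finite_induct) (simp_all add: boson_deriv_add)

lemma dd_add: "dd i k (f + g) = dd i k f + dd i k g"
  by (simp add: dd_def fps_eq_iff boson_deriv_add)

lemma dd_0 [simp]: "dd i k 0 = 0"
  by (simp add: dd_def fps_eq_iff)

lemma dd_mult: "dd i k (f * g) = dd i k f * g + f * dd i k g"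
  by (simp add: dd_def fps_eq_iff fps_mult_nth boson_deriv_sum boson_deriv_mult sum.distrib)

lemma boson_deriv_single0: "boson_deriv i k (Poly_Mapping.single (0, \<gamma>) c) = 0"
  by (simp add: boson_deriv_single)

lemma dd_sc [simp]: "dd i k (sc c) = 0"
  by (simp add: dd_def sc_def fps_eq_iff boson_deriv_single0 zero_prod_def)

lemma dd_El [simp]: "dd i k (El \<gamma>) = 0"
  by (simp add: dd_def El_def fps_eq_iff boson_deriv_single0)

lemma dd_cc [simp]: "dd i k (cc c) = 0"
  using dd_sc[of i k "fps_const c"] by (simp del: dd_sc)

lemma dd_hb [simp]: "dd i k hb = 0"
  using dd_sc[of i k fps_X] by (simp del: dd_sc)

lemma dd_endo: "A_endo UNIV (dd i k)"
  by (rule A_endoI) (simp_all add: dd_add dd_mult)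

lemma dd_av: "dd i k (av j l) = (if i = j \<and> k = l \<and> i \<noteq> 0 then of_nat k else 0)"
proof -
  have "boson_deriv i k (Poly_Mapping.single (Poly_Mapping.single (j, l) 1, 0) 1)
     = (if i = j \<and> k = l then of_nat k else 0)"
    by (auto simp: boson_deriv_single lookup_single when_def simp flip: zero_prod_def)
  then show ?thesis
    by (auto simp: dd_def av_def fps_eq_iff fps_of_nat simp flip: fps_of_nat)
qed

lemma dd_commute: "dd i k (dd j l f) = dd j l (dd i k f)"
  by (auto simp: dd_def fps_eq_iff intro: boson_deriv_commute)

lemma El_add: "El (\<gamma> + \<delta>) = El \<gamma> * El \<delta>"
  by (simp add: El_def mult_single)

lemma El_0 [simp]: "El 0 = 1"
  by (simp add: El_def flip: zero_prod_def)


section \<open>Sectors\<close>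

definition bos :: "nat \<Rightarrow> ((nat \<times> nat) \<Rightarrow>\<^sub>0 nat) \<Rightarrow> bool" where
  "bos n m \<longleftrightarrow> (\<forall>(i, k) \<in> Poly_Mapping.keys m. 1 \<le> i \<and> i \<le> n + 3 \<and> k > 0)"

definition RQ :: "nat \<Rightarrow> vec set \<Rightarrow> (basis \<Rightarrow>\<^sub>0 complex) set" where
  "RQ n L = {x. \<forall>(m, \<beta>) \<in> Poly_Mapping.keys x. bos n m \<and> \<beta> \<in> L}"

abbreviation FQ :: "nat \<Rightarrow> vec set \<Rightarrow> fock set" where
  "FQ n L \<equiv> cset (RQ n L)"

abbreviation Sec :: "nat \<Rightarrow> vec \<Rightarrow> fock set" where
  "Sec n \<beta> \<equiv> FQ n {\<beta>}"

lemma Fock_FQ: "Fock n = FQ n (Q n)"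
  by (auto simp: Fock_def cset_def RQ_def bos_def)

lemma RQ_iff: "x \<in> RQ n L \<longleftrightarrow> (\<forall>m \<beta>. (m, \<beta>) \<in> Poly_Mapping.keys x \<longrightarrow> bos n m \<and> \<beta> \<in> L)"
  by (auto simp: RQ_def)

lemma lookup_single0_mult: "Poly_Mapping.lookup (Poly_Mapping.single 0 c * x) b = c * Poly_Mapping.lookup (x :: basis \<Rightarrow>\<^sub>0 complex) b"
  by (induction x rule: pm_induct) (simp_all add: mult_single lookup_single when_def lookup_add algebra_simps)

lemma csub_RQ [simp]: "csub (RQ n L)"
proof -
  have "Poly_Mapping.keys (Poly_Mapping.single 0 c * x) \<subseteq> Poly_Mapping.keys x" for c and x :: "basis \<Rightarrow>\<^sub>0 complex"
    by (auto simp: in_keys_iff lookup_single0_mult)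
  moreover have "Poly_Mapping.keys (x + y) \<subseteq> Poly_Mapping.keys x \<union> Poly_Mapping.keys y" for x y :: "basis \<Rightarrow>\<^sub>0 complex"
    by (rule keys_add)
  ultimately show ?thesis unfolding csub_def RQ_def by fastforce
qed

lemma FQ_mono: "L \<subseteq> L' \<Longrightarrow> FQ n L \<subseteq> FQ n L'"
  unfolding cset_def using RQ_iff by blast

lemma Sec_FQ: "\<beta> \<in> L \<Longrightarrow> f \<in> Sec n \<beta> \<Longrightarrow> f \<in> FQ n L"
  using FQ_mono[of "{\<beta>}" L n] by auto

lemma bos_add: "bos n m \<Longrightarrow> bos n m' \<Longrightarrow> bos n (m + m')"
  using keys_add[of m m'] by (auto simp: bos_def)

lemma RQ_mult:
  assumes "x \<in> RQ n L" "y \<in> RQ n L'" "\<And>\<beta> \<gamma>. \<beta> \<in> L \<Longrightarrow> \<gamma> \<in> L' \<Longrightarrow> \<beta> + \<gamma> \<in> L''"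
  shows "x * y \<in> RQ n L''"
  unfolding RQ_iff
proof (intro allI impI)
  fix m \<beta> assume "(m, \<beta>) \<in> Poly_Mapping.keys (x * y)"
  then obtain b b' where b: "(m, \<beta>) = b + b'" "b \<in> Poly_Mapping.keys x" "b' \<in> Poly_Mapping.keys y"
    using keys_mult[of x y] by blast
  obtain m1 \<beta>1 m2 \<beta>2 where "b = (m1, \<beta>1)" "b' = (m2, \<beta>2)" by (cases b, cases b') auto
  then show "bos n m \<and> \<beta> \<in> L''" using b assms by (auto simp: RQ_iff intro: bos_add)
qed

lemma FQ_mult:
  assumes "f \<in> FQ n L" "g \<in> FQ n L'" "\<And>\<beta> \<gamma>. \<beta> \<in> L \<Longrightarrow> \<gamma> \<in> L' \<Longrightarrow> \<beta> + \<gamma> \<in> L''"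
  shows "f * g \<in> FQ n L''"
  using assms by (auto simp: cset_def fps_mult_nth intro!: csub_sum[OF csub_RQ] RQ_mult)

lemma RQ_deriv:
  assumes "x \<in> RQ n L"
  shows "boson_deriv i k x \<in> RQ n L"
proof -
  have "bos n m \<and> \<beta> \<in> L" if "(m, \<beta>) \<in> Poly_Mapping.keys (boson_deriv i k x)" for m \<beta>
  proof -
    have "(m + Poly_Mapping.single (i, k) 1, \<beta>) \<in> Poly_Mapping.keys x"
      using that by (auto simp: in_keys_iff lookup_boson_deriv)
    then have "bos n (m + Poly_Mapping.single (i, k) 1)" "\<beta> \<in> L" using assms by (auto simp: RQ_def)
    moreover have "Poly_Mapping.keys m \<subseteq> Poly_Mapping.keys (m + Poly_Mapping.single (i, k) 1)"
      by (auto simp: in_keys_iff lookup_add)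
    ultimately show ?thesis by (auto simp: bos_def)
  qed
  then show ?thesis by (auto simp: RQ_def)
qed

lemma dd_FQ: "A_endo (FQ n L) (dd i k)"
  by (rule A_endoI) (auto simp: dd_add dd_mult, auto simp: dd_def cset_def intro: RQ_deriv csubD(1)[OF csub_RQ])

lemma av_Sec: "i \<le> n + 3 \<Longrightarrow> k > 0 \<Longrightarrow> av i k \<in> Sec n 0"
  by (auto simp: av_def cset_def RQ_def bos_def)

lemma El_Sec: "El \<gamma> \<in> Sec n \<gamma>"
  by (auto simp: El_def cset_def RQ_def bos_def)

lemma one_Sec: "1 \<in> Sec n 0"
  using El_Sec[of 0 n] by simp

lemma Sec_mult: "f \<in> Sec n \<beta> \<Longrightarrow> g \<in> Sec n \<gamma> \<Longrightarrow> f * g \<in> Sec n (\<beta> + \<gamma>)"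
  by (rule FQ_mult) auto

lemma Sec0_mult: "f \<in> Sec n 0 \<Longrightarrow> g \<in> FQ n L \<Longrightarrow> f * g \<in> FQ n L"
  by (rule FQ_mult) auto

text \<open>Sectors suffice. On a single sector every zero mode acts as a scalar of A, which is why
  identities below are checked for one lattice exponent and then extended by linearity and
  continuity.\<close>

lemma Sec_eqI:
  assumes "A_endo (FQ n L) T" "A_endo (FQ n L) T'"
    "\<And>\<beta> f. \<beta> \<in> L \<Longrightarrow> f \<in> Sec n \<beta> \<Longrightarrow> T f = T' f" "f \<in> FQ n L"
  shows "T f = T' f"
proof (rule A_endo_eqI[OF assms(1,2) csub_RQ _ assms(4)])
  fix x assume x: "x \<in> RQ n L"
  let ?s = "\<lambda>k. fps_const (Poly_Mapping.single k (Poly_Mapping.lookup x k))"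
  have "x = (\<Sum>k\<in>Poly_Mapping.keys x. Poly_Mapping.single k (Poly_Mapping.lookup x k))"
    by (rule poly_mapping_sum_singles)
  then have e: "fps_const x = (\<Sum>k\<in>Poly_Mapping.keys x. ?s k)"
    by (subst (1) \<open>x = _\<close>) (rule fps_ext, simp add: fps_sum_nth)
  have m: "?s k \<in> Sec n (snd k)" "snd k \<in> L" if "k \<in> Poly_Mapping.keys x" for k
    using that x by (auto simp: RQ_def cset_def)
  have m': "?s k \<in> FQ n L" if "k \<in> Poly_Mapping.keys x" for k
    by (rule Sec_FQ[OF m(2,1)[OF that]])
  show "T (fps_const x) = T' (fps_const x)"
  proof -
    have "T (\<Sum>k\<in>Poly_Mapping.keys x. ?s k) = (\<Sum>k\<in>Poly_Mapping.keys x. T (?s k))"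
      by (rule A_endo_sum[OF assms(1) csub_RQ]) (rule m')
    also have "\<dots> = (\<Sum>k\<in>Poly_Mapping.keys x. T' (?s k))"
      by (rule sum.cong[OF refl]) (rule assms(3)[OF m(2,1)])
    also have "\<dots> = T' (\<Sum>k\<in>Poly_Mapping.keys x. ?s k)"
      by (rule A_endo_sum[OF assms(2) csub_RQ, symmetric]) (rule m')
    finally show ?thesis unfolding e .
  qed
qed

section \<open>Operators diagonal in the lattice exponent\<close>

definition dg :: "(vec \<Rightarrow> complex) \<Rightarrow> (basis \<Rightarrow>\<^sub>0 complex) \<Rightarrow> (basis \<Rightarrow>\<^sub>0 complex)" where
  "dg g x = (\<Sum>b\<in>Poly_Mapping.keys x. Poly_Mapping.single b (g (snd b) * Poly_Mapping.lookup x b))"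

lemma lookup_dg: "Poly_Mapping.lookup (dg g x) b = g (snd b) * Poly_Mapping.lookup x b"
  by (simp add: dg_def lookup_sum lookup_single when_def in_keys_iff)

lemma dg_add: "dg g (x + y) = dg g x + dg g y"
  by (rule poly_mapping_eqI) (simp add: lookup_dg lookup_add algebra_simps)

lemma dg_0 [simp]: "dg g 0 = 0"
  by (rule poly_mapping_eqI) (simp add: lookup_dg)

lemma dg_scale: "dg g (Poly_Mapping.single 0 c * x) = Poly_Mapping.single 0 c * dg g x"
  by (rule poly_mapping_eqI) (simp add: lookup_dg lookup_single0_mult)

lemma dg_sum: "dg g (sum f A) = (\<Sum>a\<in>A. dg g (f a))"
  by (induction A rule: infinite_finite_induct) (simp_all add: dg_add)

lemma diag_nth: "fps_nth (diag g f) N = (\<Sum>q\<le>N. dg (\<lambda>\<beta>. fps_nth (g \<beta>) q) (fps_nth f (N - q)))"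
  by (simp add: diag_def dg_def)

lemma diag_add: "diag g (f + h) = diag g f + diag g h"
  by (rule fps_ext) (simp add: diag_nth dg_add sum.distrib)

lemma dg_RQ: "x \<in> RQ n L \<Longrightarrow> dg g x \<in> RQ n L"
  by (auto simp: RQ_def in_keys_iff lookup_dg)

lemma diag_Sec:
  assumes "f \<in> Sec n \<beta>"
  shows "diag g f = sc (g \<beta>) * f"
proof (rule fps_ext)
  fix N
  have "dg (\<lambda>\<beta>. h \<beta>) x = Poly_Mapping.single 0 (h \<beta>) * x" if "x \<in> RQ n {\<beta>}" for h x
  proof (rule poly_mapping_eqI)
    fix b show "Poly_Mapping.lookup (dg h x) b = Poly_Mapping.lookup (Poly_Mapping.single 0 (h \<beta>) * x) b"
      using that
      by (cases b, cases "b \<in> Poly_Mapping.keys x") (auto simp: lookup_dg lookup_single0_mult RQ_iff in_keys_iff)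
  qed
  then show "fps_nth (diag g f) N = fps_nth (sc (g \<beta>) * f) N"
    using assms by (simp add: diag_nth fps_mult_nth sc_def cset_def atLeast0AtMost)
qed

lemma sum_triangle_swap:
  fixes N :: nat
  shows "(\<Sum>q\<le>N. \<Sum>r\<le>N - q. F q r) = (\<Sum>r\<le>N. \<Sum>q\<le>N - r. F q r)"
  by (simp add: sum.Sigma)
     (rule sum.reindex_bij_witness[of _ "\<lambda>(r, q). (q, r)" "\<lambda>(q, r). (r, q)"]; auto)

lemma diag_FQ: "A_endo (FQ n L) (diag g)"
proof (rule A_endoI)
  show "diag g f \<in> FQ n L" if "f \<in> FQ n L" for f
    using that by (auto simp: cset_def diag_nth intro!: csub_sum[OF csub_RQ] dg_RQ)
  show "diag g (f + h) = diag g f + diag g h" for f h by (rule diag_add)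
  show "diag g (sc c * f) = sc c * diag g f" for c f
  proof (rule fps_ext)
    fix N
    have "fps_nth (diag g (sc c * f)) N =
        (\<Sum>q\<le>N. \<Sum>r\<le>N - q. Poly_Mapping.single 0 (fps_nth c r) * dg (\<lambda>\<beta>. fps_nth (g \<beta>) q) (fps_nth f (N - q - r)))"
      by (simp add: diag_nth fps_mult_nth sc_def dg_sum dg_scale atLeast0AtMost)
    also have "\<dots> = (\<Sum>r\<le>N. \<Sum>q\<le>N - r. Poly_Mapping.single 0 (fps_nth c r) * dg (\<lambda>\<beta>. fps_nth (g \<beta>) q) (fps_nth f (N - q - r)))"
      by (rule sum_triangle_swap)
    also have "\<dots> = fps_nth (sc c * diag g f) N"
      by (simp add: diag_nth fps_mult_nth sc_def sum_distrib_left atLeast0AtMost add.commute)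
    finally show "fps_nth (diag g (sc c * f)) N = fps_nth (sc c * diag g f) N" .
  qed
qed

section \<open>Expansions of powers\<close>

lemma upow_self [simp]: "upow a k k = 1"
  by (simp add: upow_def)

lemma upow_gt [simp]: "k < p \<Longrightarrow> upow a k p = 0"
  by (simp add: upow_def)

lemma upow_0 [simp]: "upow 0 k p = (if k = p then 1 else 0)"
  by (auto simp: upow_def)

lemma upow_0_exp [simp]: "upow a 0 p = (if p = 0 then 1 else 0)"
  by (auto simp: upow_def gbinomial_0_left)

lemma upow_neg [simp]: "0 \<le> k \<Longrightarrow> p < 0 \<Longrightarrow> upow a k p = 0"
proof -
  assume A: "0 \<le> k" "p < 0"
  then obtain l where l: "k = int l" by (metis nonneg_int_cases)
  have "(of_int k :: complex) gchoose nat (k - p) = 0"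
    unfolding l using A by (simp add: l flip: binomial_gbinomial)
  then show ?thesis by (simp add: upow_def)
qed

lemma upow_nth: "fps_nth (upow a k p) N = (if p \<le> k \<and> N = nat (k - p) then (of_int k gchoose N) * a ^ N else 0)"
  by (auto simp: upow_def fps_X_power_mult_right_nth fps_X_power_nth)

text \<open>The coefficient of u^p in (u + a hbar)^k is a multiple of hbar^(k-p). This is the main
  source of summability in what follows: at order N the exponents k and p differ by at most
  N.\<close>

lemma sc_upow_nth_nonzero:
  assumes "fps_nth (sc (upow a k p) * f) N \<noteq> 0"
  shows "p \<le> k" "nat (k - p) \<le> N" "fps_nth f (N - nat (k - p)) \<noteq> 0"
proof -
  obtain i where i: "i \<le> N" "fps_nth (sc (upow a k p)) i \<noteq> 0" "fps_nth f (N - i) \<noteq> 0"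
    using assms by (rule fps_mult_nth_nonzero)
  have "fps_nth (upow a k p) i \<noteq> 0" using i(2) by (auto simp: sc_def)
  then have "p \<le> k" "i = nat (k - p)" by (auto simp: upow_nth split: if_splits)
  then show "p \<le> k" "nat (k - p) \<le> N" "fps_nth f (N - nat (k - p)) \<noteq> 0" using i by auto
qed

lemma upow_alt: "upow a k p = (if p \<le> k then fps_const (of_int k gchoose nat (k - p)) * (fps_const a * fps_X) ^ nat (k - p) else 0)"
  by (simp add: upow_def power_mult_distrib fps_const_power flip: fps_const_mult)

lemma fps_const_sum': "fps_const (sum f A) = (\<Sum>a\<in>A. fps_const (f a))"
  by (rule fps_ext) (simp add: fps_sum_nth)

text \<open>(u + c hbar)^k (u + c hbar)^l = (u + c hbar)^(k+l) read off at u^p, for exponents of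
  either sign. Both factors vanish above their own exponent, which bounds s on both sides.\<close>

lemma upow_vandermonde:
  assumes "p \<le> k + l"
  shows "(\<Sum>s = p - l..k. upow c k s * upow c l (p - s)) = upow c (k + l) p"
proof -
  let ?z = "fps_const c * fps_X :: complex fps"
  let ?n = "nat (k + l - p)"
  have "(\<Sum>s = p - l..k. upow c k s * upow c l (p - s))
     = (\<Sum>j\<le>?n. fps_const ((of_int k gchoose j) * (of_int l gchoose (?n - j))) * ?z ^ ?n)"
  proof (rule sum.reindex_bij_witness[of _ "\<lambda>j. k - int j" "\<lambda>s. nat (k - s)"])
    fix s assume s: "s \<in> {p - l..k}"
    have e: "nat (l - (p - s)) = ?n - nat (k - s)" "nat (k - s) + (?n - nat (k - s)) = ?n" using s by auto
    show "fps_const ((of_int k gchoose nat (k - s)) * (of_int l gchoose (?n - nat (k - s)))) * ?z ^ ?n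
        = upow c k s * upow c l (p - s)"
      using s by (subst e(2)[symmetric]) (simp add: upow_alt e(1) power_add mult_ac flip: fps_const_mult)
  qed (use assms in auto)
  also have "\<dots> = fps_const (\<Sum>j\<le>?n. (of_int k gchoose j) * (of_int l gchoose (?n - j))) * ?z ^ ?n"
    by (simp add: fps_const_sum' sum_distrib_right)
  also have "\<dots> = upow c (k + l) p"
    using assms by (simp add: upow_alt gbinomial_Vandermonde[symmetric] atMost_atLeast0)
  finally show ?thesis .
qed

text \<open>The substitution of u + c hbar for u in (u + b hbar)^l, read off at u^p. Trinomial
  revision reduces it to the binomial theorem for (b + c)^(l-p).\<close>

lemma upow_compose:
  assumes "p \<le> l"
  shows "(\<Sum>k = p..l. upow c k p * upow b l k) = upow (b + c) l p"
proof -
  let ?J = "nat (l - p)"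
  have "(\<Sum>k = p..l. upow c k p * upow b l k)
     = (\<Sum>j\<le>?J. fps_const ((of_int l gchoose ?J) * (of_nat (?J choose j) * b ^ j * c ^ (?J - j))) * fps_X ^ ?J)"
  proof (rule sum.reindex_bij_witness[of _ "\<lambda>j. l - int j" "\<lambda>k. nat (l - k)"])
    fix k assume k: "k \<in> {p..l}"
    let ?j = "nat (l - k)"
    have e: "nat (k - p) = ?J - ?j" "?j + (?J - ?j) = ?J" "?j \<le> ?J" using k by auto
    have g: "((of_int l :: complex) gchoose ?J) * of_nat (?J choose ?j) = (of_int l gchoose ?j) * (of_int k gchoose (?J - ?j))"
      using gbinomial_trinomial_revision[OF e(3), of "of_int l :: complex"] k
      by (simp add: binomial_gbinomial)
    have "fps_const ((of_int l gchoose ?J) * (of_nat (?J choose ?j) * b ^ ?j * c ^ (?J - ?j))) * fps_X ^ ?J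
      = fps_const ((of_int l gchoose ?j) * (of_int k gchoose (?J - ?j)) * b ^ ?j * c ^ (?J - ?j)) * (fps_X ^ ?j * fps_X ^ (?J - ?j))"
      using e(2) by (simp flip: g power_add mult.assoc)
    also have "\<dots> = upow c k p * upow b l k"
      using k by (simp add: upow_def e(1) mult_ac flip: fps_const_mult)
    finally show "fps_const ((of_int l gchoose ?J) * (of_nat (?J choose ?j) * b ^ ?j * c ^ (?J - ?j))) * fps_X ^ ?J
      = upow c k p * upow b l k" .
  qed (use assms in auto)
  also have "\<dots> = fps_const ((of_int l gchoose ?J) * (b + c) ^ ?J) * fps_X ^ ?J"
    unfolding binomial_ring sum_distrib_left
    by (simp add: fps_const_sum' sum_distrib_right)
  also have "\<dots> = upow (b + c) l p" using assms by (simp add: upow_def)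
  finally show ?thesis .
qed

section \<open>Reindexed sums and Cauchy products\<close>

lemma hsum_inj:
  assumes "inj h" "\<And>j. j \<notin> range h \<Longrightarrow> g j = 0"
  shows "hsummable (\<lambda>i. g (h i)) \<longleftrightarrow> hsummable g" "hsum (\<lambda>i. g (h i)) = hsum g"
proof -
  have *: "{j. fps_nth (g j) N \<noteq> 0} = h ` {i. fps_nth (g (h i)) N \<noteq> 0}" for N
    using assms(2) by (auto simp: image_iff) (metis fps_zero_nth rangeE)
  have inj: "inj_on h A" for A using assms(1) by (rule inj_on_subset) simp
  show "hsummable (\<lambda>i. g (h i)) \<longleftrightarrow> hsummable g"
    unfolding hsummable_def * finite_image_iff[OF inj] ..
  have "sum (\<lambda>j. fps_nth (g j) N) {j. fps_nth (g j) N \<noteq> 0} = sum (\<lambda>i. fps_nth (g (h i)) N) {i. fps_nth (g (h i)) N \<noteq> 0}" for N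
    unfolding * by (simp add: sum.reindex[OF inj])
  then show "hsum (\<lambda>i. g (h i)) = hsum g"
    by (simp add: hsum_def Sum_any.expand_set)
qed

lemma hsum_diag:
  fixes g :: "nat \<Rightarrow> nat \<Rightarrow> fock"
  assumes "hsummable (\<lambda>(i, j). g i j)"
  shows "hsummable (\<lambda>k. \<Sum>i\<le>k. g i (k - i))"
    "hsum (\<lambda>k. \<Sum>i\<le>k. g i (k - i)) = hsum (\<lambda>(i, j). g i j)"
proof -
  let ?G = "\<lambda>(k, i). if i \<le> k then g i (k - i) else 0"
  let ?h = "\<lambda>(i, j). (i + j, i :: nat)"
  have inj: "inj ?h" by (auto simp: inj_on_def)
  have z: "?G x = 0" if "x \<notin> range ?h" for x
    using that by (cases x) (force simp: image_iff le_iff_add)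
  have e: "(\<lambda>x. ?G (?h x)) = (\<lambda>(i, j). g i j)" by auto
  have "hsummable (\<lambda>x. ?G (?h x)) \<longleftrightarrow> hsummable ?G" "hsum (\<lambda>x. ?G (?h x)) = hsum ?G"
    by (rule hsum_inj[OF inj]; rule z; assumption)+
  then have S: "hsummable ?G" and s: "hsum (\<lambda>(i, j). g i j) = hsum ?G"
    using assms unfolding e by blast+
  have f: "hsum (\<lambda>i. if i \<le> k then g i (k - i) else 0) = (\<Sum>i\<le>k. g i (k - i))" for k
    by (subst hsum_finite(2)[of "{..k}"]) auto
  show "hsummable (\<lambda>k. \<Sum>i\<le>k. g i (k - i))"
    "hsum (\<lambda>k. \<Sum>i\<le>k. g i (k - i)) = hsum (\<lambda>(i, j). g i j)"
    using hsum_Sigma(2,3)[OF S] s unfolding f by simp_all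
qed

lemma hsum_product:
  assumes "hsummable a" "hsummable b"
  shows "hsummable (\<lambda>(i, j). a i * b j)" "hsum (\<lambda>(i, j). a i * b j) = hsum a * hsum b"
proof -
  show s: "hsummable (\<lambda>(i, j). a i * b j)"
  proof (rule hsummableI)
    fix N
    let ?I = "{i. \<exists>m\<le>N. fps_nth (a i) m \<noteq> 0} \<times> {j. \<exists>m\<le>N. fps_nth (b j) m \<noteq> 0}"
    have "fps_nth (a i * b j) N = 0" if "(i, j) \<notin> ?I" for i j
      unfolding fps_mult_nth by (rule sum.neutral) (use that in auto)
    then show "\<exists>I. finite I \<and> (\<forall>x. x \<notin> I \<longrightarrow> fps_nth (case x of (i, j) \<Rightarrow> a i * b j) N = 0)"
      using hsummable_upto[OF assms(1)] hsummable_upto[OF assms(2)]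
      by (intro exI[of _ ?I] conjI finite_cartesian_product) auto
  qed
  have "hsum (\<lambda>(i, j). a i * b j) = hsum (\<lambda>i. a i * hsum b)"
    unfolding hsum_Sigma(3)[OF s, symmetric] by (simp add: hsum_mult(2)[OF assms(2)])
  also have "\<dots> = hsum a * hsum b"
    using hsum_mult(2)[OF assms(1), of "hsum b"] by (simp add: mult.commute)
  finally show "hsum (\<lambda>(i, j). a i * b j) = hsum a * hsum b" .
qed


section \<open>Exponentials of creation operators\<close>

text \<open>Only the coefficient of u^0 hbar^0 is excluded, so each factor contributes at least 1 to
  the total degree in u and hbar. Thus c^m starts in total degree m, and the exponential series
  converges although c need not be divisible by u or by hbar.\<close>

lemma power_order:
  fixes c :: "fock fps"
  assumes "fps_nth (fps_nth c 0) 0 = 0" "p + N < m"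
  shows "fps_nth (fps_nth (c ^ m) p) N = 0"
  using assms(2)
proof (induction m arbitrary: p N)
  case (Suc m)
  have "fps_nth (fps_nth c i * fps_nth (c ^ m) (p - i)) N = 0" if "i \<le> p" for i
    unfolding fps_mult_nth
  proof (rule sum.neutral, rule ballI)
    fix j assume j: "j \<in> {0..N}"
    show "fps_nth (fps_nth c i) j * fps_nth (fps_nth (c ^ m) (p - i)) (N - j) = 0"
    proof (cases "i = 0 \<and> j = 0")
      case False
      then have "p - i + (N - j) < m" using Suc.prems j that by auto
      then show ?thesis by (simp add: Suc.IH)
    qed (use assms(1) in auto)
  qed
  then show ?case by (simp add: fps_mult_nth[of c] fps_sum_nth)
qed simp

text \<open>Creation operators act by multiplication and their currents contain only nonnegative
  powers of u. Their exponentials therefore live in a commutative ring of power series, whose outer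
  variable is u and whose inner variable is hbar.\<close>

definition mexp :: "fock fps \<Rightarrow> fock fps" where
  "mexp c = Abs_fps (\<lambda>p. hsum (\<lambda>m. cc (1 / fact m) * fps_nth (c ^ m) p))"

lemma mexp_summable:
  assumes "fps_nth (fps_nth c 0) 0 = 0"
  shows "hsummable (\<lambda>m. b m * fps_nth (c ^ m) p)"
proof (rule hsummableI)
  fix N
  have "fps_nth (b m * fps_nth (c ^ m) p) N = 0" if "m \<notin> {..p + N}" for m
    unfolding fps_mult_nth
  proof (rule sum.neutral, rule ballI)
    fix x
    have "fps_nth (fps_nth (c ^ m) p) (N - x) = 0" using that by (intro power_order[OF assms]) auto
    then show "fps_nth (b m) x * fps_nth (fps_nth (c ^ m) p) (N - x) = 0" by simp
  qed
  then show "\<exists>I. finite I \<and> (\<forall>m. m \<notin> I \<longrightarrow> fps_nth (b m * fps_nth (c ^ m) p) N = 0)"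
    by (intro exI[of _ "{..p + N}"]) auto
qed

lemma mexp_nth: "fps_nth (mexp c) p = hsum (\<lambda>m. cc (1 / fact m) * fps_nth (c ^ m) p)"
  by (simp add: mexp_def)

lemma mexp_times:
  assumes "fps_nth (fps_nth c 0) 0 = 0"
  shows "hsummable (\<lambda>m. cc (1 / fact m) * fps_nth (w * c ^ m) p)"
    "fps_nth (w * mexp c) p = hsum (\<lambda>m. cc (1 / fact m) * fps_nth (w * c ^ m) p)"
proof -
  have e: "cc (1 / fact m) * fps_nth (w * c ^ m) p
     = (\<Sum>i=0..p. fps_nth w i * (cc (1 / fact m) * fps_nth (c ^ m) (p - i)))" for m
    by (simp add: fps_mult_nth[of w] sum_distrib_left mult_ac)
  have s: "hsummable (\<lambda>m. fps_nth w i * (cc (1 / fact m) * fps_nth (c ^ m) (p - i)))" for i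
    by (rule hsum_mult(1)[OF mexp_summable[OF assms]])
  show "hsummable (\<lambda>m. cc (1 / fact m) * fps_nth (w * c ^ m) p)"
    unfolding e by (rule hsum_sum(1)) (auto intro: s)
  have "hsum (\<lambda>m. cc (1 / fact m) * fps_nth (w * c ^ m) p)
     = (\<Sum>i=0..p. hsum (\<lambda>m. fps_nth w i * (cc (1 / fact m) * fps_nth (c ^ m) (p - i))))"
    unfolding e by (rule hsum_sum(2)) (auto intro: s)
  also have "\<dots> = fps_nth (w * mexp c) p"
    by (simp add: hsum_mult(2)[OF mexp_summable[OF assms]] mexp_nth fps_mult_nth[of w])
  finally show "fps_nth (w * mexp c) p = hsum (\<lambda>m. cc (1 / fact m) * fps_nth (w * c ^ m) p)" by simp
qed

lemma mexp_0 [simp]: "mexp 0 = 1"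
proof (rule fps_ext)
  fix p
  show "fps_nth (mexp 0) p = fps_nth 1 p"
    unfolding mexp_nth by (subst hsum_single(2)[of 0]) (auto simp: zero_power)
qed

lemma fps_of_nat_mult_nth: "fps_nth (of_nat k * w) p = of_nat k * fps_nth (w :: 'a::comm_ring_1 fps) p"
  by (simp add: fps_of_nat[symmetric] fps_mult_left_const_nth)

text \<open>The binomial theorem and a rearrangement of the double series; the order estimate for
  both powers makes the double family summable.\<close>

lemma mexp_add:
  assumes a: "fps_nth (fps_nth a 0) 0 = 0" and b: "fps_nth (fps_nth b 0) 0 = 0"
  shows "mexp (a + b) = mexp a * mexp b"
proof (rule fps_ext)
  fix p
  let ?g = "\<lambda>m l. cc (1 / fact m) * (cc (1 / fact l) * fps_nth (a ^ m * b ^ l) p)"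
  have s: "hsummable (\<lambda>(m, l). ?g m l)"
  proof (rule hsummableI)
    fix N
    have "fps_nth (?g m l) N = 0" if "(m, l) \<notin> {..p + N} \<times> {..p + N}" for m l
    proof -
      have "fps_nth (fps_nth (a ^ m * b ^ l) p) k = 0" if k: "k \<le> N" for k
      proof -
        have "fps_nth (fps_nth (a ^ m) i * fps_nth (b ^ l) (p - i)) k = 0" if "i \<le> p" for i
          unfolding fps_mult_nth
        proof (rule sum.neutral, rule ballI)
          fix j assume j: "j \<in> {0..k}"
          consider "m > p + N" | "l > p + N" using \<open>(m, l) \<notin> _\<close> by fastforce
          then show "fps_nth (fps_nth (a ^ m) i) j * fps_nth (fps_nth (b ^ l) (p - i)) (k - j) = 0"
          proof cases
            case 1
            then have "fps_nth (fps_nth (a ^ m) i) j = 0" using j k that by (intro power_order[OF a]) auto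
            then show ?thesis by simp
          next
            case 2
            then have "fps_nth (fps_nth (b ^ l) (p - i)) (k - j) = 0" using j k that by (intro power_order[OF b]) auto
            then show ?thesis by simp
          qed
        qed
        then show ?thesis by (simp add: fps_mult_nth[of "a ^ m"] fps_sum_nth)
      qed
      then show ?thesis by (simp add: cc_def fps_mult_left_const_nth)
    qed
    then show "\<exists>I. finite I \<and> (\<forall>x. x \<notin> I \<longrightarrow> fps_nth (case x of (m, l) \<Rightarrow> ?g m l) N = 0)"
      by (intro exI[of _ "{..p + N} \<times> {..p + N}"]) auto
  qed
  have bin: "cc (1 / fact k) * fps_nth ((a + b) ^ k) p = (\<Sum>m\<le>k. ?g m (k - m))" for k
  proof -
    have "cc (1 / fact k) * of_nat (k choose m) = cc (1 / fact m) * cc (1 / fact (k - m))" if "m \<le> k" for m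
      using that by (simp add: binomial_fact field_simps flip: cc_of_nat cc_mult)
    then have "cc (1 / fact k) * (of_nat (k choose m) * x) = cc (1 / fact m) * (cc (1 / fact (k - m)) * x)" if "m \<le> k" for m x
      using that by (simp flip: mult.assoc)
    then show ?thesis
      by (simp add: binomial_ring fps_sum_nth sum_distrib_left mult.assoc fps_of_nat_mult_nth)
  qed
  have "fps_nth (mexp (a + b)) p = hsum (\<lambda>(m, l). ?g m l)"
    unfolding mexp_nth bin by (rule hsum_diag(2)[OF s])
  also have "\<dots> = hsum (\<lambda>m. cc (1 / fact m) * fps_nth (a ^ m * mexp b) p)"
    unfolding hsum_Sigma(3)[OF s, symmetric] mexp_times(2)[OF b]
    by (simp add: hsum_mult(2)[OF mexp_times(1)[OF b]])
  also have "\<dots> = fps_nth (mexp b * mexp a) p"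
    unfolding mexp_times(2)[OF a] by (simp add: mult.commute)
  finally show "fps_nth (mexp (a + b)) p = fps_nth (mexp a * mexp b) p" by (simp add: mult.commute)
qed

definition Dl :: "(fock \<Rightarrow> fock) \<Rightarrow> fock fps \<Rightarrow> fock fps" where
  "Dl D w = Abs_fps (\<lambda>p. D (fps_nth w p))"

lemma Dl_nth [simp]: "fps_nth (Dl D w) p = D (fps_nth w p)"
  by (simp add: Dl_def)

lemma dd_sum: "dd i k (sum f A) = (\<Sum>a\<in>A. dd i k (f a))"
  by (induction A rule: infinite_finite_induct) (simp_all add: dd_add)

lemma Dl_dd_mult: "Dl (dd i k) (w * z) = Dl (dd i k) w * z + w * Dl (dd i k) z"
  by (rule fps_ext) (simp add: fps_mult_nth dd_sum dd_mult sum.distrib)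

lemma dd_1 [simp]: "dd i k 1 = 0"
  using dd_cc[of i k 1] by (simp del: dd_cc)

lemma Dl_dd_power: "Dl (dd i k) (c ^ Suc m) = of_nat (Suc m) * (Dl (dd i k) c * c ^ m)"
proof (induction m)
  case (Suc m)
  show ?case
    by (subst power_Suc) (simp add: Dl_dd_mult Suc.IH algebra_simps del: power_Suc, simp add: algebra_simps)
qed simp

lemma hsum_Suc:
  fixes g :: "nat \<Rightarrow> fock"
  assumes "g 0 = 0"
  shows "hsum (\<lambda>m. g (Suc m)) = hsum g"
  by (rule hsum_inj(2)) (use assms in \<open>auto simp: image_iff, metis not0_implies_Suc\<close>)

text \<open>Each \<open>dd i k\<close> is a derivation of a commutative ring, so D(c^m) = m D(c)
  c^(m-1), and the exponential series reproduces itself after an index shift.\<close>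

lemma Dl_mexp:
  assumes "fps_nth (fps_nth c 0) 0 = 0"
  shows "Dl (dd i k) (mexp c) = Dl (dd i k) c * mexp c"
proof (rule fps_ext)
  fix p
  let ?g = "\<lambda>m. cc (1 / fact m) * fps_nth (Dl (dd i k) (c ^ m)) p"
  have e: "?g (Suc m) = cc (1 / fact m) * fps_nth (Dl (dd i k) c * c ^ m) p" for m
  proof -
    have "cc (1 / fact (Suc m)) * of_nat (Suc m) = cc (1 / fact m)"
      by (simp add: field_simps flip: cc_of_nat cc_mult del: of_nat_Suc)
    then show ?thesis
      by (simp only: Dl_dd_power fps_of_nat_mult_nth) (simp only: mult.assoc[symmetric])
  qed
  have "fps_nth (Dl (dd i k) (mexp c)) p = hsum (\<lambda>m. dd i k (cc (1 / fact m) * fps_nth (c ^ m) p))"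
    using A_endo_hsum(2)[of UNIV "dd i k", OF _ _ _ mexp_summable[OF assms]] dd_endo
    by (simp add: mexp_nth)
  also have "\<dots> = hsum ?g" by (simp add: dd_mult)
  also have "\<dots> = hsum (\<lambda>m. ?g (Suc m))"
    by (rule hsum_Suc[symmetric]) (simp add: fps_one_nth)
  also have "\<dots> = fps_nth (Dl (dd i k) c * mexp c) p"
    unfolding e mexp_times(2)[OF assms] ..
  finally show "fps_nth (Dl (dd i k) (mexp c)) p = fps_nth (Dl (dd i k) c * mexp c) p" .
qed

lemma hsum_int_nat:
  fixes g :: "int \<Rightarrow> fock"
  assumes "\<And>k. k < 0 \<Longrightarrow> g k = 0"
  shows "hsummable (\<lambda>k. g (int k)) \<longleftrightarrow> hsummable g" "hsum (\<lambda>k. g (int k)) = hsum g"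
proof -
  have inj: "inj int" by (simp add: inj_on_def)
  have z: "g j = 0" if "j \<notin> range int" for j
  proof -
    have "j < 0" using that by (metis nonneg_int_cases not_le rangeI)
    then show ?thesis by (rule assms)
  qed
  show "hsummable (\<lambda>k. g (int k)) \<longleftrightarrow> hsummable g" "hsum (\<lambda>k. g (int k)) = hsum g"
    by (rule hsum_inj[OF inj z]; assumption)+
qed

definition crE :: "nat \<Rightarrow> complex \<Rightarrow> fock fps" where
  "crE i b = Abs_fps (\<lambda>p. hsum (\<lambda>k. if k = 0 then 0
     else cc (1 / of_nat k) * (sc (upow b (int k) (int p)) * av i k)))"

lemma crE_summable:
  "hsummable (\<lambda>k. if k = 0 then 0 else g k * (sc (upow b (int k) (int p)) * h k))"
proof (rule hsummableI)
  fix N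
  have "fps_nth (if k = 0 then 0 else g k * (sc (upow b (int k) (int p)) * h k)) N = 0" if "k \<notin> {..p + N}" for k
  proof (rule ccontr)
    assume "\<not> ?thesis"
    then have "fps_nth (sc (upow b (int k) (int p)) * (g k * h k)) N \<noteq> 0"
      by (auto split: if_splits simp: mult.left_commute)
    from sc_upow_nth_nonzero[OF this] that show False by auto
  qed
  then show "\<exists>I. finite I \<and> (\<forall>k. k \<notin> I \<longrightarrow> fps_nth (if k = 0 then 0 else g k * (sc (upow b (int k) (int p)) * h k)) N = 0)"
    by (intro exI[of _ "{..p + N}"]) auto
qed

text \<open>This turns a creation current from an operator series into a ring element; products,
  powers and exponentials are then computed in the ring.\<close>

definition is_cre :: "series \<Rightarrow> fock fps \<Rightarrow> bool" where
  "is_cre X w \<longleftrightarrow> (\<forall>p f. X p f = (if p < 0 then 0 else fps_nth w (nat p) * f))"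

lemma is_cre_cr: "is_cre (cr i b) (crE i b)"
  unfolding is_cre_def
proof (intro allI)
  fix p f
  have t: "scal (fps_const (1 / of_nat k) * upow b (int k) p) (boson i (- int k) f)
     = f * (cc (1 / of_nat k) * (sc (upow b (int k) p) * av i k))" if "k \<noteq> 0" for k
    using that by (simp add: scal_sc sc_mult boson_av mult_ac)
  have c: "cr i b p f = hsum (\<lambda>k. f * (if k = 0 then 0 else cc (1 / of_nat k) * (sc (upow b (int k) p) * av i k)))"
    unfolding cr_def by (rule arg_cong[where f=hsum]) (use t in auto)
  show "cr i b p f = (if p < 0 then 0 else fps_nth (crE i b) (nat p) * f)"
  proof (cases "p < 0")
    case True
    then have "(\<lambda>k. f * (if k = 0 then 0 else cc (1 / of_nat k) * (sc (upow b (int k) p) * av i k))) = (\<lambda>k. 0)"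
      by auto
    then show ?thesis using True by (simp add: c)
  next
    case False
    then have p: "int (nat p) = p" by simp
    have "cr i b p f = f * fps_nth (crE i b) (nat p)"
      unfolding c crE_def fps_nth_Abs_fps p
      using hsum_mult(2)[OF crE_summable[where p="nat p", unfolded p], of f] by simp
    then show ?thesis using False by (simp add: mult.commute)
  qed
qed

lemma is_cre_add: "is_cre X w \<Longrightarrow> is_cre Y z \<Longrightarrow> is_cre (X + Y) (w + z)"
  by (simp add: is_cre_def distrib_right)

lemma is_cre_uminus: "is_cre X w \<Longrightarrow> is_cre (- X) (- w)"
  by (simp add: is_cre_def)

lemma is_cre_diff: "is_cre X w \<Longrightarrow> is_cre Y z \<Longrightarrow> is_cre (X - Y) (w - z)"
  by (simp add: is_cre_def left_diff_distrib)

lemma is_cre_smult: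
  assumes "is_cre X w" "is_cre Y z"
  shows "is_cre (X \<star> Y) (w * z)"
  unfolding is_cre_def
proof (intro allI)
  fix p f
  let ?g = "\<lambda>s. X s (Y (p - s) f)"
  show "(X \<star> Y) p f = (if p < 0 then 0 else fps_nth (w * z) (nat p) * f)"
  proof (cases "p < 0")
    case True
    then have "?g = (\<lambda>s. 0)" using assms by (auto simp: is_cre_def)
    then show ?thesis using True by (simp add: smult_def)
  next
    case False
    have "hsum ?g = sum ?g {0..p}"
      by (rule hsum_finite) (use assms in \<open>auto simp: is_cre_def\<close>)
    also have "\<dots> = (\<Sum>i=0..nat p. fps_nth w i * (fps_nth z (nat p - i) * f))"
      by (rule sum.reindex_bij_witness[of _ int nat]) (use False assms in \<open>auto simp: is_cre_def nat_diff_distrib\<close>)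
    also have "\<dots> = fps_nth (w * z) (nat p) * f"
      by (simp add: fps_mult_nth sum_distrib_right mult.assoc)
    finally show ?thesis using False by (simp add: smult_def)
  qed
qed

lemma is_cre_const: "is_cre (const_series id) 1"
  by (auto simp: is_cre_def const_series_def fps_one_nth)

lemma is_cre_spow: "is_cre X w \<Longrightarrow> is_cre (spow X m) (w ^ m)"
  by (induction m) (auto simp: is_cre_const intro: is_cre_smult)

lemma is_cre_sexp:
  assumes "is_cre X w" "fps_nth (fps_nth w 0) 0 = 0"
  shows "is_cre (sexp X) (mexp w)"
  unfolding is_cre_def
proof (intro allI)
  fix p f
  have sp: "spow X m p f = (if p < 0 then 0 else fps_nth (w ^ m) (nat p) * f)" for m
    using is_cre_spow[OF assms(1), of m] by (simp add: is_cre_def)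
  have e: "scal (fps_const (1 / fact m)) (spow X m p f)
      = (if p < 0 then 0 else f * (cc (1 / fact m) * fps_nth (w ^ m) (nat p)))" for m
    by (simp add: scal_sc sp mult_ac)
  show "sexp X p f = (if p < 0 then 0 else fps_nth (mexp w) (nat p) * f)"
    unfolding sexp_def e
    by (simp add: mexp_nth hsum_mult(2)[OF mexp_summable[OF assms(2)]] mult.commute)
qed

text \<open>An entry \<open>(y, i, b)\<close> stands for $y$ times \<open>cr i b\<close> (or \<open>an i b\<close>).\<close>

type_synonym terms = "(complex \<times> nat \<times> complex) list"

definition cfps :: "terms \<Rightarrow> fock fps" where
  "cfps C = (\<Sum>(y, i, b)\<leftarrow>C. fps_const (cc y) * crE i b)"

definition neg_terms :: "terms \<Rightarrow> terms" where
  "neg_terms C = map (\<lambda>(y, i, b). (- y, i, b)) C"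

definition shift_terms :: "complex \<Rightarrow> terms \<Rightarrow> terms" where
  "shift_terms c C = map (\<lambda>(y, i, b). (y, i, b + c)) C"

lemma cfps_append: "cfps (C @ C') = cfps C + cfps C'"
  by (simp add: cfps_def)

lemma cfps_neg: "cfps (neg_terms C) = - cfps C"
  by (induction C) (auto simp: cfps_def neg_terms_def cc_uminus simp flip: fps_const_neg)

lemma is_cre_terms:
  "is_cre (cr i b) (cfps [(1, i, b)])"
  "is_cre X (cfps C) \<Longrightarrow> is_cre Y (cfps C') \<Longrightarrow> is_cre (X + Y) (cfps (C @ C'))"
  "is_cre X (cfps C) \<Longrightarrow> is_cre Y (cfps C') \<Longrightarrow> is_cre (X - Y) (cfps (C @ neg_terms C'))"
  "is_cre X (cfps C) \<Longrightarrow> is_cre (- X) (cfps (neg_terms C))"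
  using is_cre_add[of X "cfps C" Y "cfps C'"] is_cre_diff[of X "cfps C" Y "cfps C'"]
    is_cre_uminus[of X "cfps C"]
  by (simp_all add: cfps_append cfps_neg) (simp add: cfps_def is_cre_cr)

text \<open>(u + b hbar)^k has the constant coefficient (b hbar)^k, of positive order because k > 0.
  This is the condition under which \<open>mexp\<close> converges.\<close>

lemma crE_00: "fps_nth (fps_nth (crE i b) 0) 0 = 0"
proof -
  have "fps_nth (if k = 0 then 0 else cc (1 / of_nat k) * (sc (upow b (int k) (int 0)) * av i k)) 0 = 0" for k
  proof (rule ccontr)
    assume A: "\<not> ?thesis"
    then have "fps_nth (sc (upow b (int k) 0) * (cc (1 / of_nat k) * av i k)) 0 \<noteq> 0" "k \<noteq> 0"
      by (auto split: if_splits simp: mult.left_commute)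
    from sc_upow_nth_nonzero(2)[OF this(1)] this(2) show False by simp
  qed
  then show ?thesis unfolding crE_def fps_nth_Abs_fps
    by (subst hsum_nth[of "{}"]) auto
qed

lemma cfps_00: "fps_nth (fps_nth (cfps C) 0) 0 = 0"
  by (induction C) (auto simp: cfps_def crE_00 cc_def)

definition vv :: "complex \<Rightarrow> fock fps" where
  "vv b = fps_X + fps_const (cc b * hb)"

lemma vv_power_nth: "fps_nth (vv b ^ k) p = sc (upow b (int k) (int p))"
proof -
  have 1: "fps_nth (of_nat m * (fps_X ^ i * fps_const z)) p = (if i = p then of_nat m * z else 0)" for m i and z :: fock
    by (auto simp: fps_of_nat_mult_nth fps_X_power_mult_nth fps_X_power_nth)
  have "fps_nth (vv b ^ k) p = (\<Sum>i\<le>k. if i = p then of_nat (k choose i) * (cc b * hb) ^ (k - i) else 0)"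
    unfolding vv_def binomial_ring fps_sum_nth
    by (rule sum.cong[OF refl]) (simp only: fps_const_power mult.assoc 1)
  also have "\<dots> = (if p \<le> k then of_nat (k choose p) * (cc b * hb) ^ (k - p) else 0)"
    by (simp add: if_distrib cong: if_cong)
  also have "\<dots> = sc (upow b (int k) (int p))"
    by (auto simp: upow_alt sc_mult sc_power power_mult_distrib cc_power binomial_symmetric[of p k] nat_diff_distrib
        simp flip: binomial_gbinomial)
  finally show ?thesis .
qed

text \<open>The derivation k d/da_{i,-k} leaves of the sum of a_{i,-l}/l (v + b hbar)^l the single
  power with l = k.\<close>

lemma Dl_crE:
  assumes "k > 0"
  shows "Dl (dd i k) (crE j b) = (if i = j \<and> i \<noteq> 0 then vv b ^ k else 0)"
proof (rule fps_ext)
  fix p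
  have c: "cc (1 / of_nat k) * (x * of_nat k) = x" for x :: fock
  proof -
    have "cc (1 / of_nat k) * of_nat k = (1 :: fock)"
      using assms by (simp flip: cc_of_nat cc_mult)
    then show ?thesis by (simp add: mult.left_commute[of _ x])
  qed
  have "fps_nth (Dl (dd i k) (crE j b)) p
     = hsum (\<lambda>l. dd i k (if l = 0 then 0 else cc (1 / of_nat l) * (sc (upow b (int l) (int p)) * av j l)))"
    using A_endo_hsum(2)[of UNIV "dd i k", OF _ _ _ crE_summable] dd_endo by (simp add: crE_def)
  also have "\<dots> = hsum (\<lambda>l. if l = k then (if i = j \<and> i \<noteq> 0 then fps_nth (vv b ^ k) p else 0) else 0)"
    by (rule arg_cong[where f=hsum])
       (use assms in \<open>auto simp: fun_eq_iff dd_mult dd_av vv_power_nth c\<close>)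
  also have "\<dots> = fps_nth (if i = j \<and> i \<noteq> 0 then vv b ^ k else 0) p"
    by (subst hsum_single(2)[of k]) auto
  finally show "fps_nth (Dl (dd i k) (crE j b)) p = fps_nth (if i = j \<and> i \<noteq> 0 then vv b ^ k else 0) p" .
qed

lemma Dl_dd_add: "Dl (dd i k) (w + z) = Dl (dd i k) w + Dl (dd i k) z"
  by (rule fps_ext) (simp add: dd_add)

lemma Dl_dd_0 [simp]: "Dl (dd i k) 0 = 0"
  by (rule fps_ext) simp

lemma Dl_dd_const: "Dl (dd i k) (fps_const z) = fps_const (dd i k z)"
  by (rule fps_ext) simp

lemma Dl_cfps:
  assumes "k > 0"
  shows "Dl (dd i k) (cfps C) = (\<Sum>(y, j, b)\<leftarrow>C. if i = j \<and> i \<noteq> 0 then fps_const (cc y) * vv b ^ k else 0)"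
  by (induction C) (auto simp: cfps_def Dl_dd_add Dl_dd_mult Dl_dd_const Dl_crE[OF assms])

text \<open>The creation half of a vertex operator together with its lattice translation.\<close>

definition MM :: "terms \<Rightarrow> vec \<Rightarrow> fock fps" where
  "MM C \<delta> = mexp (cfps C) * fps_const (El \<delta>)"

lemma Dl_MM:
  assumes "k > 0"
  shows "Dl (dd i k) (MM C \<delta>) = (\<Sum>(y, j, b)\<leftarrow>C. if i = j \<and> i \<noteq> 0 then fps_const (cc y) * vv b ^ k else 0) * MM C \<delta>"
  unfolding MM_def Dl_dd_mult Dl_mexp[OF cfps_00] Dl_dd_const Dl_cfps[OF assms] by (simp add: mult.assoc)

lemma MM_append: "MM (C @ C') (\<delta> + \<delta>') = MM C \<delta> * MM C' \<delta>'"
  by (simp add: MM_def cfps_append mexp_add[OF cfps_00 cfps_00] El_add mult_ac flip: fps_const_mult)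

lemma crE_Sec: "i \<le> n + 3 \<Longrightarrow> fps_nth (crE i b) p \<in> Sec n 0"
  unfolding crE_def fps_nth_Abs_fps
  by (rule cset_hsum) (auto intro!: cset_cc cset_sc av_Sec cset_0)

lemma fps_mult_Sec0:
  "(\<And>p. fps_nth w p \<in> Sec n 0) \<Longrightarrow> (\<And>p. fps_nth z p \<in> FQ n L) \<Longrightarrow> fps_nth (w * z) p \<in> FQ n L"
  by (auto simp: fps_mult_nth intro!: cset_sum Sec0_mult)

lemma cfps_Sec: "\<forall>(y, i, b)\<in>set C. i \<le> n + 3 \<Longrightarrow> fps_nth (cfps C) p \<in> Sec n 0"
  by (induction C) (auto simp: cfps_def intro!: cset_add cset_cc crE_Sec cset_0)

lemma mexp_Sec:
  assumes "\<And>p. fps_nth w p \<in> Sec n 0"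
  shows "fps_nth (mexp w) p \<in> Sec n 0"
proof -
  have "fps_nth (w ^ m) p \<in> Sec n 0" for m p
  proof (induction m arbitrary: p)
    case 0
    show ?case
      by (cases "p = 0") (simp_all only: power_0 fps_one_nth refl if_True if_False one_Sec cset_0[OF csub_RQ])
  qed (simp add: fps_mult_Sec0 assms)
  then show ?thesis unfolding mexp_nth by (intro cset_hsum cset_cc) auto
qed

lemma MM_Sec: "\<forall>(y, i, b)\<in>set C. i \<le> n + 3 \<Longrightarrow> fps_nth (MM C \<delta>) p \<in> Sec n \<delta>"
  by (simp add: MM_def Sec0_mult[OF mexp_Sec[OF cfps_Sec] El_Sec])


section \<open>Translation of creation operators\<close>

text \<open>The Taylor shift u -> u + c hbar; the infinite sum over k converges
  hbar-adically.\<close>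

definition Tsh :: "complex \<Rightarrow> fock fps \<Rightarrow> fock fps" where
  "Tsh c w = Abs_fps (\<lambda>p. hsum (\<lambda>k. sc (upow c (int k) (int p)) * fps_nth w k))"

lemma Tsh_summable: "hsummable (\<lambda>k. sc (upow c (int k) (int p)) * g k)"
proof (rule hsummableI)
  fix N
  have "fps_nth (sc (upow c (int k) (int p)) * g k) N = 0" if "k \<notin> {..p + N}" for k
  proof (rule ccontr)
    assume "\<not> ?thesis"
    from sc_upow_nth_nonzero(2)[OF this] that show False by auto
  qed
  then show "\<exists>I. finite I \<and> (\<forall>k. k \<notin> I \<longrightarrow> fps_nth (sc (upow c (int k) (int p)) * g k) N = 0)"
    by (intro exI[of _ "{..p + N}"]) auto
qed

lemma Tsh_nth: "fps_nth (Tsh c w) p = hsum (\<lambda>k. sc (upow c (int k) (int p)) * fps_nth w k)"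
  by (simp add: Tsh_def)

lemma Tsh_add: "Tsh c (w + z) = Tsh c w + Tsh c z"
  by (rule fps_ext) (simp add: Tsh_nth distrib_left hsum_add Tsh_summable)

lemma Tsh_scale: "Tsh c (fps_const z * w) = fps_const z * Tsh c w"
proof (rule fps_ext)
  fix p
  show "fps_nth (Tsh c (fps_const z * w)) p = fps_nth (fps_const z * Tsh c w) p"
    using hsum_mult(2)[OF Tsh_summable[of c p "fps_nth w"], of z] by (simp add: Tsh_nth mult.left_commute)
qed

lemma Tsh_const [simp]: "Tsh c (fps_const z) = fps_const z"
  by (rule fps_ext) (auto simp: Tsh_nth intro!: trans[OF hsum_single(2)[of 0]])

lemma Tsh_0 [simp]: "Tsh c 0 = 0"
  by (rule fps_ext) (simp add: Tsh_nth)

lemma Tsh_1 [simp]: "Tsh c 1 = 1"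
  using Tsh_const[of c 1] by (simp del: Tsh_const)

lemma upow_vandermonde_nat:
  "upow c (int (i + j)) (int p) = (\<Sum>s\<le>p. upow c (int i) (int s) * upow c (int j) (int (p - s)))"
proof (cases "p \<le> i + j")
  case True
  have "(\<Sum>s\<le>p. upow c (int i) (int s) * upow c (int j) (int (p - s)))
     = (\<Sum>s\<in>{0..int p}. upow c (int i) s * upow c (int j) (int p - s))"
    by (rule sum.reindex_bij_witness[of _ nat int]) (auto simp: of_nat_diff)
  also have "\<dots> = (\<Sum>s = int p - int j..int i. upow c (int i) s * upow c (int j) (int p - s))"
    by (rule sum.mono_neutral_cong) auto
  also have "\<dots> = upow c (int i + int j) (int p)"
    by (rule upow_vandermonde) (use True in simp)
  finally show ?thesis by simp
next
  case False
  have "upow c (int i) (int s) * upow c (int j) (int (p - s)) = 0" if "s \<le> p" for s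
    using that False by (cases "s \<le> i") auto
  then have "(\<Sum>s\<le>p. upow c (int i) (int s) * upow c (int j) (int (p - s))) = 0"
    by (intro sum.neutral) simp
  then show ?thesis using False by simp
qed

text \<open>Substitution is a ring homomorphism. Coefficientwise this is the Vandermonde identity,
  summed over both factors.\<close>

lemma Tsh_mult: "Tsh c (w * z) = Tsh c w * Tsh c z"
proof (rule fps_ext)
  fix p
  let ?a = "\<lambda>s i. sc (upow c (int i) (int s)) * fps_nth w i"
  let ?b = "\<lambda>s j. sc (upow c (int j) (int s)) * fps_nth z j"
  let ?g = "\<lambda>i j. sc (upow c (int (i + j)) (int p)) * (fps_nth w i * fps_nth z j)"
  have g: "?g i j = (\<Sum>s\<le>p. ?a s i * ?b (p - s) j)" for i j
    unfolding upow_vandermonde_nat by (simp add: sc_sum sc_mult sum_distrib_right sum_distrib_left mult_ac)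
  have G: "(\<lambda>(i, j). ?g i j) = (\<lambda>x. \<Sum>s\<le>p. case x of (i, j) \<Rightarrow> ?a s i * ?b (p - s) j)"
    by (auto simp: g simp del: of_nat_add)
  have s: "hsummable (\<lambda>(i, j). ?g i j)"
    unfolding G
    by (rule hsum_sum(1)) (simp_all only: finite_atMost hsum_product(1)[OF Tsh_summable Tsh_summable])
  have "fps_nth (Tsh c (w * z)) p = hsum (\<lambda>k. \<Sum>i\<le>k. ?g i (k - i))"
    by (simp add: Tsh_nth fps_mult_nth sum_distrib_left atLeast0AtMost)
  also have "\<dots> = hsum (\<lambda>(i, j). ?g i j)" by (rule hsum_diag(2)[OF s])
  also have "\<dots> = (\<Sum>s\<le>p. hsum (\<lambda>(i, j). ?a s i * ?b (p - s) j))"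
    unfolding G
    by (rule hsum_sum(2)) (simp_all only: finite_atMost hsum_product(1)[OF Tsh_summable Tsh_summable])
  also have "\<dots> = (\<Sum>s\<le>p. fps_nth (Tsh c w) s * fps_nth (Tsh c z) (p - s))"
    unfolding Tsh_nth by (rule sum.cong[OF refl]) (rule hsum_product(2)[OF Tsh_summable Tsh_summable])
  finally show "fps_nth (Tsh c (w * z)) p = fps_nth (Tsh c w * Tsh c z) p"
    by (simp add: fps_mult_nth atLeast0AtMost)
qed

lemma Tsh_power: "Tsh c (w ^ m) = Tsh c w ^ m"
  by (induction m) (simp_all add: Tsh_mult)

lemma Tsh_mexp:
  assumes "fps_nth (fps_nth w 0) 0 = 0"
  shows "Tsh c (mexp w) = mexp (Tsh c w)"
proof (rule fps_ext)
  fix p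
  let ?g = "\<lambda>k m. sc (upow c (int k) (int p)) * (cc (1 / fact m) * fps_nth (w ^ m) k)"
  have s: "hsummable (\<lambda>(k, m). ?g k m)"
  proof (rule hsummableI)
    fix N
    have "fps_nth (?g k m) N = 0" if "(k, m) \<notin> {..p + N} \<times> {..p + N + N}" for k m
    proof (rule ccontr)
      assume "\<not> ?thesis"
      from sc_upow_nth_nonzero[OF this] have A: "nat (int k - int p) \<le> N"
        "fps_nth (cc (1 / fact m) * fps_nth (w ^ m) k) (N - nat (int k - int p)) \<noteq> 0" by auto
      then have "\<not> k + (N - nat (int k - int p)) < m"
        using power_order[OF assms] by (auto simp: cc_def)
      then show False using that A(1) by auto
    qed
    then show "\<exists>I. finite I \<and> (\<forall>x. x \<notin> I \<longrightarrow> fps_nth (case x of (k, m) \<Rightarrow> ?g k m) N = 0)"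
      by (intro exI[of _ "{..p + N} \<times> {..p + N + N}"]) auto
  qed
  have "fps_nth (Tsh c (mexp w)) p = hsum (\<lambda>k. hsum (\<lambda>m. ?g k m))"
    by (simp add: Tsh_nth mexp_nth hsum_mult(2)[OF mexp_summable[OF assms]])
  also have "\<dots> = hsum (\<lambda>m. hsum (\<lambda>k. ?g k m))" by (rule hsum_swap(2)[OF s])
  also have "\<dots> = hsum (\<lambda>m. cc (1 / fact m) * fps_nth (Tsh c (w ^ m)) p)"
    unfolding Tsh_nth by (subst hsum_mult(2)[OF Tsh_summable, symmetric]) (simp add: mult.left_commute)
  finally show "fps_nth (Tsh c (mexp w)) p = fps_nth (mexp (Tsh c w)) p"
    by (simp add: Tsh_power mexp_nth)
qed

text \<open>Shifts add: once the sums over k and l are exchanged, the sum over k is a composition of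
  two substitutions.\<close>

lemma Tsh_crE: "Tsh c (crE i b) = crE i (b + c)"
proof (rule fps_ext)
  fix p
  let ?t = "\<lambda>k l. cc (1 / of_nat l) * (sc (upow b (int l) (int k)) * av i l)"
  let ?g = "\<lambda>k l. sc (upow c (int k) (int p)) * (if l = 0 then 0 else ?t k l)"
  have s: "hsummable (\<lambda>(k, l). ?g k l)"
  proof (rule hsummableI)
    fix N
    have "fps_nth (?g k l) N = 0" if "(k, l) \<notin> {..p + N} \<times> {..p + N + N}" for k l
    proof (rule ccontr)
      assume A: "\<not> ?thesis"
      from sc_upow_nth_nonzero[OF this] have 1: "nat (int k - int p) \<le> N" by auto
      have "?g k l = sc (upow b (int l) (int k)) * (sc (upow c (int k) (int p)) * (if l = 0 then 0 else cc (1 / of_nat l) * av i l))"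
        by (simp add: mult_ac)
      then have "fps_nth (sc (upow b (int l) (int k)) * (sc (upow c (int k) (int p)) * (if l = 0 then 0 else cc (1 / of_nat l) * av i l))) N \<noteq> 0"
        using A by simp
      from sc_upow_nth_nonzero(2)[OF this] have "nat (int l - int k) \<le> N" .
      with 1 that show False by auto
    qed
    then show "\<exists>I. finite I \<and> (\<forall>x. x \<notin> I \<longrightarrow> fps_nth (case x of (k, l) \<Rightarrow> ?g k l) N = 0)"
      by (intro exI[of _ "{..p + N} \<times> {..p + N + N}"]) auto
  qed
  have c: "hsum (\<lambda>k. sc (upow c (int k) (int p)) * sc (upow b (int l) (int k))) = sc (upow (b + c) (int l) (int p))" for l
  proof (cases "p \<le> l")
    case True
    have "hsum (\<lambda>k. sc (upow c (int k) (int p)) * sc (upow b (int l) (int k)))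
        = (\<Sum>k\<in>{p..l}. sc (upow c (int k) (int p)) * sc (upow b (int l) (int k)))"
      by (rule hsum_finite) (auto simp: not_le)
    also have "\<dots> = sc (\<Sum>k = int p..int l. upow c k (int p) * upow b (int l) k)"
      unfolding sc_sum sc_mult by (rule sum.reindex_bij_witness[of _ nat int]) auto
    finally show ?thesis using upow_compose[of "int p" "int l" c b] True by simp
  next
    case False
    have "sc (upow c (int k) (int p)) * sc (upow b (int l) (int k)) = 0" for k
      using False by (cases "k \<le> l") auto
    then show ?thesis using False by simp
  qed
  have "fps_nth (Tsh c (crE i b)) p = hsum (\<lambda>k. hsum (\<lambda>l. ?g k l))"
    unfolding Tsh_nth crE_def fps_nth_Abs_fps by (subst hsum_mult(2)) (simp_all add: crE_summable)
  also have "\<dots> = hsum (\<lambda>l. hsum (\<lambda>k. ?g k l))" by (rule hsum_swap(2)[OF s])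
  also have "\<dots> = hsum (\<lambda>l. if l = 0 then 0 else cc (1 / of_nat l) * (sc (upow (b + c) (int l) (int p)) * av i l))"
  proof (rule arg_cong[where f=hsum], rule ext)
    fix l
    have "hsum (\<lambda>k. ?g k l) = hsum (\<lambda>k. (cc (1 / of_nat l) * av i l) * (sc (upow c (int k) (int p)) * sc (upow b (int l) (int k))))"
      if "l \<noteq> 0" using that by (simp add: mult_ac)
    also have "\<dots> = (cc (1 / of_nat l) * av i l) * sc (upow (b + c) (int l) (int p))"
      unfolding c[symmetric] by (rule hsum_mult(2)[OF Tsh_summable])
    finally show "hsum (\<lambda>k. ?g k l) = (if l = 0 then 0 else cc (1 / of_nat l) * (sc (upow (b + c) (int l) (int p)) * av i l))"
      by (auto simp: mult_ac)
  qed
  finally show "fps_nth (Tsh c (crE i b)) p = fps_nth (crE i (b + c)) p" by (simp add: crE_def)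
qed

lemma Tsh_cfps: "Tsh c (cfps C) = cfps (shift_terms c C)"
  by (induction C) (auto simp: cfps_def shift_terms_def Tsh_add Tsh_scale Tsh_crE)

lemma Tsh_MM: "Tsh c (MM C \<delta>) = MM (shift_terms c C) \<delta>"
  by (simp add: MM_def Tsh_mult Tsh_mexp[OF cfps_00] Tsh_cfps)

section \<open>Annihilation operators\<close>

text \<open>The coefficient of $u^{-s}$ in $-u\partial_u\sum_k\frac{a_{i,k}}k(u+a\hbar)^{-k}$ is
  $\sum_{k=1}^s\binom sk(-a\hbar)^{s-k}a_{i,k}$.\<close>

definition Aop1 :: "nat \<Rightarrow> complex \<Rightarrow> nat \<Rightarrow> fock \<Rightarrow> fock" where
  "Aop1 i a s f = (\<Sum>k = 1..s. cc (of_nat (s choose k) * (- a) ^ (s - k)) * hb ^ (s - k) * dd i k f)"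

definition Aop :: "terms \<Rightarrow> nat \<Rightarrow> fock \<Rightarrow> fock" where
  "Aop A s f = (\<Sum>(x, i, a)\<leftarrow>A. cc x * Aop1 i a s f)"

lemma Aop_simps:
  "Aop [] s f = 0" "Aop ((x, i, a) # A) s f = cc x * Aop1 i a s f + Aop A s f"
  "Aop (A @ A') s f = Aop A s f + Aop A' s f"
  by (simp_all add: Aop_def)

lemma Aop_neg: "Aop (neg_terms A) s f = - Aop A s f"
  by (induction A) (auto simp: Aop_simps neg_terms_def cc_uminus)

lemma A_endo_scaled:
  assumes "csub R" "A_endo (cset R) T"
  shows "A_endo (cset R) (\<lambda>f. cc z * T f)" "A_endo (cset R) (\<lambda>f. cc z * hb ^ k * T f)"
  using A_endo_lincomb(6)[OF assms, of "fps_const z"] A_endo_lincomb(6)[OF assms, of "fps_const z * fps_X ^ k"]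
  by (simp_all add: sc_mult sc_power)

lemma Aop1_endo: "A_endo (FQ n L) (Aop1 i a s)"
proof -
  have "A_endo (FQ n L) (\<lambda>f. \<Sum>k = 1..s. cc (of_nat (s choose k) * (- a) ^ (s - k)) * hb ^ (s - k) * dd i k f)"
    by (intro A_endo_sumI csub_RQ A_endo_scaled dd_FQ)
  then show ?thesis by (simp add: Aop1_def[abs_def])
qed

lemma Aop_endo: "A_endo (FQ n L) (Aop A s)"
proof (induction A)
  case Nil
  then show ?case using A_endo_lincomb(1)[OF csub_RQ] by (simp add: Aop_simps[abs_def])
next
  case (Cons t A)
  obtain x i a where t: "t = (x, i, a)" by (cases t)
  show ?case unfolding t Aop_simps
    by (intro A_endo_lincomb(3) csub_RQ A_endo_scaled Aop1_endo Cons.IH)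
qed

lemma Aop1_commute: "Aop1 i a s (Aop1 j b t f) = Aop1 j b t (Aop1 i a s f)"
proof -
  have d: "dd i k (cc z * hb ^ m * g) = cc z * hb ^ m * dd i k g" for i k z m g
    using A_endoD(3)[OF dd_endo[of i k], of g "fps_const z * fps_X ^ m"] by (simp add: sc_mult sc_power)
  show ?thesis
    unfolding Aop1_def dd_sum d sum_distrib_left
    by (subst sum.swap) (simp add: dd_commute mult_ac)
qed

lemma Aop1_lin: "Aop1 i a s (f + g) = Aop1 i a s f + Aop1 i a s g" "Aop1 i a s (cc z * f) = cc z * Aop1 i a s f"
  "Aop1 i a s 0 = 0"
  by (simp_all add: Aop1_def dd_add dd_mult distrib_left distrib_right sum.distrib sum_distrib_left mult.left_commute)

lemma Aop_lin: "Aop A s (f + g) = Aop A s f + Aop A s g" "Aop A s (cc z * f) = cc z * Aop A s f" "Aop A s 0 = 0"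
  by (induction A) (auto simp: Aop_simps Aop1_lin distrib_left mult.left_commute)

lemma Aop_sum: "Aop A s (sum f K) = (\<Sum>k\<in>K. Aop A s (f k))"
  by (induction K rule: infinite_finite_induct) (simp_all add: Aop_lin)

lemma Aop_of_nat: "Aop A s (of_nat r * f) = of_nat r * Aop A s f"
  using Aop_lin(2)[of A s "of_nat r" f] by simp

lemma Aop_commute: "Aop A s (Aop A' t f) = Aop A' t (Aop A s f)"
proof -
  have 1: "Aop1 i a s (Aop A' t f) = Aop A' t (Aop1 i a s f)" for i a s f
    by (induction A') (auto simp: Aop_simps Aop1_lin Aop1_commute[of i a])
  show ?thesis by (induction A) (auto simp: Aop_simps Aop_lin 1)
qed

lemma Aop_El: "Aop A s (El \<delta> * f) = El \<delta> * Aop A s f"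
proof -
  have "Aop1 i a s (El \<delta> * f) = El \<delta> * Aop1 i a s f" for i a
    by (simp add: Aop1_def dd_mult sum_distrib_left mult_ac)
  then show ?thesis by (induction A) (auto simp: Aop_simps algebra_simps)
qed

text \<open>If the operators \<open>Bs s\<close> commute, this is the coefficient of z^r in the
  exponential of the sum of \<open>Bs s\<close> z^s / s, just as power sums determine complete
  symmetric functions. The recursion makes sense without any convergence, and
  \<open>phi_unique\<close> identifies every family that satisfies it.\<close>

fun phi :: "(nat \<Rightarrow> fock \<Rightarrow> fock) \<Rightarrow> nat \<Rightarrow> fock \<Rightarrow> fock" where
  "phi Bs r f = (if r = 0 then f else cc (1 / of_nat r) * (\<Sum>s = 1..r. Bs s (phi Bs (r - s) f)))"

declare phi.simps [simp del]

lemma phi_0 [simp]: "phi Bs 0 f = f"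
  by (simp add: phi.simps)

lemma cc_inverse_of_nat: "r > 0 \<Longrightarrow> of_nat r * (cc (1 / of_nat r) * x) = x"
proof -
  assume "r > 0"
  then have "of_nat r * cc (1 / of_nat r) = 1" by (simp flip: cc_of_nat cc_mult)
  then show ?thesis by (simp flip: mult.assoc)
qed

lemma phi_newton: "of_nat r * phi Bs r f = (\<Sum>s = 1..r. Bs s (phi Bs (r - s) f))"
proof (cases "r = 0")
  case False
  then show ?thesis by (subst phi.simps) (simp add: cc_inverse_of_nat)
qed simp

lemma newton_unique:
  assumes "W 0 = W' 0" "\<And>r. r > 0 \<Longrightarrow> of_nat r * W r = (\<Sum>s = 1..r. Bs s (W (r - s)))"
    "\<And>r. r > 0 \<Longrightarrow> of_nat r * W' r = (\<Sum>s = 1..r. Bs s (W' (r - s) :: fock))"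
  shows "W r = W' r"
proof (induction r rule: less_induct)
  case (less r)
  show ?case
  proof (cases "r = 0")
    case False
    then have r: "r > 0" by simp
    have "of_nat r * W r = (\<Sum>s = 1..r. Bs s (W (r - s)))" by (rule assms(2)[OF r])
    also have "\<dots> = (\<Sum>s = 1..r. Bs s (W' (r - s)))"
      by (rule sum.cong) (use less in auto)
    also have "\<dots> = of_nat r * W' r" by (rule assms(3)[OF r, symmetric])
    finally show ?thesis by (rule of_nat_cancel[OF _ r])
  qed (use assms in simp)
qed

lemma phi_unique:
  assumes "W 0 = f" "\<And>r. r > 0 \<Longrightarrow> of_nat r * W r = (\<Sum>s = 1..r. Bs s (W (r - s)))"
  shows "W r = phi Bs r f"
  by (rule newton_unique[where Bs = Bs]) (use assms phi_newton in auto)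

lemma phi_endo:
  assumes "csub R" "\<And>s. A_endo (cset R) (Bs s)"
  shows "A_endo (cset R) (phi Bs r)"
proof (induction r rule: less_induct)
  case (less r)
  show ?case
  proof (cases "r = 0")
    case True
    then have "phi Bs r = (\<lambda>f. f)" by (simp add: fun_eq_iff)
    then show ?thesis using A_endo_lincomb(2)[OF assms(1)] by simp
  next
    case False
    have e: "phi Bs r = (\<lambda>f. cc (1 / of_nat r) * (\<Sum>s = 1..r. Bs s (phi Bs (r - s) f)))"
      using False by (simp add: fun_eq_iff) (subst phi.simps, simp)
    have "A_endo (cset R) (\<lambda>f. Bs s (phi Bs (r - s) f))" if "s \<in> {1..r}" for s
      by (rule A_endo_lincomb(7)[OF assms(1) assms(2)]) (use that in \<open>auto intro: less.IH\<close>)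
    then show ?thesis unfolding e by (intro A_endo_scaled(1) assms(1) A_endo_sumI) auto
  qed
qed

text \<open>Applying T to the recursion gives the recursion that starts at T f, so uniqueness
  applies.\<close>

lemma phi_hom:
  assumes "\<And>s f. T (Bs s f) = Bs s (T f)" "\<And>z f. T (cc z * f) = cc z * T f"
    "\<And>f g. T (f + g) = T f + T g" "T 0 = 0"
  shows "T (phi Bs r f) = phi Bs r (T f)"
proof (rule phi_unique[where W = "\<lambda>r. T (phi Bs r f)"])
  fix r :: nat
  have s: "T (sum h K) = (\<Sum>k\<in>K. T (h k))" for h :: "nat \<Rightarrow> fock" and K
    by (induction K rule: infinite_finite_induct) (simp_all add: assms)
  have "of_nat r * T (phi Bs r f) = T (of_nat r * phi Bs r f)"
    using assms(2)[of "of_nat r" "phi Bs r f"] by simp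
  also have "\<dots> = (\<Sum>s = 1..r. Bs s (T (phi Bs (r - s) f)))"
    unfolding phi_newton s assms(1) ..
  finally show "of_nat r * T (phi Bs r f) = (\<Sum>s = 1..r. Bs s (T (phi Bs (r - s) f)))" .
qed simp


section \<open>Exponentials of annihilation operators\<close>

text \<open>Annihilation currents collected by powers of u: the operator at u^(-s) is
  \<open>Aop A s\<close> divided by s, the form to which the Newton recursion applies.\<close>

definition genA :: "terms \<Rightarrow> series" where
  "genA A p f = (if p < 0 then cc (1 / of_nat (nat (- p))) * Aop A (nat (- p)) f else 0)"

lemma genA_ops:
  "genA A + genA A' = genA (A @ A')"
  "genA A - genA A' = genA (A @ neg_terms A')"
  "- genA A = genA (neg_terms A)"
  by (auto simp: fun_eq_iff genA_def Aop_simps Aop_neg algebra_simps)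

text \<open>Expanding (u + a hbar)^(-k) gives binomials with negative upper entry. Negation and
  absorption turn binom(-k, s-k)/k into (-1)^(s-k) binom(s,k)/s.\<close>

lemma an_genA: "an i a = genA [(1, i, a)]"
proof (intro ext)
  fix p f
  show "an i a p f = genA [(1, i, a)] p f"
  proof (cases "p < 0")
    case False
    then have "(\<lambda>k :: nat. if k = 0 then 0 else scal (fps_const (1 / of_nat k) * upow a (- int k) p) (boson i (int k) f)) = (\<lambda>k. 0)"
      by (auto simp: fun_eq_iff scal_sc)
    then show ?thesis using False by (simp only: an_def hsum_zero genA_def if_False)
  next
    case True
    define s where "s = nat (- p)"
    have s: "s > 0" "p = - int s" using True by (auto simp: s_def)
    have t: "scal (fps_const (1 / of_nat k) * upow a (- int k) p) (boson i (int k) f)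
        = cc (1 / of_nat s) * (cc (of_nat (s choose k) * (- a) ^ (s - k)) * hb ^ (s - k) * dd i k f)"
      if k: "k \<in> {1..s}" for k
    proof -
      have "((- of_nat k :: complex) gchoose (s - k)) = (- 1) ^ (s - k) * of_nat ((s - 1) choose (s - k))"
        using k by (simp add: gbinomial_minus binomial_gbinomial of_nat_diff)
      moreover have "of_nat ((s - 1) choose (s - k)) * of_nat s = (of_nat k * of_nat (s choose k) :: complex)"
      proof -
        have "(s - 1) choose (s - k) = (s - 1) choose (k - 1)"
          using k by (subst binomial_symmetric) (auto intro!: arg_cong2[where f=binomial])
        moreover have "k * (s choose k) = s * ((s - 1) choose (k - 1))"
          using k by (simp add: times_binomial_minus1_eq)
        ultimately show ?thesis by (simp add: mult.commute flip: of_nat_mult)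
      qed
      ultimately have g: "1 / of_nat k * ((- of_nat k gchoose (s - k)) * a ^ (s - k))
          = 1 / of_nat s * (of_nat (s choose k) * (- a) ^ (s - k) :: complex)"
        using k s(1) by (simp add: field_simps power_minus[of a])
      have u: "upow a (- int k) p = fps_const ((- of_nat k gchoose (s - k)) * a ^ (s - k)) * fps_X ^ (s - k)"
      proof -
        have n: "nat (- int k - p) = s - k" "p \<le> - int k" using k s(2) by auto
        show ?thesis by (simp add: upow_def n)
      qed
      have "scal (fps_const (1 / of_nat k) * upow a (- int k) p) (boson i (int k) f)
          = cc (1 / of_nat k * ((- of_nat k gchoose (s - k)) * a ^ (s - k))) * hb ^ (s - k) * dd i k f"
      proof -
        have b: "boson i (int k) f = dd i k f" using k by (intro boson_dd) simp
        show ?thesis unfolding u b by (simp only: scal_sc sc_mult sc_simps sc_power cc_mult mult.assoc)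
      qed
      then show ?thesis unfolding g by (simp only: cc_mult mult.assoc)
    qed
    have "an i a p f = (\<Sum>k\<in>{1..s}. scal (fps_const (1 / of_nat k) * upow a (- int k) p) (boson i (int k) f))"
      unfolding an_def
      by (subst hsum_finite(2)[of "{1..s}"]) (auto simp: scal_sc s(2) not_le intro!: sum.cong)
    also have "\<dots> = cc (1 / of_nat s) * Aop1 i a s f"
      unfolding Aop1_def sum_distrib_left by (rule sum.cong[OF refl t])
    finally show ?thesis using True by (simp add: genA_def Aop_simps s_def)
  qed
qed

lemma sum_triangle_swap1:
  fixes r :: nat
  shows "(\<Sum>s = 1..r. \<Sum>t = 1..r - s. F s t) = (\<Sum>t = 1..r. \<Sum>s = 1..r - t. F s t)"
  by (simp add: sum.Sigma)
     (rule sum.reindex_bij_witness[of _ "\<lambda>(r, q). (q, r)" "\<lambda>(q, r). (r, q)"]; auto)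

context
  fixes A :: terms
begin

private definition al :: "nat \<Rightarrow> fock \<Rightarrow> fock" where
  "al s f = cc (1 / of_nat s) * Aop A s f"

private primrec Pw :: "nat \<Rightarrow> nat \<Rightarrow> fock \<Rightarrow> fock" where
  "Pw 0 r f = (if r = 0 then f else 0)"
| "Pw (Suc m) r f = (\<Sum>s = 1..r. al s (Pw m (r - s) f))"

private lemma spow_Pw: "spow (genA A) m p f = (if p \<le> 0 then Pw m (nat (- p)) f else 0)"
proof (induction m arbitrary: p)
  case 0
  then show ?case by (auto simp: const_series_def)
next
  case (Suc m)
  have "spow (genA A) (Suc m) p f = hsum (\<lambda>s. genA A s (spow (genA A) m (p - s) f))"
    by (simp add: smult_def)
  also have "\<dots> = (\<Sum>s\<in>{p..-1}. genA A s (spow (genA A) m (p - s) f))"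
    by (rule hsum_finite) (auto simp: Suc.IH genA_def Aop_lin)
  also have "\<dots> = (if p \<le> 0 then \<Sum>s = 1..nat (- p). al s (Pw m (nat (- p) - s) f) else 0)"
  proof (cases "p \<le> 0")
    case True
    have "(\<Sum>s\<in>{p..-1}. genA A s (spow (genA A) m (p - s) f)) = (\<Sum>s = 1..nat (- p). al s (Pw m (nat (- p) - s) f))"
    proof (rule sum.reindex_bij_witness[of _ "\<lambda>s. - int s" "\<lambda>s. nat (- s)"])
      fix s assume s: "s \<in> {p..-1}"
      have "nat (- (p - s)) = nat (- p) - nat (- s)" using s by auto
      then show "al (nat (- s)) (Pw m (nat (- p) - nat (- s)) f) = genA A s (spow (genA A) m (p - s) f)"
        using s by (simp add: Suc.IH genA_def al_def)
    qed auto
    then show ?thesis using True by simp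
  qed simp
  finally show ?case by simp
qed

private lemma al_lin: "al s (sum g K) = (\<Sum>k\<in>K. al s (g k))" "al s (of_nat r * f) = of_nat r * al s f"
  "al s (cc z * f) = cc z * al s f" "al s 0 = 0"
  by (simp_all add: al_def Aop_sum sum_distrib_left Aop_of_nat Aop_lin mult.left_commute)

private lemma al_commute: "al s (Aop A t f) = Aop A t (al s f)"
  by (simp add: al_def Aop_lin Aop_commute)

private lemma al_Aop: "s > 0 \<Longrightarrow> of_nat s * al s f = Aop A s f"
  by (simp add: al_def cc_inverse_of_nat)

text \<open>This is the rule D(X^(m+1)) = (m+1) D(X) X^m for X = \<open>genA A\<close> and D = -u
  d/du. It holds because the operators \<open>Aop A s\<close> commute; the induction splits r as s +
  (r - s) between the first factor and the rest.\<close>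

private lemma Pw_newton:
  "of_nat r * Pw (Suc m) r f = of_nat (Suc m) * (\<Sum>s = 1..r. Aop A s (Pw m (r - s) f))"
proof (induction m arbitrary: r)
  case 0
  have "of_nat r * Pw (Suc 0) r f = (\<Sum>s = 1..r. of_nat r * al s (if r - s = 0 then f else 0))"
    by (simp add: sum_distrib_left)
  also have "\<dots> = (\<Sum>s = 1..r. Aop A s (Pw 0 (r - s) f))"
    by (rule sum.cong) (auto simp: al_lin Aop_lin al_Aop)
  finally show ?case by simp
next
  case (Suc m)
  have "of_nat r * Pw (Suc (Suc m)) r f = (\<Sum>s = 1..r. of_nat r * al s (Pw (Suc m) (r - s) f))"
    by (simp add: sum_distrib_left)
  also have "\<dots> = (\<Sum>s = 1..r. Aop A s (Pw (Suc m) (r - s) f)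
      + of_nat (Suc m) * (\<Sum>t = 1..r - s. Aop A t (al s (Pw m (r - s - t) f))))"
  proof (rule sum.cong[OF refl])
    fix s assume s: "s \<in> {1..r}"
    have "of_nat r * al s (Pw (Suc m) (r - s) f)
        = of_nat s * al s (Pw (Suc m) (r - s) f) + al s (of_nat (r - s) * Pw (Suc m) (r - s) f)"
    proof -
      have "of_nat r = (of_nat s + of_nat (r - s) :: fock)" using s by (simp flip: of_nat_add)
      then show ?thesis by (simp only: al_lin distrib_right)
    qed
    also have "\<dots> = Aop A s (Pw (Suc m) (r - s) f)
      + of_nat (Suc m) * (\<Sum>t = 1..r - s. Aop A t (al s (Pw m (r - s - t) f)))"
      unfolding Suc.IH using s by (simp only: al_lin al_commute) (simp add: al_Aop del: Pw.simps)
    finally show "of_nat r * al s (Pw (Suc m) (r - s) f) = Aop A s (Pw (Suc m) (r - s) f)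
      + of_nat (Suc m) * (\<Sum>t = 1..r - s. Aop A t (al s (Pw m (r - s - t) f)))" .
  qed
  also have "\<dots> = (\<Sum>s = 1..r. Aop A s (Pw (Suc m) (r - s) f))
      + of_nat (Suc m) * (\<Sum>s = 1..r. \<Sum>t = 1..r - s. Aop A t (al s (Pw m (r - s - t) f)))"
    by (simp only: sum.distrib sum_distrib_left)
  also have "(\<Sum>s = 1..r. \<Sum>t = 1..r - s. Aop A t (al s (Pw m (r - s - t) f)))
     = (\<Sum>t = 1..r. \<Sum>s = 1..r - t. Aop A t (al s (Pw m (r - t - s) f)))"
    by (subst sum_triangle_swap1) (simp add: add.commute)
  also have "\<dots> = (\<Sum>t = 1..r. Aop A t (Pw (Suc m) (r - t) f))"
    by (simp only: Pw.simps Aop_sum)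
  finally show ?case by (simp add: algebra_simps del: Pw.simps)
qed

private lemma Pw_zero: "r < m \<Longrightarrow> Pw m r f = 0"
proof (induction m arbitrary: r)
  case (Suc m)
  have "al s (Pw m (r - s) f) = 0" if "s \<in> {1..r}" for s
  proof -
    have "Pw m (r - s) f = 0" by (rule Suc.IH) (use that Suc.prems in auto)
    then show ?thesis by (simp add: al_lin)
  qed
  then show ?case by simp
qed simp

lemma sexp_genA: "sexp (genA A) p f = (if p \<le> 0 then phi (Aop A) (nat (- p)) f else 0)"
proof (cases "p \<le> 0")
  case False
  then show ?thesis by (simp add: sexp_def spow_Pw scal_sc)
next
  case True
  define W where "W r = (\<Sum>m\<le>r. cc (1 / fact m) * Pw m r f)" for r
  have W_alt: "W r = (\<Sum>m\<le>M. cc (1 / fact m) * Pw m r f)" if "r \<le> M" for r M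
    unfolding W_def by (rule sum.mono_neutral_left) (use that in \<open>auto simp: Pw_zero\<close>)
  have "W r = phi (Aop A) r f" for r
  proof (rule phi_unique)
    show "W 0 = f" by (simp add: W_def)
    fix r :: nat assume r: "r > 0"
    have f: "cc (1 / fact (Suc m)) * of_nat (Suc m) = cc (1 / fact m)" for m
      by (simp add: field_simps flip: cc_of_nat cc_mult del: of_nat_Suc)
    have "of_nat r * W r = (\<Sum>m\<le>r. cc (1 / fact m) * (of_nat r * Pw m r f))"
      by (simp add: W_def sum_distrib_left mult.left_commute)
    also have "\<dots> = (\<Sum>m\<le>r. cc (1 / fact (Suc m)) * (of_nat r * Pw (Suc m) r f))"
    proof -
      \<comment> \<open>For r > 0 the term m = 0 vanishes, and so does the term m = r + 1. Hence the
        index can be shifted by one while the range stays the same.\<close>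
      have "(\<Sum>m\<le>Suc r. cc (1 / fact m) * (of_nat r * Pw m r f))
         = (\<Sum>m\<le>r. cc (1 / fact (Suc m)) * (of_nat r * Pw (Suc m) r f))"
        using r by (simp add: sum.atMost_Suc_shift del: sum.atMost_Suc fact_Suc Pw.simps(2))
      then show ?thesis by (simp add: Pw_zero del: fact_Suc Pw.simps(2))
    qed
    also have "\<dots> = (\<Sum>m\<le>r. \<Sum>s = 1..r. Aop A s (cc (1 / fact m) * Pw m (r - s) f))"
      unfolding Pw_newton mult.assoc[symmetric] f by (simp add: sum_distrib_left Aop_lin)
    also have "\<dots> = (\<Sum>s = 1..r. Aop A s (W (r - s)))"
      by (subst sum.swap) (simp add: Aop_sum W_alt[of _ r])
    finally show "of_nat r * W r = (\<Sum>s = 1..r. Aop A s (W (r - s)))" .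
  qed
  moreover have "sexp (genA A) p f = W (nat (- p))"
    unfolding sexp_def spow_Pw
    by (subst hsum_finite(2)[of "{..nat (- p)}"]) (use True in \<open>auto simp: W_def scal_sc Pw_zero\<close>)
  ultimately show ?thesis using True by simp
qed

end

section \<open>Weights and summability\<close>

definition wt :: "((nat \<times> nat) \<Rightarrow>\<^sub>0 nat) \<Rightarrow> nat" where
  "wt m = (\<Sum>j\<in>Poly_Mapping.keys m. snd j * Poly_Mapping.lookup m j)"

lemma wt_add: "wt (m + m') = wt m + wt m'"
  unfolding wt_def by (rule setsum_keys_plus_distrib) (auto simp: algebra_simps)

lemma wt_single [simp]: "wt (Poly_Mapping.single j c) = snd j * c"
  by (simp add: wt_def)

text \<open>$\hbar$ has weight $1$ and $a_{i,-k}$ has weight $k$.\<close>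

definition wf_le :: "int \<Rightarrow> fock \<Rightarrow> bool" where
  "wf_le w f \<longleftrightarrow> (\<forall>N. \<forall>b\<in>Poly_Mapping.keys (fps_nth f N). int (wt (fst b)) \<le> w + int N)"

lemma wf_le_0: "wf_le w 0"
  by (simp add: wf_le_def)

lemma wf_le_add: "wf_le w f \<Longrightarrow> wf_le w g \<Longrightarrow> wf_le w (f + g)"
  unfolding wf_le_def fps_add_nth by (meson UnE keys_add subsetD)

lemma wf_le_sum: "(\<And>k. k \<in> K \<Longrightarrow> wf_le w (f k)) \<Longrightarrow> wf_le w (sum f K)"
  by (induction K rule: infinite_finite_induct) (simp_all add: wf_le_0 wf_le_add)

lemma wf_le_cc: "wf_le w f \<Longrightarrow> wf_le w (cc z * f)"
  by (auto simp: wf_le_def cc_def in_keys_iff lookup_single0_mult)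

lemma wf_le_hb: "wf_le w f \<Longrightarrow> wf_le (w - int k) (hb ^ k * f)"
  by (force simp: wf_le_def fps_X_power_mult_nth of_nat_diff split: if_splits)

lemma wf_le_dd:
  assumes "wf_le w f"
  shows "wf_le (w - int k) (dd i k f)"
proof (cases "i = 0")
  case False
  show ?thesis
    unfolding wf_le_def
  proof (intro allI ballI)
    fix N b assume "b \<in> Poly_Mapping.keys (fps_nth (dd i k f) N)"
    moreover obtain m \<beta> where b: "b = (m, \<beta>)" by (cases b)
    ultimately have "(m + Poly_Mapping.single (i, k) 1, \<beta>) \<in> Poly_Mapping.keys (fps_nth f N)"
      using False by (auto simp: dd_def in_keys_iff lookup_boson_deriv)
    then have "int (wt (m + Poly_Mapping.single (i, k) 1)) \<le> w + int N"
      using assms unfolding wf_le_def by (metis fst_conv)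
    then show "int (wt (fst b)) \<le> w - int k + int N" by (simp add: b wt_add)
  qed
qed (simp add: dd_def wf_le_0)

text \<open>Each summand lowers the bound by exactly s: by k through the derivation and by s - k
  through the power of hbar.\<close>

lemma wf_le_Aop: "wf_le w f \<Longrightarrow> wf_le (w - int s) (Aop A s f)"
proof (induction A)
  case (Cons t A)
  obtain x i a where t: "t = (x, i, a)" by (cases t)
  have "wf_le (w - int s) (cc (of_nat (s choose k) * (- a) ^ (s - k)) * hb ^ (s - k) * dd i k f)"
    if "k \<in> {1..s}" for k
  proof -
    have "wf_le (w - int k - int (s - k)) (hb ^ (s - k) * dd i k f)"
      by (intro wf_le_hb wf_le_dd Cons.prems)
    moreover have "w - int k - int (s - k) = w - int s" using that by auto
    ultimately show ?thesis by (simp add: mult.assoc wf_le_cc)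
  qed
  then show ?case unfolding t Aop_simps Aop1_def
    by (intro wf_le_add wf_le_cc wf_le_sum Cons.IH Cons.prems)
qed (simp add: Aop_simps wf_le_0)

lemma wf_le_phi:
  assumes "\<And>s w f. wf_le w f \<Longrightarrow> wf_le (w - int s) (Bs s f)" "wf_le w f"
  shows "wf_le (w - int r) (phi Bs r f)"
proof (induction r rule: less_induct)
  case (less r)
  show ?case
  proof (cases "r = 0")
    case False
    have "wf_le (w - int r) (Bs s (phi Bs (r - s) f))" if "s \<in> {1..r}" for s
    proof -
      have "wf_le (w - int (r - s) - int s) (Bs s (phi Bs (r - s) f))"
        by (intro assms(1) less.IH) (use that in auto)
      moreover have "w - int (r - s) - int s = w - int r" using that by auto
      ultimately show ?thesis by simp
    qed
    then show ?thesis using False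
      by (subst phi.simps) (auto intro!: wf_le_cc wf_le_sum)
  qed (use assms(2) in simp)
qed

lemma wf_le_nth_zero: "wf_le w f \<Longrightarrow> w + int N < 0 \<Longrightarrow> fps_nth f N = 0"
proof -
  assume A: "wf_le w f" "w + int N < 0"
  then have "Poly_Mapping.keys (fps_nth f N) = {}" unfolding wf_le_def by fastforce
  then show ?thesis by simp
qed

text \<open>Modulo hbar^(N+1) finitely many monomials of f matter, so their weights have a common
  bound w. Each unit of r lowers it, and a negative value of w + N - r forces the coefficient of
  hbar^N to vanish.\<close>

lemma phi_hsummable:
  assumes "csub R" "\<And>s. A_endo (cset R) (Bs s)" "\<And>s w f. wf_le w f \<Longrightarrow> wf_le (w - int s) (Bs s f)"
    "f \<in> cset R"
  shows "hsummable (\<lambda>r. phi Bs r f)"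
proof (rule hsummableI)
  fix N
  \<comment> \<open>Only a truncation of f is sure to have bounded weight; the weights in f itself
    may grow with the order in hbar.\<close>
  define g where "g = Abs_fps (\<lambda>k. if k \<le> N then fps_nth f k else 0)"
  have g: "g \<in> cset R" using assms(4) csubD(1)[OF assms(1)] by (auto simp: cset_def g_def)
  define K where "K = (\<Union>k\<le>N. Poly_Mapping.keys (fps_nth f k))"
  have fin: "finite (wt ` fst ` K)" by (auto simp: K_def)
  define w where "w = Max (insert 0 (wt ` fst ` K))"
  have wfg: "wf_le (int w) g"
    unfolding wf_le_def
  proof (intro allI ballI)
    fix M b assume b: "b \<in> Poly_Mapping.keys (fps_nth g M)"
    then have "M \<le> N" by (auto simp: g_def split: if_splits)
    then have "b \<in> K" using b by (auto simp: g_def K_def)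
    then have "wt (fst b) \<le> w" unfolding w_def using fin by (intro Max_ge) auto
    then show "int (wt (fst b)) \<le> int w + int M" by simp
  qed
  have wf: "wf_le (int w - int r) (phi Bs r g)" for r by (rule wf_le_phi[OF assms(3) wfg])
  have "fps_nth (phi Bs r f) N = 0" if "r \<notin> {..w + N}" for r
  proof -
    have "fps_nth (phi Bs r f) N = fps_nth (phi Bs r g) N"
      by (rule A_endo_nth_cong[OF phi_endo[OF assms(1,2)] assms(1,4) g, of _ N]) (auto simp: g_def)
    also have "\<dots> = 0" by (rule wf_le_nth_zero[OF wf]) (use that in auto)
    finally show ?thesis .
  qed
  then show "\<exists>I. finite I \<and> (\<forall>r. r \<notin> I \<longrightarrow> fps_nth (phi Bs r f) N = 0)"
    by (intro exI[of _ "{..w + N}"]) auto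
qed

text \<open>The class closed under \<open>\<star>\<close> to which annihilation exponentials and
  zero modes belong: on each f only finitely many modes are nonzero modulo a power of hbar. Creation
  exponentials in general lie outside it.\<close>

definition FS :: "nat \<Rightarrow> vec set \<Rightarrow> series \<Rightarrow> bool" where
  "FS n L X \<longleftrightarrow> (\<forall>p. A_endo (FQ n L) (X p)) \<and> (\<forall>f\<in>FQ n L. hsummable (\<lambda>p. X p f))"

lemma FS_endo: "FS n L X \<Longrightarrow> A_endo (FQ n L) (X p)"
  and FS_hsummable: "FS n L X \<Longrightarrow> f \<in> FQ n L \<Longrightarrow> hsummable (\<lambda>p. X p f)"
  by (simp_all add: FS_def)

lemma FS_FQ: "FS n L X \<Longrightarrow> f \<in> FQ n L \<Longrightarrow> X p f \<in> FQ n L"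
  by (rule A_endoD(1)[OF FS_endo])

text \<open>At order N finitely many t matter, and for each of them finitely many s. Continuity of
  the operators X s makes the two choices compatible.\<close>

lemma FS_pair:
  assumes "FS n L X" "FS n L Y" "f \<in> FQ n L"
  shows "hsummable (\<lambda>(s, t). X s (Y t f))"
proof (rule hsummableI)
  fix N
  define T where "T = {t. \<exists>m\<le>N. fps_nth (Y t f) m \<noteq> 0}"
  define I where "I = (\<Union>t\<in>T. {s. \<exists>m\<le>N. fps_nth (X s (Y t f)) m \<noteq> 0} \<times> {t})"
  have "finite T" unfolding T_def by (rule hsummable_upto[OF FS_hsummable[OF assms(2,3)]])
  then have "finite I" unfolding I_def
    by (intro finite_UN_I finite_cartesian_product hsummable_upto FS_hsummable[OF assms(1)] FS_FQ[OF assms(2,3)]) auto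
  moreover have "fps_nth (X s (Y t f)) N = 0" if "(s, t) \<notin> I" for s t
  proof (cases "t \<in> T")
    case True
    then show ?thesis using that by (auto simp: I_def)
  next
    case False
    then show ?thesis
      by (intro A_endo_small[OF FS_endo[OF assms(1)] csub_RQ FS_FQ[OF assms(2,3)], of "Suc N"]) (auto simp: T_def)
  qed
  ultimately show "\<exists>I. finite I \<and> (\<forall>x. x \<notin> I \<longrightarrow> fps_nth (case x of (s, t) \<Rightarrow> X s (Y t f)) N = 0)"
    by (intro exI[of _ I]) auto
qed

lemma bij_diff: "bij (\<lambda>(p, s). (s, p - s :: int))"
  by (rule o_bij[of "\<lambda>(s, t). (s + t, s)"]) auto

lemma FS_pair':
  assumes "FS n L X" "FS n L Y" "f \<in> FQ n L"
  shows "hsummable (\<lambda>(p, s). X s (Y (p - s) f))"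
proof -
  have "(\<lambda>x. case (case x of (p, s) \<Rightarrow> (s, p - s)) of (s, t) \<Rightarrow> X s (Y t f)) = (\<lambda>(p, s). X s (Y (p - s) f))"
    by auto
  then show ?thesis
    using hsum_reindex(1)[OF bij_diff, of "\<lambda>(s, t). X s (Y t f)"] FS_pair[OF assms] by simp
qed

lemma FS_smult:
  assumes "FS n L X" "FS n L Y"
  shows "FS n L (X \<star> Y)"
proof -
  note s = hsum_Sigma[OF FS_pair'[OF assms]]
  have "A_endo (FQ n L) ((X \<star> Y) p)" for p
  proof -
    have "A_endo (FQ n L) (\<lambda>f. hsum (\<lambda>s. X s (Y (p - s) f)))"
      by (rule A_endo_family[OF csub_RQ A_endo_lincomb(7)[OF csub_RQ FS_endo[OF assms(1)] FS_endo[OF assms(2)]] s(1)])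
    then show ?thesis by (simp add: smult_def[abs_def])
  qed
  then show ?thesis using s(2) by (simp add: FS_def smult_def)
qed

lemma FS_const: "FS n L (const_series id)"
  unfolding FS_def
proof (intro conjI allI ballI)
  fix p show "A_endo (FQ n L) (const_series id p)"
    using A_endo_lincomb(1,2)[OF csub_RQ] by (cases "p = 0") (simp_all add: const_series_def[abs_def] id_def)
next
  fix f show "hsummable (\<lambda>p. const_series id p f)"
    by (rule hsum_single(1)[of 0]) (simp add: const_series_def)
qed

lemma FS_genA: "FS n L (sexp (genA A))"
  unfolding FS_def
proof (intro conjI allI ballI)
  fix p
  have "sexp (genA A) p = (if p \<le> 0 then phi (Aop A) (nat (- p)) else (\<lambda>f. 0))"
    by (auto simp: sexp_genA fun_eq_iff)
  then show "A_endo (FQ n L) (sexp (genA A) p)"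
    using phi_endo[OF csub_RQ Aop_endo] A_endo_lincomb(1)[OF csub_RQ] by simp
next
  fix f assume f: "f \<in> FQ n L"
  have "hsummable (\<lambda>r. phi (Aop A) r f)"
    by (rule phi_hsummable[OF csub_RQ Aop_endo wf_le_Aop f])
  then have "hsummable (\<lambda>r. sexp (genA A) (- int r) f)" by (simp add: sexp_genA)
  moreover have "bij (uminus :: int \<Rightarrow> int)" by (rule bij_uminus)
  ultimately show "hsummable (\<lambda>p. sexp (genA A) p f)"
    using hsum_int_nat(1)[of "\<lambda>p. sexp (genA A) (- p) f"] hsum_reindex(1)[OF bij_uminus, of "\<lambda>p. sexp (genA A) p f"]
    by (simp add: sexp_genA)
qed

definition lev :: "nat \<Rightarrow> vec \<Rightarrow> vec \<Rightarrow> int" where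
  "lev n \<gamma> \<beta> = \<lfloor>ip n \<gamma> \<beta>\<rfloor>"

text \<open>Modulo hbar^(N+1) the vector f meets finitely many lattice exponents, and each
  contributes powers of u within N of its pairing with \<gamma>.\<close>

lemma FS_zpow: "FS n L (zpow n \<sigma> a \<gamma>)"
  unfolding FS_def
proof (intro conjI allI ballI)
  fix p show "A_endo (FQ n L) (zpow n \<sigma> a \<gamma> p)"
    unfolding zpow_def by (rule diag_FQ)
next
  fix f
  show "hsummable (\<lambda>p. zpow n \<sigma> a \<gamma> p f)"
  proof (rule hsummableI)
    fix N
    define K where "K = (\<Union>k\<le>N. Poly_Mapping.keys (fps_nth f k))"
    define P where "P = (\<lambda>(b, q). lev n \<gamma> (snd b) - int q) ` (K \<times> {..N})"
    have "finite P" by (auto simp: P_def K_def)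
    moreover have "fps_nth (zpow n \<sigma> a \<gamma> p f) N = 0" if p: "p \<notin> P" for p
    proof -
      have "dg (\<lambda>\<beta>. fps_nth (fps_const (\<sigma> powi \<lfloor>ip n \<gamma> \<beta>\<rfloor>) * upow a \<lfloor>ip n \<gamma> \<beta>\<rfloor> p) q) (fps_nth f (N - q)) = 0"
        if q: "q \<le> N" for q
      proof (rule poly_mapping_eqI)
        fix b
        show "Poly_Mapping.lookup (dg (\<lambda>\<beta>. fps_nth (fps_const (\<sigma> powi \<lfloor>ip n \<gamma> \<beta>\<rfloor>) * upow a \<lfloor>ip n \<gamma> \<beta>\<rfloor> p) q) (fps_nth f (N - q))) b
          = Poly_Mapping.lookup 0 b"
        proof (cases "b \<in> Poly_Mapping.keys (fps_nth f (N - q))")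
          case True
          then have "lev n \<gamma> (snd b) - int q \<in> P"
            unfolding P_def K_def using q by (intro image_eqI[of _ _ "(b, q)"]) auto
          then have "fps_nth (upow a \<lfloor>ip n \<gamma> (snd b)\<rfloor> p) q = 0"
            using p by (auto simp: upow_nth lev_def)
          then show ?thesis by (simp add: lookup_dg)
        qed (simp add: lookup_dg in_keys_iff)
      qed
      then show ?thesis by (simp add: zpow_def diag_nth)
    qed
    ultimately show "\<exists>I. finite I \<and> (\<forall>p. p \<notin> I \<longrightarrow> fps_nth (zpow n \<sigma> a \<gamma> p f) N = 0)" by blast
  qed
qed


section \<open>The annihilation part of a vertex operator\<close>

text \<open>An entry \<open>(\<sigma>, \<gamma>, a)\<close> stands for \<open>zpow n \<sigma> a \<gamma>\<close>.\<close>

type_synonym latt = "(complex \<times> vec \<times> complex) list"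

definition genZ :: "nat \<Rightarrow> latt \<Rightarrow> series" where
  "genZ n Z = foldr (\<lambda>(\<sigma>, \<gamma>, a) Y. zpow n \<sigma> a \<gamma> \<star> Y) Z (const_series id)"

text \<open>The annihilation half of a vertex operator: derivations and zero modes, but no
  multiplication by a_{i,-k} and no lattice translation.\<close>

definition PH :: "nat \<Rightarrow> terms \<Rightarrow> latt \<Rightarrow> series" where
  "PH n A Z = sexp (genA A) \<star> genZ n Z"

lemma genZ_simps: "genZ n [] = const_series id" "genZ n ((\<sigma>, \<gamma>, a) # Z) = zpow n \<sigma> a \<gamma> \<star> genZ n Z"
  by (simp_all add: genZ_def)

lemma FS_genZ: "FS n L (genZ n Z)"
proof (induction Z)
  case Nil
  then show ?case by (simp add: genZ_simps FS_const)
next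
  case (Cons t Z)
  then show ?case by (cases t) (simp add: genZ_simps FS_smult FS_zpow)
qed

lemma FS_PH: "FS n L (PH n A Z)"
  unfolding PH_def by (intro FS_smult FS_genA FS_genZ)

text \<open>This is (u + a hbar)^k / u^k as a power series in 1/u. In the definitions that follow,
  \<open>mm\<close> is the leading u-exponent of a product of zero modes on a sector, and the
  \<open>zs\<close> are, up to sign and powers of hbar, the coefficients of the logarithmic
  derivative of \<open>zhat\<close>.\<close>

definition fb :: "complex \<Rightarrow> int \<Rightarrow> fock fps" where
  "fb a k = Abs_fps (\<lambda>j. cc ((of_int k gchoose j) * a ^ j) * hb ^ j)"

definition mm :: "nat \<Rightarrow> latt \<Rightarrow> vec \<Rightarrow> int" where
  "mm n Z \<beta> = (\<Sum>(\<sigma>, \<gamma>, a)\<leftarrow>Z. lev n \<gamma> \<beta>)"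

definition sg :: "nat \<Rightarrow> latt \<Rightarrow> vec \<Rightarrow> complex" where
  "sg n Z \<beta> = prod_list (map (\<lambda>(\<sigma>, \<gamma>, a). \<sigma> powi lev n \<gamma> \<beta>) Z)"

definition zhat :: "nat \<Rightarrow> latt \<Rightarrow> vec \<Rightarrow> fock fps" where
  "zhat n Z \<beta> = prod_list (map (\<lambda>(\<sigma>, \<gamma>, a). fb a (lev n \<gamma> \<beta>)) Z)"

definition zs :: "nat \<Rightarrow> latt \<Rightarrow> vec \<Rightarrow> nat \<Rightarrow> complex" where
  "zs n Z \<beta> s = (\<Sum>(\<sigma>, \<gamma>, a)\<leftarrow>Z. of_int (lev n \<gamma> \<beta>) * (- a) ^ s)"

text \<open>On the sector of \<beta> the zero modes are scalar series whose logarithmic derivative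
  adds to that of the annihilation exponential. One Newton recursion then describes all of
  \<open>PH\<close>.\<close>

definition Bop :: "nat \<Rightarrow> terms \<Rightarrow> latt \<Rightarrow> vec \<Rightarrow> nat \<Rightarrow> fock \<Rightarrow> fock" where
  "Bop n A Z \<beta> s f = Aop A s f - cc (zs n Z \<beta> s) * hb ^ s * f"

lemma sc_upow_fb: "sc (upow a k p) = (if p \<le> k then fps_nth (fb a k) (nat (k - p)) else 0)"
  by (simp add: upow_def fb_def sc_mult sc_power)

text \<open>Product of two series in u with highest exponents k and m, with coefficients counted
  from the top.\<close>

lemma conv_top:
  fixes a b :: "fock fps"
  shows "hsum (\<lambda>s. (if s \<le> k then fps_nth a (nat (k - s)) else 0) * (if p - s \<le> m then fps_nth b (nat (m - (p - s))) else 0))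
    = (if p \<le> k + m then fps_nth (a * b) (nat (k + m - p)) else 0)"
proof -
  let ?g = "\<lambda>s. (if s \<le> k then fps_nth a (nat (k - s)) else 0) * (if p - s \<le> m then fps_nth b (nat (m - (p - s))) else 0)"
  have "hsum ?g = (\<Sum>s\<in>{p - m..k}. ?g s)"
    by (rule hsum_finite) auto
  also have "\<dots> = (if p \<le> k + m then fps_nth (a * b) (nat (k + m - p)) else 0)"
  proof (cases "p \<le> k + m")
    case True
    have "(\<Sum>s\<in>{p - m..k}. ?g s) = (\<Sum>i = 0..nat (k + m - p). fps_nth a i * fps_nth b (nat (k + m - p) - i))"
    proof (rule sum.reindex_bij_witness[of _ "\<lambda>i. k - int i" "\<lambda>s. nat (k - s)"])
      fix s assume s: "s \<in> {p - m..k}"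
      have "nat (m - (p - s)) = nat (k + m - p) - nat (k - s)" using s by auto
      then show "fps_nth a (nat (k - s)) * fps_nth b (nat (k + m - p) - nat (k - s)) = ?g s" using s by simp
    qed (use True in auto)
    then show ?thesis using True by (simp add: fps_mult_nth)
  qed simp
  finally show ?thesis .
qed

lemma genZ_Sec:
  assumes "f \<in> Sec n \<beta>"
  shows "genZ n Z p f = (if p \<le> mm n Z \<beta> then cc (sg n Z \<beta>) * fps_nth (zhat n Z \<beta>) (nat (mm n Z \<beta> - p)) else 0) * f"
proof (induction Z arbitrary: p)
  case Nil
  then show ?case by (auto simp: genZ_simps const_series_def mm_def sg_def zhat_def fps_one_nth)
next
  case (Cons t Z)
  obtain \<sigma> \<gamma> a where t: "t = (\<sigma>, \<gamma>, a)" by (cases t)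
  let ?k = "lev n \<gamma> \<beta>"
  let ?m = "mm n Z \<beta>"
  let ?c = "cc (\<sigma> powi ?k) * cc (sg n Z \<beta>)"
  have m: "mm n (t # Z) \<beta> = ?k + ?m" "cc (sg n (t # Z) \<beta>) = ?c" "zhat n (t # Z) \<beta> = fb a ?k * zhat n Z \<beta>"
    by (simp_all add: t mm_def sg_def zhat_def cc_mult)
  let ?h = "\<lambda>s. (if s \<le> ?k then fps_nth (fb a ?k) (nat (?k - s)) else 0) * (if p - s \<le> ?m then fps_nth (zhat n Z \<beta>) (nat (?m - (p - s))) else 0)"
  have fin: "hsummable ?h" by (rule hsum_finite(1)[of "{p - ?m..?k}"]) auto
  have "genZ n (t # Z) p f = hsum (\<lambda>s. zpow n \<sigma> a \<gamma> s (genZ n Z (p - s) f))"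
    by (simp add: t genZ_simps smult_def)
  also have "\<dots> = hsum (\<lambda>s. (?c * f) * ?h s)"
  proof (rule arg_cong[where f=hsum], rule ext)
    fix s
    have "genZ n Z (p - s) f \<in> Sec n \<beta>" by (rule FS_FQ[OF FS_genZ assms])
    then have "zpow n \<sigma> a \<gamma> s (genZ n Z (p - s) f) = cc (\<sigma> powi ?k) * sc (upow a ?k s) * genZ n Z (p - s) f"
      by (simp add: zpow_def diag_Sec sc_mult lev_def)
    then show "zpow n \<sigma> a \<gamma> s (genZ n Z (p - s) f) = (?c * f) * ?h s"
      by (simp add: Cons.IH sc_upow_fb mult_ac)
  qed
  also have "\<dots> = (?c * f) * hsum ?h" by (rule hsum_mult(2)[OF fin])
  finally show ?case unfolding m conv_top by (simp add: mult_ac)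
qed

definition Dt :: "'a::comm_ring_1 fps \<Rightarrow> 'a fps" where
  "Dt w = Abs_fps (\<lambda>r. of_nat r * fps_nth w r)"

lemma Dt_nth: "fps_nth (Dt w) r = of_nat r * fps_nth w r"
  by (simp add: Dt_def)

lemma Dt_mult: "Dt (w * z) = Dt w * z + w * Dt z"
proof (rule fps_ext)
  fix r
  have "of_nat r * (fps_nth w i * fps_nth z (r - i)) =
     of_nat i * fps_nth w i * fps_nth z (r - i) + fps_nth w i * (of_nat (r - i) * fps_nth z (r - i))" if "i \<le> r" for i
  proof -
    have "of_nat r = (of_nat i + of_nat (r - i) :: 'a)" using that by (simp flip: of_nat_add)
    then show ?thesis by (simp only: algebra_simps)
  qed
  then show "fps_nth (Dt (w * z)) r = fps_nth (Dt w * z + w * Dt z) r"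
    by (simp add: Dt_nth fps_mult_nth sum_distrib_left sum.distrib)
qed

definition lamc :: "complex \<Rightarrow> int \<Rightarrow> fock fps" where
  "lamc a k = Abs_fps (\<lambda>s. if s = 0 then 0 else - (cc (of_int k * (- a) ^ s) * hb ^ s))"

text \<open>The identity x d/dx (1+x)^k = (k x/(1+x)) (1+x)^k, compared at x^j.\<close>

lemma gbinomial_alternating:
  "of_nat j * (k gchoose j) = - k * (\<Sum>s = 1..j. (- 1) ^ s * (k gchoose (j - s)))" for k :: complex
proof (induction j)
  case (Suc j)
  have "(\<Sum>s = 1..Suc j. (- 1) ^ s * (k gchoose (Suc j - s))) = - (k gchoose j) + (\<Sum>s = 1..j. (- 1) ^ Suc s * (k gchoose (j - s)))"
    by (subst sum.atLeast_Suc_atMost) (simp_all add: sum.shift_bounds_cl_Suc_ivl del: sum.cl_ivl_Suc)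
  also have "\<dots> = - (k gchoose j) - (\<Sum>s = 1..j. (- 1) ^ s * (k gchoose (j - s)))"
    by (simp add: sum_negf)
  finally have S: "(\<Sum>s = 1..Suc j. (- 1) ^ s * (k gchoose (Suc j - s)))
    = - (k gchoose j) - (\<Sum>s = 1..j. (- 1) ^ s * (k gchoose (j - s)))" .
  have "- k * (\<Sum>s = 1..Suc j. (- 1) ^ s * (k gchoose (Suc j - s)))
      = k * (k gchoose j) - (- k * (\<Sum>s = 1..j. (- 1) ^ s * (k gchoose (j - s))))"
    unfolding S by (simp add: right_diff_distrib)
  then show ?case using gbinomial_mult_1[of k j] Suc.IH by (simp del: sum.cl_ivl_Suc of_nat_Suc)
qed simp

lemma Dt_fb: "Dt (fb a k) = lamc a k * fb a k"
proof (rule fps_ext)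
  fix j
  have "fps_nth (lamc a k * fb a k) j = (\<Sum>s = 1..j. - (cc (of_int k * (- a) ^ s) * hb ^ s) * fps_nth (fb a k) (j - s))"
    unfolding fps_mult_nth by (subst sum.atLeast_Suc_atMost) (auto simp: lamc_def intro!: sum.cong)
  also have "\<dots> = (\<Sum>s = 1..j. cc (- of_int k * ((- 1) ^ s * (of_int k gchoose (j - s))) * a ^ j) * hb ^ j)"
  proof (rule sum.cong[OF refl])
    fix s assume s: "s \<in> {1..j}"
    have "a ^ j = a ^ s * a ^ (j - s)" "hb ^ j = hb ^ s * hb ^ (j - s)" "(- a) ^ s = (- 1) ^ s * a ^ s"
      using s by (simp_all flip: power_add power_mult_distrib)
    then show "- (cc (of_int k * (- a) ^ s) * hb ^ s) * fps_nth (fb a k) (j - s)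
      = cc (- of_int k * ((- 1) ^ s * (of_int k gchoose (j - s))) * a ^ j) * hb ^ j"
      by (simp only: fb_def fps_nth_Abs_fps cc_mult cc_uminus mult_minus_left mult_minus_right mult_ac)
  qed
  also have "\<dots> = cc (of_nat j * (of_int k gchoose j) * a ^ j) * hb ^ j"
    unfolding gbinomial_alternating sum_distrib_left sum_distrib_right cc_sum ..
  finally show "fps_nth (Dt (fb a k)) j = fps_nth (lamc a k * fb a k) j"
    by (simp add: Dt_nth fb_def cc_mult mult.assoc)
qed

definition lamz :: "nat \<Rightarrow> latt \<Rightarrow> vec \<Rightarrow> fock fps" where
  "lamz n Z \<beta> = Abs_fps (\<lambda>s. if s = 0 then 0 else - (cc (zs n Z \<beta> s) * hb ^ s))"

lemma Dt_zhat: "Dt (zhat n Z \<beta>) = lamz n Z \<beta> * zhat n Z \<beta>"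
proof (induction Z)
  case Nil
  show ?case by (rule fps_ext) (simp add: Dt_nth zhat_def fps_one_nth lamz_def zs_def)
next
  case (Cons t Z)
  obtain \<sigma> \<gamma> a where t: "t = (\<sigma>, \<gamma>, a)" by (cases t)
  have "lamz n (t # Z) \<beta> = lamc a (lev n \<gamma> \<beta>) + lamz n Z \<beta>"
    by (rule fps_ext) (simp add: t lamz_def lamc_def zs_def cc_add algebra_simps)
  moreover have "zhat n (t # Z) \<beta> = fb a (lev n \<gamma> \<beta>) * zhat n Z \<beta>" by (simp add: t zhat_def)
  ultimately show ?case by (simp add: Dt_mult Dt_fb Cons.IH algebra_simps)
qed

text \<open>These coefficients are scalars of A and hence pass through A-linear operators.\<close>

lemma zhat_sc: "fps_nth (zhat n Z \<beta>) j \<in> range sc"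
proof (induction Z arbitrary: j)
  case Nil
  have "(0 :: fock) \<in> range sc" "(1 :: fock) \<in> range sc" by (metis rangeI sc_simps(1), metis rangeI sc_simps(2))
  then show ?case by (simp add: zhat_def fps_one_nth)
next
  case (Cons t Z)
  obtain \<sigma> \<gamma> a where t: "t = (\<sigma>, \<gamma>, a)" by (cases t)
  have mult: "x * y \<in> range sc" if "x \<in> range sc" "y \<in> range sc" for x y
  proof -
    obtain c d where "x = sc c" "y = sc d" using \<open>x \<in> range sc\<close> \<open>y \<in> range sc\<close> by blast
    then have "x * y = sc (c * d)" by (simp add: sc_mult)
    then show ?thesis by blast
  qed
  have add: "x + y \<in> range sc" if "x \<in> range sc" "y \<in> range sc" for x y
  proof -
    obtain c d where "x = sc c" "y = sc d" using \<open>x \<in> range sc\<close> \<open>y \<in> range sc\<close> by blast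
    then have "x + y = sc (c + d)" by (simp add: sc_add)
    then show ?thesis by blast
  qed
  have zero: "0 \<in> range sc" by (metis rangeI sc_simps(1))
  have sum: "sum g K \<in> range sc" if "\<And>k. k \<in> K \<Longrightarrow> g k \<in> range sc" for g :: "nat \<Rightarrow> fock" and K
    using that by (induction K rule: infinite_finite_induct) (auto intro: add zero simp del: image_iff)
  have "fps_nth (fb a (lev n \<gamma> \<beta>)) i \<in> range sc" for i
  proof -
    have "fps_nth (fb a (lev n \<gamma> \<beta>)) i = sc (fps_const ((of_int (lev n \<gamma> \<beta>) gchoose i) * a ^ i) * fps_X ^ i)"
      by (simp add: fb_def sc_mult sc_power)
    then show ?thesis by simp
  qed
  then have "fps_nth (fb a (lev n \<gamma> \<beta>) * zhat n Z \<beta>) j \<in> range sc"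
    unfolding fps_mult_nth by (intro sum mult Cons.IH)
  then show ?case by (simp add: t zhat_def)
qed

lemma fps_mult_nth_pos:
  fixes L W :: "'a::comm_ring_1 fps"
  assumes "fps_nth L 0 = 0"
  shows "fps_nth (L * W) r = (\<Sum>s = 1..r. fps_nth L s * fps_nth W (r - s))"
  unfolding fps_mult_nth using assms by (subst sum.atLeast_Suc_atMost) auto

lemma Aop_sc: "Aop A s (sc c * f) = sc c * Aop A s f"
proof -
  have "Aop1 i a s (sc c * f) = sc c * Aop1 i a s f" for i a
    by (simp add: Aop1_def dd_mult sum_distrib_left mult.left_commute)
  then show ?thesis by (induction A) (auto simp: Aop_simps distrib_left mult.left_commute)
qed

text \<open>By the Leibniz rule for \<open>Dt\<close>, the product of solutions of two Newton
  recursions solves the recursion of the summed operators.\<close>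

lemma phi_zhat:
  "fps_nth (Abs_fps (\<lambda>r. phi (Aop A) r f) * zhat n Z \<beta>) r = phi (Bop n A Z \<beta>) r f"
proof (rule phi_unique)
  let ?F = "Abs_fps (\<lambda>r. phi (Aop A) r f)"
  let ?z = "zhat n Z \<beta>"
  have "fps_nth ?z 0 = 1"
    by (induction Z) (auto simp: zhat_def fb_def fps_mult_nth)
  then show "fps_nth (?F * ?z) 0 = f" by (simp add: fps_mult_nth)
  fix r :: nat
  have sc: "Aop A s (g * fps_nth ?z j) = Aop A s g * fps_nth ?z j" for s g j
  proof -
    obtain c where c: "fps_nth ?z j = sc c" using zhat_sc by blast
    show ?thesis using Aop_sc[of A s c g] by (simp add: c mult.commute)
  qed
  have 1: "fps_nth (Dt ?F * ?z) r = (\<Sum>s = 1..r. Aop A s (fps_nth (?F * ?z) (r - s)))"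
  proof -
    have "fps_nth (Dt ?F * ?z) r = (\<Sum>j\<le>r. \<Sum>s = 1..j. Aop A s (phi (Aop A) (j - s) f) * fps_nth ?z (r - j))"
      by (simp add: fps_mult_nth Dt_nth phi_newton sum_distrib_right atLeast0AtMost)
    also have "\<dots> = (\<Sum>s = 1..r. \<Sum>i\<le>r - s. Aop A s (phi (Aop A) i f) * fps_nth ?z (r - s - i))"
      by (simp add: sum.Sigma)
         (rule sum.reindex_bij_witness[of _ "\<lambda>(s, i). (s + i, s)" "\<lambda>(j, s). (s, j - s)"]; auto)
    also have "\<dots> = (\<Sum>s = 1..r. Aop A s (fps_nth (?F * ?z) (r - s)))"
      by (simp add: fps_mult_nth Aop_sum sc atLeast0AtMost)
    finally show ?thesis .
  qed
  have 2: "fps_nth (?F * Dt ?z) r = (\<Sum>s = 1..r. - (cc (zs n Z \<beta> s) * hb ^ s * fps_nth (?F * ?z) (r - s)))"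
  proof -
    have "?F * Dt ?z = lamz n Z \<beta> * (?F * ?z)" by (simp add: Dt_zhat mult_ac)
    moreover have "fps_nth (lamz n Z \<beta>) 0 = 0" by (simp add: lamz_def)
    ultimately have "fps_nth (?F * Dt ?z) r = (\<Sum>s = 1..r. fps_nth (lamz n Z \<beta>) s * fps_nth (?F * ?z) (r - s))"
      using fps_mult_nth_pos[of "lamz n Z \<beta>" "?F * ?z" r] by simp
    also have "\<dots> = (\<Sum>s = 1..r. - (cc (zs n Z \<beta> s) * hb ^ s * fps_nth (?F * ?z) (r - s)))"
      by (rule sum.cong[OF refl]) (simp add: lamz_def)
    finally show ?thesis .
  qed
  show "of_nat r * fps_nth (?F * ?z) r = (\<Sum>s = 1..r. Bop n A Z \<beta> s (fps_nth (?F * ?z) (r - s)))"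
    unfolding Bop_def Dt_nth[symmetric] Dt_mult fps_add_nth 1 2 by (simp add: sum_subtractf sum_negf)
qed

lemma PH_Sec:
  assumes "f \<in> Sec n \<beta>"
  shows "PH n A Z p f = (if p \<le> mm n Z \<beta> then cc (sg n Z \<beta>) * phi (Bop n A Z \<beta>) (nat (mm n Z \<beta> - p)) f else 0)"
proof -
  let ?F = "Abs_fps (\<lambda>r. phi (Aop A) r f)"
  let ?m = "mm n Z \<beta>"
  let ?h = "\<lambda>s. (if s \<le> 0 then fps_nth ?F (nat (0 - s)) else 0) * (if p - s \<le> ?m then fps_nth (zhat n Z \<beta>) (nat (?m - (p - s))) else 0)"
  have fin: "hsummable ?h" by (rule hsum_finite(1)[of "{p - ?m..0}"]) auto
  have "PH n A Z p f = hsum (\<lambda>s. sexp (genA A) s (genZ n Z (p - s) f))"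
    by (simp add: PH_def smult_def)
  also have "\<dots> = hsum (\<lambda>s. cc (sg n Z \<beta>) * ?h s)"
  proof (rule arg_cong[where f=hsum], rule ext)
    fix s
    obtain c where c: "fps_nth (zhat n Z \<beta>) (nat (?m - (p - s))) = sc c" using zhat_sc by blast
    have e: "A_endo (Sec n \<beta>) (sexp (genA A) s)" by (rule FS_endo[OF FS_genA])
    show "sexp (genA A) s (genZ n Z (p - s) f) = cc (sg n Z \<beta>) * ?h s"
    proof (cases "p - s \<le> ?m")
      case True
      then have "sexp (genA A) s (genZ n Z (p - s) f) = cc (sg n Z \<beta>) * (sc c * sexp (genA A) s f)"
        by (simp add: genZ_Sec[OF assms] c mult.assoc A_endoD(3,4)[OF e] assms cset_sc)
      then show ?thesis using True by (simp add: c sexp_genA mult.commute)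
    next
      case False
      then show ?thesis by (simp add: genZ_Sec[OF assms] A_endo_0[OF e csub_RQ])
    qed
  qed
  also have "\<dots> = cc (sg n Z \<beta>) * hsum ?h" by (rule hsum_mult(2)[OF fin])
  finally show ?thesis unfolding conv_top phi_zhat by simp
qed

section \<open>Exchange of annihilation and creation operators\<close>

text \<open>All contracted pairs, each with the product of its coefficients and both shifts. Index 0
  is left out because a_{0,k} = 0.\<close>

definition prs :: "terms \<Rightarrow> terms \<Rightarrow> (complex \<times> complex \<times> complex) list" where
  "prs A C = [(x * y, a, b). (x, i, a) \<leftarrow> A, (y, j, b) \<leftarrow> C, i = j \<and> i \<noteq> 0]"

text \<open>The sum of binom(s,k) (-a hbar)^(s-k) (v + b hbar)^k over k >= 1 is (v + (b-a) hbar)^s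
  without its term k = 0. That leftover (-a hbar)^s is free of v; the zero modes will absorb
  it.\<close>

lemma Dl_Aop1_MM:
  "Dl (Aop1 i a s) (MM C \<delta> * w) = MM C \<delta> * Dl (Aop1 i a s) w
    + (\<Sum>(y, j, b)\<leftarrow>C. if i = j \<and> i \<noteq> 0 then fps_const (cc y) * (vv (b - a) ^ s - fps_const (cc (- a) * hb) ^ s) else 0) * (MM C \<delta> * w)"
proof -
  let ?c = "\<lambda>k. fps_const (cc (of_nat (s choose k) * (- a) ^ (s - k)) * hb ^ (s - k))"
  let ?S = "\<lambda>F. (\<Sum>(y, j, b)\<leftarrow>C. if i = j \<and> i \<noteq> 0 then fps_const (cc y) * F b else 0) :: fock fps"
  have D: "Dl (Aop1 i a s) z = (\<Sum>k = 1..s. ?c k * Dl (dd i k) z)" for z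
    by (rule fps_ext) (simp add: Aop1_def fps_sum_nth)
  have S_mult: "x * ?S F = ?S (\<lambda>b. x * F b)" for x F
    by (induction C) (auto simp: algebra_simps)
  have S_sum: "(\<Sum>k\<in>K. ?S (F k)) = ?S (\<lambda>b. \<Sum>k\<in>K. F k b)" for F and K :: "nat set"
  proof (induction C)
    case (Cons t C)
    have e: "(\<Sum>k\<in>K. if P then x * F k b else 0) = (if P then x * (\<Sum>k\<in>K. F k b) else 0)" for P x b
      by (simp add: sum_distrib_left)
    show ?case
      by (cases t) (simp only: list.map sum_list.Cons prod.case sum.distrib e Cons.IH)
  qed simp
  have b: "(\<Sum>k = 1..s. ?c k * vv b ^ k) = vv (b - a) ^ s - fps_const (cc (- a) * hb) ^ s" for b
  proof -
    have "vv (b - a) = vv b + fps_const (cc (- a) * hb)"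
      by (simp add: vv_def cc_diff cc_uminus algebra_simps flip: fps_const_add fps_const_neg)
    then have "vv (b - a) ^ s = (\<Sum>k\<le>s. of_nat (s choose k) * vv b ^ k * fps_const (cc (- a) * hb) ^ (s - k))"
      by (simp only: binomial_ring)
    also have "\<dots> = (\<Sum>k\<le>s. ?c k * vv b ^ k)"
      by (rule sum.cong) (simp_all add: fps_const_power power_mult_distrib cc_mult cc_power fps_of_nat[symmetric] mult_ac)
    also have "\<dots> = ?c 0 + (\<Sum>k = 1..s. ?c k * vv b ^ k)"
      by (simp add: atMost_atLeast0 sum.atLeast_Suc_atMost)
    also have "?c 0 = fps_const (cc (- a) * hb) ^ s"
      by (simp add: fps_const_power power_mult_distrib cc_power)
    finally show ?thesis by simp
  qed
  have "Dl (Aop1 i a s) (MM C \<delta> * w) = (\<Sum>k = 1..s. ?c k * (?S (\<lambda>b. vv b ^ k) * MM C \<delta> * w + MM C \<delta> * Dl (dd i k) w))"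
    unfolding D by (rule sum.cong) (simp_all add: Dl_dd_mult Dl_MM)
  also have "\<dots> = (\<Sum>k = 1..s. ?c k * ?S (\<lambda>b. vv b ^ k)) * (MM C \<delta> * w) + MM C \<delta> * Dl (Aop1 i a s) w"
    unfolding D by (simp add: sum_distrib_left sum_distrib_right sum.distrib algebra_simps)
  also have "(\<Sum>k = 1..s. ?c k * ?S (\<lambda>b. vv b ^ k)) = ?S (\<lambda>b. vv (b - a) ^ s - fps_const (cc (- a) * hb) ^ s)"
    unfolding S_mult S_sum b ..
  finally show ?thesis by (simp add: add.commute)
qed

lemma Dl_Aop_simps: "Dl (Aop []  s) w = 0" "Dl (Aop ((x, i, a) # A) s) w = fps_const (cc x) * Dl (Aop1 i a s) w + Dl (Aop A s) w"
  by (rule fps_ext, simp add: Aop_simps)+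

lemma Dl_Aop_MM:
  "Dl (Aop A s) (MM C \<delta> * w) = MM C \<delta> * Dl (Aop A s) w
    + (\<Sum>(e, a, b)\<leftarrow>prs A C. fps_const (cc e) * (vv (b - a) ^ s - fps_const (cc (- a) * hb) ^ s)) * (MM C \<delta> * w)"
proof (induction A)
  case Nil
  show ?case by (simp add: Dl_Aop_simps prs_def)
next
  case (Cons t A)
  obtain x i a where t: "t = (x, i, a)" by (cases t)
  define F where "F = (\<lambda>a b. vv (b - a) ^ s - fps_const (cc (- a) * hb) ^ s)"
  have p: "prs (t # A) C = [(x * y, a, b). (y, j, b) \<leftarrow> C, i = j \<and> i \<noteq> 0] @ prs A C"
    by (simp add: prs_def t)
  have e: "(\<Sum>(e, a, b)\<leftarrow>[(x * y, a, b). (y, j, b) \<leftarrow> C, i = j \<and> i \<noteq> 0]. fps_const (cc e) * F a b)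
      = fps_const (cc x) * (\<Sum>(y, j, b)\<leftarrow>C. if i = j \<and> i \<noteq> 0 then fps_const (cc y) * F a b else 0)"
    by (induction C) (auto simp: cc_mult algebra_simps simp flip: fps_const_mult)
  have pr: "(\<Sum>(e, a, b)\<leftarrow>prs (t # A) C. fps_const (cc e) * F a b)
      = fps_const (cc x) * (\<Sum>(y, j, b)\<leftarrow>C. if i = j \<and> i \<noteq> 0 then fps_const (cc y) * F a b else 0)
        + (\<Sum>(e, a, b)\<leftarrow>prs A C. fps_const (cc e) * F a b)"
    unfolding p map_append sum_list_append e ..
  have IH: "Dl (Aop A s) (MM C \<delta> * w) = MM C \<delta> * Dl (Aop A s) w
      + (\<Sum>(e, a, b)\<leftarrow>prs A C. fps_const (cc e) * F a b) * (MM C \<delta> * w)"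
    using Cons.IH by (simp only: F_def)
  have D1: "Dl (Aop1 i a s) (MM C \<delta> * w) = MM C \<delta> * Dl (Aop1 i a s) w
    + (\<Sum>(y, j, b)\<leftarrow>C. if i = j \<and> i \<noteq> 0 then fps_const (cc y) * F a b else 0) * (MM C \<delta> * w)"
    using Dl_Aop1_MM[of i a s C \<delta> w] by (simp only: F_def)
  have "Dl (Aop (t # A) s) (MM C \<delta> * w) = MM C \<delta> * Dl (Aop (t # A) s) w
    + (\<Sum>(e, a, b)\<leftarrow>prs (t # A) C. fps_const (cc e) * F a b) * (MM C \<delta> * w)"
    unfolding pr unfolding t Dl_Aop_simps IH D1 by (simp only: algebra_simps)
  then show ?case by (simp only: F_def)
qed

text \<open>Integral pairings make the exponents additive under lattice translation, and a nonzero
  \<sigma> makes the signs multiplicative.\<close>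

definition intg :: "nat \<Rightarrow> latt \<Rightarrow> bool" where
  "intg n Z \<longleftrightarrow> (\<forall>(\<sigma>, \<gamma>, a)\<in>set Z. \<sigma> \<noteq> 0 \<and> (\<forall>\<beta>\<in>Q n. ip n \<gamma> \<beta> \<in> \<int>))"

lemma ip_add: "ip n \<gamma> (\<beta> + \<delta>) = ip n \<gamma> \<beta> + ip n \<gamma> \<delta>"
  by (simp add: ip_def algebra_simps sum.distrib)

lemma lev_add:
  assumes "ip n \<gamma> \<beta> \<in> \<int>" "ip n \<gamma> \<delta> \<in> \<int>"
  shows "lev n \<gamma> (\<beta> + \<delta>) = lev n \<gamma> \<beta> + lev n \<gamma> \<delta>"
  using assms by (auto simp: lev_def ip_add elim!: Ints_cases simp flip: of_int_add)

lemma intg_add: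
  assumes "intg n Z" "\<beta> \<in> Q n" "\<delta> \<in> Q n"
  shows "mm n Z (\<beta> + \<delta>) = mm n Z \<beta> + mm n Z \<delta>"
    "sg n Z (\<beta> + \<delta>) = sg n Z \<beta> * sg n Z \<delta>"
    "zs n Z (\<beta> + \<delta>) s = zs n Z \<beta> s + zs n Z \<delta> s"
  using assms(1)
  by (induction Z)
     (auto simp: mm_def sg_def zs_def intg_def lev_add assms(2,3) power_int_add algebra_simps)

text \<open>Moving the annihilation part given by \<open>A\<close>, \<open>Z\<close> at $u$ past the creation part given by \<open>C\<close>, \<open>\<delta>\<close> at $v$
  produces the factors \<open>lin c\<close> for \<open>c\<close> in \<open>pos\<close> and their inverses for \<open>c\<close> in \<open>neg\<close>; the second and third
  conditions make the pure powers of $u$ cancel.\<close>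

definition ctr :: "nat \<Rightarrow> terms \<Rightarrow> latt \<Rightarrow> terms \<Rightarrow> vec \<Rightarrow> complex list \<Rightarrow> complex list \<Rightarrow> bool" where
  "ctr n A Z C \<delta> neg pos \<longleftrightarrow>
    (\<forall>h :: complex \<Rightarrow> fock fps. (\<Sum>(e, a, b)\<leftarrow>prs A C. fps_const (cc e) * h (a - b)) = (\<Sum>c\<leftarrow>neg. h c) - (\<Sum>c\<leftarrow>pos. h c)) \<and>
    (\<forall>g :: complex \<Rightarrow> complex. (\<Sum>(e, a, b)\<leftarrow>prs A C. e * g a) + (\<Sum>(\<sigma>, \<gamma>, a)\<leftarrow>Z. of_int (lev n \<gamma> \<delta>) * g a) = 0) \<and>
    mm n Z \<delta> = int (length pos) - int (length neg)"

text \<open>This is (u - v + c hbar)/u: the outer variable is now 1/u, the inner one v.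
  \<open>Pr\<close> is a product of such factors and \<open>lam2\<close> its logarithmic
  derivative.\<close>

definition lint :: "complex \<Rightarrow> fock fps fps" where
  "lint c = 1 - fps_const (vv (- c)) * fps_X"

definition lam2 :: "complex list \<Rightarrow> fock fps fps" where
  "lam2 cs = Abs_fps (\<lambda>s. if s = 0 then 0 else - (\<Sum>c\<leftarrow>cs. vv (- c) ^ s))"

definition Pr :: "complex list \<Rightarrow> fock fps fps" where
  "Pr cs = prod_list (map lint cs)"

lemma lint_mult_nth: "fps_nth (lint c * W) r = fps_nth W r - (if r = 0 then 0 else vv (- c) * fps_nth W (r - 1))"
  by (simp add: lint_def left_diff_distrib mult.assoc fps_mult_left_const_nth)

lemma lam2_simps: "lam2 [] = 0" "lam2 (c # cs) = lam2 [c] + lam2 cs"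
  by (rule fps_ext, simp add: lam2_def)+

lemma Dt_lint: "Dt (lint c) = lam2 [c] * lint c"
proof (rule fps_ext)
  fix r
  have 1: "fps_nth (lint c) r = (if r = 0 then 1 else if r = 1 then - vv (- c) else 0)" for r
    using lint_mult_nth[of c 1 r] by (auto simp: fps_one_nth)
  have "fps_nth (lint c * lam2 [c]) r = (if r = 1 then - vv (- c) else 0)"
    unfolding lint_mult_nth by (cases r) (auto simp: lam2_def)
  then show "fps_nth (Dt (lint c)) r = fps_nth (lam2 [c] * lint c) r"
    by (simp add: Dt_nth 1 mult.commute)
qed

lemma Dt_Pr: "Dt (Pr cs) = lam2 cs * Pr cs"
proof (induction cs)
  case Nil
  show ?case by (rule fps_ext) (simp add: Dt_nth Pr_def lam2_simps fps_one_nth)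
next
  case (Cons c cs)
  have "Pr (c # cs) = lint c * Pr cs" by (simp add: Pr_def)
  then show ?case unfolding lam2_simps(2)[of c cs] by (simp add: Dt_mult Dt_lint Cons.IH algebra_simps)
qed

text \<open>The right side of the Newton recursion as a single operator on series in 1/u whose
  coefficients are series in v.\<close>

definition AA :: "(nat \<Rightarrow> fock \<Rightarrow> fock) \<Rightarrow> fock fps fps \<Rightarrow> fock fps fps" where
  "AA Bs W = Abs_fps (\<lambda>r. \<Sum>s = 1..r. Dl (Bs s) (fps_nth W (r - s)))"

lemma Bop_lin:
  "Bop n A Z \<beta> s (f + g) = Bop n A Z \<beta> s f + Bop n A Z \<beta> s g"
  "Bop n A Z \<beta> s (sc c * f) = sc c * Bop n A Z \<beta> s f"
  "Bop n A Z \<beta> s 0 = 0"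
  by (simp_all add: Bop_def Aop_lin Aop_sc distrib_left right_diff_distrib mult.left_commute)

lemma Bop_cc:
  "Bop n A Z \<beta> s (cc z * f) = cc z * Bop n A Z \<beta> s f"
  "Bop n A Z \<beta> s (hb * f) = hb * Bop n A Z \<beta> s f"
  "Bop n A Z \<beta> s (- f) = - Bop n A Z \<beta> s f"
  "Bop n A Z \<beta> s (f - g) = Bop n A Z \<beta> s f - Bop n A Z \<beta> s g"
proof -
  show 1: "Bop n A Z \<beta> s (cc z * f) = cc z * Bop n A Z \<beta> s f" for z f
    using Bop_lin(2)[of n A Z \<beta> s "fps_const z" f] by simp
  show "Bop n A Z \<beta> s (hb * f) = hb * Bop n A Z \<beta> s f"
    using Bop_lin(2)[of n A Z \<beta> s fps_X f] by simp
  show 2: "Bop n A Z \<beta> s (- f) = - Bop n A Z \<beta> s f" for f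
    using 1[of "-1" f] by (simp add: cc_uminus)
  show "Bop n A Z \<beta> s (f - g) = Bop n A Z \<beta> s f - Bop n A Z \<beta> s g"
    using Bop_lin(1)[of n A Z \<beta> s f "- g"] 2[of g] by simp
qed

lemma Dl_Bop_vv: "Dl (Bop n A Z \<beta> s) (vv c * w) = vv c * Dl (Bop n A Z \<beta> s) w"
proof (rule fps_ext)
  fix q
  have "fps_nth (vv c * z) q = (if q = 0 then 0 else fps_nth z (q - 1)) + cc c * (hb * fps_nth z q)" for z
    by (simp add: vv_def distrib_right fps_mult_left_const_nth mult.assoc)
  then show "fps_nth (Dl (Bop n A Z \<beta> s) (vv c * w)) q = fps_nth (vv c * Dl (Bop n A Z \<beta> s) w) q"
    by (simp add: Bop_lin Bop_cc)
qed

text \<open>The coefficients of \<open>lint c\<close> are series in v over A, and \<open>Bop\<close>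
  acts A-linearly on each coefficient in v.\<close>

lemma AA_lint: "AA (Bop n A Z \<beta>) (lint c * W) = lint c * AA (Bop n A Z \<beta>) W"
proof (rule fps_ext)
  fix r
  let ?D = "\<lambda>s. Dl (Bop n A Z \<beta> s)"
  have diff: "?D s (w - z) = ?D s w - ?D s z" for s w z
    by (rule fps_ext) (simp add: Bop_cc)
  have z: "?D s 0 = 0" for s by (rule fps_ext) (simp add: Bop_lin)
  have "fps_nth (AA (Bop n A Z \<beta>) (lint c * W)) r
     = (\<Sum>s = 1..r. ?D s (fps_nth W (r - s))) - (\<Sum>s = 1..r. if r - s = 0 then 0 else vv (- c) * ?D s (fps_nth W (r - s - 1)))"
    unfolding AA_def fps_nth_Abs_fps lint_mult_nth diff sum_subtractf[symmetric]
    by (rule sum.cong) (auto simp: Dl_Bop_vv z)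
  also have "(\<Sum>s = 1..r. if r - s = 0 then 0 else vv (- c) * ?D s (fps_nth W (r - s - 1)))
     = (if r = 0 then 0 else \<Sum>s = 1..r - 1. vv (- c) * ?D s (fps_nth W (r - 1 - s)))"
  proof (cases r)
    case (Suc r')
    have "(\<Sum>s = 1..r'. if r - s = 0 then 0 else vv (- c) * ?D s (fps_nth W (r - s - 1)))
      = (\<Sum>s = 1..r'. vv (- c) * ?D s (fps_nth W (r' - s)))"
      by (rule sum.cong) (use Suc in auto)
    then show ?thesis by (simp add: Suc)
  qed simp
  finally show "fps_nth (AA (Bop n A Z \<beta>) (lint c * W)) r = fps_nth (lint c * AA (Bop n A Z \<beta>) W) r"
    by (simp add: lint_mult_nth AA_def sum_distrib_left)
qed

lemma AA_Pr: "AA (Bop n A Z \<beta>) (Pr cs * W) = Pr cs * AA (Bop n A Z \<beta>) W"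
proof (induction cs)
  case (Cons c cs)
  have "Pr (c # cs) = lint c * Pr cs" by (simp add: Pr_def)
  then show ?case by (simp add: mult.assoc AA_lint Cons.IH)
qed (simp add: Pr_def)

text \<open>L has no constant term, so the coefficient at r is determined by the earlier
  ones.\<close>

lemma newton_unique2:
  fixes W W' :: "fock fps fps"
  assumes "fps_nth W 0 = fps_nth W' 0" "Dt W = AA Bs W + L * W" "Dt W' = AA Bs W' + L * W'" "fps_nth L 0 = 0"
  shows "W = W'"
proof -
  have n: "of_nat r * fps_nth V r = (\<Sum>s = 1..r. Dl (Bs s) (fps_nth V (r - s)) + fps_nth L s * fps_nth V (r - s))"
    if "Dt V = AA Bs V + L * V" for V r
  proof -
    have "fps_nth (Dt V) r = fps_nth (AA Bs V) r + fps_nth (L * V) r" using that by simp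
    then show ?thesis by (simp add: Dt_nth AA_def fps_mult_nth_pos[OF assms(4)] sum.distrib)
  qed
  have "fps_nth W r = fps_nth W' r" for r
  proof (induction r rule: less_induct)
    case (less r)
    show ?case
    proof (cases "r = 0")
      case False
      have "(\<Sum>s = 1..r. Dl (Bs s) (fps_nth W (r - s)) + fps_nth L s * fps_nth W (r - s))
         = (\<Sum>s = 1..r. Dl (Bs s) (fps_nth W' (r - s)) + fps_nth L s * fps_nth W' (r - s))"
        by (rule sum.cong) (use less in auto)
      then have e: "of_nat r * fps_nth W r = of_nat r * fps_nth W' r"
        by (simp only: n[OF assms(2)] n[OF assms(3)])
      show ?thesis
      proof (rule fps_ext)
        fix q
        have "of_nat r * fps_nth (fps_nth W r) q = of_nat r * fps_nth (fps_nth W' r) q"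
          using arg_cong[OF e, of "\<lambda>w. fps_nth w q"] by (simp add: fps_of_nat_mult_nth)
        then show "fps_nth (fps_nth W r) q = fps_nth (fps_nth W' r) q"
          by (rule of_nat_cancel) (use False in simp)
      qed
    qed (use assms(1) in simp)
  qed
  then show ?thesis by (rule fps_ext)
qed

text \<open>Both sides have the same constant coefficient and satisfy the same recursion. Moving
  \<open>Bop\<close> past \<open>MM C \<delta>\<close> adds power sums over \<open>neg\<close> minus
  power sums over \<open>pos\<close>, and these are exactly the logarithmic derivatives supplied by
  the two products of linear factors.\<close>

lemma exchange_fps:
  assumes c: "ctr n A Z C \<delta> neg pos" and Z: "intg n Z" "\<beta> \<in> Q n" "\<delta> \<in> Q n"
  shows "Pr neg * Abs_fps (\<lambda>r. Dl (phi (Bop n A Z (\<beta> + \<delta>)) r) (MM C \<delta> * fps_const g))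
    = Pr pos * Abs_fps (\<lambda>r. MM C \<delta> * fps_const (phi (Bop n A Z \<beta>) r g))"
proof -
  let ?M = "MM C \<delta>"
  let ?B = "Bop n A Z (\<beta> + \<delta>)"
  let ?F1 = "Abs_fps (\<lambda>r. Dl (phi ?B r) (?M * fps_const g))"
  let ?F2 = "Abs_fps (\<lambda>r. ?M * fps_const (phi (Bop n A Z \<beta>) r g))"
  define K where "K s = (\<Sum>c\<leftarrow>neg. vv (- c) ^ s) - (\<Sum>c\<leftarrow>pos. vv (- c) ^ s)" for s
  \<comment> \<open>The powers of v - c hbar come from the first condition of \<open>ctr\<close>. By
    the second one, the leftovers free of v add up to the change of the zero modes between the
    sectors of \<beta> and \<beta> + \<delta>.\<close>
  have K: "(\<Sum>(e, a, b)\<leftarrow>prs A C. fps_const (cc e) * (vv (b - a) ^ s - fps_const (cc (- a) * hb) ^ s))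
     = K s + fps_const (cc (zs n Z \<delta> s) * hb ^ s)" for s
  proof -
    have h: "(\<Sum>(e, a, b)\<leftarrow>prs A C. fps_const (cc e) * vv (b - a) ^ s) = K s"
      using c unfolding ctr_def K_def by (auto dest!: spec[of _ "\<lambda>c. vv (- c) ^ s"])
    have "(\<Sum>(e, a, b)\<leftarrow>prs A C. e * (- a) ^ s) = - zs n Z \<delta> s"
      using c unfolding ctr_def zs_def by (auto dest!: spec[of _ "\<lambda>a. (- a) ^ s"] simp: add_eq_0_iff2)
    then have g: "fps_const (cc (\<Sum>(e, a, b)\<leftarrow>prs A C. e * (- a) ^ s) * hb ^ s) = - fps_const (cc (zs n Z \<delta> s) * hb ^ s)"
      by (simp add: cc_uminus flip: fps_const_neg)
    have l: "(\<Sum>(e, a, b)\<leftarrow>l. fps_const (cc e) * (vv (b - a) ^ s - fps_const (cc (- a) * hb) ^ s))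
       = (\<Sum>(e, a, b)\<leftarrow>l. fps_const (cc e) * vv (b - a) ^ s) - fps_const (cc (\<Sum>(e, a, b)\<leftarrow>l. e * (- a) ^ s) * hb ^ s)" for l
      by (induction l)
         (auto simp: algebra_simps cc_add cc_mult cc_power fps_const_power power_mult_distrib simp flip: fps_const_add fps_const_mult)
    show ?thesis unfolding l h g by simp
  qed
  have Kl: "Abs_fps (\<lambda>s. if s = 0 then 0 else K s) = lam2 pos - lam2 neg"
    by (rule fps_ext) (simp add: K_def lam2_def)
  \<comment> \<open>The zero mode contribution of \<delta> cancels against the leftover, so that
    only \<open>K s\<close> remains.\<close>
  have DlB: "Dl (?B s) (?M * fps_const f) = ?M * fps_const (Bop n A Z \<beta> s f) + K s * (?M * fps_const f)" for s f
  proof -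
    let ?z1 = "fps_const (cc (zs n Z \<beta> s) * hb ^ s)"
    let ?z2 = "fps_const (cc (zs n Z \<delta> s) * hb ^ s)"
    have z: "fps_const (cc (zs n Z (\<beta> + \<delta>) s) * hb ^ s) = ?z1 + ?z2"
      by (simp add: intg_add(3)[OF Z] cc_add distrib_right flip: fps_const_add)
    have r: "M * a + (k + z2) * (M * f) - (z1 + z2) * (M * f) = M * (a - z1 * f) + k * (M * f)"
      for M a f k z1 z2 :: "fock fps" by (simp add: algebra_simps)
    have b: "fps_const (Bop n A Z \<beta> s f) = fps_const (Aop A s f) - ?z1 * fps_const f"
      by (simp add: Bop_def)
    have a: "Dl (Aop A s) (fps_const f) = fps_const (Aop A s f)"
      by (rule fps_ext) (simp add: Aop_lin)
    have "Dl (?B s) (?M * fps_const f) = Dl (Aop A s) (?M * fps_const f)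
       - fps_const (cc (zs n Z (\<beta> + \<delta>) s) * hb ^ s) * (?M * fps_const f)"
      by (rule fps_ext) (simp add: Bop_def)
    also have "\<dots> = ?M * fps_const (Bop n A Z \<beta> s f) + K s * (?M * fps_const f)"
      unfolding Dl_Aop_MM K z b a by (rule r)
    finally show ?thesis .
  qed
  have D1: "Dt ?F1 = AA ?B ?F1"
  proof (rule fps_ext)
    fix r
    show "fps_nth (Dt ?F1) r = fps_nth (AA ?B ?F1) r"
      by (rule fps_ext) (simp add: Dt_nth AA_def fps_of_nat_mult_nth fps_sum_nth phi_newton)
  qed
  have D2: "AA ?B ?F2 = Dt ?F2 + (lam2 pos - lam2 neg) * ?F2"
  proof (rule fps_ext)
    fix r
    have n: "of_nat r * (?M * fps_const (phi (Bop n A Z \<beta>) r g)) = (\<Sum>s = 1..r. ?M * fps_const (Bop n A Z \<beta> s (phi (Bop n A Z \<beta>) (r - s) g)))"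
    proof -
      have "of_nat r * (?M * fps_const (phi (Bop n A Z \<beta>) r g)) = ?M * fps_const (of_nat r * phi (Bop n A Z \<beta>) r g)"
        by (simp add: fps_of_nat[symmetric] mult.left_commute flip: fps_const_mult)
      then show ?thesis by (simp add: phi_newton fps_const_sum' sum_distrib_left)
    qed
    have "fps_nth ((lam2 pos - lam2 neg) * ?F2) r = (\<Sum>s = 1..r. K s * (?M * fps_const (phi (Bop n A Z \<beta>) (r - s) g)))"
      unfolding Kl[symmetric] by (subst fps_mult_nth_pos) auto
    then show "fps_nth (AA ?B ?F2) r = fps_nth (Dt ?F2 + (lam2 pos - lam2 neg) * ?F2) r"
      by (simp add: AA_def Dt_nth DlB n sum.distrib)
  qed
  show ?thesis
  proof (rule newton_unique2[where Bs = ?B and L = "lam2 neg"])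
    have P0: "fps_nth (Pr cs) 0 = 1" for cs
      by (induction cs) (auto simp: Pr_def lint_def fps_mult_nth)
    show "fps_nth (Pr neg * ?F1) 0 = fps_nth (Pr pos * ?F2) 0"
      by (simp add: fps_mult_nth P0 fps_eq_iff)
    have 1: "Dt (Pr neg * F) = AA ?B (Pr neg * F) + lam2 neg * (Pr neg * F)" if "Dt F = AA ?B F" for F
      by (simp add: Dt_mult Dt_Pr that AA_Pr mult.assoc)
    show "Dt (Pr neg * ?F1) = AA ?B (Pr neg * ?F1) + lam2 neg * (Pr neg * ?F1)"
      by (rule 1[OF D1])
    have 2: "Dt (Pr pos * F) = AA ?B (Pr pos * F) + lam2 neg * (Pr pos * F)"
      if "AA ?B F = Dt F + (lam2 pos - lam2 neg) * F" for F
    proof -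
      have "Dt F = AA ?B F - (lam2 pos - lam2 neg) * F" using that by simp
      then have "Dt (Pr pos * F) = lam2 pos * Pr pos * F + Pr pos * (AA ?B F - (lam2 pos - lam2 neg) * F)"
        by (simp add: Dt_mult Dt_Pr)
      also have "\<dots> = Pr pos * AA ?B F + lam2 neg * (Pr pos * F)" by (simp add: algebra_simps)
      finally show ?thesis by (simp only: AA_Pr)
    qed
    show "Dt (Pr pos * ?F2) = AA ?B (Pr pos * ?F2) + lam2 neg * (Pr pos * ?F2)"
      by (rule 2[OF D2])
  qed (simp add: lam2_def)
qed

text \<open>The factor that \<open>lin\<close> encodes as a kernel, here in the form on which
  \<open>act\<close> operates.\<close>

definition LU :: "complex \<Rightarrow> (int \<times> int) \<Rightarrow>\<^sub>0 fock" where
  "LU c = Poly_Mapping.single (1, 0) 1 - Poly_Mapping.single (0, 1) 1 + Poly_Mapping.single (0, 0) (cc c * hb)"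

definition LUs :: "complex list \<Rightarrow> (int \<times> int) \<Rightarrow>\<^sub>0 fock" where
  "LUs cs = prod_list (map LU cs)"

lemma act_LU: "act (LU c) W (p, q) = W (p - 1, q) - W (p, q - 1) + cc c * hb * W (p, q)"
  by (simp add: LU_def act_add act_diff act_single flip: zero_prod_def)

text \<open>From power series back to families: the r-th coefficient of W sits at u^(m-r), so m is
  the highest exponent of u.\<close>

definition ext2 :: "int \<Rightarrow> fock fps fps \<Rightarrow> int \<times> int \<Rightarrow> fock" where
  "ext2 m W = (\<lambda>(p, q). if p \<le> m \<and> 0 \<le> q then fps_nth (fps_nth W (nat (m - p))) (nat q) else 0)"

text \<open>u - v + c hbar is u times the factor \<open>lint c\<close>, so each factor raises the
  highest exponent by one.\<close>

lemma act_LU_ext2: "act (LU c) (ext2 m W) = ext2 (m + 1) (lint c * W)"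
proof (rule ext, clarify)
  fix p q :: int
  have v: "fps_nth (vv (- c) * w) i = (if i = 0 then 0 else fps_nth w (i - 1)) - cc c * hb * fps_nth w i" for w i
    by (simp add: vv_def distrib_right fps_mult_left_const_nth cc_uminus)
  consider "p > m + 1" | "p = m + 1" | "p \<le> m" by linarith
  then show "act (LU c) (ext2 m W) (p, q) = ext2 (m + 1) (lint c * W) (p, q)"
  proof cases
    case 3
    then have n: "nat (m + 1 - p) = Suc (nat (m - p))" "nat (m - (p - 1)) = Suc (nat (m - p))" by auto
    have q: "nat (q - 1) = nat q - 1" by auto
    show ?thesis using 3
      by (auto simp: act_LU ext2_def lint_mult_nth n v q)
  qed (auto simp: act_LU ext2_def lint_mult_nth simp del: fps_mult_nth_0)
qed

lemma act_LUs_ext2: "act (LUs cs) (ext2 m W) = ext2 (m + int (length cs)) (Pr cs * W)"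
proof (induction cs arbitrary: m W)
  case (Cons c cs)
  have "act (LUs (c # cs)) (ext2 m W) = act (LU c) (act (LUs cs) (ext2 m W))"
    by (simp add: LUs_def act_mult)
  also have "\<dots> = ext2 (m + int (length cs) + 1) (lint c * (Pr cs * W))"
    by (simp add: Cons.IH act_LU_ext2)
  finally show ?case by (simp add: Pr_def algebra_simps)
qed (simp add: LUs_def Pr_def)

section \<open>Vertex operators\<close>

lemma Q_add: "\<beta> \<in> Q n \<Longrightarrow> \<delta> \<in> Q n \<Longrightarrow> \<beta> + \<delta> \<in> Q n"
proof -
  assume "\<beta> \<in> Q n" "\<delta> \<in> Q n"
  then obtain a b a' b' :: "nat \<Rightarrow> int" where
    e: "\<beta> = (\<lambda>k. (\<Sum>i = 1..n. of_int (a i) * alpha n i k) + (\<Sum>j = 1..4. of_int (b j) * beta n j k))"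
    "\<delta> = (\<lambda>k. (\<Sum>i = 1..n. of_int (a' i) * alpha n i k) + (\<Sum>j = 1..4. of_int (b' j) * beta n j k))"
    unfolding Q_def by blast
  show ?thesis
    unfolding Q_def mem_Collect_eq
    by (intro exI[of _ "\<lambda>i. a i + a' i"] exI[of _ "\<lambda>j. b j + b' j"])
       (simp add: e fun_eq_iff distrib_right sum.distrib)
qed

definition Mz :: "fock fps \<Rightarrow> int \<Rightarrow> fock" where
  "Mz w s = (if 0 \<le> s then fps_nth w (nat s) else 0)"

definition okC :: "nat \<Rightarrow> terms \<Rightarrow> vec \<Rightarrow> bool" where
  "okC n C \<delta> \<longleftrightarrow> (\<forall>(y, i, b)\<in>set C. i \<le> n + 3) \<and> \<delta> \<in> Q n"

text \<open>The normal form to which every current is brought: annihilation half first, then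
  creation half. The side conditions keep both inside the Fock space and make exponents additive in
  the sectors.\<close>

definition vop :: "nat \<Rightarrow> series \<Rightarrow> terms \<Rightarrow> vec \<Rightarrow> terms \<Rightarrow> latt \<Rightarrow> bool" where
  "vop n X C \<delta> A Z \<longleftrightarrow>
    (\<forall>f\<in>Fock n. \<forall>p. X p f = hsum (\<lambda>r. Mz (MM C \<delta>) (p - r) * PH n A Z r f)) \<and> okC n C \<delta> \<and> intg n Z"

lemma Mz_Fock: "okC n C \<delta> \<Longrightarrow> f \<in> Fock n \<Longrightarrow> Mz (MM C \<delta>) s * f \<in> Fock n"
  unfolding Fock_FQ okC_def Mz_def
  by (auto intro!: cset_0 FQ_mult[OF MM_Sec] Q_add)

lemma Mz_Sec: "okC n C \<delta> \<Longrightarrow> f \<in> Sec n \<beta> \<Longrightarrow> Mz (MM C \<delta>) s * f \<in> Sec n (\<beta> + \<delta>)"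
  unfolding okC_def Mz_def using Sec_mult[OF MM_Sec, of C n f \<beta> \<delta>]
  by (auto intro: cset_0 simp: add.commute)

lemma endo_PH: "A_endo (Fock n) (PH n A Z p)"
  unfolding Fock_FQ by (rule FS_endo[OF FS_PH])

lemma PH_Fock: "f \<in> Fock n \<Longrightarrow> PH n A Z p f \<in> Fock n"
  by (rule A_endoD(1)[OF endo_PH])

lemma hsummable_times: "hsummable g \<Longrightarrow> hsummable (\<lambda>i. c i * g i)"
  by (erule hsummable_mono) (metis diff_le_self fps_mult_nth_nonzero)

lemma PH_hsummable: "f \<in> Fock n \<Longrightarrow> hsummable (\<lambda>r. c r * PH n A Z r f)"
  unfolding Fock_FQ by (rule hsummable_times) (rule FS_hsummable[OF FS_PH])

lemma vopD:
  assumes "vop n X C \<delta> A Z"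
  shows "f \<in> Fock n \<Longrightarrow> X p f = hsum (\<lambda>r. Mz (MM C \<delta>) (p - r) * PH n A Z r f)"
    "okC n C \<delta>" "intg n Z"
  using assms by (simp_all add: vop_def)

lemma bij_minus: "bij (\<lambda>s. q - s :: int)"
  by (rule o_bij[of "\<lambda>s. q - s"]) auto

lemma vopD':
  assumes "vop n X C \<delta> A Z" "f \<in> Fock n"
  shows "X p f = hsum (\<lambda>s. Mz (MM C \<delta>) s * PH n A Z (p - s) f)"
  unfolding vopD(1)[OF assms]
  by (subst hsum_reindex(2)[OF bij_minus, of _ p, symmetric]) simp

lemma vop_endo: "vop n X C \<delta> A Z \<Longrightarrow> A_endo (Fock n) (X p)"
proof -
  assume v: "vop n X C \<delta> A Z"
  have "A_endo (Fock n) (\<lambda>f. hsum (\<lambda>r. Mz (MM C \<delta>) (p - r) * PH n A Z r f))"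
  proof (subst Fock_FQ, rule A_endo_family[OF csub_RQ])
    fix r
    have "A_endo (FQ n (Q n)) (\<lambda>f. Mz (MM C \<delta>) (p - r) * f)"
      by (rule A_endo_mult) (rule Mz_Fock[OF vopD(2)[OF v], unfolded Fock_FQ])
    then show "A_endo (FQ n (Q n)) (\<lambda>f. Mz (MM C \<delta>) (p - r) * PH n A Z r f)"
      by (rule A_endo_lincomb(7)[OF csub_RQ _ endo_PH[unfolded Fock_FQ]])
  qed (rule PH_hsummable[unfolded Fock_FQ])
  then show ?thesis
    by (auto intro!: A_endoI simp: A_endoD vopD(1)[OF v])
       (simp_all add: A_endo_def Fock_FQ cset_add cset_sc vopD(1)[OF v, unfolded Fock_FQ] scal_sc)
qed

lemma vop_Fock: "vop n X C \<delta> A Z \<Longrightarrow> f \<in> Fock n \<Longrightarrow> X p f \<in> Fock n"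
  by (rule A_endoD(1)[OF vop_endo])

lemma act_LUs_endo:
  assumes "\<And>e. A_endo (FQ n L) (\<lambda>f. W f e)"
  shows "A_endo (FQ n L) (\<lambda>f. act (LUs cs) (W f) e)"
proof (induction cs arbitrary: e)
  case Nil
  show ?case by (simp add: LUs_def assms)
next
  case (Cons c cs)
  obtain p q where e: "e = (p, q)" by (cases e)
  have "act (LUs (c # cs)) (W f) e = act (LUs cs) (W f) (p - 1, q) - act (LUs cs) (W f) (p, q - 1)
      + sc (fps_const c * fps_X) * act (LUs cs) (W f) (p, q)" for f
    by (simp add: LUs_def act_mult e act_LU sc_mult)
  then show ?case
    by (simp only:) (intro A_endo_lincomb(3,4,6) csub_RQ Cons.IH)
qed

text \<open>On a sector this is \<open>exchange_fps\<close>. The third condition of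
  \<open>ctr\<close> makes the highest exponents of u agree once the linear factors have acted, and
  the scalar in front is the sign that the zero modes collect from the translation by
  \<delta>.\<close>

lemma exchange0:
  assumes "ctr n A Z C \<delta> neg pos" "intg n Z" "okC n C \<delta>" "f \<in> Fock n"
  shows "act (LUs neg) (\<lambda>(p, q). PH n A Z p (Mz (MM C \<delta>) q * f)) e
    = cc (sg n Z \<delta>) * act (LUs pos) (\<lambda>(p, q). Mz (MM C \<delta>) q * PH n A Z p f) e"
proof -
  have m: "A_endo (FQ n (Q n)) (\<lambda>f. Mz (MM C \<delta>) q * f)" for q
    by (rule A_endo_mult) (rule Mz_Fock[OF assms(3), unfolded Fock_FQ])
  note ph = endo_PH[unfolded Fock_FQ]
  show ?thesis
  proof (rule Sec_eqI[where L = "Q n" and T = "\<lambda>f. act (LUs neg) (\<lambda>(p, q). PH n A Z p (Mz (MM C \<delta>) q * f)) e"])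
    show "A_endo (FQ n (Q n)) (\<lambda>f. act (LUs neg) (\<lambda>(p, q). PH n A Z p (Mz (MM C \<delta>) q * f)) e)"
      by (rule act_LUs_endo) (auto simp: case_prod_beta intro!: A_endo_lincomb(7)[OF csub_RQ ph m])
    show "A_endo (FQ n (Q n)) (\<lambda>f. cc (sg n Z \<delta>) * act (LUs pos) (\<lambda>(p, q). Mz (MM C \<delta>) q * PH n A Z p f) e)"
      by (rule A_endo_scaled(1)[OF csub_RQ act_LUs_endo]) (auto simp: case_prod_beta intro!: A_endo_lincomb(7)[OF csub_RQ m ph])
    show "f \<in> FQ n (Q n)" using assms(4) by (simp add: Fock_FQ)
  next
    fix \<beta> f assume \<beta>: "\<beta> \<in> Q n" and f: "f \<in> Sec n \<beta>"
    have \<delta>: "\<delta> \<in> Q n" using assms(3) by (simp add: okC_def)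
    let ?F1 = "Abs_fps (\<lambda>r. Dl (phi (Bop n A Z (\<beta> + \<delta>)) r) (MM C \<delta> * fps_const f))"
    let ?F2 = "Abs_fps (\<lambda>r. MM C \<delta> * fps_const (phi (Bop n A Z \<beta>) r f))"
    have z: "PH n A Z p 0 = 0" for p by (rule A_endo_0[OF ph csub_RQ])
    have 1: "(\<lambda>(p, q). PH n A Z p (Mz (MM C \<delta>) q * f)) = (\<lambda>e. cc (sg n Z (\<beta> + \<delta>)) * ext2 (mm n Z (\<beta> + \<delta>)) ?F1 e)"
    proof (rule ext, clarify)
      fix p q
      show "PH n A Z p (Mz (MM C \<delta>) q * f) = cc (sg n Z (\<beta> + \<delta>)) * ext2 (mm n Z (\<beta> + \<delta>)) ?F1 (p, q)"
      proof (cases "0 \<le> q")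
        case True
        show ?thesis
          unfolding PH_Sec[OF Mz_Sec[OF assms(3) f]] using True by (simp add: ext2_def Mz_def)
      qed (simp add: ext2_def Mz_def z)
    qed
    have 2: "(\<lambda>(p, q). Mz (MM C \<delta>) q * PH n A Z p f) = (\<lambda>e. cc (sg n Z \<beta>) * ext2 (mm n Z \<beta>) ?F2 e)"
      by (auto simp: fun_eq_iff PH_Sec[OF f] ext2_def Mz_def mult.left_commute)
    have l: "mm n Z (\<beta> + \<delta>) + int (length neg) = mm n Z \<beta> + int (length pos)"
      using assms(1) by (simp add: intg_add(1)[OF assms(2) \<beta> \<delta>] ctr_def)
    show "act (LUs neg) (\<lambda>(p, q). PH n A Z p (Mz (MM C \<delta>) q * f)) e
      = cc (sg n Z \<delta>) * act (LUs pos) (\<lambda>(p, q). Mz (MM C \<delta>) q * PH n A Z p f) e"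
      unfolding 1 2 act_fun_mult act_LUs_ext2 l exchange_fps[OF assms(1,2) \<beta> \<delta>]
      by (simp add: intg_add(2)[OF assms(2) \<beta> \<delta>] cc_mult mult_ac)
  qed
qed

lemma Bop_commute: "Bop n A Z \<beta> s (Bop n A' Z' \<beta>' t f) = Bop n A' Z' \<beta>' t (Bop n A Z \<beta> s f)"
proof -
  have s: "Aop A s (cc z * hb ^ t * f) = cc z * hb ^ t * Aop A s f" for A s z t f
    using Aop_sc[of A s "fps_const z * fps_X ^ t" f] by (simp add: sc_mult sc_power)
  have d: "Aop A s (f - g) = Aop A s f - Aop A s g" for A s f g
    using Aop_lin(1)[of A s f "- g"] Aop_lin(2)[of A s "-1" g] by (simp add: cc_uminus)
  show ?thesis
    by (simp only: Bop_def s d right_diff_distrib Aop_commute[of A s A' t]) (simp add: mult_ac)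
qed

lemma phi_Bop_lin:
  "phi (Bop n A Z \<beta>) r (cc z * f) = cc z * phi (Bop n A Z \<beta>) r f"
  "phi (Bop n A Z \<beta>) r (f + g) = phi (Bop n A Z \<beta>) r f + phi (Bop n A Z \<beta>) r g"
  "phi (Bop n A Z \<beta>) r 0 = 0"
  "phi (Bop n A Z \<beta>) r (sc c * f) = sc c * phi (Bop n A Z \<beta>) r f"
proof -
  have lin: "A_endo UNIV (Bop n A Z \<beta> s)" for s by (rule A_endoI) (simp_all add: Bop_lin)
  have "A_endo UNIV (phi (Bop n A Z \<beta>) r)"
    using phi_endo[OF csub_UNIV, of "Bop n A Z \<beta>"] lin by simp
  note E = A_endoD[OF this]
  show "phi (Bop n A Z \<beta>) r (cc z * f) = cc z * phi (Bop n A Z \<beta>) r f" by (rule E(4)) simp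
  show "phi (Bop n A Z \<beta>) r (f + g) = phi (Bop n A Z \<beta>) r f + phi (Bop n A Z \<beta>) r g" by (rule E(2)) simp_all
  show "phi (Bop n A Z \<beta>) r 0 = 0" by (rule E(6)[of 0]) simp
  show "phi (Bop n A Z \<beta>) r (sc c * f) = sc c * phi (Bop n A Z \<beta>) r f" by (rule E(3)) simp
qed

lemma phi_Bop_commute:
  "phi (Bop n A Z \<beta>) r (phi (Bop n A' Z' \<beta>') r' f) = phi (Bop n A' Z' \<beta>') r' (phi (Bop n A Z \<beta>) r f)"
proof (rule phi_hom)
  show "phi (Bop n A Z \<beta>) r (Bop n A' Z' \<beta>' s f) = Bop n A' Z' \<beta>' s (phi (Bop n A Z \<beta>) r f)" for s f
    by (rule phi_hom[symmetric]) (simp_all add: Bop_commute[of n A'] Bop_lin Bop_cc)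
qed (simp_all add: phi_Bop_lin)

text \<open>On a sector both sides are iterated Newton recursions whose operators commute.\<close>

lemma PH_commute:
  assumes "f \<in> Fock n"
  shows "PH n A Z p (PH n A' Z' q f) = PH n A' Z' q (PH n A Z p f)"
proof (rule Sec_eqI[where L = "Q n" and T = "\<lambda>f. PH n A Z p (PH n A' Z' q f)"])
  note ph = endo_PH[unfolded Fock_FQ]
  show "A_endo (FQ n (Q n)) (\<lambda>f. PH n A Z p (PH n A' Z' q f))" "A_endo (FQ n (Q n)) (\<lambda>f. PH n A' Z' q (PH n A Z p f))"
    by (rule A_endo_lincomb(7)[OF csub_RQ ph ph])+
  show "f \<in> FQ n (Q n)" using assms by (simp add: Fock_FQ)
next
  fix \<beta> f assume f: "f \<in> Sec n \<beta>"
  have P: "PH n A Z p g \<in> Sec n \<beta>" if "g \<in> Sec n \<beta>" for A Z p g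
    by (rule FS_FQ[OF FS_PH that])
  have e: "A_endo (Sec n \<beta>) (PH n A Z p)" for A Z p by (rule FS_endo[OF FS_PH])
  show "PH n A Z p (PH n A' Z' q f) = PH n A' Z' q (PH n A Z p f)"
    unfolding PH_Sec[OF P[OF f]] unfolding PH_Sec[OF f]
    by (auto simp: phi_Bop_lin phi_Bop_commute[of n A Z] mult_ac)
qed

lemma act_hsum:
  assumes "\<And>e. hsummable (\<lambda>s. F s e)"
  shows "hsummable (\<lambda>s. act P (F s) e)" "act P (\<lambda>e. hsum (\<lambda>s. F s e)) e = hsum (\<lambda>s. act P (F s) e)"
proof -
  have h: "hsummable (\<lambda>s. Poly_Mapping.lookup P k * F s (e - k))" for k by (rule hsum_mult(1)[OF assms])
  show "hsummable (\<lambda>s. act P (F s) e)"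
    unfolding act_def by (rule hsum_sum(1)) (auto intro: h)
  show "act P (\<lambda>e. hsum (\<lambda>s. F s e)) e = hsum (\<lambda>s. act P (F s) e)"
    unfolding act_def by (subst hsum_sum(2)) (auto simp: h hsum_mult(2)[OF assms])
qed

lemma act_shift: "act P (\<lambda>e. W (e - d)) e = act P W (e - d)"
  by (simp add: act_def diff_diff_eq add.commute)

text \<open>The creation half of Y is handled by \<open>exchange0\<close>, and its annihilation half
  commutes with \<open>PH\<close>. The sum over the modes of the latter is hbar-adic, so
  \<open>act\<close> can be taken inside.\<close>

lemma exchange1:
  assumes Y: "vop n Y C \<delta> A' Z'" and c: "ctr n A Z C \<delta> neg pos" "intg n Z" and f: "f \<in> Fock n"
  shows "act (LUs neg) (\<lambda>(p, q). PH n A Z p (Y q f)) e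
    = cc (sg n Z \<delta>) * act (LUs pos) (\<lambda>(p, q). Y q (PH n A Z p f)) e"
proof -
  let ?M = "Mz (MM C \<delta>)"
  define g where "g r = PH n A' Z' r f" for r
  have g: "g r \<in> Fock n" for r unfolding g_def by (rule PH_Fock[OF f])
  have ok: "okC n C \<delta>" by (rule vopD(2)[OF Y])
  define G where "G r = (\<lambda>(p, q). PH n A Z p (?M q * g r))" for r
  define H where "H r = (\<lambda>(p, q). ?M q * PH n A Z p (g r))" for r
  have G: "hsummable (\<lambda>r. G r (e - (0, r)))" "(\<lambda>(p, q). PH n A Z p (Y q f)) = (\<lambda>e. hsum (\<lambda>r. G r (e - (0, r))))" for e
  proof -
    have m: "?M (q - r) * g r \<in> FQ n (Q n)" for q r
      using Mz_Fock[OF ok g] by (simp add: Fock_FQ)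
    have "hsummable (\<lambda>r. ?M (q - r) * g r)" for q
      unfolding g_def by (rule PH_hsummable[OF f])
    note hs = A_endo_hsum[OF endo_PH[unfolded Fock_FQ] csub_RQ m this]
    show "hsummable (\<lambda>r. G r (e - (0, r)))" using hs(1) by (cases e) (simp add: G_def)
    show "(\<lambda>(p, q). PH n A Z p (Y q f)) = (\<lambda>e. hsum (\<lambda>r. G r (e - (0, r))))"
      by (auto simp: fun_eq_iff G_def vopD(1)[OF Y f] hs(2) simp flip: g_def)
  qed
  have H: "hsummable (\<lambda>r. H r (e - (0, r)))" "(\<lambda>(p, q). Y q (PH n A Z p f)) = (\<lambda>e. hsum (\<lambda>r. H r (e - (0, r))))" for e
  proof -
    have c: "PH n A' Z' r (PH n A Z p f) = PH n A Z p (g r)" for r p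
      unfolding g_def by (rule PH_commute[OF f])
    have "hsummable (\<lambda>r. ?M (q - r) * PH n A Z p (g r))" for p q
      unfolding c[symmetric] by (rule PH_hsummable[OF PH_Fock[OF f]])
    then show "hsummable (\<lambda>r. H r (e - (0, r)))" by (cases e) (simp add: H_def)
    show "(\<lambda>(p, q). Y q (PH n A Z p f)) = (\<lambda>e. hsum (\<lambda>r. H r (e - (0, r))))"
      by (auto simp: fun_eq_iff H_def vopD(1)[OF Y PH_Fock[OF f]] c)
  qed
  have ex: "act (LUs neg) (G r) e = cc (sg n Z \<delta>) * act (LUs pos) (H r) e" for r e
    unfolding G_def H_def by (rule exchange0[OF c ok g])
  show ?thesis
    unfolding G(2) H(2) act_hsum(2)[OF G(1)] act_hsum(2)[OF H(1)] act_shift ex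
  proof (rule hsum_mult(2))
    have "hsummable (\<lambda>r. act (LUs pos) (\<lambda>e. H r (e - (0, r))) e)" by (rule act_hsum(1)[OF H(1)])
    then show "hsummable (\<lambda>r. act (LUs pos) (H r) (e - (0, r)))" by (simp only: act_shift)
  qed
qed

text \<open>The normally ordered product: both annihilation parts are applied first.\<close>

definition Nrm :: "nat \<Rightarrow> fock fps \<Rightarrow> terms \<Rightarrow> latt \<Rightarrow> fock fps \<Rightarrow> terms \<Rightarrow> latt \<Rightarrow> fock \<Rightarrow> int \<times> int \<Rightarrow> fock" where
  "Nrm n w A Z w' A' Z' f =
    (\<lambda>(p, q). hsum (\<lambda>(r, t). Mz w (p - r) * Mz w' (q - t) * PH n A Z r (PH n A' Z' t f)))"

lemma Nrm_summable:
  assumes "f \<in> Fock n"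
  shows "hsummable (\<lambda>(r, t). c r t * PH n A Z r (PH n A' Z' t f))"
proof -
  have "hsummable (\<lambda>(r, t). PH n A Z r (PH n A' Z' t f))"
    by (rule FS_pair[OF FS_PH FS_PH, of f n "Q n"]) (use assms in \<open>simp add: Fock_FQ\<close>)
  from hsummable_times[OF this, of "\<lambda>(r, t). c r t"] show ?thesis
    by (simp add: case_prod_unfold)
qed

lemma Nrm_swap:
  assumes "f \<in> Fock n"
  shows "Nrm n w A Z w' A' Z' f (p, q) = Nrm n w' A' Z' w A Z f (q, p)"
proof -
  have "Nrm n w A Z w' A' Z' f (p, q) = hsum (\<lambda>t. hsum (\<lambda>r. Mz w (p - r) * Mz w' (q - t) * PH n A Z r (PH n A' Z' t f)))"
    unfolding Nrm_def prod.case
    using hsum_Sigma(3)[OF Nrm_summable[OF assms]] hsum_swap(2)[OF Nrm_summable[OF assms]] by simp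
  also have "\<dots> = hsum (\<lambda>t. hsum (\<lambda>r. Mz w' (q - t) * Mz w (p - r) * PH n A' Z' t (PH n A Z r f)))"
    by (simp add: PH_commute[OF assms, of A Z _ A' Z'] mult.commute)
  also have "\<dots> = Nrm n w' A' Z' w A Z f (q, p)"
    unfolding Nrm_def prod.case by (rule hsum_Sigma(3)[OF Nrm_summable[OF assms]])
  finally show ?thesis .
qed

text \<open>Wick's theorem for two operators: after \<open>exchange1\<close> only the creation half
  of X is left, and it multiplies from the left. Contractions that would be denominators stay as
  factors on the left side.\<close>

lemma uv_rel:
  assumes X: "vop n X C \<delta> A Z" and Y: "vop n Y C' \<delta>' A' Z'"
    and c: "ctr n A Z C' \<delta>' neg pos" and f: "f \<in> Fock n"
  shows "act (LUs neg) (\<lambda>(p, q). X p (Y q f)) e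
    = cc (sg n Z \<delta>') * act (LUs pos) (Nrm n (MM C \<delta>) A Z (MM C' \<delta>') A' Z' f) e"
proof -
  let ?M = "Mz (MM C \<delta>)"
  define G where "G = (\<lambda>(p, q). PH n A Z p (Y q f))"
  define H where "H = (\<lambda>(p, q). Y q (PH n A Z p f))"
  have Yf: "Y q f \<in> Fock n" for q by (rule vop_Fock[OF Y f])
  have G: "hsummable (\<lambda>s. ?M s * G (e - (s, 0)))" "(\<lambda>(p, q). X p (Y q f)) = (\<lambda>e. hsum (\<lambda>s. ?M s * G (e - (s, 0))))" for e
  proof -
    have "hsummable (\<lambda>r. ?M (p - r) * PH n A Z r (Y q f))" for p q by (rule PH_hsummable[OF Yf])
    then have "hsummable (\<lambda>s. ?M s * PH n A Z (p - s) (Y q f))" for p q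
      using hsum_reindex(1)[OF bij_minus, of "\<lambda>r. ?M (p - r) * PH n A Z r (Y q f)" p] by simp
    then show "hsummable (\<lambda>s. ?M s * G (e - (s, 0)))" by (cases e) (simp add: G_def)
    show "(\<lambda>(p, q). X p (Y q f)) = (\<lambda>e. hsum (\<lambda>s. ?M s * G (e - (s, 0))))"
      by (auto simp: fun_eq_iff G_def vopD'[OF X Yf])
  qed
  have Hs: "hsummable (\<lambda>(s, t). ?M s * (Mz (MM C' \<delta>') (q - t) * PH n A' Z' t (PH n A Z (p - s) f)))" for p q
  proof -
    have b: "bij (\<lambda>(s, t). (p - s, t :: int))" by (rule o_bij[of "\<lambda>(s, t). (p - s, t)"]) auto
    have "hsummable (\<lambda>(r, t). ?M (p - r) * Mz (MM C' \<delta>') (q - t) * PH n A Z r (PH n A' Z' t f))"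
      by (rule Nrm_summable[OF f])
    then show ?thesis
      using hsum_reindex(1)[OF b, of "\<lambda>(r, t). ?M (p - r) * Mz (MM C' \<delta>') (q - t) * PH n A Z r (PH n A' Z' t f)"]
      by (simp add: case_prod_unfold PH_commute[OF f, of A Z _ A' Z'] mult.assoc)
  qed
  have Hm: "?M s * H (p - s, q) = hsum (\<lambda>t. ?M s * (Mz (MM C' \<delta>') (q - t) * PH n A' Z' t (PH n A Z (p - s) f)))" for p q s
    unfolding H_def prod.case vopD(1)[OF Y PH_Fock[OF f]]
    by (rule hsum_mult(2)[OF PH_hsummable[OF PH_Fock[OF f]], symmetric])
  have H: "hsummable (\<lambda>s. ?M s * H (e - (s, 0)))" "(\<lambda>e. hsum (\<lambda>s. ?M s * H (e - (s, 0)))) = Nrm n (MM C \<delta>) A Z (MM C' \<delta>') A' Z' f" for e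
  proof -
    show "hsummable (\<lambda>s. ?M s * H (e - (s, 0)))"
      using hsum_Sigma(2)[OF Hs] by (cases e) (simp add: Hm)
    have "hsum (\<lambda>s. ?M s * H (p - s, q)) = Nrm n (MM C \<delta>) A Z (MM C' \<delta>') A' Z' f (p, q)" for p q
    proof -
      have b: "bij (\<lambda>(s, t). (p - s, t :: int))" by (rule o_bij[of "\<lambda>(s, t). (p - s, t)"]) auto
      show ?thesis
        unfolding Hm hsum_Sigma(3)[OF Hs] Nrm_def prod.case
        by (subst hsum_reindex(2)[OF b, symmetric])
           (simp add: case_prod_unfold PH_commute[OF f, of A Z _ A' Z'] mult.assoc)
    qed
    then show "(\<lambda>e. hsum (\<lambda>s. ?M s * H (e - (s, 0)))) = Nrm n (MM C \<delta>) A Z (MM C' \<delta>') A' Z' f"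
      by (auto simp: fun_eq_iff)
  qed
  have ex: "act (LUs neg) G e = cc (sg n Z \<delta>') * act (LUs pos) H e" for e
    unfolding G_def H_def by (rule exchange1[OF Y c vopD(3)[OF X] f])
  have a: "act P (\<lambda>e. ?M s * W (e - (s, 0))) e = ?M s * act P W (e - (s, 0))" for P s W e
    unfolding act_fun_mult by (simp only: act_shift)
  have "act (LUs neg) (\<lambda>(p, q). X p (Y q f)) e = hsum (\<lambda>s. cc (sg n Z \<delta>') * (?M s * act (LUs pos) H (e - (s, 0))))"
    unfolding G(2) act_hsum(2)[OF G(1)] a ex by (simp add: mult.left_commute)
  also have "\<dots> = cc (sg n Z \<delta>') * hsum (\<lambda>s. act (LUs pos) (\<lambda>e. ?M s * H (e - (s, 0))) e)"
  proof -
    have "hsummable (\<lambda>s. act (LUs pos) (\<lambda>e. ?M s * H (e - (s, 0))) e)" by (rule act_hsum(1)[OF H(1)])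
    then have "hsummable (\<lambda>s. ?M s * act (LUs pos) H (e - (s, 0)))" by (simp only: a)
    then show ?thesis unfolding a by (rule hsum_mult(2))
  qed
  also have "\<dots> = cc (sg n Z \<delta>') * act (LUs pos) (Nrm n (MM C \<delta>) A Z (MM C' \<delta>') A' Z' f) e"
    unfolding H(2)[symmetric] act_hsum(2)[OF H(1)] ..
  finally show ?thesis .
qed

section \<open>Bounded families and inversion of linear factors\<close>

text \<open>Divisibility by hbar^(N+1).\<close>

definition zN :: "nat \<Rightarrow> fock \<Rightarrow> bool" where
  "zN N f \<longleftrightarrow> (\<forall>m\<le>N. fps_nth f m = 0)"

lemma zN_simps [simp]: "zN N 0"
  by (simp add: zN_def)

lemma zN_add: "zN N f \<Longrightarrow> zN N g \<Longrightarrow> zN N (f + g)"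
  and zN_diff: "zN N f \<Longrightarrow> zN N g \<Longrightarrow> zN N (f - g)"
  by (simp_all add: zN_def)

lemma zN_mult: "zN N f \<Longrightarrow> zN N (c * f)"
  by (auto simp: zN_def fps_mult_nth)

lemma zN_hsum: "(\<And>i. zN N (g i)) \<Longrightarrow> zN N (hsum g)"
  by (simp add: zN_def hsum_def)

lemma zN_endo: "A_endo (Fock n) T \<Longrightarrow> f \<in> Fock n \<Longrightarrow> zN N f \<Longrightarrow> zN N (T f)"
  unfolding Fock_FQ zN_def using A_endo_small[OF _ csub_RQ, of n "Q n" T f "Suc N"] by auto

text \<open>Modulo each power of hbar the family starts at some exponent of v, uniformly in the
  exponent of u. The start may depend on the order.\<close>

definition vbd :: "(int \<times> int \<Rightarrow> fock) \<Rightarrow> bool" where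
  "vbd W \<longleftrightarrow> (\<forall>N. \<exists>c. \<forall>p q. q < c \<longrightarrow> zN N (W (p, q)))"

lemma vbdE:
  assumes "vbd W"
  obtains c where "\<forall>p q. q < c \<longrightarrow> zN N (W (p, q))"
  using assms unfolding vbd_def by blast

definition ubd :: "(int \<times> int \<Rightarrow> fock) \<Rightarrow> bool" where
  "ubd W \<longleftrightarrow> (\<forall>N. \<exists>c. \<forall>p q. p < c \<longrightarrow> zN N (W (p, q)))"

definition swp :: "(int \<times> int \<Rightarrow> fock) \<Rightarrow> int \<times> int \<Rightarrow> fock" where
  "swp W = (\<lambda>(p, q). W (q, p))"

lemma swp_apply [simp]: "swp W (p, q) = W (q, p)" and swp_swp [simp]: "swp (swp W) = W"
  by (auto simp: swp_def fun_eq_iff)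

lemma ubd_swp: "ubd (swp W) \<longleftrightarrow> vbd W" and vbd_swp: "vbd (swp W) \<longleftrightarrow> ubd W"
  by (auto simp: ubd_def vbd_def; metis)+

text \<open>Exchanging the variables turns u - v + c hbar into minus the factor with -c. This is the
  origin of the signs and the negated lists for products in the other order.\<close>

lemma act_LU_swp: "act (LU c) (swp W) = (\<lambda>e. - swp (act (LU (- c)) W) e)"
  by (auto simp: fun_eq_iff act_LU cc_uminus)

lemma act_fun_uminus: "act P (\<lambda>e. - W e) e = - act P W e"
  by (simp add: act_def sum_negf)

lemma act_LUs_swp: "act (LUs cs) (swp W) = (\<lambda>e. cc ((-1) ^ length cs) * swp (act (LUs (map uminus cs)) W) e)"
proof (induction cs)
  case (Cons c cs)
  have "act (LUs (c # cs)) (swp W) = act (LU c) (act (LUs cs) (swp W))"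
    by (simp add: LUs_def act_mult)
  also have "\<dots> = (\<lambda>e. cc ((-1) ^ length cs) * act (LU c) (swp (act (LUs (map uminus cs)) W)) e)"
    unfolding Cons.IH by (rule ext) (rule act_fun_mult)
  also have "\<dots> = (\<lambda>e. cc ((-1) ^ length (c # cs)) * swp (act (LUs (map uminus (c # cs))) W) e)"
    unfolding act_LU_swp by (simp add: cc_uminus LUs_def act_mult)
  finally show ?case .
qed (simp add: LUs_def)

lemma vbd_act_LU: "vbd W \<Longrightarrow> vbd (act (LU c) W)"
proof -
  assume v: "vbd W"
  show ?thesis unfolding vbd_def
  proof
    fix N
    obtain b where "\<forall>p q. q < b \<longrightarrow> zN N (W (p, q))" by (rule vbdE[OF v])
    then have "\<forall>p q. q < b \<longrightarrow> zN N (act (LU c) W (p, q))"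
      by (auto simp: act_LU intro!: zN_add zN_diff zN_mult)
    then show "\<exists>b. \<forall>p q. q < b \<longrightarrow> zN N (act (LU c) W (p, q))" by blast
  qed
qed

lemma vbd_act: "vbd W \<Longrightarrow> vbd (act (LUs cs) W)"
  by (induction cs) (simp_all add: LUs_def act_mult vbd_act_LU)

lemma vbd_mult: "vbd W \<Longrightarrow> vbd (\<lambda>e. c * W e)"
  unfolding vbd_def by (meson zN_mult)

lemma ubd_mult: "ubd W \<Longrightarrow> ubd (\<lambda>e. c * W e)"
  unfolding ubd_def by (meson zN_mult)

lemma ubd_act: "ubd W \<Longrightarrow> ubd (act (LUs cs) W)"
proof -
  assume "ubd W"
  then have "vbd (act (LUs (map uminus cs)) (swp W))" by (intro vbd_act) (simp add: vbd_swp)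
  then have "ubd (swp (act (LUs (map uminus cs)) (swp W)))" by (simp add: ubd_swp)
  then have "ubd (\<lambda>e. cc ((-1) ^ length cs) * swp (act (LUs (map uminus cs)) (swp W)) e)" by (rule ubd_mult)
  moreover have "act (LUs cs) W = (\<lambda>e. cc ((-1) ^ length cs) * swp (act (LUs (map uminus cs)) (swp W)) e)"
    using act_LUs_swp[of cs "swp W"] by simp
  ultimately show ?thesis by simp
qed

lemma vbd_diff: "vbd W \<Longrightarrow> vbd W' \<Longrightarrow> vbd (\<lambda>e. W e - W' e)"
proof -
  assume v: "vbd W" "vbd W'"
  show ?thesis unfolding vbd_def
  proof
    fix N
    obtain b where "\<forall>p q. q < b \<longrightarrow> zN N (W (p, q))" by (rule vbdE[OF v(1)])
    moreover obtain b' where "\<forall>p q. q < b' \<longrightarrow> zN N (W' (p, q))" by (rule vbdE[OF v(2)])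
    ultimately
    have "\<forall>p q. q < min b b' \<longrightarrow> zN N (W (p, q) - W' (p, q))" by (auto intro!: zN_diff)
    then show "\<exists>b. \<forall>p q. q < b \<longrightarrow> zN N (W (p, q) - W' (p, q))" by blast
  qed
qed

text \<open>Induction on the order in hbar. At order N the equation makes the coefficient constant
  along p + q = const, and moving along such a line brings the exponent of v below the
  bound.\<close>

lemma LU_inj0:
  assumes v: "vbd W" and z: "\<And>e. act (LU c) W e = 0"
  shows "W e = 0"
proof -
  have "zN N (W (p, q))" for N p q
  proof (induction N arbitrary: p q rule: less_induct)
    case (less N)
    have low: "fps_nth (W e) m = 0" if "m < N" for e m
      using less[OF that] by (cases e) (auto simp: zN_def)
    have step: "fps_nth (W (p, q)) N = fps_nth (W (p + 1, q - 1)) N" for p q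
    proof -
      have "fps_nth (hb * W (p + 1, q)) N = 0" using low[of "N - 1"] by simp
      then have "fps_nth (cc c * hb * W (p + 1, q)) N = 0" by (simp add: mult.assoc cc_def)
      moreover have "fps_nth (W (p, q) - W (p + 1, q - 1) + cc c * hb * W (p + 1, q)) N = 0"
        using z[of "(p + 1, q)"] by (simp add: act_LU)
      ultimately show ?thesis by simp
    qed
    have steps: "fps_nth (W (p, q)) N = fps_nth (W (p + int i, q - int i)) N" for i p q
    proof (induction i)
      case (Suc i)
      then show ?case using step[of "p + int i" "q - int i"] by (simp add: algebra_simps)
    qed simp
    obtain b where b: "\<forall>p q. q < b \<longrightarrow> zN N (W (p, q))" by (rule vbdE[OF v])
    have "q - int (nat (q - b + 1)) < b" by simp
    then have "fps_nth (W (p, q)) N = 0"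
      using b steps[of p q "nat (q - b + 1)"] by (auto simp: zN_def)
    then show ?case using low by (auto simp: zN_def le_less)
  qed
  then have "fps_nth (W (p, q)) N = 0" for p q N by (auto simp: zN_def)
  then show ?thesis by (cases e) (simp add: fps_eq_iff)
qed

lemma LU_inj:
  assumes "vbd W" "vbd W'" "act (LU c) W = act (LU c) W'"
  shows "W = W'"
proof
  fix e
  have "W e - W' e = 0"
    by (rule LU_inj0[OF vbd_diff[OF assms(1,2)], of c]) (simp add: act_fun_diff assms(3))
  then show "W e = W' e" by simp
qed

lemma LU_inj_u:
  assumes "ubd W" "ubd W'" "act (LU c) W = act (LU c) W'"
  shows "W = W'"
proof -
  have "act (LU (- c)) (swp W) = act (LU (- c)) (swp W')"
    unfolding act_LU_swp by (simp add: assms(3))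
  then have "swp W = swp W'" by (intro LU_inj[of "swp W" "swp W'" "- c"]) (simp_all add: vbd_swp assms)
  then have "swp (swp W) = swp (swp W')" by simp
  then show ?thesis by simp
qed

section \<open>The two expansions of the inverse of a linear factor\<close>

definition gconv :: "dscalar \<Rightarrow> (int \<times> int \<Rightarrow> fock) \<Rightarrow> int \<times> int \<Rightarrow> fock" where
  "gconv g W e = hsum (\<lambda>(s, t). sc (g s t) * W (e - (s, t)))"

definition ev :: "dseries \<Rightarrow> fock \<Rightarrow> int \<times> int \<Rightarrow> fock" where
  "ev W f = (\<lambda>(p, q). W p q f)"

lemma ev_dmul: "ev (g \<odot> W) f = gconv g (ev W f)"
  by (auto simp: fun_eq_iff ev_def gconv_def dmul_def scal_sc case_prod_unfold)

lemma ev_lin: "ev (lin b \<odot> W) f = act (LU b) (ev W f)"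
proof (rule ext, clarify)
  fix p q
  let ?g = "\<lambda>(s, t). sc (lin b s t) * ev W f ((p, q) - (s, t))"
  have "gconv (lin b) (ev W f) (p, q) = (\<Sum>x\<in>{(1, 0), (0, 1), (0, 0)}. ?g x)"
    unfolding gconv_def by (rule hsum_finite(2)) (auto simp: lin_def split: if_splits)
  also have "\<dots> = act (LU b) (ev W f) (p, q)"
    by (simp add: lin_def act_LU sc_uminus sc_mult algebra_simps)
  finally show "ev (lin b \<odot> W) f (p, q) = act (LU b) (ev W f) (p, q)" by (simp add: ev_dmul)
qed

lemma inv_u_nonzero:
  assumes "fps_nth (sc (inv_u b s t) * w) N \<noteq> 0"
  shows "s < 0" "0 \<le> t" "t \<le> - s - 1" "- s - 1 - t \<le> int N" "\<not> zN N w"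
proof -
  have st: "s < 0 \<and> 0 \<le> t" using assms by (auto simp: inv_u_def split: if_splits)
  then have "fps_nth (sc (upow (- b) (- s - 1) t) * w) N \<noteq> 0" using assms by (simp add: inv_u_def)
  from sc_upow_nth_nonzero[OF this]
  show "s < 0" "0 \<le> t" "t \<le> - s - 1" "- s - 1 - t \<le> int N" "\<not> zN N w" using st by (auto simp: zN_def intro!: exI[of _ "N - nat (- s - 1 - t)"])
qed

lemma inv_u_summable:
  assumes "vbd W"
  shows "hsummable (\<lambda>(s, t). sc (inv_u b s t) * W (e - (s, t)))"
proof (rule hsummableI)
  fix N
  obtain p q where e: "e = (p, q)" by (cases e)
  obtain c where c: "\<forall>p q. q < c \<longrightarrow> zN N (W (p, q))" by (rule vbdE[OF assms])
  let ?I = "{- (q - c) - 1 - int N..-1} \<times> {0..q - c}"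
  have "fps_nth (sc (inv_u b s t) * W (e - (s, t))) N = 0" if "(s, t) \<notin> ?I" for s t
  proof (rule ccontr)
    assume A: "\<not> ?thesis"
    note n = inv_u_nonzero[OF A]
    have "\<not> q - t < c" using n(5) c by (auto simp: e)
    then show False using that n by auto
  qed
  then show "\<exists>I. finite I \<and> (\<forall>x. x \<notin> I \<longrightarrow> fps_nth (case x of (s, t) \<Rightarrow> sc (inv_u b s t) * W (e - (s, t))) N = 0)"
    by (intro exI[of _ ?I]) auto
qed

text \<open>The kernel has only nonnegative powers of v, so it cannot lower the start in v.\<close>

lemma inv_u_vbd:
  assumes "vbd W"
  shows "vbd (gconv (inv_u b) W)"
  unfolding vbd_def
proof
  fix N
  obtain c where c: "\<forall>p q. q < c \<longrightarrow> zN N (W (p, q))" by (rule vbdE[OF assms])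
  have "zN N (sc (inv_u b s t) * W ((p, q) - (s, t)))" if "q < c" for p q s t
  proof (cases "0 \<le> t")
    case True
    then show ?thesis using that c by (auto intro!: zN_mult)
  qed (simp add: inv_u_def)
  then have "\<forall>p q. q < c \<longrightarrow> zN N (gconv (inv_u b) W (p, q))"
    by (auto simp: gconv_def intro!: zN_hsum)
  then show "\<exists>c. \<forall>p q. q < c \<longrightarrow> zN N (gconv (inv_u b) W (p, q))" by blast
qed

lemma upow_pascal: "0 \<le> k \<Longrightarrow> upow a (k + 1) t = upow a k (t - 1) + fps_const a * fps_X * upow a k t"
proof -
  assume k: "0 \<le> k"
  consider "t > k + 1" | "t = k + 1" | "t \<le> k" by linarith
  then show ?thesis
  proof cases
    case 3
    let ?j = "nat (k - t)"
    have n: "nat (k + 1 - t) = Suc ?j" "nat (k - (t - 1)) = Suc ?j" using 3 by auto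
    have "upow a (k + 1) t = fps_const (((of_int k :: complex) gchoose ?j) + (of_int k gchoose Suc ?j)) * (fps_const a * fps_X) ^ Suc ?j"
      using 3 unfolding gbinomial_Suc_Suc[symmetric] by (simp add: upow_alt n(1) del: power_Suc)
    also have "\<dots> = upow a k (t - 1) + fps_const a * fps_X * upow a k t"
      using 3 by (simp add: upow_alt n(2) distrib_right distrib_left mult_ac flip: fps_const_add)
    finally show ?thesis .
  qed auto
qed

text \<open>The factor times its expansion is 1. For s < 0 and t >= 0 this is Pascal's rule; at s =
  0 only the zeroth power is met.\<close>

lemma inv_u_lin:
  "sc (inv_u b (s - 1) t) - sc (inv_u b s (t - 1)) + cc b * hb * sc (inv_u b s t) = (if s = 0 \<and> t = 0 then 1 else 0)"
proof -
  consider "s > 0" | "s = 0" | "s < 0" "t < 0" | "s < 0" "0 \<le> t" by linarith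
  then show ?thesis
  proof cases
    case 4
    have "upow (- b) (- s - 1 + 1) t = upow (- b) (- s - 1) (t - 1) + fps_const (- b) * fps_X * upow (- b) (- s - 1) t"
      by (rule upow_pascal) (use 4 in simp)
    then have "sc (upow (- b) (- s) t) = sc (upow (- b) (- s - 1) (t - 1)) - cc b * hb * sc (upow (- b) (- s - 1) t)"
      by (simp add: sc_add sc_mult cc_uminus)
    then show ?thesis using 4 by (cases "t = 0") (auto simp: inv_u_def)
  qed (auto simp: inv_u_def)
qed

lemma hsum_shift:
  fixes d :: "'g::ab_group_add"
  shows "hsum (\<lambda>x. g (x - d)) = hsum g" "hsummable (\<lambda>x. g (x - d)) \<longleftrightarrow> hsummable g"
proof -
  have b: "bij (\<lambda>x. x - d)" by (rule o_bij[of "\<lambda>x. x + d"]) auto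
  show "hsum (\<lambda>x. g (x - d)) = hsum g" "hsummable (\<lambda>x. g (x - d)) \<longleftrightarrow> hsummable g"
    by (rule hsum_reindex[OF b])+
qed

lemma act_inv_u:
  assumes "vbd W"
  shows "act (LU b) (gconv (inv_u b) W) = W"
proof (rule ext, clarify)
  fix p q
  let ?g = "\<lambda>x. sc (inv_u b (fst x) (snd x))"
  let ?F = "\<lambda>e x. ?g x * W (e - x)"
  have s: "hsummable (?F e)" for e
    using inv_u_summable[OF assms, of b e] by (simp add: case_prod_unfold)
  have G: "gconv (inv_u b) W e = hsum (?F e)" for e by (simp add: gconv_def case_prod_unfold)
  have sh: "hsum (?F (e - d)) = hsum (\<lambda>x. ?g (x - d) * W (e - x))" "hsummable (\<lambda>x. ?g (x - d) * W (e - x))" for e d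
    using hsum_shift(1)[of "?F (e - d)" d] hsum_shift(2)[of "?F (e - d)" d] s[of "e - d"] by simp_all
  let ?e = "(p, q) :: int \<times> int"
  have "act (LU b) (gconv (inv_u b) W) ?e = hsum (?F (?e - (1, 0))) - hsum (?F (?e - (0, 1))) + cc b * hb * hsum (?F ?e)"
    by (simp add: act_LU G)
  also have "\<dots> = hsum (\<lambda>x. ?g (x - (1, 0)) * W (?e - x)) - hsum (\<lambda>x. ?g (x - (0, 1)) * W (?e - x)) + hsum (\<lambda>x. cc b * hb * ?F ?e x)"
    unfolding sh(1) hsum_mult(2)[OF s] ..
  also have "\<dots> = hsum (\<lambda>x. ?g (x - (1, 0)) * W (?e - x) - ?g (x - (0, 1)) * W (?e - x) + cc b * hb * ?F ?e x)"
    by (simp only: hsum_add(2)[OF hsum_diff(1)[OF sh(2) sh(2)] hsum_mult(1)[OF s]] hsum_diff(2)[OF sh(2) sh(2)])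
  also have "\<dots> = hsum (\<lambda>x :: int \<times> int. if x = (0, 0) then W ?e else 0)"
  proof (rule arg_cong[where f=hsum], rule ext)
    fix x :: "int \<times> int"
    obtain s t where x: "x = (s, t)" by (cases x)
    have "?g (x - (1, 0)) * W (?e - x) - ?g (x - (0, 1)) * W (?e - x) + cc b * hb * ?F ?e x
       = (sc (inv_u b (s - 1) t) - sc (inv_u b s (t - 1)) + cc b * hb * sc (inv_u b s t)) * W (?e - x)"
      by (simp add: x algebra_simps)
    then show "?g (x - (1, 0)) * W (?e - x) - ?g (x - (0, 1)) * W (?e - x) + cc b * hb * ?F ?e x = (if x = (0, 0) then W ?e else 0)"
      unfolding inv_u_lin by (auto simp: x)
  qed
  also have "\<dots> = W ?e" by (subst hsum_single(2)[of "(0, 0)"]) auto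
  finally show "act (LU b) (gconv (inv_u b) W) (p, q) = W (p, q)" .
qed

text \<open>Reduces expansion in the direction of v to that in the direction of u by exchanging the
  variables.\<close>

lemma inv_v_swp: "inv_v b s t = - inv_u (- b) t s"
  by (auto simp: inv_v_def inv_u_def)

lemma gconv_inv_v: "gconv (inv_v b) W = (\<lambda>e. - swp (gconv (inv_u (- b)) (swp W)) e)"
  if "ubd W"
proof (rule ext, clarify)
  fix p q
  have b: "bij (\<lambda>(s, t). (t, s))" by (rule o_bij[of "\<lambda>(s, t). (t, s)"]) auto
  have s: "hsummable (\<lambda>(s, t). sc (inv_u (- b) s t) * swp W ((q, p) - (s, t)))"
    by (rule inv_u_summable) (simp add: vbd_swp that)
  have "gconv (inv_v b) W (p, q) = hsum (\<lambda>x. - (case (case x of (s, t) \<Rightarrow> (t, s)) of (s, t) \<Rightarrow> sc (inv_u (- b) s t) * swp W ((q, p) - (s, t))))"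
    unfolding gconv_def by (rule arg_cong[where f=hsum]) (auto simp: inv_v_swp sc_uminus fun_eq_iff)
  also have "\<dots> = - gconv (inv_u (- b)) (swp W) (q, p)"
    using hsum_reindex[OF b, of "\<lambda>x. - (case x of (s, t) \<Rightarrow> sc (inv_u (- b) s t) * swp W ((q, p) - (s, t)))"]
      hsum_uminus(2)[OF s] by (simp add: gconv_def)
  finally show "gconv (inv_v b) W (p, q) = - swp (gconv (inv_u (- b)) (swp W)) (p, q)" by simp
qed

lemma inv_v_summable:
  assumes "ubd W"
  shows "hsummable (\<lambda>(s, t). sc (inv_v b s t) * W (e - (s, t)))"
proof -
  obtain p q where e: "e = (p, q)" by (cases e)
  have b: "bij (\<lambda>(s, t). (t, s))" by (rule o_bij[of "\<lambda>(s, t). (t, s)"]) auto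
  have s: "hsummable (\<lambda>(s, t). sc (inv_u (- b) s t) * swp W ((q, p) - (s, t)))"
    by (rule inv_u_summable) (simp add: vbd_swp assms)
  have "(\<lambda>(s, t). sc (inv_v b s t) * W (e - (s, t))) = (\<lambda>x. - (case (case x of (s, t) \<Rightarrow> (t, s)) of (s, t) \<Rightarrow> sc (inv_u (- b) s t) * swp W ((q, p) - (s, t))))"
    by (auto simp: inv_v_swp sc_uminus fun_eq_iff e)
  then show ?thesis
    using hsum_reindex(1)[OF b, of "\<lambda>x. - (case x of (s, t) \<Rightarrow> sc (inv_u (- b) s t) * swp W ((q, p) - (s, t)))"]
      hsum_uminus(1)[OF s] by simp
qed

lemma inv_v_ubd: "ubd W \<Longrightarrow> ubd (gconv (inv_v b) W)"
  using ubd_mult[of "swp (gconv (inv_u (- b)) (swp W))" "-1"] inv_u_vbd[of "swp W" "- b"]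
  by (simp add: gconv_inv_v ubd_swp vbd_swp)

lemma act_inv_v:
  assumes "ubd W"
  shows "act (LU b) (gconv (inv_v b) W) = W"
proof -
  have "act (LU b) (swp (gconv (inv_u (- b)) (swp W))) = (\<lambda>e. - W e)"
    unfolding act_LU_swp using act_inv_u[of "swp W" "- b"] assms by (simp add: vbd_swp)
  then show ?thesis
    unfolding gconv_inv_v[OF assms] by (rule_tac ext) (simp add: act_fun_uminus)
qed


section \<open>Relations between two vertex operators\<close>

text \<open>N will be the same normally ordered product for both orders of X and Y; this is how the
  two orders are compared.\<close>

definition resolved :: "(int \<times> int \<Rightarrow> fock) \<Rightarrow> complex \<Rightarrow> complex list \<Rightarrow> complex list \<Rightarrow> (int \<times> int \<Rightarrow> fock) \<Rightarrow> bool" where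
  "resolved W \<sigma> neg pos N \<longleftrightarrow> act (LUs neg) W = (\<lambda>e. cc \<sigma> * act (LUs pos) N e)"

text \<open>Cross-multiplication: A' and B' are chosen so that both orders end at the same Laurent
  polynomial times N.\<close>

lemma resolved_combine:
  assumes "resolved U \<sigma> n1 p1 N" "resolved V \<sigma> n2 p2 N"
    "A = A' * LUs n1" "A2 = B' * LUs n2" "A' * LUs p1 = B' * LUs p2"
  shows "act A U = act A2 V"
proof
  fix e
  have "act A U e = act A' (\<lambda>e. cc \<sigma> * act (LUs p1) N e) e"
    using assms(1) unfolding assms(3) resolved_def by (simp add: act_mult)
  also have "\<dots> = cc \<sigma> * act (A' * LUs p1) N e" by (simp add: act_fun_mult act_mult)
  also have "\<dots> = act B' (\<lambda>e. cc \<sigma> * act (LUs p2) N e) e"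
    unfolding assms(5) by (simp add: act_fun_mult act_mult)
  also have "\<dots> = act A2 V e"
    using assms(2) unfolding assms(4) resolved_def by (simp add: act_mult)
  finally show "act A U e = act A2 V e" .
qed

lemma resolved_nil: "resolved U \<sigma> [] p N \<Longrightarrow> U = (\<lambda>e. cc \<sigma> * act (LUs p) N e)"
  by (simp add: resolved_def LUs_def)

lemma resolved_uv:
  assumes "vop n X C \<delta> A Z" "vop n Y C' \<delta>' A' Z'" "ctr n A Z C' \<delta>' neg pos" "f \<in> Fock n"
  shows "resolved (ev (uv X Y) f) (sg n Z \<delta>') neg pos (Nrm n (MM C \<delta>) A Z (MM C' \<delta>') A' Z' f)"
  using uv_rel[OF assms] by (auto simp: resolved_def ev_def uv_def)

text \<open>The normally ordered product is symmetric under simultaneous exchange of operators and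
  variables. The exchange costs one sign for each linear factor.\<close>

lemma resolved_vu:
  assumes "vop n X C \<delta> A Z" "vop n Y C' \<delta>' A' Z'" "ctr n A' Z' C \<delta> neg pos" "f \<in> Fock n"
  shows "resolved (ev (vu X Y) f) (sg n Z' \<delta> * (-1) ^ (length neg + length pos)) (map uminus neg) (map uminus pos)
    (Nrm n (MM C \<delta>) A Z (MM C' \<delta>') A' Z' f)"
proof -
  let ?N = "Nrm n (MM C \<delta>) A Z (MM C' \<delta>') A' Z' f"
  have 1: "(\<lambda>(p, q). Y p (X q f)) = swp (ev (vu X Y) f)"
    by (auto simp: ev_def vu_def fun_eq_iff)
  have 2: "Nrm n (MM C' \<delta>') A' Z' (MM C \<delta>) A Z f = swp ?N"
    by (auto simp: fun_eq_iff Nrm_swap[OF assms(4), of _ A'])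
  have r: "act (LUs neg) (swp (ev (vu X Y) f)) e = cc (sg n Z' \<delta>) * act (LUs pos) (swp ?N) e" for e
    using uv_rel[OF assms(2,1,3,4)] unfolding 1 2 .
  have "act (LUs (map uminus neg)) (ev (vu X Y) f) (q, p)
      = cc (sg n Z' \<delta> * (-1) ^ (length neg + length pos)) * act (LUs (map uminus pos)) ?N (q, p)" for p q
  proof -
    have m: "cc ((-1) ^ k) * cc ((-1) ^ k) = 1" for k
      by (simp flip: cc_mult power_mult_distrib)
    have "cc ((-1) ^ length neg) * (act (LUs (map uminus neg)) (ev (vu X Y) f) (q, p))
       = cc (sg n Z' \<delta>) * (cc ((-1) ^ length pos) * act (LUs (map uminus pos)) ?N (q, p))"
      using r[of "(p, q)"] unfolding act_LUs_swp swp_apply .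
    then have "cc ((-1) ^ length neg) * (cc ((-1) ^ length neg) * act (LUs (map uminus neg)) (ev (vu X Y) f) (q, p))
       = cc ((-1) ^ length neg) * (cc (sg n Z' \<delta>) * (cc ((-1) ^ length pos) * act (LUs (map uminus pos)) ?N (q, p)))"
      by (rule arg_cong)
    then show ?thesis
      by (simp only: mult.assoc[symmetric] m power_add cc_mult mult_1_left) (simp only: mult.assoc mult.left_commute mult.commute)
  qed
  then show ?thesis by (auto simp: resolved_def fun_eq_iff)
qed

text \<open>Both annihilation halves act first, so modulo hbar^(N+1) finitely many of their modes
  survive on f, and the creation halves only raise exponents.\<close>

lemma Nrm_bd:
  assumes "f \<in> Fock n"
  shows "ubd (Nrm n w A Z w' A' Z' f)" "vbd (Nrm n w A Z w' A' Z' f)"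
proof -
  have u: "ubd (Nrm n w A Z w' A' Z' f)" for w A Z w' A' Z'
    unfolding ubd_def
  proof
    fix N
    let ?g = "\<lambda>(r, t). PH n A Z r (PH n A' Z' t f)"
    have "hsummable (\<lambda>(r, t). 1 * PH n A Z r (PH n A' Z' t f))" by (rule Nrm_summable[OF assms])
    then have fin: "finite {x. \<exists>m\<le>N. fps_nth (?g x) m \<noteq> 0}" (is "finite ?I")
      by (intro hsummable_upto) simp
    define c where "c = Min (insert 0 (fst ` ?I))"
    have "zN N (Mz w (p - r) * Mz w' (q - t) * PH n A Z r (PH n A' Z' t f))" if "p < c" for p q r t
    proof (cases "(r, t) \<in> ?I")
      case True
      then have "c \<le> r" unfolding c_def using fin by (intro Min_le finite.insertI finite_imageI insertI2 image_eqI[of r fst "(r, t)"]) auto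
      then show ?thesis using that by (simp add: Mz_def)
    next
      case False
      then have "zN N (PH n A Z r (PH n A' Z' t f))" by (auto simp: zN_def)
      then show ?thesis by (rule zN_mult)
    qed
    then show "\<exists>c. \<forall>p q. p < c \<longrightarrow> zN N (Nrm n w A Z w' A' Z' f (p, q))"
      by (intro exI[of _ c]) (auto simp: Nrm_def intro!: zN_hsum)
  qed
  have "Nrm n w A Z w' A' Z' f = swp (Nrm n w' A' Z' w A Z f)"
    by (auto simp: fun_eq_iff Nrm_swap[OF assms, of w])
  then show "ubd (Nrm n w A Z w' A' Z' f)" "vbd (Nrm n w A Z w' A' Z' f)"
    using u[of w A Z w' A' Z'] u[of w' A' Z' w A Z] by (simp_all add: vbd_swp)
qed

definition lbd :: "(int \<Rightarrow> fock) \<Rightarrow> bool" where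
  "lbd W \<longleftrightarrow> (\<forall>N. \<exists>c. \<forall>p < c. zN N (W p))"

lemma vop_lbd:
  assumes "vop n X C \<delta> A Z" "f \<in> Fock n"
  shows "lbd (\<lambda>p. X p f)"
  unfolding lbd_def
proof
  fix N
  have "hsummable (\<lambda>r. 1 * PH n A Z r f)" by (rule PH_hsummable[OF assms(2)])
  then have fin: "finite {r. \<exists>m\<le>N. fps_nth (PH n A Z r f) m \<noteq> 0}" (is "finite ?I")
    by (intro hsummable_upto) simp
  define c where "c = Min (insert 0 ?I)"
  have "zN N (Mz (MM C \<delta>) (p - r) * PH n A Z r f)" if "p < c" for p r
  proof (cases "r \<in> ?I")
    case True
    then have "c \<le> r" unfolding c_def using fin by (intro Min_le) auto
    then show ?thesis using that by (simp add: Mz_def)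
  next
    case False
    then have "zN N (PH n A Z r f)" by (auto simp: zN_def)
    then show ?thesis by (rule zN_mult)
  qed
  then show "\<exists>c. \<forall>p<c. zN N (X p f)"
    by (intro exI[of _ c]) (auto simp: vopD(1)[OF assms] intro!: zN_hsum)
qed

lemma vop_zN: "vop n X C \<delta> A Z \<Longrightarrow> f \<in> Fock n \<Longrightarrow> zN N f \<Longrightarrow> zN N (X p f)"
  by (rule zN_endo[OF vop_endo])

lemma uv_vbd:
  assumes "vop n X C \<delta> A Z" "vop n Y C' \<delta>' A' Z'" "f \<in> Fock n"
  shows "vbd (ev (uv X Y) f)"
  unfolding vbd_def
proof
  fix N
  obtain c where "\<forall>q<c. zN N (Y q f)" using vop_lbd[OF assms(2,3)] by (auto simp: lbd_def)
  then show "\<exists>c. \<forall>p q. q < c \<longrightarrow> zN N (ev (uv X Y) f (p, q))"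
    by (intro exI[of _ c]) (auto simp: ev_def uv_def intro!: vop_zN[OF assms(1)] vop_Fock[OF assms(2,3)])
qed

lemma vu_ubd:
  assumes "vop n X C \<delta> A Z" "vop n Y C' \<delta>' A' Z'" "f \<in> Fock n"
  shows "ubd (ev (vu X Y) f)"
proof -
  have "ev (vu X Y) f = swp (ev (uv Y X) f)" by (auto simp: ev_def uv_def vu_def fun_eq_iff)
  then show ?thesis using uv_vbd[OF assms(2,1,3)] by (simp add: ubd_swp)
qed

lemma resolved_nil_bd:
  assumes "resolved U \<sigma> [] p N"
  shows "ubd N \<Longrightarrow> ubd U" "vbd N \<Longrightarrow> vbd U"
  unfolding resolved_nil[OF assms] by (simp_all add: ubd_mult ubd_act vbd_mult vbd_act)

text \<open>The expanded quotient has the right product with the factor, and the factor is injective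
  on families that start in v; so V must be that quotient.\<close>

lemma rel_inv_u:
  assumes "vbd U" "vbd V" "act (LU c) V = act (LU d) U"
  shows "V = act (LU d) (gconv (inv_u c) U)"
proof (rule LU_inj[OF assms(2), of _ c])
  show "vbd (act (LU d) (gconv (inv_u c) U))" by (rule vbd_act_LU[OF inv_u_vbd[OF assms(1)]])
  have "act (LU c) (act (LU d) (gconv (inv_u c) U)) = act (LU d) (act (LU c) (gconv (inv_u c) U))"
    by (simp add: mult.commute flip: act_mult)
  then show "act (LU c) V = act (LU c) (act (LU d) (gconv (inv_u c) U))"
    by (simp add: act_inv_u[OF assms(1)] assms(3))
qed

lemma rel_inv_v:
  assumes "ubd U" "ubd V" "act (LU c) V = act (LU d) U"
  shows "V = act (LU d) (gconv (inv_v c) U)"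
proof (rule LU_inj_u[OF assms(2), of _ c])
  show "ubd (act (LU d) (gconv (inv_v c) U))"
    using ubd_act[OF inv_v_ubd[OF assms(1)], of "[d]"] by (simp add: LUs_def)
  have "act (LU c) (act (LU d) (gconv (inv_v c) U)) = act (LU d) (act (LU c) (gconv (inv_v c) U))"
    by (simp add: mult.commute flip: act_mult)
  then show "act (LU c) V = act (LU c) (act (LU d) (gconv (inv_v c) U))"
    by (simp add: act_inv_v[OF assms(1)] assms(3))
qed

lemma eq_on_ev: "eq_on S W W' \<longleftrightarrow> (\<forall>f\<in>S. ev W f = ev W' f)"
  by (auto simp: eq_on_def ev_def fun_eq_iff)

lemma dmul_summable_ev:
  "dmul_summable S g W \<longleftrightarrow> (\<forall>f\<in>S. \<forall>e. hsummable (\<lambda>(s, t). sc (g s t) * ev W f (e - (s, t))))"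
  by (auto simp: dmul_summable_def ev_def scal_sc)

section \<open>Serre relations\<close>

text \<open>Variables are numbered: 0 stands for v and k > 0 for u_k.\<close>

definition dl :: "nat \<Rightarrow> nat \<Rightarrow> int" where
  "dl k = (\<lambda>j. if j = k then 1 else 0)"

definition Lin :: "nat \<Rightarrow> nat \<Rightarrow> complex \<Rightarrow> (nat \<Rightarrow> int) \<Rightarrow>\<^sub>0 fock" where
  "Lin k l c = Poly_Mapping.single (dl k) 1 - Poly_Mapping.single (dl l) 1 + Poly_Mapping.single 0 (cc c * hb)"

lemma act_Lin: "act (Lin k l c) W e = W (e - dl k) - W (e - dl l) + cc c * hb * W e"
  by (simp add: Lin_def act_add act_diff act_single)

text \<open>Below the bound in the variable \<open>k\<close>, uniformly in the variables of \<open>I\<close> (the exponents of the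
  other ones are fixed), \<open>W\<close> is small.\<close>

definition bdd :: "nat set \<Rightarrow> nat \<Rightarrow> ((nat \<Rightarrow> int) \<Rightarrow> fock) \<Rightarrow> bool" where
  "bdd I k W \<longleftrightarrow> (\<forall>N e. \<exists>c. \<forall>e'. (\<forall>l. l \<notin> I \<longrightarrow> e' l = e l) \<and> e' k < c \<longrightarrow> zN N (W e'))"

lemma bddI:
  assumes "\<And>N e. \<exists>c. \<forall>e'. (\<forall>l. l \<notin> I \<longrightarrow> e' l = e l) \<longrightarrow> e' k < c \<longrightarrow> zN N (W e')"
  shows "bdd I k W"
  using assms unfolding bdd_def by blast

lemma bddE: "bdd I k W \<Longrightarrow> \<exists>c. \<forall>e'. (\<forall>l. l \<notin> I \<longrightarrow> e' l = e l) \<longrightarrow> e' k < c \<longrightarrow> zN N (W e')"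
  unfolding bdd_def by metis

lemma bdd_mono: "bdd I k W \<Longrightarrow> J \<subseteq> I \<Longrightarrow> bdd J k W"
  unfolding bdd_def by (meson subsetD)

lemma bdd_mult: "bdd I k W \<Longrightarrow> bdd I k (\<lambda>e. x * W e)"
  unfolding bdd_def by (meson zN_mult)

lemma bdd_0: "bdd I k (\<lambda>e. 0)"
  by (simp add: bdd_def)

lemma bdd_add:
  assumes "bdd I k W" "bdd I k W'"
  shows "bdd I k (\<lambda>e. W e + W' e)"
proof (rule bddI)
  fix N e
  obtain c where c: "\<And>e'. \<forall>l. l \<notin> I \<longrightarrow> e' l = e l \<Longrightarrow> e' k < c \<Longrightarrow> zN N (W e')" using bddE[OF assms(1), of "e" N] by blast
  obtain c' where c': "\<And>e'. \<forall>l. l \<notin> I \<longrightarrow> e' l = e l \<Longrightarrow> e' k < c' \<Longrightarrow> zN N (W' e')" using bddE[OF assms(2), of "e" N] by blast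
  show "\<exists>c. \<forall>e'. (\<forall>l. l \<notin> I \<longrightarrow> e' l = e l) \<longrightarrow> e' k < c \<longrightarrow> zN N (W e' + W' e')"
    by (rule exI[of _ "min c c'"]) (auto intro!: zN_add c c')
qed

lemma bdd_shift:
  assumes "bdd I k W"
  shows "bdd I k (\<lambda>e. W (e - d))"
proof (rule bddI)
  fix N e
  obtain c where c: "\<And>e'. \<forall>l. l \<notin> I \<longrightarrow> e' l = (e - d) l \<Longrightarrow> e' k < c \<Longrightarrow> zN N (W e')" using bddE[OF assms(1), of "e - d" N] by blast
  show "\<exists>c. \<forall>e'. (\<forall>l. l \<notin> I \<longrightarrow> e' l = e l) \<longrightarrow> e' k < c \<longrightarrow> zN N (W (e' - d))"
    by (rule exI[of _ "c + d k"]) (auto intro!: c)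
qed

lemma bdd_act: "bdd I k W \<Longrightarrow> bdd I k (act P W)"
proof (induction P rule: pm_induct)
  case (single j c)
  then show ?case unfolding act_single by (intro bdd_mult bdd_shift)
next
  case (add P P')
  then show ?case unfolding act_add by (intro bdd_add)
qed

text \<open>Freezing all exponents except those of u_k and v reduces this to two variables.\<close>

lemma Lin_inj0:
  assumes v: "bdd {0, k} 0 W" and z: "\<And>e. act (Lin k 0 c) W e = 0" and k: "k \<noteq> 0"
  shows "W e = 0"
proof -
  define G where "G = (\<lambda>(p, q). W (e(k := p, 0 := q)))"
  have "G x = 0" for x
  proof (rule LU_inj0)
    show "vbd G"
      unfolding vbd_def
    proof
      fix N
      obtain c where c: "\<And>e'. \<forall>l. l \<notin> {0, k} \<longrightarrow> e' l = e l \<Longrightarrow> e' 0 < c \<Longrightarrow> zN N (W e')" using bddE[OF v, of "e" N] by blast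
      show "\<exists>c. \<forall>p q. q < c \<longrightarrow> zN N (G (p, q))"
        by (rule exI[of _ c]) (auto simp: G_def intro!: c split: if_splits)
    qed
    show "act (LU c) G x = 0" for x
    proof -
      obtain p q where x: "x = (p, q)" by (cases x)
      have 1: "e(k := p, 0 := q) - dl k = e(k := p - 1, 0 := q)" "e(k := p, 0 := q) - dl 0 = e(k := p, 0 := q - 1)"
        using k by (auto simp: fun_eq_iff dl_def)
      show ?thesis using z[of "e(k := p, 0 := q)"] unfolding act_Lin 1 by (simp add: x act_LU G_def)
    qed
  qed
  from this[of "(e k, e 0)"] show ?thesis by (simp add: G_def fun_upd_idem)
qed

lemma zN_hb: "zN N w \<Longrightarrow> zN (Suc N) (hb * w)" "zN 0 (hb * w)" "zN (Suc N) (hb * w) \<Longrightarrow> zN N w"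
proof -
  show "zN N w \<Longrightarrow> zN (Suc N) (hb * w)" "zN 0 (hb * w)" by (auto simp: zN_def)
  show "zN N w" if "zN (Suc N) (hb * w)"
    unfolding zN_def
  proof (intro allI impI)
    fix m assume "m \<le> N"
    then have "fps_nth (hb * w) (Suc m) = 0" using that by (auto simp: zN_def)
    then show "fps_nth w m = 0" by simp
  qed
qed

text \<open>\<open>a (U + V) = 0\<close> makes \<open>a V\<close> bounded in \<open>v\<close>, and \<open>b - a\<close> is a multiple of \<open>\<hbar>\<close>.\<close>

lemma two_sided_zero:
  assumes U: "bdd {0, k} 0 U" and bB: "bdd {0, k} 0 (act (Lin k 0 (- d)) V)" and d: "d \<noteq> 0" and k: "k \<noteq> 0"
    and z: "\<And>e. act (Lin k 0 d) (\<lambda>e. U e + V e) e = 0"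
  shows "U e + V e = 0"
proof -
  have aB: "act (Lin k 0 d) V e = (-1) * act (Lin k 0 d) U e" for e
    using z[of e] by (simp add: act_fun_add add_eq_0_iff)
  \<comment> \<open>The two factors differ by -2 d hbar, so hbar V is a combination of two families
    already known to be bounded.\<close>
  have hB: "hb * V e = cc (-1 / (2 * d)) * (act (Lin k 0 (- d)) V e + (-1) * act (Lin k 0 d) V e)" for e
  proof -
    have "act (Lin k 0 (- d)) V e + (-1) * act (Lin k 0 d) V e = cc (- 2 * d) * (hb * V e)"
      unfolding act_Lin by (simp only: cc_mult cc_uminus) (simp add: algebra_simps)
    then have "cc (-1 / (2 * d)) * (act (Lin k 0 (- d)) V e + (-1) * act (Lin k 0 d) V e) = cc (-1 / (2 * d) * (- 2 * d)) * (hb * V e)"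
      unfolding cc_mult by (simp add: mult.assoc)
    then show ?thesis using d by simp
  qed
  have "bdd {0, k} 0 (\<lambda>e. hb * V e)"
    unfolding hB unfolding aB by (intro bdd_mult bdd_add bdd_act bB U)
  \<comment> \<open>Division by hbar: the bound for hbar V at order N + 1 is a bound for V at order
    N.\<close>
  then have "bdd {0, k} 0 V" unfolding bdd_def by (meson zN_hb(3))
  then have "bdd {0, k} 0 (\<lambda>e. U e + V e)" by (intro bdd_add U)
  from Lin_inj0[OF this z k] show ?thesis .
qed

text \<open>The factor expresses W at e' by W at the neighbour with lower exponent of u_l and higher
  exponent of v, up to a term with hbar and the bounded product. After finitely many steps the
  exponent of u_l is below its uniform bound. The number of steps depends on that exponent, so the
  bound in v obtained is no longer uniform in u_l, and l leaves I.\<close>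

lemma bdd_strip:
  assumes U: "bdd UNIV l W" and H: "bdd I 0 (act (Lin l 0 c) W)" and I: "0 \<in> I" "l \<noteq> 0"
  shows "bdd (I - {l}) 0 W"
proof (rule bddI)
  fix N e
  have W: "W e' = W ((e' + dl 0) - dl l) + cc c * (hb * W (e' + dl 0)) - act (Lin l 0 c) W (e' + dl 0)" for e'
    by (simp add: act_Lin mult.assoc)
  let ?R = "\<lambda>e e'. \<forall>j. j \<notin> I - {l} \<longrightarrow> e' j = e j"
  show "\<exists>c. \<forall>e'. ?R e e' \<longrightarrow> e' 0 < c \<longrightarrow> zN N (W e')"
  proof (induction N arbitrary: e)
    \<comment> \<open>The outer induction on N provides the bound for hbar W; the inner one runs
      over the distance of the exponent of u_l from its uniform bound \<open>c0\<close>.\<close>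
    have step: "\<exists>c. \<forall>e'. ?R e e' \<longrightarrow> e' 0 < c \<longrightarrow> zN N (W e')"
      if hW: "\<And>e. \<exists>c. \<forall>e'. ?R e e' \<longrightarrow> e' 0 < c \<longrightarrow> zN N (hb * W e')" for N e
    proof -
      obtain c0 where c0: "\<And>e'. e' l < c0 \<Longrightarrow> zN N (W e')" using bddE[OF U, of "e" N] by blast
      show ?thesis
      proof (induction "nat (e l - c0 + 1)" arbitrary: e)
        case 0
        then have "e l < c0" by simp
        then show ?case using c0 by (intro exI[of _ 0]) auto
      next
        case (Suc m)
        have "m = nat ((e - dl l) l - c0 + 1)" using Suc(2) by (simp add: dl_def)
        then have "\<exists>c. \<forall>e'. ?R (e - dl l) e' \<longrightarrow> e' 0 < c \<longrightarrow> zN N (W e')" by (rule Suc(1))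
        then obtain c1 where c1: "\<And>e'. ?R (e - dl l) e' \<Longrightarrow> e' 0 < c1 \<Longrightarrow> zN N (W e')" by blast
        obtain c2 where c2: "\<And>e'. ?R e e' \<Longrightarrow> e' 0 < c2 \<Longrightarrow> zN N (hb * W e')" using hW[of e] by blast
        obtain c3 where c3: "\<And>e'. \<forall>j. j \<notin> I \<longrightarrow> e' j = e j \<Longrightarrow> e' 0 < c3 \<Longrightarrow> zN N (act (Lin l 0 c) W e')"
          using bddE[OF H, of "e" N] by blast
        have "zN N (W e')" if R: "?R e e'" and lt: "e' 0 < min (min c1 c2) c3 - 1" for e'
        proof -
          have "zN N (W ((e' + dl 0) - dl l))"
            by (rule c1) (use R lt I in \<open>auto simp: dl_def\<close>)
          moreover have "zN N (hb * W (e' + dl 0))" by (rule c2) (use R lt I in \<open>auto simp: dl_def\<close>)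
          moreover have "zN N (act (Lin l 0 c) W (e' + dl 0))" by (rule c3) (use R lt I in \<open>auto simp: dl_def\<close>)
          ultimately show ?thesis by (subst W) (assumption | rule zN_diff zN_add zN_mult)+
        qed
        then show ?case by blast
      qed
    qed
    case 0
    show ?case by (rule step) (simp add: zN_hb)
    case (Suc N)
    show ?case by (rule step) (meson Suc.IH zN_hb(1))
  qed
qed

lemma act_LUs_bound:
  assumes "\<And>p q. p < c \<Longrightarrow> zN N (W (p, q))" "p < c"
  shows "zN N (act (LUs cs) W (p, q))"
  using assms(2)
proof (induction cs arbitrary: p q)
  case (Cons b cs)
  have "act (LUs (b # cs)) W (p, q) = act (LUs cs) W (p - 1, q) - act (LUs cs) W (p, q - 1) + cc b * hb * act (LUs cs) W (p, q)"
    by (simp add: LUs_def act_mult act_LU)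
  then show ?case using Cons by (auto intro!: zN_add zN_diff zN_mult)
qed (simp add: LUs_def assms(1))

text \<open>Common frame for E and F: d is the constant in the exchange of X with Y, and -r the one
  in the exchange of X with itself. The empty list of denominators in the contraction of X with
  itself is what makes words in X bounded in each variable.\<close>

locale serre_pair =
  fixes n X C \<delta> A Z Y C' \<delta>' A' Z' d r pos f
  assumes vX: "vop n X C \<delta> A Z" and vY: "vop n Y C' \<delta>' A' Z'"
    and pos: "ctr n A Z C \<delta> [] pos"
    and XY: "\<And>g. g \<in> Fock n \<Longrightarrow> act (LU d) (ev (uv X Y) g) = act (LU (- d)) (ev (vu X Y) g)"
    and XX: "\<And>g. g \<in> Fock n \<Longrightarrow> act (LU (- r)) (ev (uv X X) g) = act (LU r) (ev (vu X X) g)"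
    and d: "d \<noteq> 0" and f: "f \<in> Fock n"
begin

definition Xs :: "nat list \<Rightarrow> (nat \<Rightarrow> int) \<Rightarrow> fock \<Rightarrow> fock" where
  "Xs ls e g = foldr (\<lambda>k. X (e k)) ls g"

definition wrd :: "nat list \<Rightarrow> nat list \<Rightarrow> (nat \<Rightarrow> int) \<Rightarrow> fock" where
  "wrd ls ms e = Xs ls e (Y (e 0) (Xs ms e f))"

lemma Xs_simps: "Xs [] e g = g" "Xs (k # ls) e g = X (e k) (Xs ls e g)"
  "Xs (ls @ ls') e g = Xs ls e (Xs ls' e g)"
  by (simp_all add: Xs_def)

lemma Xs_cong: "(\<And>k. k \<in> set ls \<Longrightarrow> e k = e' k) \<Longrightarrow> Xs ls e g = Xs ls e' g"
  by (induction ls) (auto simp: Xs_simps)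

lemma Xs_endo: "A_endo (Fock n) (Xs ls e)"
proof (induction ls)
  case Nil
  show ?case unfolding Xs_simps by (auto intro!: A_endoI simp: A_endo_def)
next
  case (Cons k ls)
  show ?case
    unfolding Xs_simps Fock_FQ
    by (rule A_endo_lincomb(7)[OF csub_RQ vop_endo[OF vX, unfolded Fock_FQ] Cons.IH[unfolded Fock_FQ]])
qed

lemma Xs_Fock: "g \<in> Fock n \<Longrightarrow> Xs ls e g \<in> Fock n"
  by (rule A_endoD(1)[OF Xs_endo])

lemma Xs_zN: "g \<in> Fock n \<Longrightarrow> zN N g \<Longrightarrow> zN N (Xs ls e g)"
  by (rule zN_endo[OF Xs_endo])

lemma Y_Fock: "g \<in> Fock n \<Longrightarrow> Y q g \<in> Fock n"
  by (rule vop_Fock[OF vY])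

lemma X_Fock: "g \<in> Fock n \<Longrightarrow> X q g \<in> Fock n"
  by (rule vop_Fock[OF vX])

text \<open>Moving the annihilation half to the right past each X produces polynomial factors only,
  and these do not lower the start in its variable. The bound for f alone thus serves for the whole
  word, uniformly in all exponents.\<close>

lemma PH_Xs_bound: "\<exists>c. \<forall>p<c. \<forall>e. zN N (PH n A Z p (Xs ms e f))"
proof (induction ms)
  case Nil
  have "hsummable (\<lambda>r. 1 * PH n A Z r f)" by (rule PH_hsummable[OF f])
  then have fin: "finite {r. \<exists>m\<le>N. fps_nth (PH n A Z r f) m \<noteq> 0}" (is "finite ?I")
    by (intro hsummable_upto) simp
  have "zN N (PH n A Z p f)" if "p < Min (insert 0 ?I)" for p
    using that fin by (auto simp: zN_def)
  then show ?case unfolding Xs_simps by blast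
next
  case (Cons k ms)
  then obtain c where c: "\<And>p e. p < c \<Longrightarrow> zN N (PH n A Z p (Xs ms e f))" by blast
  have "zN N (PH n A Z p (Xs (k # ms) e f))" if p: "p < c" for p e
  proof -
    have g: "Xs ms e f \<in> Fock n" by (rule Xs_Fock[OF f])
    have "PH n A Z p (X (e k) (Xs ms e f)) = cc (sg n Z \<delta>) * act (LUs pos) (\<lambda>(p, q). X q (PH n A Z p (Xs ms e f))) (p, e k)"
      using exchange1[OF vX pos vopD(3)[OF vX] g, of "(p, e k)"] by (simp add: LUs_def)
    moreover have "zN N (act (LUs pos) (\<lambda>(p, q). X q (PH n A Z p (Xs ms e f))) (p, e k))"
      by (rule act_LUs_bound[where c = c]) (auto intro!: vop_zN[OF vX] PH_Fock g c p)
    ultimately show ?thesis unfolding Xs_simps by (simp add: zN_mult)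
  qed
  then show ?case by blast
qed

lemma X_Xs_bound: "\<exists>c. \<forall>p<c. \<forall>e. zN N (X p (Xs ms e f))"
proof -
  obtain c where c: "\<And>p e. p < c \<Longrightarrow> zN N (PH n A Z p (Xs ms e f))" using PH_Xs_bound by blast
  have "zN N (Mz (MM C \<delta>) (p - r) * PH n A Z r (Xs ms e f))" if "p < c" for p r e
    using c[of r e] that by (cases "r < c") (auto simp: Mz_def zN_mult)
  then show ?thesis
    by (intro exI[of _ c]) (auto simp: vopD(1)[OF vX Xs_Fock[OF f]] intro!: zN_hsum)
qed

lemma Xs_bdd: "k \<in> set ms \<Longrightarrow> bdd UNIV k (\<lambda>e. Xs ms e f)"
proof (induction ms)
  case (Cons l ms)
  show ?case
  proof (cases "k = l")
    case True
    show ?thesis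
    proof (rule bddI)
      fix N and e :: "nat \<Rightarrow> int"
      show "\<exists>c. \<forall>e'. (\<forall>l. l \<notin> UNIV \<longrightarrow> e' l = e l) \<longrightarrow> e' k < c \<longrightarrow> zN N (Xs (l # ms) e' f)"
        using X_Xs_bound[of N ms] unfolding Xs_simps True by blast
    qed
  next
    case False
    then have "bdd UNIV k (\<lambda>e. Xs ms e f)" using Cons by simp
    then show ?thesis unfolding bdd_def Xs_simps by (meson vop_zN[OF vX Xs_Fock[OF f]])
  qed
qed simp

lemma wrd_bdd_after: "k \<in> set ms \<Longrightarrow> bdd UNIV k (wrd ls ms)"
proof -
  assume "k \<in> set ms"
  from Xs_bdd[OF this] show ?thesis
    unfolding bdd_def wrd_def by (meson Xs_zN Y_Fock Xs_Fock f vop_zN[OF vY])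
qed

text \<open>The letters to the right of Y determine the vector on which Y acts, so the bound depends
  on their exponents but not on those of the letters to the left.\<close>

lemma wrd_bdd_before:
  assumes "set ls \<inter> set ms = {}" "0 \<notin> set ms"
  shows "bdd (insert 0 (set ls)) 0 (wrd ls ms)"
proof (rule bddI)
  fix N and e :: "nat \<Rightarrow> int"
  obtain c where c: "\<forall>p<c. zN N (Y p (Xs ms e f))" using vop_lbd[OF vY Xs_Fock[OF f]] unfolding lbd_def by blast
  have "zN N (wrd ls ms e')" if e': "\<forall>l. l \<notin> insert 0 (set ls) \<longrightarrow> e' l = e l" "e' 0 < c" for e'
  proof -
    have "e' k = e k" if "k \<in> set ms" for k
      using e'(1) that assms by (metis IntI empty_iff insert_iff)
    then have "Xs ms e' f = Xs ms e f" by (rule Xs_cong)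
    then show ?thesis unfolding wrd_def by (intro Xs_zN) (use c e' in \<open>auto intro!: Y_Fock Xs_Fock f\<close>)
  qed
  then show "\<exists>c. \<forall>e'. (\<forall>l. l \<notin> insert 0 (set ls) \<longrightarrow> e' l = e l) \<longrightarrow> e' 0 < c \<longrightarrow> zN N (wrd ls ms e')" by blast
qed

lemma lift_Lin:
  assumes l: "A_endo (Fock n) T" and G: "\<And>p q. G (p, q) \<in> Fock n"
    and W: "\<And>e'. (\<And>j. j \<noteq> k \<Longrightarrow> j \<noteq> l \<Longrightarrow> e' j = e j) \<Longrightarrow> W e' = T (G (e' k, e' l))" and kl: "k \<noteq> l"
  shows "act (Lin k l c) W e = T (act (LU c) G (e k, e l))"
proof -
  have 1: "W (e - dl k) = T (G (e k - 1, e l))" "W (e - dl l) = T (G (e k, e l - 1))" "W e = T (G (e k, e l))"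
    using kl by (simp_all add: W dl_def)
  have "T (act (LU c) G (e k, e l)) = T (G (e k - 1, e l)) - T (G (e k, e l - 1)) + sc (fps_const c * fps_X) * T (G (e k, e l))"
  proof -
    note g = G[unfolded Fock_FQ]
    have "sc (fps_const c * fps_X) * G (e k, e l) \<in> FQ n (Q n)" by (rule cset_sc[OF csub_RQ g])
    then show ?thesis
      using A_endoD(2)[OF l[unfolded Fock_FQ] cset_diff[OF csub_RQ g g]] A_endo_diff[OF l[unfolded Fock_FQ] csub_RQ g g]
        A_endoD(3)[OF l[unfolded Fock_FQ] g, of "fps_const c * fps_X"]
      by (simp add: act_LU sc_mult)
  qed
  then show ?thesis by (simp add: act_Lin 1 sc_mult)
qed

text \<open>One exchange of Y with its left neighbour, the letters on both sides being held
  fixed.\<close>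

lemma wrd_move:
  assumes "k \<noteq> 0" "k \<notin> set ls" "k \<notin> set ms" "0 \<notin> set ls" "0 \<notin> set ms"
  shows "act (Lin k 0 d) (wrd (ls @ [k]) ms) = act (Lin k 0 (- d)) (wrd ls (k # ms))"
proof
  fix e
  let ?g = "Xs ms e f"
  have g: "?g \<in> Fock n" by (rule Xs_Fock[OF f])
  have c: "Xs ms e' f = ?g" "Xs ls e' x = Xs ls e x" if "\<And>j. j \<noteq> k \<Longrightarrow> j \<noteq> 0 \<Longrightarrow> e' j = e j" for e' x
    by (rule Xs_cong, use that assms in metis)+
  have "act (Lin k 0 d) (wrd (ls @ [k]) ms) e = Xs ls e (act (LU d) (ev (uv X Y) ?g) (e k, e 0))"
  proof (rule lift_Lin[OF Xs_endo _ _ assms(1)])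
    show "wrd (ls @ [k]) ms e' = Xs ls e (ev (uv X Y) ?g (e' k, e' 0))" if "\<And>j. j \<noteq> k \<Longrightarrow> j \<noteq> 0 \<Longrightarrow> e' j = e j" for e'
      by (simp add: wrd_def Xs_simps ev_def uv_def c[OF that])
  qed (simp add: ev_def uv_def X_Fock Y_Fock g)
  also have "\<dots> = Xs ls e (act (LU (- d)) (ev (vu X Y) ?g) (e k, e 0))" unfolding XY[OF g] ..
  also have "\<dots> = act (Lin k 0 (- d)) (wrd ls (k # ms)) e"
  proof (rule lift_Lin[OF Xs_endo _ _ assms(1), symmetric])
    show "wrd ls (k # ms) e' = Xs ls e (ev (vu X Y) ?g (e' k, e' 0))" if "\<And>j. j \<noteq> k \<Longrightarrow> j \<noteq> 0 \<Longrightarrow> e' j = e j" for e'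
      by (simp add: wrd_def Xs_simps ev_def vu_def c[OF that])
  qed (simp add: ev_def vu_def X_Fock Y_Fock g)
  finally show "act (Lin k 0 d) (wrd (ls @ [k]) ms) e = act (Lin k 0 (- d)) (wrd ls (k # ms)) e" .
qed

lemma wrd_swap:
  assumes "k \<noteq> l" "{k, l} \<inter> (set ls \<union> set ms) = {}" "0 \<notin> {k, l}"
  shows "act (Lin k l (- r)) (wrd [] (ls @ k # l # ms)) = act (Lin k l r) (wrd [] (ls @ l # k # ms))"
proof
  fix e
  let ?g = "Xs ms e f"
  have g: "?g \<in> Fock n" by (rule Xs_Fock[OF f])
  have c: "Xs ms e' f = ?g" "Xs ls e' x = Xs ls e x" "e' 0 = e 0" if e': "\<And>j. j \<noteq> k \<Longrightarrow> j \<noteq> l \<Longrightarrow> e' j = e j" for e' x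
  proof -
    have "e' j = e j" if "j \<in> set ls \<union> set ms" for j by (rule e') (use that assms(2) in blast)+
    then show "Xs ms e' f = ?g" "Xs ls e' x = Xs ls e x" by (auto intro: Xs_cong)
    show "e' 0 = e 0" by (rule e') (use assms(3) in auto)
  qed
  define T where "T = (\<lambda>x. Y (e 0) (Xs ls e x))"
  have T: "A_endo (Fock n) T"
    unfolding T_def Fock_FQ by (rule A_endo_lincomb(7)[OF csub_RQ vop_endo[OF vY, unfolded Fock_FQ] Xs_endo[unfolded Fock_FQ]])
  have "act (Lin k l (- r)) (wrd [] (ls @ k # l # ms)) e = T (act (LU (- r)) (ev (uv X X) ?g) (e k, e l))"
  proof (rule lift_Lin[OF T _ _ assms(1)])
    show "wrd [] (ls @ k # l # ms) e' = T (ev (uv X X) ?g (e' k, e' l))" if "\<And>j. j \<noteq> k \<Longrightarrow> j \<noteq> l \<Longrightarrow> e' j = e j" for e'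
      by (simp add: wrd_def Xs_simps ev_def uv_def T_def c[OF that])
  qed (simp add: ev_def uv_def X_Fock g)
  also have "\<dots> = T (act (LU r) (ev (vu X X) ?g) (e k, e l))" unfolding XX[OF g] ..
  also have "\<dots> = act (Lin k l r) (wrd [] (ls @ l # k # ms)) e"
  proof (rule lift_Lin[OF T _ _ assms(1), symmetric])
    show "wrd [] (ls @ l # k # ms) e' = T (ev (vu X X) ?g (e' k, e' l))" if "\<And>j. j \<noteq> k \<Longrightarrow> j \<noteq> l \<Longrightarrow> e' j = e j" for e'
      by (simp add: wrd_def Xs_simps ev_def vu_def T_def c[OF that])
  qed (simp add: ev_def vu_def X_Fock g)
  finally show "act (Lin k l (- r)) (wrd [] (ls @ k # l # ms)) e = act (Lin k l r) (wrd [] (ls @ l # k # ms)) e" .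
qed

lemma wrd_move_all:
  assumes "distinct (ls @ ms)" "0 \<notin> set (ls @ ms)"
  shows "act (\<Prod>k\<leftarrow>ms. Lin k 0 (- d)) (wrd ls ms) = act (\<Prod>k\<leftarrow>ms. Lin k 0 d) (wrd (ls @ ms) [])"
  using assms
proof (induction ms arbitrary: ls)
  case (Cons k ms)
  have "act (\<Prod>k\<leftarrow>k # ms. Lin k 0 (- d)) (wrd ls (k # ms)) = act ((\<Prod>k\<leftarrow>ms. Lin k 0 (- d)) * Lin k 0 (- d)) (wrd ls (k # ms))"
    by (simp add: mult.commute)
  also have "\<dots> = act ((\<Prod>k\<leftarrow>ms. Lin k 0 (- d))) (act (Lin k 0 d) (wrd (ls @ [k]) ms))"
    unfolding act_mult by (subst wrd_move) (use Cons.prems in auto)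
  also have "\<dots> = act (Lin k 0 d) (act (\<Prod>k\<leftarrow>ms. Lin k 0 (- d)) (wrd (ls @ [k]) ms))"
    unfolding act_mult[symmetric] by (simp only: mult.commute)
  also have "\<dots> = act (\<Prod>k\<leftarrow>k # ms. Lin k 0 d) (wrd (ls @ k # ms) [])"
    by (subst Cons.IH) (use Cons.prems in \<open>auto simp: act_mult\<close>)
  finally show ?case .
qed simp

lemma bdd_strips:
  assumes "bdd I 0 (act (P * (\<Prod>k\<leftarrow>rs. Lin k 0 c)) W)" "0 \<in> I" "0 \<notin> set rs" "\<And>l. l \<in> set rs \<Longrightarrow> bdd UNIV l W"
  shows "bdd (I - set rs) 0 (act P W)"
  using assms
proof (induction rs arbitrary: I)
  case (Cons l rs)
  have "bdd I 0 (act (Lin l 0 c) (act (P * (\<Prod>k\<leftarrow>rs. Lin k 0 c)) W))"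
    using Cons.prems(1) by (simp add: mult.left_commute flip: act_mult)
  from bdd_strip[OF bdd_act this] have "bdd (I - {l}) 0 (act (P * (\<Prod>k\<leftarrow>rs. Lin k 0 c)) W)"
    using Cons.prems by auto
  then have "bdd (I - {l} - set rs) 0 (act P W)" by (rule Cons.IH) (use Cons.prems in auto)
  moreover have "I - set (l # rs) = I - {l} - set rs" by auto
  ultimately show ?case by simp
qed simp

text \<open>With one factor for every letter right of Y, the word becomes one with Y at the right
  end, which starts in v uniformly in all letters. Stripping the factors of the other letters leaves
  uniformity in u_k and v.\<close>

lemma wrd_bdd_b:
  assumes "distinct (ls @ ms)" "0 \<notin> set (ls @ ms)" "k \<in> set ms"
  shows "bdd {0, k} 0 (act (Lin k 0 (- d)) (wrd ls ms))"
proof -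
  have "bdd (insert 0 (set (ls @ ms))) 0 (act (\<Prod>k\<leftarrow>ms. Lin k 0 (- d)) (wrd ls ms))"
    unfolding wrd_move_all[OF assms(1,2)] by (rule bdd_act[OF wrd_bdd_before]) auto
  moreover obtain us vs where ms: "ms = us @ k # vs" using split_list[OF assms(3)] by blast
  then have "(\<Prod>k\<leftarrow>ms. Lin k 0 (- d)) = Lin k 0 (- d) * (\<Prod>k\<leftarrow>us @ vs. Lin k 0 (- d))"
    by (simp add: mult_ac)
  ultimately have "bdd (insert 0 (set (ls @ ms))) 0 (act (Lin k 0 (- d) * (\<Prod>k\<leftarrow>us @ vs. Lin k 0 (- d))) (wrd ls ms))"
    by simp
  then have "bdd (insert 0 (set (ls @ ms)) - set (us @ vs)) 0 (act (Lin k 0 (- d)) (wrd ls ms))"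
    by (rule bdd_strips) (use assms(2) in \<open>auto simp: ms intro!: wrd_bdd_after\<close>)
  moreover have "{0, k} \<subseteq> insert 0 (set (ls @ ms)) - set (us @ vs)"
    using assms unfolding ms by auto
  ultimately show ?thesis by (rule bdd_mono)
qed

lemma wrd_all_after:
  assumes "distinct (ls @ ms)" "0 \<notin> set (ls @ ms)"
  shows "act (P * (\<Prod>k\<leftarrow>ls. Lin k 0 d)) (wrd ls ms) = act (P * (\<Prod>k\<leftarrow>ls. Lin k 0 (- d))) (wrd [] (ls @ ms))"
  using assms
proof (induction ls arbitrary: ms P rule: rev_induct)
  case (snoc k ls)
  have m: "act (Lin k 0 d) (wrd (ls @ [k]) ms) = act (Lin k 0 (- d)) (wrd ls (k # ms))"
    by (rule wrd_move) (use snoc.prems in auto)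
  have "P * (\<Prod>k\<leftarrow>ls @ [k]. Lin k 0 d) = (P * (\<Prod>k\<leftarrow>ls. Lin k 0 d)) * Lin k 0 d"
    by (simp add: mult.assoc)
  then have "act (P * (\<Prod>k\<leftarrow>ls @ [k]. Lin k 0 d)) (wrd (ls @ [k]) ms) = act ((P * (\<Prod>k\<leftarrow>ls. Lin k 0 d)) * Lin k 0 (- d)) (wrd ls (k # ms))"
    by (simp only: m act_mult)
  also have "\<dots> = act ((P * Lin k 0 (- d)) * (\<Prod>k\<leftarrow>ls. Lin k 0 d)) (wrd ls (k # ms))"
    by (simp only: mult_ac)
  also have "\<dots> = act ((P * Lin k 0 (- d)) * (\<Prod>k\<leftarrow>ls. Lin k 0 (- d))) (wrd [] (ls @ k # ms))"
    by (rule snoc.IH) (use snoc.prems in auto)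
  also have "\<dots> = act (P * (\<Prod>k\<leftarrow>ls @ [k]. Lin k 0 (- d))) (wrd [] ((ls @ [k]) @ ms))"
    by (simp add: mult_ac)
  finally show ?case .
qed simp

text \<open>Under the exchange factor two neighbouring letters anticommute, up to the naming of the
  variables. In a symmetrised sum such terms cancel in pairs.\<close>

lemma wrd_swap_neg:
  assumes "k \<noteq> l" "{k, l} \<inter> (set ls \<union> set ms) = {}" "0 \<notin> {k, l}"
  shows "act (P * Lin k l (- r)) (wrd [] (ls @ k # l # ms)) e = - act (P * Lin l k (- r)) (wrd [] (ls @ l # k # ms)) e"
proof -
  have "Lin k l r = - Lin l k (- r)"
    by (simp add: Lin_def cc_uminus single_uminus)
  then have "act (P * Lin k l (- r)) (wrd [] (ls @ k # l # ms)) = act (- (P * Lin l k (- r))) (wrd [] (ls @ l # k # ms))"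
    unfolding act_mult wrd_swap[OF assms] by (simp flip: act_mult)
  then show ?thesis by (simp add: act_uminus)
qed

definition wsum :: "(complex \<times> nat list \<times> nat list) list \<Rightarrow> (nat \<Rightarrow> int) \<Rightarrow> fock" where
  "wsum ts e = (\<Sum>(c, ls, ms)\<leftarrow>ts. cc c * wrd ls ms e)"

lemma wsum_simps: "wsum [] = (\<lambda>e. 0)" "wsum ((c, ls, ms) # ts) = (\<lambda>e. cc c * wrd ls ms e + wsum ts e)"
  by (auto simp: wsum_def)

lemma act_wsum: "act P (wsum ts) e = (\<Sum>(c, ls, ms)\<leftarrow>ts. cc c * act P (wrd ls ms) e)"
  by (induction ts) (auto simp: wsum_simps act_fun_add act_fun_mult)

lemma bdd_wsum:
  assumes "\<And>c ls ms. (c, ls, ms) \<in> set ts \<Longrightarrow> bdd I k (act P (wrd ls ms))"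
  shows "bdd I k (act P (wsum ts))"
proof -
  have "act P (wsum ts) = (\<lambda>e. \<Sum>(c, ls, ms)\<leftarrow>ts. cc c * act P (wrd ls ms) e)" by (rule ext) (rule act_wsum)
  moreover have "bdd I k (\<lambda>e. \<Sum>(c, ls, ms)\<leftarrow>ts. cc c * act P (wrd ls ms) e)"
    using assms
  proof (induction ts)
    case (Cons t ts)
    have "bdd I k (\<lambda>e. \<Sum>(c, ls, ms)\<leftarrow>ts. cc c * act P (wrd ls ms) e)"
    proof (rule Cons.IH)
      show "bdd I k (act P (wrd ls ms))" if "(c, ls, ms) \<in> set ts" for c ls ms
        by (rule Cons.prems[of c]) (use that in simp)
    qed
    moreover have "bdd I k (act P (wrd (fst (snd t)) (snd (snd t))))" by (rule Cons.prems[of "fst t"]) simp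
    ultimately show ?case by (simp add: case_prod_unfold bdd_add bdd_mult)
  qed (simp add: bdd_0)
  ultimately show ?thesis by simp
qed

text \<open>Words with X(u_k) to the left of Y start in v; the other ones do so after multiplication
  by the factor with -d. These are the two hypotheses of \<open>two_sided_zero\<close>.\<close>

lemma wsum_step:
  assumes z: "\<And>e. act (P * Lin k 0 d) (wsum ts) e = 0"
    and ts: "\<And>c ls ms. (c, ls, ms) \<in> set ts \<Longrightarrow> distinct (ls @ ms) \<and> 0 \<notin> set (ls @ ms) \<and> k \<in> set (ls @ ms)"
    and k: "k \<noteq> 0"
  shows "act P (wsum ts) e = 0"
proof -
  let ?A = "filter (\<lambda>(c, ls, ms). k \<in> set ls) ts" and ?B = "filter (\<lambda>(c, ls, ms). k \<notin> set ls) ts"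
  have split: "wsum ts e = wsum ?A e + wsum ?B e" for e
    by (induction ts) (auto simp: wsum_simps)
  have s: "act P (wsum ts) e = act P (wsum ?A) e + act P (wsum ?B) e" for P e
    using act_fun_add[of P "wsum ?A" "wsum ?B" e] by (simp flip: split)
  have "act P (wsum ?A) e + act P (wsum ?B) e = 0"
  proof (rule two_sided_zero[OF _ _ d k])
    show "bdd {0, k} 0 (act P (wsum ?A))"
    proof (rule bdd_wsum)
      fix c ls ms assume i: "(c, ls, ms) \<in> set ?A"
      then have "bdd (insert 0 (set ls)) 0 (wrd ls ms)" using ts by (intro wrd_bdd_before) auto
      then show "bdd {0, k} 0 (act P (wrd ls ms))" by (intro bdd_act) (erule bdd_mono, use i in auto)
    qed
    have "bdd {0, k} 0 (act (Lin k 0 (- d)) (wsum ?B))"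
    proof (rule bdd_wsum)
      fix c ls ms assume i: "(c, ls, ms) \<in> set ?B"
      then have "distinct (ls @ ms)" "0 \<notin> set (ls @ ms)" "k \<in> set ms" using ts[of c ls ms] by auto
      then show "bdd {0, k} 0 (act (Lin k 0 (- d)) (wrd ls ms))" by (rule wrd_bdd_b)
    qed
    then have "bdd {0, k} 0 (act P (act (Lin k 0 (- d)) (wsum ?B)))" by (rule bdd_act)
    then show "bdd {0, k} 0 (act (Lin k 0 (- d)) (act P (wsum ?B)))"
      unfolding act_mult[symmetric] by (simp only: mult.commute)
    show "act (Lin k 0 d) (\<lambda>e. act P (wsum ?A) e + act P (wsum ?B) e) e = 0" for e
      using z[of e] unfolding s[symmetric] by (simp only: mult.commute act_mult[symmetric])
  qed
  then show ?thesis by (simp add: s)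
qed

lemma X_diff: "u \<in> Fock n \<Longrightarrow> v \<in> Fock n \<Longrightarrow> X p (u - v) = X p u - X p v"
  unfolding Fock_FQ by (rule A_endo_diff[OF vop_endo[OF vX, unfolded Fock_FQ] csub_RQ])

lemma Fock_diff: "u \<in> Fock n \<Longrightarrow> v \<in> Fock n \<Longrightarrow> u - v \<in> Fock n"
  unfolding Fock_FQ by (rule cset_diff[OF csub_RQ])

end

abbreviation Kh :: "complex \<Rightarrow> (nat \<Rightarrow> int) \<Rightarrow>\<^sub>0 fock" where
  "Kh c \<equiv> Poly_Mapping.single 0 (cc c * hb)"

lemma Kh_simps: "Kh (- c) = - Kh c" "Kh (2 * c) = 2 * Kh c"
proof -
  have 1: "cc (- c) * hb = - (cc c * hb)" by (simp add: cc_uminus)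
  have 2: "cc (2 * c) * hb = cc c * hb + cc c * hb" by (simp add: cc_mult)
  show "Kh (- c) = - Kh c" by (simp only: single_uminus 1)
  show "Kh (2 * c) = 2 * Kh c" unfolding 2 single_add by simp
qed

context serre_pair begin

lemma act_numeral: "act (numeral m * P) W e = numeral m * act P W e"
proof -
  have "act (of_nat k * P) W e = of_nat k * act P W e" for k
    by (induction k) (simp_all add: distrib_right act_add)
  from this[of "numeral m"] show ?thesis by simp
qed

lemma wsum_append: "act P (wsum (ts @ ts')) e = act P (wsum ts) e + act P (wsum ts') e"
  by (simp add: act_wsum)

text \<open>The nested commutator after symmetrisation: words with equally many letters left of Y
  are gathered, which produces signed binomial coefficients. Summing over all orders of the indices
  gives the Serre sum; \<open>ts3\<close> is the analogue for three letters.\<close>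

definition ts2 :: "nat \<Rightarrow> nat \<Rightarrow> (complex \<times> nat list \<times> nat list) list" where
  "ts2 k l = [(1, [k, l], []), (- 2, [k], [l]), (1, [], [k, l])]"

definition ts3 :: "nat \<Rightarrow> nat \<Rightarrow> nat \<Rightarrow> (complex \<times> nat list \<times> nat list) list" where
  "ts3 k l m = [(1, [k, l, m], []), (- 3, [k, l], [m]), (3, [k], [l, m]), (- 1, [], [k, l, m])]"

text \<open>Under both factors each word becomes a multiple of the word with Y in front, and the
  quadratic combination collapses to -2 d hbar (u_k - u_l - 2 d hbar). For r = 2 d this contains the
  exchange factor of the two letters.\<close>

lemma act_ts2:
  assumes "distinct [0, k, l]"
  shows "act (Lin k 0 d * Lin l 0 d) (wsum (ts2 k l)) e = act (- 2 * Kh d * Lin k l (- (2 * d))) (wrd [] [k, l]) e"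
proof -
  let ?P = "Lin k 0 d * Lin l 0 d"
  have w: "act ?P (wrd [k, l] []) = act (Lin k 0 (- d) * Lin l 0 (- d)) (wrd [] [k, l])"
    "act ?P (wrd [k] [l]) = act (Lin k 0 (- d) * Lin l 0 d) (wrd [] [k, l])"
    using wrd_all_after[of "[k, l]" "[]" 1] wrd_all_after[of "[k]" "[l]" "Lin l 0 d"] assms
    by (simp_all add: mult.commute)
  have "Lin k 0 (- d) * Lin l 0 (- d) - 2 * (Lin k 0 (- d) * Lin l 0 d) + Lin k 0 d * Lin l 0 d
      = - 2 * Kh d * Lin k l (- (2 * d))"
    unfolding Lin_def Kh_simps by (simp add: algebra_simps)
  note this = arg_cong[OF this, of "\<lambda>P. act P (wrd [] [k, l]) e"]
  then show ?thesis
    by (simp only: act_add act_diff act_numeral ts2_def act_wsum list.map sum_list.Cons sum_list.Nil prod.case w)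
       (simp add: cc_uminus algebra_simps)
qed

text \<open>The cubic combination splits into two terms. Each contains the exchange factor of one
  neighbouring pair, for r = d, and a factor that involves only v and the remaining letter; so each
  term cancels when its own pair is exchanged.\<close>

lemma act_ts3:
  assumes "distinct [0, k, l, m]"
  shows "act (Lin k 0 d * Lin l 0 d * Lin m 0 d) (wsum (ts3 k l m)) e
    = act (2 * Kh d * Lin m 0 (2 * d) * Lin k l (- d)) (wrd [] [k, l, m]) e
      + act (- 2 * Kh d * Lin k 0 (- (2 * d)) * Lin l m (- d)) (wrd [] [k, l, m]) e"
proof -
  let ?P = "Lin k 0 d * Lin l 0 d * Lin m 0 d"
  have w: "act ?P (wrd [k, l, m] []) = act (Lin k 0 (- d) * Lin l 0 (- d) * Lin m 0 (- d)) (wrd [] [k, l, m])"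
    "act ?P (wrd [k, l] [m]) = act (Lin k 0 (- d) * Lin l 0 (- d) * Lin m 0 d) (wrd [] [k, l, m])"
    "act ?P (wrd [k] [l, m]) = act (Lin k 0 (- d) * Lin l 0 d * Lin m 0 d) (wrd [] [k, l, m])"
    using wrd_all_after[of "[k, l, m]" "[]" 1] wrd_all_after[of "[k, l]" "[m]" "Lin m 0 d"]
      wrd_all_after[of "[k]" "[l, m]" "Lin l 0 d * Lin m 0 d"] assms
    by (simp_all add: mult_ac)
  have "Lin k 0 (- d) * Lin l 0 (- d) * Lin m 0 (- d) - 3 * (Lin k 0 (- d) * Lin l 0 (- d) * Lin m 0 d)
      + 3 * (Lin k 0 (- d) * Lin l 0 d * Lin m 0 d) - Lin k 0 d * Lin l 0 d * Lin m 0 d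
      = 2 * Kh d * Lin m 0 (2 * d) * Lin k l (- d) + (- 2 * Kh d * Lin k 0 (- (2 * d)) * Lin l m (- d))"
    unfolding Lin_def Kh_simps by (simp add: algebra_simps)
  note this = arg_cong[OF this, of "\<lambda>P. act P (wrd [] [k, l, m]) e"]
  then show ?thesis
    by (simp only: act_add act_diff act_numeral ts3_def act_wsum list.map sum_list.Cons sum_list.Nil prod.case w)
       (simp add: cc_uminus algebra_simps)
qed

lemma serre2:
  assumes r: "r = 2 * d"
  shows "serre 2 X Y p q f = 0"
proof -
  let ?ts = "ts2 1 2 @ ts2 2 1"
  have "act (Lin 1 0 d * Lin 2 0 d) (wsum ?ts) e = 0" for e
    using act_ts2[of 1 2] act_ts2[of 2 1] wrd_swap_neg[of 1 2 "[]" "[]" "- 2 * Kh d"]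
    unfolding wsum_append r by (simp add: mult.commute[of "Lin 2 0 d"])
  then have "act (Lin 1 0 d) (wsum ?ts) e = 0" for e
    by (rule wsum_step) (auto simp: ts2_def)
  then have "act 1 (wsum ?ts) e = 0" for e
    by (intro wsum_step[of 1 1]) (auto simp: ts2_def)
  then have z: "wsum ?ts e = 0" for e by simp
  let ?e = "\<lambda>k. if k = 0 then q else p k"
  have u: "[1..<Suc 2] = [1, 2]" by (simp add: upt_rec)
  have p: "{1..2} = insert 1 (insert (2 :: nat) {})" by auto
  have "serre 2 X Y p q f = wsum ?ts ?e"
    unfolding serre_def p u
    by (simp add: sum_over_permutations_insert comm_def X_diff Fock_diff X_Fock Y_Fock f wsum_def wrd_def Xs_simps
        transpose_def cc_uminus ts2_def)
  then show ?thesis by (simp only: z)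
qed

lemma serre3:
  assumes r: "r = d"
  shows "serre 3 X Y p q f = 0"
proof -
  let ?ts = "ts3 1 2 3 @ ts3 2 1 3 @ ts3 1 3 2 @ ts3 3 1 2 @ ts3 2 3 1 @ ts3 3 2 1"
  have P: "Lin 2 0 d * Lin 1 0 d * Lin 3 0 d = Lin 1 0 d * Lin 2 0 d * Lin 3 0 d"
    "Lin 1 0 d * Lin 3 0 d * Lin 2 0 d = Lin 1 0 d * Lin 2 0 d * Lin 3 0 d"
    "Lin 3 0 d * Lin 1 0 d * Lin 2 0 d = Lin 1 0 d * Lin 2 0 d * Lin 3 0 d"
    "Lin 2 0 d * Lin 3 0 d * Lin 1 0 d = Lin 1 0 d * Lin 2 0 d * Lin 3 0 d"
    "Lin 3 0 d * Lin 2 0 d * Lin 1 0 d = Lin 1 0 d * Lin 2 0 d * Lin 3 0 d"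
    by (simp_all add: mult_ac)
  \<comment> \<open>Of the six cancellations three exchange the first two letters and three the last
    two, one for each choice of the letter held fixed.\<close>
  have "act (Lin 1 0 d * Lin 2 0 d * Lin 3 0 d) (wsum ?ts) e = 0" for e
    using act_ts3[of 1 2 3 e] act_ts3[of 2 1 3 e] act_ts3[of 1 3 2 e] act_ts3[of 3 1 2 e] act_ts3[of 2 3 1 e] act_ts3[of 3 2 1 e]
      wrd_swap_neg[of 1 2 "[]" "[3]" "2 * Kh d * Lin 3 0 (2 * d)" e]
      wrd_swap_neg[of 1 3 "[]" "[2]" "2 * Kh d * Lin 2 0 (2 * d)" e]
      wrd_swap_neg[of 2 3 "[]" "[1]" "2 * Kh d * Lin 1 0 (2 * d)" e]
      wrd_swap_neg[of 1 2 "[3]" "[]" "- 2 * Kh d * Lin 3 0 (- (2 * d))" e]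
      wrd_swap_neg[of 1 3 "[2]" "[]" "- 2 * Kh d * Lin 2 0 (- (2 * d))" e]
      wrd_swap_neg[of 2 3 "[1]" "[]" "- 2 * Kh d * Lin 1 0 (- (2 * d))" e]
    unfolding wsum_append r P by simp
  then have "act (Lin 1 0 d * Lin 2 0 d) (wsum ?ts) e = 0" for e
    by (rule wsum_step) (auto simp: ts3_def)
  then have "act (Lin 1 0 d) (wsum ?ts) e = 0" for e
    by (rule wsum_step) (auto simp: ts3_def)
  then have "act 1 (wsum ?ts) e = 0" for e
    by (intro wsum_step[of 1 1]) (auto simp: ts3_def)
  then have z: "wsum ?ts e = 0" for e by simp
  let ?e = "\<lambda>k. if k = 0 then q else p k"
  have u: "[1..<Suc 3] = [1, 2, 3]" by (simp add: upt_rec)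
  have p: "{1..3} = insert 1 (insert 2 (insert (3 :: nat) {}))" by auto
  have "serre 3 X Y p q f = wsum ?ts ?e"
    unfolding serre_def p u
    by (simp add: sum_over_permutations_insert comm_def X_diff Fock_diff X_Fock Y_Fock f wsum_def wrd_def Xs_simps
        transpose_def cc_uminus ts3_def)
  then show ?thesis by (simp only: z)
qed

end

section \<open>Shifts and products of annihilation parts\<close>

text \<open>Upper negation of binomials. It allows a delta function of shifted variables to be
  expanded from either side.\<close>

lemma upow_dual: "upow a (- k - 1) s = upow (- a) (- s - 1) k"
proof (cases "s \<le> - k - 1")
  case True
  define m where "m = nat (- k - 1 - s)"
  have m: "nat (- s - 1 - k) = m" "of_int k + of_nat m = (of_int (- s - 1) :: complex)"
    using True by (simp_all add: m_def algebra_simps)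
  have "(of_int (- k - 1) :: complex) gchoose m = (-1) ^ m * ((of_int (k + 1) + of_nat m - 1) gchoose m)"
    using gbinomial_minus[of "of_int (k + 1) :: complex" m] by simp
  also have "of_int (k + 1) + of_nat m - 1 = (of_int (- s - 1) :: complex)" using m(2) by simp
  finally have "((of_int (- k - 1) :: complex) gchoose m) * a ^ m = (of_int (- s - 1) gchoose m) * (- a) ^ m"
    by (simp add: power_minus[of a])
  then show ?thesis using True by (simp add: upow_def m(1) flip: m_def)
qed (simp add: upow_def)

text \<open>u d/du (u + c hbar)^r = r u (u + c hbar)^(r-1), read off at u^p.\<close>

lemma upow_absorb: "of_int p * upow c r p = of_int r * upow c (r - 1) (p - 1)"
proof (cases "p \<le> r")
  case True
  let ?m = "nat (r - p)"
  have "of_int r - of_nat ?m = (of_int p :: complex)" using True by simp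
  then have g: "of_int p * (of_int r gchoose ?m) = (of_int r :: complex) * (of_int (r - 1) gchoose ?m)"
    using gbinomial_absorb_comp[of "of_int r :: complex" ?m] by simp
  have "of_int p * upow c r p = fps_const (of_int p * (of_int r gchoose ?m)) * (fps_const c * fps_X) ^ ?m"
    using True by (simp add: upow_alt mult.assoc fps_of_int flip: fps_const_mult)
  also have "\<dots> = of_int r * upow c (r - 1) (p - 1)"
    unfolding g using True by (simp add: upow_alt mult.assoc fps_of_int flip: fps_const_mult)
  finally show ?thesis .
qed simp

lemma upow_vandermonde_on:
  assumes "finite S" "\<And>x. x \<notin> S \<Longrightarrow> upow c k x * upow c l (p - x) = 0"
  shows "(\<Sum>x\<in>S. upow c k x * upow c l (p - x)) = upow c (k + l) p"
proof (cases "p \<le> k + l")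
  case True
  have "(\<Sum>x\<in>S. upow c k x * upow c l (p - x)) = (\<Sum>x\<in>S \<union> {p - l..k}. upow c k x * upow c l (p - x))"
    by (rule sum.mono_neutral_left) (use assms in auto)
  also have "\<dots> = (\<Sum>x = p - l..k. upow c k x * upow c l (p - x))"
  proof (rule sum.mono_neutral_right)
    have "upow c k x * upow c l (p - x) = 0" if "x \<notin> {p - l..k}" for x
      using that by (cases "x \<le> k") auto
    then show "\<forall>i\<in>S \<union> {p - l..k} - {p - l..k}. upow c k i * upow c l (p - i) = 0" by blast
  qed (use assms in auto)
  finally show ?thesis unfolding upow_vandermonde[OF True] .
next
  case False
  have "upow c k x * upow c l (p - x) = 0" for x using False by (cases "x \<le> k") auto
  then have "(\<Sum>x\<in>S. upow c k x * upow c l (p - x)) = 0" by (intro sum.neutral) blast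
  then show ?thesis using False by simp
qed

lemma upow_vandermonde_hsum:
  "hsummable (\<lambda>x. sc (upow c k x) * sc (upow c l (p - x)))"
  "hsum (\<lambda>x. sc (upow c k x) * sc (upow c l (p - x))) = sc (upow c (k + l) p)"
proof -
  have z: "upow c k x * upow c l (p - x) = 0" if "x \<notin> {p - l..k}" for x
    using that by (cases "x \<le> k") auto
  then have z': "sc (upow c k x) * sc (upow c l (p - x)) = 0" if "x \<notin> {p - l..k}" for x
    using that by (metis sc_mult sc_simps(1))
  show "hsummable (\<lambda>x. sc (upow c k x) * sc (upow c l (p - x)))"
    by (rule hsum_finite(1)[of "{p - l..k}"], simp, rule z')
  have "hsum (\<lambda>x. sc (upow c k x) * sc (upow c l (p - x))) = (\<Sum>x\<in>{p - l..k}. sc (upow c k x) * sc (upow c l (p - x)))"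
    by (rule hsum_finite(2), simp, rule z')
  also have "\<dots> = sc (\<Sum>x\<in>{p - l..k}. upow c k x * upow c l (p - x))"
    by (simp add: sc_sum sc_mult)
  also have "\<dots> = sc (upow c (k + l) p)" by (subst upow_vandermonde_on) (use z in auto)
  finally show "hsum (\<lambda>x. sc (upow c k x) * sc (upow c l (p - x))) = sc (upow c (k + l) p)" .
qed

lemma upow_compose_nat:
  assumes "k \<le> l"
  shows "(\<Sum>s = k..l. upow a (int s) (int k) * upow c (int l) (int s)) = upow (a + c) (int l) (int k)"
proof -
  have "(\<Sum>s = k..l. upow a (int s) (int k) * upow c (int l) (int s)) = (\<Sum>s = int k..int l. upow a s (int k) * upow c (int l) s)"
    by (rule sum.reindex_bij_witness[of _ nat int]) auto
  also have "\<dots> = upow (c + a) (int l) (int k)" by (rule upow_compose) (use assms in simp)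
  finally show ?thesis by (simp add: add.commute)
qed

lemma sc_upow_nat: "k \<le> s \<Longrightarrow> sc (upow a (int s) (int k)) = cc (of_nat (s choose k) * a ^ (s - k)) * hb ^ (s - k)"
  by (simp add: upow_def sc_mult sc_power binomial_symmetric[of k s] binomial_gbinomial[symmetric] nat_diff_distrib')

definition shift_latt :: "complex \<Rightarrow> latt \<Rightarrow> latt" where
  "shift_latt c Z = map (\<lambda>(\<sigma>, \<gamma>, a). (\<sigma>, \<gamma>, a + c)) Z"

lemma mm_shift [simp]: "mm n (shift_latt c Z) \<beta> = mm n Z \<beta>"
  and sg_shift [simp]: "sg n (shift_latt c Z) \<beta> = sg n Z \<beta>"
  by (induction Z) (auto simp: mm_def sg_def shift_latt_def)

lemma mm_append: "mm n (Z @ Z') \<beta> = mm n Z \<beta> + mm n Z' \<beta>"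
  and sg_append: "sg n (Z @ Z') \<beta> = sg n Z \<beta> * sg n Z' \<beta>"
  and zs_append: "zs n (Z @ Z') \<beta> s = zs n Z \<beta> s + zs n Z' \<beta> s"
  by (simp_all add: mm_def sg_def zs_def)

text \<open>The coefficient binom(l,k) (-a-c)^(l-k) arises by composing two binomial expansions, one
  in -c and one in -a.\<close>

lemma Aop1_shift: "Aop1 i (a + c) l f = (\<Sum>s\<le>l. sc (upow (- c) (int l) (int s)) * Aop1 i a s f)"
proof -
  have A: "Aop1 i a s f = (\<Sum>k = 1..s. sc (upow (- a) (int s) (int k)) * dd i k f)" for a s
    unfolding Aop1_def by (rule sum.cong) (simp_all add: sc_upow_nat)
  have "(\<Sum>s\<le>l. sc (upow (- c) (int l) (int s)) * Aop1 i a s f)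
     = (\<Sum>s\<le>l. \<Sum>k = 1..s. sc (upow (- a) (int s) (int k)) * sc (upow (- c) (int l) (int s)) * dd i k f)"
    by (simp add: A sum_distrib_left mult_ac)
  also have "\<dots> = (\<Sum>k = 1..l. \<Sum>s = k..l. sc (upow (- a) (int s) (int k)) * sc (upow (- c) (int l) (int s)) * dd i k f)"
    by (simp add: sum.Sigma)
       (rule sum.reindex_bij_witness[of _ "\<lambda>(k, s). (s, k)" "\<lambda>(s, k). (k, s)"]; auto)
  also have "\<dots> = (\<Sum>k = 1..l. sc (\<Sum>s = k..l. upow (- a) (int s) (int k) * upow (- c) (int l) (int s)) * dd i k f)"
    by (simp add: sc_sum sc_mult sum_distrib_right)
  also have "\<dots> = Aop1 i (a + c) l f"
    unfolding A by (rule sum.cong) (simp_all add: upow_compose_nat)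
  finally show ?thesis ..
qed

lemma zs_shift: "cc (zs n (shift_latt c Z) \<beta> l) * hb ^ l = (\<Sum>s\<le>l. sc (upow (- c) (int l) (int s)) * (cc (zs n Z \<beta> s) * hb ^ s))"
proof (induction Z)
  case (Cons z Z)
  obtain \<sigma> \<gamma> a where z: "z = (\<sigma>, \<gamma>, a)" by (cases z)
  have p: "sc (upow (- a) (int s) 0) = cc ((- a) ^ s) * hb ^ s" for a s
    using sc_upow_nat[of 0 s "- a"] by simp
  have "(\<Sum>s = 0..l. upow (- a) (int s) (int 0) * upow (- c) (int l) (int s)) = upow (- a + - c) (int l) (int 0)"
    by (rule upow_compose_nat) simp
  then have "(\<Sum>s\<le>l. sc (upow (- a) (int s) 0 * upow (- c) (int l) (int s))) = sc (upow (- (a + c)) (int l) 0)"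
    by (simp add: atMost_atLeast0 flip: sc_sum)
  then have "(\<Sum>s\<le>l. sc (upow (- c) (int l) (int s)) * (cc ((- a) ^ s) * hb ^ s)) = cc ((- (a + c)) ^ l) * hb ^ l"
    unfolding p[symmetric] by (simp add: sc_mult mult.commute)
  from arg_cong[OF this[symmetric], of "\<lambda>x. cc (of_int (lev n \<gamma> \<beta>)) * x"]
  have "cc (of_int (lev n \<gamma> \<beta>) * (- (a + c)) ^ l) * hb ^ l
      = (\<Sum>s\<le>l. sc (upow (- c) (int l) (int s)) * (cc (of_int (lev n \<gamma> \<beta>) * (- a) ^ s) * hb ^ s))"
    by (simp add: cc_mult sum_distrib_left mult_ac)
  moreover have "zs n (shift_latt c (z # Z)) \<beta> l = of_int (lev n \<gamma> \<beta>) * (- (a + c)) ^ l + zs n (shift_latt c Z) \<beta> l"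
    "\<And>s. zs n (z # Z) \<beta> s = of_int (lev n \<gamma> \<beta>) * (- a) ^ s + zs n Z \<beta> s"
    by (simp_all add: z zs_def shift_latt_def)
  ultimately show ?case
    by (simp only: cc_add distrib_right Cons.IH distrib_left sum.distrib)
qed (simp add: zs_def shift_latt_def)

lemma Bop_shift: "Bop n (shift_terms c A) (shift_latt c Z) \<beta> l f = (\<Sum>s\<le>l. sc (upow (- c) (int l) (int s)) * Bop n A Z \<beta> s f)"
proof -
  have "Aop (shift_terms c A) l f = (\<Sum>s\<le>l. sc (upow (- c) (int l) (int s)) * Aop A s f)"
  proof (induction A)
    case (Cons t A)
    obtain x i a where t: "t = (x, i, a)" by (cases t)
    have "Aop (shift_terms c (t # A)) l f = cc x * Aop1 i (a + c) l f + Aop (shift_terms c A) l f"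
      by (simp add: t shift_terms_def Aop_simps)
    then show ?case
      unfolding Cons.IH Aop1_shift t Aop_simps by (simp add: distrib_left sum.distrib sum_distrib_left mult_ac)
  qed (simp add: shift_terms_def Aop_simps)
  then show ?thesis
    by (simp add: Bop_def zs_shift right_diff_distrib sum_subtractf sum_distrib_right mult.assoc)
qed

lemma Bop_append: "Bop n (A @ A') (Z @ Z') \<beta> s f = Bop n A Z \<beta> s f + Bop n A' Z' \<beta> s f"
  by (simp add: Bop_def Aop_simps zs_append cc_add algebra_simps)

text \<open>Newton's recursion starts at s = 1. Including s = 0 replaces r by r - mm, so that the
  recursion describes u d/du, up to sign, on the series with its leading power of u
  restored.\<close>

lemma Bop_0: "Bop n A Z \<beta> 0 f = - of_int (mm n Z \<beta>) * f"
proof -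
  have "Aop A 0 f = 0" by (induction A) (auto simp: Aop_simps Aop1_def)
  moreover have "zs n Z \<beta> 0 = of_int (mm n Z \<beta>)" by (induction Z) (auto simp: zs_def mm_def)
  ultimately show ?thesis by (simp add: Bop_def)
qed

lemma Bop_sum: "Bop n A Z \<beta> s (\<Sum>k\<in>K. h k) = (\<Sum>k\<in>K. Bop n A Z \<beta> s (h k))"
  by (induction K rule: infinite_finite_induct) (simp_all add: Bop_lin)

lemma triangle_box:
  fixes F :: "nat \<Rightarrow> nat \<Rightarrow> fock"
  assumes "\<And>s i. j < s + i \<Longrightarrow> F s i = 0"
  shows "(\<Sum>i\<le>j. \<Sum>s\<le>i. F s (i - s)) = (\<Sum>s\<le>j. \<Sum>i\<le>j. F s i)"
proof -
  have "(\<Sum>i\<le>j. \<Sum>s\<le>i. F s (i - s)) = (\<Sum>s\<le>j. \<Sum>i\<le>j - s. F s i)"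
    by (simp add: sum.Sigma)
       (rule sum.reindex_bij_witness[of _ "\<lambda>(s, i). (s + i, s)" "\<lambda>(i, s). (s, i - s)"]; auto)
  also have "\<dots> = (\<Sum>s\<le>j. \<Sum>i\<le>j. F s i)"
    by (rule sum.cong[OF refl], rule sum.mono_neutral_left) (auto intro!: assms)
  finally show ?thesis .
qed

text \<open>The substitution of u + c hbar in u^m times the sum of the coefficients at u^(-i). The
  substituted series satisfies the recursion of the shifted operators: the kernels combine by
  duality and Vandermonde, and absorption converts the degree i - m before the shift into j - m
  after it.\<close>

lemma phi_shift:
  assumes m_def: "m = mm n Z \<beta>"
  shows "phi (Bop n (shift_terms c A) (shift_latt c Z) \<beta>) j f
    = (\<Sum>i\<le>j. sc (upow c (m - int i) (m - int j)) * phi (Bop n A Z \<beta>) i f)"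
proof (rule phi_unique[symmetric, where W = "\<lambda>j. \<Sum>i\<le>j. sc (upow c (m - int i) (m - int j)) * phi (Bop n A Z \<beta>) i f"])
  let ?b = "Bop n A Z \<beta>" and ?b' = "Bop n (shift_terms c A) (shift_latt c Z) \<beta>"
  let ?p = "\<lambda>i. phi ?b i f"
  let ?W = "\<lambda>i j. sc (upow c (m - int i) (m - int j))"
  define psi where "psi j = (\<Sum>i\<le>j. ?W i j * ?p i)" for j
  fix j :: nat
  define T where "T k = sc (upow c (m - int k - 1) (m - int j - 1))" for k
  have b0: "(of_nat i - of_int m) * ?p i = (\<Sum>s\<le>i. ?b s (?p (i - s)))" for i
    using phi_newton[of i ?b f] by (simp add: atMost_atLeast0 sum.atLeast_Suc_atMost Bop_0 m_def algebra_simps)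
  \<comment> \<open>\<open>upow_dual\<close> rewrites the first kernel as a power with exponent
    -s-1, after which the sum is a Vandermonde convolution. The result depends on s + i
    only.\<close>
  have V: "(\<Sum>s'\<le>j. sc (upow (- c) (int s') (int s)) * ?W i (j - s')) = T (s + i)" for s i
  proof -
    let ?S = "(\<lambda>s'. - int s' - 1) ` {..j}"
    have "(\<Sum>s'\<le>j. upow (- c) (int s') (int s) * upow c (m - int i) (m - int (j - s')))
       = (\<Sum>x\<in>?S. upow c (- int s - 1) x * upow c (m - int i) (m - int j - 1 - x))"
    proof (subst sum.reindex)
      show "inj_on (\<lambda>s'. - int s' - 1) {..j}" by (auto simp: inj_on_def)
      show "(\<Sum>s'\<le>j. upow (- c) (int s') (int s) * upow c (m - int i) (m - int (j - s')))
        = sum ((\<lambda>x. upow c (- int s - 1) x * upow c (m - int i) (m - int j - 1 - x)) \<circ> (\<lambda>s'. - int s' - 1)) {..j}"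
        by (rule sum.cong) (auto simp: upow_dual[of c "int s"] of_nat_diff algebra_simps)
    qed
    also have "\<dots> = upow c (- int s - 1 + (m - int i)) (m - int j - 1)"
    proof (rule upow_vandermonde_on)
      fix x assume x: "x \<notin> ?S"
      have "x > - int s - 1 \<or> m - int j - 1 - x > m - int i"
      proof (rule ccontr)
        assume n: "\<not> ?thesis"
        then have "x = - int (nat (- x - 1)) - 1" "nat (- x - 1) \<le> j" by auto
        then show False using x by blast
      qed
      then show "upow c (- int s - 1) x * upow c (m - int i) (m - int j - 1 - x) = 0" by auto
    qed simp
    finally show ?thesis by (simp add: T_def sc_sum sc_mult algebra_simps flip: sc_mult sc_sum)
  qed
  have R: "?b' s' (psi (j - s')) = (\<Sum>s\<le>j. \<Sum>i\<le>j. sc (upow (- c) (int s') (int s)) * ?W i (j - s') * ?b s (?p i))" if "s' \<le> j" for s'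
  proof -
    have "?b' s' (psi (j - s')) = (\<Sum>s\<le>s'. \<Sum>i\<le>j - s'. sc (upow (- c) (int s') (int s)) * ?W i (j - s') * ?b s (?p i))"
      by (simp add: Bop_shift psi_def Bop_sum Bop_lin sum_distrib_left mult.assoc)
         (subst sum.swap, simp add: mult.left_commute)
    also have "\<dots> = (\<Sum>s\<le>s'. \<Sum>i\<le>j. sc (upow (- c) (int s') (int s)) * ?W i (j - s') * ?b s (?p i))"
    proof (rule sum.cong[OF refl], rule sum.mono_neutral_left)
      have z: "?W i (j - s') = 0" if "j - s' < i" for i using that by (simp del: of_nat_diff)
      show "\<forall>i\<in>{..j} - {..j - s'}. sc (upow (- c) (int s') (int s)) * ?W i (j - s') * ?b s (?p i) = 0" for s
      proof
        fix i assume "i \<in> {..j} - {..j - s'}"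
        then have "j - s' < i" by simp
        then show "sc (upow (- c) (int s') (int s)) * ?W i (j - s') * ?b s (?p i) = 0"
          by (simp only: z mult_zero_left mult_zero_right)
      qed
    qed auto
    also have "\<dots> = (\<Sum>s\<le>j. \<Sum>i\<le>j. sc (upow (- c) (int s') (int s)) * ?W i (j - s') * ?b s (?p i))"
      by (rule sum.mono_neutral_left) (use that in auto)
    finally show ?thesis .
  qed
  have "(\<Sum>s'\<le>j. ?b' s' (psi (j - s'))) = (\<Sum>s'\<le>j. \<Sum>s\<le>j. \<Sum>i\<le>j. sc (upow (- c) (int s') (int s)) * ?W i (j - s') * ?b s (?p i))"
    by (rule sum.cong) (auto simp: R)
  also have "\<dots> = (\<Sum>s\<le>j. \<Sum>s'\<le>j. \<Sum>i\<le>j. sc (upow (- c) (int s') (int s)) * ?W i (j - s') * ?b s (?p i))"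
    by (rule sum.swap)
  also have "\<dots> = (\<Sum>s\<le>j. \<Sum>i\<le>j. \<Sum>s'\<le>j. sc (upow (- c) (int s') (int s)) * ?W i (j - s') * ?b s (?p i))"
    by (rule sum.cong[OF refl]) (rule sum.swap)
  also have "\<dots> = (\<Sum>s\<le>j. \<Sum>i\<le>j. T (s + i) * ?b s (?p i))"
    by (simp only: sum_distrib_right[symmetric] V)
  also have "\<dots> = (\<Sum>i\<le>j. \<Sum>s\<le>i. T (s + (i - s)) * ?b s (?p (i - s)))"
    by (rule triangle_box[symmetric]) (simp add: T_def)
  also have "\<dots> = (\<Sum>i\<le>j. T i * ((of_nat i - of_int m) * ?p i))"
    unfolding b0 sum_distrib_left by (intro sum.cong) auto
  also have "\<dots> = (of_nat j - of_int m) * psi j"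
  proof -
    have sco: "sc (of_int k * w) = of_int k * sc w" for k :: int and w
      by (simp add: sc_mult fps_of_int[symmetric])
    have "of_int (m - int j) * ?W i j = of_int (m - int i) * T i" for i
      using arg_cong[OF upow_absorb[of "m - int j" c "m - int i"], of sc] unfolding sco T_def .
    then have "T i * ((of_nat i - of_int m) * ?p i) = (of_nat j - of_int m) * (?W i j * ?p i)" for i
    proof -
      assume "\<And>i. of_int (m - int j) * ?W i j = of_int (m - int i) * T i"
      then have "of_int (m - int j) * ?W i j * ?p i = of_int (m - int i) * T i * ?p i" by simp
      then show ?thesis by (simp add: algebra_simps)
    qed
    then show ?thesis by (simp add: psi_def sum_distrib_left)
  qed
  finally have "(of_nat j - of_int m) * psi j = (\<Sum>s'\<le>j. ?b' s' (psi (j - s')))" ..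
  then have "of_nat j * psi j = (\<Sum>s' = 1..j. ?b' s' (psi (j - s')))"
    by (simp add: atMost_atLeast0 sum.atLeast_Suc_atMost Bop_0 m_def algebra_simps)
  then show "of_nat j * (\<Sum>i\<le>j. ?W i j * ?p i) = (\<Sum>s' = 1..j. ?b' s' (\<Sum>i\<le>j - s'. ?W i (j - s') * ?p i))"
    unfolding psi_def .
qed simp

text \<open>The exponential of the sum of two commuting families is the product of the exponentials;
  the proof splits r as (r - j) + j.\<close>

lemma phi_append:
  "phi (Bop n (A @ A') (Z @ Z') \<beta>) r f = (\<Sum>j\<le>r. phi (Bop n A Z \<beta>) (r - j) (phi (Bop n A' Z' \<beta>) j f))"
proof (rule phi_unique[symmetric, where W = "\<lambda>r. \<Sum>j\<le>r. phi (Bop n A Z \<beta>) (r - j) (phi (Bop n A' Z' \<beta>) j f)"])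
  let ?b = "Bop n A Z \<beta>" and ?b' = "Bop n A' Z' \<beta>"
  fix r :: nat
  have c: "phi ?b k (?b' s g) = ?b' s (phi ?b k g)" for k s g
    by (rule phi_hom[symmetric]) (simp_all add: Bop_commute[of n A'] Bop_lin Bop_cc)
  have s: "phi ?b k (\<Sum>x\<in>K. h x) = (\<Sum>x\<in>K. phi ?b k (h x))" for k and h :: "nat \<Rightarrow> fock" and K
    by (induction K rule: infinite_finite_induct) (simp_all add: phi_Bop_lin)
  have "of_nat r * (\<Sum>j\<le>r. phi ?b (r - j) (phi ?b' j f))
     = (\<Sum>j\<le>r. of_nat (r - j) * phi ?b (r - j) (phi ?b' j f)) + (\<Sum>j\<le>r. phi ?b (r - j) (of_nat j * phi ?b' j f))"
  proof -
    have "phi ?b (r - j) (of_nat j * phi ?b' j f) = of_nat j * phi ?b (r - j) (phi ?b' j f)" for j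
      using phi_Bop_lin(1)[of n A Z \<beta> "r - j" "of_nat j"] by simp
    then show ?thesis
      by (simp add: sum_distrib_left of_nat_diff left_diff_distrib flip: sum.distrib)
  qed
  also have "(\<Sum>j\<le>r. of_nat (r - j) * phi ?b (r - j) (phi ?b' j f)) = (\<Sum>s = 1..r. \<Sum>j\<le>r - s. ?b s (phi ?b (r - s - j) (phi ?b' j f)))"
    unfolding phi_newton
    by (simp add: sum.Sigma)
       (rule sum.reindex_bij_witness[of _ "\<lambda>(s, j). (j, s)" "\<lambda>(j, s). (s, j)"]; auto simp: add.commute)
  also have "(\<Sum>j\<le>r. phi ?b (r - j) (of_nat j * phi ?b' j f)) = (\<Sum>s = 1..r. \<Sum>j\<le>r - s. ?b' s (phi ?b (r - s - j) (phi ?b' j f)))"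
    unfolding phi_newton s c
    by (simp add: sum.Sigma)
       (rule sum.reindex_bij_witness[of _ "\<lambda>(s, j). (s + j, s)" "\<lambda>(j, s). (s, j - s)"]; auto)
  finally show "of_nat r * (\<Sum>j\<le>r. phi ?b (r - j) (phi ?b' j f))
     = (\<Sum>s = 1..r. Bop n (A @ A') (Z @ Z') \<beta> s (\<Sum>j\<le>r - s. phi ?b (r - s - j) (phi ?b' j f)))"
    by (simp add: Bop_append Bop_sum flip: sum.distrib)
qed simp

text \<open>The substitution $u=v+c\hbar$.\<close>

definition dgn :: "complex \<Rightarrow> (int \<times> int \<Rightarrow> fock) \<Rightarrow> int \<Rightarrow> fock" where
  "dgn c W r = hsum (\<lambda>(p, q). sc (upow c p (r - q)) * W (p, q))"

lemma upow_nonzero: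
  assumes "fps_nth (sc (upow a k p) * w) N \<noteq> 0"
  shows "p \<le> k" "k - p \<le> int N" "\<not> zN N w"
proof -
  note n = sc_upow_nth_nonzero[OF assms]
  show "p \<le> k" "k - p \<le> int N" using n(1,2) by auto
  show "\<not> zN N w" unfolding zN_def using n(3) diff_le_self by blast
qed

lemma upow_not_zN: "\<not> zN N (sc (upow a k p) * w) \<Longrightarrow> p \<le> k \<and> k - p \<le> int N \<and> \<not> zN N w"
proof -
  assume "\<not> zN N (sc (upow a k p) * w)"
  then obtain m where m: "m \<le> N" "fps_nth (sc (upow a k p) * w) m \<noteq> 0" by (auto simp: zN_def)
  note n = upow_nonzero[OF m(2)]
  have "\<not> zN N w" using n(3) m(1) unfolding zN_def by (meson le_trans)
  then show ?thesis using n m(1) by auto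
qed

text \<open>On a sector the substitution is \<open>phi_shift\<close>, and the product with the
  second factor is \<open>phi_append\<close>.\<close>

lemma PH_dgn:
  assumes "f \<in> Fock n"
  shows "hsum (\<lambda>(a, b). sc (upow c a (t - b)) * PH n A Z a (PH n A' Z' b f))
    = PH n (shift_terms c A @ A') (shift_latt c Z @ Z') t f"
proof (rule Sec_eqI[where L = "Q n" and T = "\<lambda>f. hsum (\<lambda>(a, b). sc (upow c a (t - b)) * PH n A Z a (PH n A' Z' b f))"])
  note ph = endo_PH[unfolded Fock_FQ]
  have "A_endo (FQ n (Q n)) (\<lambda>f. hsum (\<lambda>x. sc (upow c (fst x) (t - snd x)) * PH n A Z (fst x) (PH n A' Z' (snd x) f)))"
    by (rule A_endo_family[OF csub_RQ])
       (use Nrm_summable[of _ n "\<lambda>a b. sc (upow c a (t - b))" A Z A' Z'] in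
         \<open>auto simp: Fock_FQ case_prod_unfold intro!: A_endo_lincomb(6)[OF csub_RQ A_endo_lincomb(7)[OF csub_RQ ph ph]]\<close>)
  then show "A_endo (FQ n (Q n)) (\<lambda>f. hsum (\<lambda>(a, b). sc (upow c a (t - b)) * PH n A Z a (PH n A' Z' b f)))"
    by (simp add: case_prod_unfold)
  show "A_endo (FQ n (Q n)) (\<lambda>f. PH n (shift_terms c A @ A') (shift_latt c Z @ Z') t f)"
    by (rule ph)
  show "f \<in> FQ n (Q n)" using assms by (simp add: Fock_FQ)
next
  fix \<beta> f assume f: "f \<in> Sec n \<beta>"
  let ?m = "mm n Z \<beta>" and ?m' = "mm n Z' \<beta>"
  let ?p = "phi (Bop n A Z \<beta>)" and ?p' = "phi (Bop n A' Z' \<beta>)"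
  let ?s = "cc (sg n Z \<beta>) * cc (sg n Z' \<beta>)"
  define g where "g = (\<lambda>(a, b). sc (upow c a (t - b)) * PH n A Z a (PH n A' Z' b f))"
  have P: "PH n A' Z' b f \<in> Sec n \<beta>" for b by (rule FS_FQ[OF FS_PH f])
  have g: "g (a, b) = (if a \<le> ?m \<and> b \<le> ?m' then ?s * (sc (upow c a (t - b)) * ?p (nat (?m - a)) (?p' (nat (?m' - b)) f)) else 0)" for a b
    unfolding g_def prod.case PH_Sec[OF P] unfolding PH_Sec[OF f] by (simp add: phi_Bop_lin mult_ac)
  have "hsum g = PH n (shift_terms c A @ A') (shift_latt c Z @ Z') t f"
  proof (cases "t \<le> ?m + ?m'")
    case True
    define R where "R = nat (?m + ?m' - t)"
    let ?S = "SIGMA j:{..R}. {..R - j}"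
    let ?h = "\<lambda>(j, i). (?m - int i, ?m' - int j)"
    have "hsum g = sum g (?h ` ?S)"
    proof (rule hsum_finite(2))
      fix x assume x: "x \<notin> ?h ` ?S"
      obtain a b where ab: "x = (a, b)" by (cases x)
      show "g x = 0"
      proof (rule ccontr)
        assume n: "g x \<noteq> 0"
        then have "a \<le> ?m" "b \<le> ?m'" by (auto simp: ab g split: if_splits)
        moreover have "t - b \<le> a"
        proof (rule ccontr)
          assume "\<not> ?thesis"
          then have "upow c a (t - b) = 0" by simp
          then show False using n by (auto simp: ab g split: if_splits)
        qed
        ultimately have "x = ?h (nat (?m' - b), nat (?m - a))" "(nat (?m' - b), nat (?m - a)) \<in> ?S"
          by (auto simp: ab R_def)
        then show False using x by blast
      qed
    qed simp
    also have "\<dots> = (\<Sum>(j, i)\<in>?S. g (?m - int i, ?m' - int j))"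
      by (subst sum.reindex) (auto simp: inj_on_def case_prod_unfold)
    also have "\<dots> = (\<Sum>j\<le>R. \<Sum>i\<le>R - j. g (?m - int i, ?m' - int j))"
      by (simp add: sum.Sigma)
    also have "\<dots> = (\<Sum>j\<le>R. ?s * (\<Sum>i\<le>R - j. sc (upow c (?m - int i) (?m - int (R - j))) * ?p i (?p' j f)))"
    proof (rule sum.cong[OF refl])
      fix j assume "j \<in> {..R}"
      then have "t - (?m' - int j) = ?m - int (R - j)" using True by (simp add: R_def of_nat_diff)
      then show "(\<Sum>i\<le>R - j. g (?m - int i, ?m' - int j)) = ?s * (\<Sum>i\<le>R - j. sc (upow c (?m - int i) (?m - int (R - j))) * ?p i (?p' j f))"
        by (simp only: g sum_distrib_left) simp
    qed
    also have "\<dots> = PH n (shift_terms c A @ A') (shift_latt c Z @ Z') t f"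
      unfolding phi_shift[OF refl, symmetric] PH_Sec[OF f] phi_append
      using True by (simp add: mm_append sg_append cc_mult R_def sum_distrib_left)
    finally show ?thesis .
  next
    case False
    have "g x = 0" for x
    proof -
      obtain a b where ab: "x = (a, b)" by (cases x)
      show ?thesis
      proof (cases "a \<le> ?m \<and> b \<le> ?m'")
        case True
        then have "a < t - b" using False by linarith
        then show ?thesis by (auto simp: ab g)
      qed (auto simp: ab g)
    qed
    then have "g = (\<lambda>x. 0)" by (rule ext)
    then have "hsum g = 0" by simp
    then show ?thesis using False by (simp add: PH_Sec[OF f] mm_append)
  qed
  then show "hsum (\<lambda>(a, b). sc (upow c a (t - b)) * PH n A Z a (PH n A' Z' b f)) = PH n (shift_terms c A @ A') (shift_latt c Z @ Z') t f"
    unfolding g_def .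
qed

section \<open>Restriction of normally ordered products to a diagonal\<close>

lemma hsummable_box:
  assumes "\<And>N. finite (I N)" "\<And>x N. fps_nth (g x) N \<noteq> 0 \<Longrightarrow> x \<in> I N"
  shows "hsummable g"
  by (rule hsummableI) (use assms in blast)

lemma hsummable_box2:
  assumes "\<And>N. finite (I N)" "\<And>i j N. fps_nth (g i j) N \<noteq> 0 \<Longrightarrow> (i, j) \<in> I N"
  shows "hsummable (\<lambda>(i, j). g i j)"
  by (rule hsummable_box[of I]) (use assms in \<open>auto simp: case_prod_unfold\<close>)

lemma Mz_neg: "s < 0 \<Longrightarrow> Mz w s = 0"
  by (simp add: Mz_def)

lemma Mz_nonneg: "\<not> zN N (x * Mz w s) \<Longrightarrow> 0 \<le> s" "\<not> zN N (Mz w s * x) \<Longrightarrow> 0 \<le> s" "\<not> zN N (Mz w s) \<Longrightarrow> 0 \<le> s"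
  by (auto simp: Mz_def zN_def split: if_splits)

lemma Mz_mult:
  "hsum (\<lambda>j. Mz w (y - j) * Mz w' j) = Mz (w * w') y"
proof -
  have "hsum (\<lambda>j. Mz w (y - j) * Mz w' j) = (\<Sum>j = 0..y. Mz w (y - j) * Mz w' j)"
    by (rule hsum_finite(2)) (auto simp: Mz_def)
  also have "\<dots> = Mz (w * w') y"
  proof (cases "0 \<le> y")
    case True
    have "(\<Sum>j = 0..y. Mz w (y - j) * Mz w' j) = (\<Sum>j = 0..nat y. fps_nth w' j * fps_nth w (nat y - j))"
      by (rule sum.reindex_bij_witness[of _ int nat]) (use True in \<open>auto simp: Mz_def nat_diff_distrib mult.commute\<close>)
    then show ?thesis using True by (simp add: Mz_def fps_mult_nth mult.commute[of w])
  qed (simp add: Mz_def)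
  finally show ?thesis .
qed

text \<open>(u + c hbar)^(a+i) splits as (u + c hbar)^a (u + c hbar)^i, and the second factor is
  absorbed into the Taylor shift of w.\<close>

lemma Tsh_Mz:
  "hsum (\<lambda>i. sc (upow c (a + i) z) * Mz w i) = hsum (\<lambda>x. sc (upow c a (z - x)) * Mz (Tsh c w) x)"
proof -
  define g where "g i x = sc (upow c a (z - x)) * (sc (upow c i x) * Mz w i)" for i x
  have s: "hsummable (\<lambda>(i, x). g i x)"
  proof (rule hsummable_box2[of "\<lambda>N. {0..z - a + 2 * int N} \<times> {0..z - a + int N}"])
    show "(i, x) \<in> {0..z - a + 2 * int N} \<times> {0..z - a + int N}" if nz: "fps_nth (g i x) N \<noteq> 0" for i x N
    proof -
      note n = upow_nonzero[OF nz[unfolded g_def]]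
      note n' = upow_not_zN[OF n(3)]
      have "0 \<le> i" using n' Mz_nonneg(3) by blast
      moreover have "0 \<le> x" using n(3) \<open>0 \<le> i\<close> by (cases "x < 0") auto
      ultimately show ?thesis using n(1,2) n' by auto
    qed
  qed simp
  have 1: "hsum (g i) = sc (upow c (a + i) z) * Mz w i" for i
  proof -
    have "hsum (\<lambda>x. Mz w i * (sc (upow c i x) * sc (upow c a (z - x)))) = Mz w i * sc (upow c (i + a) z)"
      unfolding hsum_mult(2)[OF upow_vandermonde_hsum(1)] upow_vandermonde_hsum(2) ..
    then show ?thesis by (simp add: g_def[abs_def] mult_ac add.commute)
  qed
  have 2: "hsum (\<lambda>i. g i x) = sc (upow c a (z - x)) * Mz (Tsh c w) x" for x
  proof -
    let ?h = "\<lambda>i. sc (upow c i x) * Mz w i"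
    have h: "hsummable (\<lambda>k. ?h (int k)) \<longleftrightarrow> hsummable ?h" "hsum (\<lambda>k. ?h (int k)) = hsum ?h"
      by (rule hsum_int_nat; simp add: Mz_neg)+
    show ?thesis
    proof (cases "0 \<le> x")
      case True
      have "hsummable (\<lambda>k. sc (upow c (int k) (int (nat x))) * fps_nth w k)" by (rule Tsh_summable)
      then have "hsummable ?h" unfolding h(1)[symmetric] using True by (simp add: Mz_def)
      moreover have "hsum ?h = Mz (Tsh c w) x"
        unfolding h(2)[symmetric] using True by (simp add: Mz_def Tsh_nth)
      ultimately show ?thesis unfolding g_def by (simp add: hsum_mult(2))
    next
      case False
      then have "g i x = 0" for i by (cases "0 \<le> i") (auto simp: g_def Mz_neg)
      then show ?thesis using False by (simp add: Mz_neg)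
    qed
  qed
  show ?thesis using hsum_swap(2)[OF s] by (simp add: 1 2)
qed

lemma Tsh_Mz2:
  "hsum (\<lambda>(i, j). sc (upow c (a + i) (r - j)) * (Mz w i * Mz w' j)) = hsum (\<lambda>y. sc (upow c a (r - y)) * Mz (Tsh c w * w') y)"
proof -
  define g where "g i j = sc (upow c (a + i) (r - j)) * (Mz w i * Mz w' j)" for i j
  define h where "h j x = sc (upow c a (r - j - x)) * (Mz (Tsh c w) x * Mz w' j)" for j x
  have nn: "0 \<le> i \<and> 0 \<le> j" if "\<not> zN N (Mz u i * Mz u' j)" for u u' N i j
    using Mz_nonneg(1)[OF that] Mz_nonneg(2)[OF that] by simp
  have s: "hsummable (\<lambda>(i, j). g i j)"
  proof (rule hsummable_box2[of "\<lambda>N. {0..r - a + int N} \<times> {0..r - a + int N}"])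
    show "(i, j) \<in> {0..r - a + int N} \<times> {0..r - a + int N}" if nz: "fps_nth (g i j) N \<noteq> 0" for i j N
      using upow_nonzero[OF nz[unfolded g_def]] nn[of N w i w' j] by auto
  qed simp
  have s': "hsummable (\<lambda>(j, x). h j x)"
  proof (rule hsummable_box2[of "\<lambda>N. {0..r - a + int N} \<times> {0..r - a + int N}"])
    show "(j, x) \<in> {0..r - a + int N} \<times> {0..r - a + int N}" if nz: "fps_nth (h j x) N \<noteq> 0" for j x N
      using upow_nonzero[OF nz[unfolded h_def]] nn[of N "Tsh c w" x w' j] by auto
  qed simp
  have sw: "hsummable (\<lambda>i. sc (upow c (a + i) z) * Mz w i)" for z
  proof (rule hsummable_box[of "\<lambda>N. {0..z - a + int N}"])
    show "i \<in> {0..z - a + int N}" if nz: "fps_nth (sc (upow c (a + i) z) * Mz w i) N \<noteq> 0" for i N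
      using upow_nonzero[OF nz] Mz_nonneg(3)[of N w i] by auto
  qed simp
  have sx: "hsummable (\<lambda>x. sc (upow c a (z - x)) * Mz (Tsh c w) x)" for z
  proof (rule hsummable_box[of "\<lambda>N. {0..z - a + int N}"])
    show "i \<in> {0..z - a + int N}" if nz: "fps_nth (sc (upow c a (z - i)) * Mz (Tsh c w) i) N \<noteq> 0" for i N
      using upow_nonzero[OF nz] Mz_nonneg(3)[of N "Tsh c w" i] by auto
  qed simp
  have 1: "hsum (\<lambda>i. g i j) = hsum (h j)" for j
  proof -
    have "hsum (\<lambda>i. g i j) = Mz w' j * hsum (\<lambda>i. sc (upow c (a + i) (r - j)) * Mz w i)"
      unfolding hsum_mult(2)[OF sw, symmetric] by (simp add: g_def mult_ac)
    also have "\<dots> = Mz w' j * hsum (\<lambda>x. sc (upow c a (r - j - x)) * Mz (Tsh c w) x)"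
      unfolding Tsh_Mz ..
    also have "\<dots> = hsum (h j)"
      unfolding hsum_mult(2)[OF sx, symmetric] by (simp add: h_def[abs_def] mult_ac)
    finally show ?thesis .
  qed
  have b: "bij (\<lambda>(y, j). (j, y - j :: int))" by (rule o_bij[of "\<lambda>(j, x). (x + j, j)"]) auto
  let ?k = "\<lambda>y j. h j (y - j)"
  have e: "(\<lambda>x. case (case x of (y, j) \<Rightarrow> (j, y - j)) of (j, x) \<Rightarrow> h j x) = (\<lambda>(y, j). ?k y j)" by auto
  have k: "hsummable (\<lambda>(y, j). ?k y j)" "hsum (\<lambda>(y, j). ?k y j) = hsum (\<lambda>(j, x). h j x)"
    using hsum_reindex[OF b, of "\<lambda>(j, x). h j x"] s' unfolding e by blast+
  have 3: "hsum (?k y) = sc (upow c a (r - y)) * Mz (Tsh c w * w') y" for y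
  proof -
    have "hsummable (\<lambda>j. Mz (Tsh c w) (y - j) * Mz w' j)"
      by (rule hsum_finite(1)[of "{0..y}"]) (auto simp: Mz_def)
    from hsum_mult(2)[OF this, of "sc (upow c a (r - y))"] show ?thesis
      by (simp add: h_def Mz_mult)
  qed
  have "hsum (\<lambda>(i, j). g i j) = hsum (\<lambda>j. hsum (h j))"
    using hsum_swap(2)[OF s] hsum_Sigma(3)[OF s] by (simp add: 1)
  also have "\<dots> = hsum (\<lambda>y. hsum (?k y))"
    using hsum_Sigma(3)[OF s'] hsum_Sigma(3)[OF k(1)] k(2) by simp
  finally show ?thesis by (simp add: g_def 3)
qed

text \<open>Setting u = v + c hbar concatenates the data, those of the first operator being shifted
  by c. The sums over annihilation modes and over the exponents of the product may be exchanged,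
  because \<open>upow\<close> confines the exponents once modes and order are fixed.\<close>

lemma dgn_Nrm:
  assumes f: "f \<in> Fock n"
  shows "dgn c (Nrm n (MM C \<delta>) A Z (MM C' \<delta>') A' Z' f) r
    = hsum (\<lambda>y. Mz (MM (shift_terms c C @ C') (\<delta> + \<delta>')) y * PH n (shift_terms c A @ A') (shift_latt c Z @ Z') (r - y) f)"
proof -
  let ?M = "Mz (MM C \<delta>)" and ?M' = "Mz (MM C' \<delta>')" and ?w = "MM (shift_terms c C @ C') (\<delta> + \<delta>')"
  define G where "G x = PH n A Z (fst x) (PH n A' Z' (snd x) f)" for x
  have "hsummable (\<lambda>(r, t). 1 * PH n A Z r (PH n A' Z' t f))" by (rule Nrm_summable[OF f])
  then have "hsummable G" by (simp add: G_def[abs_def] case_prod_unfold)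
  then have "finite {x. \<exists>m\<le>N. fps_nth (G x) m \<noteq> 0}" for N by (rule hsummable_upto)
  moreover have "{x. \<exists>m\<le>N. fps_nth (G x) m \<noteq> 0} = {x. \<not> zN N (G x)}" for N by (auto simp: zN_def)
  ultimately have fin: "finite {x. \<not> zN N (G x)}" for N by metis
  have w: "Tsh c (MM C \<delta>) * MM C' \<delta>' = ?w" by (simp add: Tsh_MM MM_append)
  have zm: "\<not> zN N v" if "\<not> zN N (u * v)" for N u v using that zN_mult by blast
  define g where "g x p = sc (upow c (fst p) (r - snd p)) * (?M (fst p - fst x) * ?M' (snd p - snd x) * G x)" for x p
  have g: "hsummable (\<lambda>(x, p). g x p)"
  proof (rule hsummable_box2[of "\<lambda>N. SIGMA x:{x. \<not> zN N (G x)}. {fst x..int N + r - snd x} \<times> {snd x..int N + r - fst x}"])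
    fix x p N assume nz: "fps_nth (g x p) N \<noteq> 0"
    note n = upow_nonzero[OF nz[unfolded g_def]]
    have "\<not> zN N (?M (fst p - fst x) * (?M' (snd p - snd x) * G x))" using n(3) by (simp add: mult.assoc)
    then have "\<not> zN N (G x)" "0 \<le> snd p - snd x" "0 \<le> fst p - fst x"
      using zm Mz_nonneg(2) by blast+
    then show "(x, p) \<in> (SIGMA x:{x. \<not> zN N (G x)}. {fst x..int N + r - snd x} \<times> {snd x..int N + r - fst x})"
      using n(1,2) by (cases p) auto
  qed (rule finite_SigmaI[OF fin], simp)
  define h where "h x y = sc (upow c (fst x) (r - snd x - y)) * (Mz ?w y * G x)" for x y
  have h: "hsummable (\<lambda>(x, y). h x y)"
  proof (rule hsummable_box2[of "\<lambda>N. SIGMA x:{x. \<not> zN N (G x)}. {0..int N + r - snd x - fst x}"])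
    fix x y N assume nz: "fps_nth (h x y) N \<noteq> 0"
    note n = upow_nonzero[OF nz[unfolded h_def]]
    have "\<not> zN N (G x)" "0 \<le> y" using n(3) zm Mz_nonneg(2) by blast+
    then show "(x, y) \<in> (SIGMA x:{x. \<not> zN N (G x)}. {0..int N + r - snd x - fst x})"
      using n(1,2) by auto
  qed (rule finite_SigmaI[OF fin], simp)
  have gh: "hsum (g x) = hsum (h x)" for x
  proof -
    obtain a b where x: "x = (a, b)" by (cases x)
    let ?k = "\<lambda>p. sc (upow c (fst p) (r - snd p)) * (?M (fst p - a) * ?M' (snd p - b))"
    let ?K = "\<lambda>(i, j). sc (upow c (a + i) (r - b - j)) * (?M i * ?M' j)"
    let ?L = "\<lambda>y. sc (upow c a (r - b - y)) * Mz ?w y"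
    have e: "?k = (\<lambda>p. ?K (p - (a, b)))"
      by (auto simp: fun_eq_iff case_prod_unfold)
    have K: "hsummable ?K"
    proof (rule hsummable_box2[of "\<lambda>N. {0..r - b - a + int N} \<times> {0..r - b - a + int N}"])
      fix i j N assume nz: "fps_nth (sc (upow c (a + i) (r - b - j)) * (?M i * ?M' j)) N \<noteq> 0"
      note n = upow_nonzero[OF nz]
      have "0 \<le> i" "0 \<le> j" using n(3) Mz_nonneg by blast+
      then show "(i, j) \<in> {0..r - b - a + int N} \<times> {0..r - b - a + int N}" using n(1,2) by auto
    qed simp
    have L: "hsummable ?L"
    proof (rule hsummable_box[of "\<lambda>N. {0..r - b - a + int N}"])
      fix y N assume nz: "fps_nth (?L y) N \<noteq> 0"
      note n = upow_nonzero[OF nz]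
      have "0 \<le> y" using n(3) Mz_nonneg by blast
      then show "y \<in> {0..r - b - a + int N}" using n(1,2) by auto
    qed simp
    have k1: "hsummable ?k" using K unfolding e hsum_shift .
    have k2: "hsum ?k = hsum ?K" unfolding e hsum_shift ..
    have "hsum (g x) = G x * hsum ?k"
      unfolding hsum_mult(2)[OF k1, symmetric] by (simp add: g_def[abs_def] x mult_ac)
    also have "hsum ?k = hsum ?L" unfolding k2 Tsh_Mz2 w ..
    also have "G x * hsum ?L = hsum (h x)"
      unfolding hsum_mult(2)[OF L, symmetric] by (simp add: h_def[abs_def] x mult_ac)
    finally show ?thesis .
  qed
  have "dgn c (Nrm n (MM C \<delta>) A Z (MM C' \<delta>') A' Z' f) r = hsum (\<lambda>p. hsum (\<lambda>x. g x p))"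
    unfolding dgn_def
  proof (rule arg_cong[where f = hsum], rule ext)
    fix p :: "int \<times> int"
    have "hsummable (\<lambda>x. ?M (fst p - fst x) * ?M' (snd p - snd x) * G x)"
      using Nrm_summable[OF f, of "\<lambda>r t. ?M (fst p - r) * ?M' (snd p - t)" A Z A' Z']
      by (simp add: G_def case_prod_unfold)
    from hsum_mult(2)[OF this, of "sc (upow c (fst p) (r - snd p))"]
    show "(case p of (p, q) \<Rightarrow> sc (upow c p (r - q)) * Nrm n (MM C \<delta>) A Z (MM C' \<delta>') A' Z' f (p, q)) = hsum (\<lambda>x. g x p)"
      by (simp add: g_def Nrm_def G_def case_prod_unfold)
  qed
  also have "\<dots> = hsum (\<lambda>x. hsum (h x))" unfolding hsum_swap(2)[OF g, symmetric] gh ..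
  also have "\<dots> = hsum (\<lambda>y. hsum (\<lambda>x. h x y))" by (rule hsum_swap(2)[OF h])
  also have "\<dots> = hsum (\<lambda>y. Mz ?w y * PH n (shift_terms c A @ A') (shift_latt c Z @ Z') (r - y) f)"
  proof (rule arg_cong[where f = hsum], rule ext)
    fix y
    have s: "hsummable (\<lambda>x. sc (upow c (fst x) (r - y - snd x)) * G x)"
      using Nrm_summable[OF f, of "\<lambda>a b. sc (upow c a (r - y - b))" A Z A' Z']
      by (simp add: G_def case_prod_unfold)
    have "hsum (\<lambda>x. h x y) = Mz ?w y * hsum (\<lambda>x. sc (upow c (fst x) (r - y - snd x)) * G x)"
      unfolding hsum_mult(2)[OF s, symmetric] by (simp add: h_def mult_ac algebra_simps)
    also have "hsum (\<lambda>x. sc (upow c (fst x) (r - y - snd x)) * G x) = PH n (shift_terms c A @ A') (shift_latt c Z @ Z') (r - y) f"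
      using PH_dgn[OF f, of c "r - y" A Z A' Z'] by (simp add: G_def case_prod_unfold)
    finally show "hsum (\<lambda>x. h x y) = Mz ?w y * PH n (shift_terms c A @ A') (shift_latt c Z @ Z') (r - y) f" .
  qed
  finally show ?thesis .
qed

lemma PH_nil:
  assumes "f \<in> Fock n"
  shows "PH n [] [] t f = (if t = 0 then f else 0)"
proof (rule Sec_eqI[where L = "Q n" and T = "PH n [] [] t"])
  show "A_endo (FQ n (Q n)) (PH n [] [] t)" by (rule endo_PH[unfolded Fock_FQ])
  show "A_endo (FQ n (Q n)) (\<lambda>f. if t = 0 then f else 0)"
    using A_endo_lincomb(1,2)[OF csub_RQ] by (cases "t = 0") simp_all
  show "f \<in> FQ n (Q n)" using assms by (simp add: Fock_FQ)
  fix \<beta> f assume f: "f \<in> Sec n \<beta>"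
  have "phi (Bop n [] [] \<beta>) r f = (if r = 0 then f else 0)" for r
    by (rule phi_unique[symmetric]) (simp_all add: Bop_def Aop_simps zs_def)
  then show "PH n [] [] t f = (if t = 0 then f else 0)"
    by (auto simp: PH_Sec[OF f] mm_def sg_def)
qed

text \<open>X is its own normally ordered product with the identity, whose data are empty; its shift
  is the restriction of that product to a diagonal.\<close>

lemma shift_vop:
  assumes v: "vop n X C \<delta> A Z" and f: "f \<in> Fock n"
  shows "shift c X r f = hsum (\<lambda>y. Mz (MM (shift_terms c C) \<delta>) y * PH n (shift_terms c A) (shift_latt c Z) (r - y) f)"
proof -
  let ?N = "Nrm n (MM C \<delta>) A Z (MM [] 0) [] [] f"
  have one: "Mz (MM [] 0) s = (if s = 0 then 1 else 0)" for s
    by (auto simp: Mz_def MM_def cfps_def)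
  have z: "PH n A Z a 0 = 0" for a by (rule A_endo_0[OF endo_PH[unfolded Fock_FQ] csub_RQ])
  have N: "?N (p, q) = (if q = 0 then X p f else 0)" for p q
  proof -
    have "?N (p, q) = hsum (\<lambda>(a, b). Mz (MM C \<delta>) (p - a) * Mz (MM [] 0) (q - b) * PH n A Z a (PH n [] [] b f))"
      by (simp add: Nrm_def)
    also have "\<dots> = hsum (\<lambda>a. hsum (\<lambda>b. Mz (MM C \<delta>) (p - a) * Mz (MM [] 0) (q - b) * PH n A Z a (PH n [] [] b f)))"
      by (rule hsum_Sigma(3)[OF Nrm_summable[OF f], symmetric])
    also have "\<dots> = hsum (\<lambda>a. if q = 0 then Mz (MM C \<delta>) (p - a) * PH n A Z a f else 0)"
      by (rule arg_cong[where f = hsum], rule ext, subst hsum_single(2)[of 0]) (auto simp: PH_nil[OF f] z one)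
    finally show ?thesis by (simp add: vopD(1)[OF v f])
  qed
  have inj: "inj (\<lambda>p :: int. (p, 0 :: int))" by (auto simp: inj_on_def)
  have "dgn c ?N r = hsum (\<lambda>(p, q). sc (upow c p (r - q)) * (if q = 0 then X p f else 0))"
    by (simp add: dgn_def N)
  also have "\<dots> = hsum (\<lambda>p. sc (upow c p r) * X p f)"
    using hsum_inj(2)[OF inj, of "\<lambda>(p, q). sc (upow c p (r - q)) * (if q = 0 then X p f else 0)"] by force
  also have "\<dots> = shift c X r f" by (simp add: shift_def scal_sc)
  finally show ?thesis unfolding dgn_Nrm[OF f] by (simp add: shift_terms_def shift_latt_def)
qed

text \<open>Different lists may describe the same operator, for instance when entries cancel. The
  Newton operators and the sign determine it; the leading exponent is \<open>zs\<close> at s =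
  0.\<close>

lemma PH_cong:
  assumes "\<And>s f. Aop A s f = Aop A' s f" "\<And>\<beta> s. \<beta> \<in> Q n \<Longrightarrow> zs n Z \<beta> s = zs n Z' \<beta> s"
    "\<And>\<beta>. \<beta> \<in> Q n \<Longrightarrow> sg n Z \<beta> = sg n Z' \<beta>" "f \<in> Fock n"
  shows "PH n A Z t f = PH n A' Z' t f"
proof (rule Sec_eqI[where L = "Q n" and T = "PH n A Z t"])
  show "A_endo (FQ n (Q n)) (PH n A Z t)" "A_endo (FQ n (Q n)) (PH n A' Z' t)" by (rule endo_PH[unfolded Fock_FQ])+
  show "f \<in> FQ n (Q n)" using assms by (simp add: Fock_FQ)
  fix \<beta> f assume \<beta>: "\<beta> \<in> Q n" and f: "f \<in> Sec n \<beta>"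
  have "zs n Z \<beta> 0 = of_int (mm n Z \<beta>)" for Z by (induction Z) (auto simp: zs_def mm_def)
  then have m: "mm n Z \<beta> = mm n Z' \<beta>" using assms(2)[OF \<beta>, of 0] by simp
  have "Bop n A Z \<beta> = Bop n A' Z' \<beta>" by (simp add: fun_eq_iff Bop_def assms(1) assms(2)[OF \<beta>])
  then show "PH n A Z t f = PH n A' Z' t f" by (simp add: PH_Sec[OF f] m assms(3)[OF \<beta>])
qed

section \<open>The commutator of $E_i$ and $F_i$\<close>

lemma delta_upow: "delta a b s t = upow (b - a) (- s - 1) t"
proof -
  have e: "upow a (- k - 1) s * upow b k t = upow b k t * upow (- a) (- s - 1) k" for k
    unfolding upow_dual[of a k s] by (rule mult.commute)
  have "delta a b s t = (\<Sum>k = t..- s - 1. upow b k t * upow (- a) (- s - 1) k)"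
    unfolding delta_def e
  proof (rule Sum_any.expand_superset)
    show "{k. upow b k t * upow (- a) (- s - 1) k \<noteq> 0} \<subseteq> {t..- s - 1}"
    proof
      fix k assume "k \<in> {k. upow b k t * upow (- a) (- s - 1) k \<noteq> 0}"
      then have "upow b k t \<noteq> 0" "upow (- a) (- s - 1) k \<noteq> 0" by auto
      then show "k \<in> {t..- s - 1}" by (auto simp: upow_def split: if_splits)
    qed
  qed simp
  also have "\<dots> = upow (b - a) (- s - 1) t"
  proof (cases "t \<le> - s - 1")
    case True
    then show ?thesis by (simp add: upow_compose)
  qed simp
  finally show ?thesis .
qed

text \<open>The two expansions of 1/(u - v + c hbar) differ by the delta function on u = v - c
  hbar.\<close>

lemma inv_diff: "inv_u c s t - inv_v c s t = upow (- c) (- s - 1) t"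
proof -
  have d: "upow c (- t - 1) s = upow (- c) (- s - 1) t" by (rule upow_dual)
  consider "s < 0" "0 \<le> t" | "s < 0" "t < 0" | "0 \<le> s" "t < 0" | "0 \<le> s" "0 \<le> t" by linarith
  then show ?thesis
    by cases (simp_all add: inv_u_def inv_v_def d)
qed

text \<open>A delta function restricts W to its support u = v + k hbar. The bounds in both variables
  make the sum over the kernel exponent and the exponents of W jointly summable, so it can be taken
  in either order.\<close>

lemma dgn_conv:
  assumes W: "ubd W" "vbd W"
  shows "hsum (\<lambda>(s, t). sc (upow k (- s - 1) t) * W (p - s, q - t)) = hsum (\<lambda>t. sc (upow k (- p - 1) t) * dgn k W (q - t))"
proof -
  define g where "g t x = sc (upow k (- p - 1) t) * (sc (upow k (fst x) (q - t - snd x)) * W x)" for t and x :: "int \<times> int"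
  have bd: "\<exists>c. \<forall>x. \<not> zN N (W x) \<longrightarrow> c \<le> fst x \<and> c \<le> snd x" for N
  proof -
    obtain c where c: "\<forall>p q. q < c \<longrightarrow> zN N (W (p, q))" by (rule vbdE[OF W(2)])
    obtain c' where c': "\<forall>p q. p < c' \<longrightarrow> zN N (W (p, q))" using W(1) unfolding ubd_def by blast
    show ?thesis
      by (rule exI[of _ "min c c'"]) (use c c' in \<open>force simp: not_less[symmetric]\<close>)
  qed
  obtain c where c: "\<And>N x. \<not> zN N (W x) \<Longrightarrow> c N \<le> fst x \<and> c N \<le> snd x" using bd by metis
  have inner: "hsummable (\<lambda>x. sc (upow k (fst x) (z - snd x)) * W x)" for z
  proof (rule hsummable_box[of "\<lambda>N. {c N..int N + z - c N} \<times> {c N..int N + z - c N}"])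
    fix x N assume nz: "fps_nth (sc (upow k (fst x) (z - snd x)) * W x) N \<noteq> 0"
    note n = upow_nonzero[OF nz]
    show "x \<in> {c N..int N + z - c N} \<times> {c N..int N + z - c N}"
      using n(1,2) c[OF n(3)] by (cases x) auto
  qed simp
  have g: "hsummable (\<lambda>(t, x). g t x)"
  proof (rule hsummable_box2[of "\<lambda>N. {- p - 1 - int N..- p - 1} \<times> {c N..2 * int N + q + p + 1 - c N} \<times> {c N..2 * int N + q + p + 1 - c N}"])
    fix t x N assume nz: "fps_nth (g t x) N \<noteq> 0"
    note n = upow_nonzero[OF nz[unfolded g_def]]
    note n' = upow_not_zN[OF n(3)]
    have "c N \<le> fst x \<and> c N \<le> snd x" using n' c by blast
    then show "(t, x) \<in> {- p - 1 - int N..- p - 1} \<times> {c N..2 * int N + q + p + 1 - c N} \<times> {c N..2 * int N + q + p + 1 - c N}"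
      using n(1,2) n' by (cases x) auto
  qed simp
  have 1: "hsum (g t) = sc (upow k (- p - 1) t) * dgn k W (q - t)" for t
    using hsum_mult(2)[OF inner[of "q - t"], of "sc (upow k (- p - 1) t)"]
    by (simp add: g_def[abs_def] dgn_def case_prod_unfold)
  have 2: "hsum (\<lambda>t. g t x) = sc (upow k (fst x - p - 1) (q - snd x)) * W x" for x
  proof -
    have "hsum (\<lambda>t. W x * (sc (upow k (- p - 1) t) * sc (upow k (fst x) (q - snd x - t)))) = W x * sc (upow k (- p - 1 + fst x) (q - snd x))"
      unfolding hsum_mult(2)[OF upow_vandermonde_hsum(1)] upow_vandermonde_hsum(2) ..
    then show ?thesis by (simp add: g_def mult_ac algebra_simps)
  qed
  have b: "bij (\<lambda>x. (p - fst x, q - snd x))"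
    by (rule o_bij[of "\<lambda>x. (p - fst x, q - snd x)"]) auto
  have "hsum (\<lambda>(s, t). sc (upow k (- s - 1) t) * W (p - s, q - t)) = hsum (\<lambda>x. sc (upow k (fst x - p - 1) (q - snd x)) * W x)"
    using hsum_reindex(2)[OF b, of "\<lambda>x. sc (upow k (fst x - p - 1) (q - snd x)) * W x"]
    by (simp add: case_prod_unfold)
  also have "\<dots> = hsum (\<lambda>x. hsum (\<lambda>t. g t x))" by (simp add: 2)
  also have "\<dots> = hsum (\<lambda>t. hsum (g t))" by (rule hsum_swap(2)[OF g, symmetric])
  finally show ?thesis by (simp add: 1)
qed

lemma delta_in_v:
  "(delta a b \<odot> in_v X) p q f = hsum (\<lambda>t. sc (upow (b - a) (- p - 1) t) * X (q - t) f)"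
proof -
  have inj: "inj (\<lambda>t :: int. (p, t))" by (auto simp: inj_on_def)
  have z: "(if p - s = 0 then w else 0) = (if s = p then w else (0 :: fock))" for s w by auto
  show ?thesis
    unfolding dmul_def in_v_def uv_def const_series_def scal_sc delta_upow id_def z
    using hsum_inj(2)[OF inj, of "\<lambda>(s, t). sc (upow (b - a) (- s - 1) t) * (if s = p then X (q - t) f else 0)"] by force
qed

lemma delta_in_u:
  assumes "\<And>p. X p 0 = 0"
  shows "(delta a b \<odot> in_u X) p q f = hsum (\<lambda>s. sc (upow (a - b) (- q - 1) s) * X (p - s) f)"
proof -
  have inj: "inj (\<lambda>s :: int. (s, q))" by (auto simp: inj_on_def)
  have z: "X r (if q - t = 0 then f else 0) = (if t = q then X r f else 0)" for r t by (auto simp: assms)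
  have d: "upow (b - a) (- s - 1) t = upow (a - b) (- t - 1) s" for s t
    using upow_dual[of "b - a" s t] upow_dual[of "a - b" t s] by simp
  show ?thesis
    unfolding dmul_def in_u_def uv_def const_series_def scal_sc delta_upow id_def z d
    using hsum_inj(2)[OF inj, of "\<lambda>(s, t). sc (upow (a - b) (- t - 1) s) * (if t = q then X (p - s) f else 0)"] by force
qed

lemma LU_half: "act (LU (1/2)) W e - act (LU (-1/2)) W e = hb * W e"
proof -
  have "cc (1/2) * hb * w - cc (- 1/2) * hb * w = hb * w" for w :: fock
  proof -
    have "cc (1/2) * hb * w - cc (- 1/2) * hb * w = cc (1/2 - (- 1/2)) * hb * w"
      by (simp only: cc_diff left_diff_distrib)
    then show ?thesis by simp
  qed
  then show ?thesis by (cases e) (simp add: act_LU)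
qed

text \<open>The partial fraction hbar/((x + hbar/2)(x - hbar/2)) = 1/(x - hbar/2) - 1/(x + hbar/2)
  for x = u - v, in either direction of expansion. Both sides are multiplied by the two factors and
  compared by injectivity; \<open>bd\<close> stands for a bound in u or in v.\<close>

lemma half_inverse:
  assumes bd: "\<And>U V c. bd U \<Longrightarrow> bd V \<Longrightarrow> act (LU c) U = act (LU c) V \<Longrightarrow> U = V"
    and cl: "\<And>c U. bd U \<Longrightarrow> bd (act (LU c) U)" "\<And>U. bd U \<Longrightarrow> bd (\<lambda>e. hb * U e)" "\<And>U V. bd U \<Longrightarrow> bd V \<Longrightarrow> bd (\<lambda>e. U e - V e)"
    and G: "bd (G (1/2))" "bd (G (-1/2))" "act (LU (1/2)) (G (1/2)) = W" "act (LU (-1/2)) (G (-1/2)) = W"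
    and U: "bd U" "act (LU (1/2)) (act (LU (-1/2)) U) = W"
  shows "hb * U e = G (-1/2) e - G (1/2) e"
proof -
  let ?D = "\<lambda>e. G (-1/2) e - G (1/2) e" and ?U = "\<lambda>e. hb * U e"
  have c: "act (LU c) (act (LU c') V) = act (LU c') (act (LU c) V)" for c c' V
    by (simp add: mult.commute flip: act_mult)
  have dU: "act P ?D = (\<lambda>e. act P (G (-1/2)) e - act P (G (1/2)) e)" "act P ?U = (\<lambda>e. hb * act P U e)" for P
    by (rule ext, rule act_fun_diff, rule ext, rule act_fun_mult)
  have "act (LU (1/2)) (act (LU (-1/2)) ?U) = act (LU (1/2)) (act (LU (-1/2)) ?D)"
  proof
    fix e
    have "act (LU (1/2)) (act (LU (-1/2)) ?U) e = hb * W e"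
      unfolding dU(2) act_fun_mult U(2) ..
    also have "\<dots> = act (LU (1/2)) W e - act (LU (-1/2)) W e" by (simp only: LU_half)
    also have "\<dots> = act (LU (1/2)) (act (LU (-1/2)) ?D) e"
      unfolding dU(1) act_fun_diff c[of "1/2" "-1/2" "G (1/2)"] G(3,4) ..
    finally show "act (LU (1/2)) (act (LU (-1/2)) ?U) e = act (LU (1/2)) (act (LU (-1/2)) ?D) e" .
  qed
  then have "act (LU (-1/2)) ?U = act (LU (-1/2)) ?D"
    by (rule bd[rotated 2]) (intro cl G U)+
  then have "?U = ?D" by (rule bd[rotated 2]) (intro cl G U)+
  then show ?thesis by (rule fun_cong)
qed

lemma ubd_diff: "ubd U \<Longrightarrow> ubd V \<Longrightarrow> ubd (\<lambda>e. U e - V e)"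
proof -
  assume "ubd U" "ubd V"
  then have "vbd (\<lambda>e. swp U e - swp V e)" by (intro vbd_diff) (simp_all add: vbd_swp)
  moreover have "(\<lambda>e. swp U e - swp V e) = swp (\<lambda>e. U e - V e)" by (auto simp: fun_eq_iff)
  ultimately show ?thesis by (simp add: vbd_swp)
qed

text \<open>The two orders of X and Y are expansions, in opposite directions, of one normally
  ordered product over the same two factors. Their difference is a pair of delta functions. On u = v
  + hbar/2 the product has the data of H shifted by 1/4; on v = u + hbar/2 it has those of K shifted
  by 1/4.\<close>

lemma EF_relation:
  assumes X: "vop n X C \<delta> A Z" and Y: "vop n Y C' \<delta>' A' Z'"
    and c1: "ctr n A Z C' \<delta>' [1/2, -1/2] []" "sg n Z \<delta>' = 1"
    and c2: "ctr n A' Z' C \<delta> [1/2, -1/2] []" "sg n Z' \<delta> = 1"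
    and H: "vop n H CH \<delta>H AH ZH" "cfps (shift_terms (1/2) C @ C') = cfps (shift_terms (1/4) CH)" "\<delta> + \<delta>' = \<delta>H"
      "\<And>s f. Aop (shift_terms (1/2) A @ A') s f = Aop (shift_terms (1/4) AH) s f"
      "\<And>\<beta> s. \<beta> \<in> Q n \<Longrightarrow> zs n (shift_latt (1/2) Z @ Z') \<beta> s = zs n (shift_latt (1/4) ZH) \<beta> s"
      "\<And>\<beta>. \<beta> \<in> Q n \<Longrightarrow> sg n (Z @ Z') \<beta> = sg n ZH \<beta>"
    and K: "vop n K CK \<delta>H AK ZK" "cfps (shift_terms (1/2) C' @ C) = cfps (shift_terms (1/4) CK)"
      "\<And>s f. Aop (shift_terms (1/2) A' @ A) s f = Aop (shift_terms (1/4) AK) s f"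
      "\<And>\<beta> s. \<beta> \<in> Q n \<Longrightarrow> zs n (shift_latt (1/2) Z' @ Z) \<beta> s = zs n (shift_latt (1/4) ZK) \<beta> s"
      "\<And>\<beta>. \<beta> \<in> Q n \<Longrightarrow> sg n (Z' @ Z) \<beta> = sg n ZK \<beta>"
  shows "eq_on (Fock n) (\<lambda>p q f. scal fps_X (comm (X p) (Y q) f))
    (delta (-1/4) (1/4) \<odot> in_v (shift (1/4) H) - delta (1/4) (-1/4) \<odot> in_u (shift (1/4) K))"
  unfolding eq_on_def
proof (intro allI ballI)
  fix p q f assume f: "f \<in> Fock n"
  let ?N = "Nrm n (MM C \<delta>) A Z (MM C' \<delta>') A' Z' f"
  let ?U = "ev (uv X Y) f" and ?V = "ev (vu X Y) f"
  note bd = Nrm_bd[OF f, of "MM C \<delta>" A Z "MM C' \<delta>'" A' Z']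
  have U: "act (LU (1/2)) (act (LU (-1/2)) ?U) = ?N"
    using resolved_uv[OF X Y c1(1) f] c1(2) by (simp add: resolved_def LUs_def act_mult)
  have V: "act (LU (1/2)) (act (LU (-1/2)) ?V) = ?N"
    using resolved_vu[OF X Y c2(1) f] c2(2) by (simp add: resolved_def LUs_def mult.commute flip: act_mult)
  have 1: "hb * ?U (p, q) = gconv (inv_u (-1/2)) ?N (p, q) - gconv (inv_u (1/2)) ?N (p, q)"
    by (rule half_inverse[where bd = vbd and G = "\<lambda>c. gconv (inv_u c) ?N", OF LU_inj])
      (assumption | rule vbd_act_LU vbd_mult vbd_diff inv_u_vbd act_inv_u bd U uv_vbd[OF X Y f])+
  have 2: "hb * ?V (p, q) = gconv (inv_v (-1/2)) ?N (p, q) - gconv (inv_v (1/2)) ?N (p, q)"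
  proof (rule half_inverse[where bd = ubd and G = "\<lambda>c. gconv (inv_v c) ?N", OF LU_inj_u])
    show "ubd (act (LU c) W)" if "ubd W" for c W using ubd_act[OF that, of "[c]"] by (simp add: LUs_def)
  qed (assumption | rule ubd_mult ubd_diff inv_v_ubd act_inv_v bd V vu_ubd[OF X Y f])+
  have D: "gconv (inv_u c) ?N (p, q) - gconv (inv_v c) ?N (p, q) = hsum (\<lambda>(s, t). sc (upow (- c) (- s - 1) t) * ?N (p - s, q - t))" for c
  proof -
    have "gconv (inv_u c) ?N (p, q) - gconv (inv_v c) ?N (p, q)
       = hsum (\<lambda>x. (case x of (s, t) \<Rightarrow> sc (inv_u c s t) * ?N ((p, q) - (s, t))) - (case x of (s, t) \<Rightarrow> sc (inv_v c s t) * ?N ((p, q) - (s, t))))"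
      unfolding gconv_def by (rule hsum_diff(2)[OF inv_u_summable[OF bd(2)] inv_v_summable[OF bd(1)], symmetric])
    also have "\<dots> = hsum (\<lambda>(s, t). sc (upow (- c) (- s - 1) t) * ?N (p - s, q - t))"
      by (rule arg_cong[where f = hsum]) (auto simp: fun_eq_iff sc_diff left_diff_distrib simp flip: inv_diff)
    finally show ?thesis .
  qed
  have b: "bij (\<lambda>(s, t). (t, s))" by (rule o_bij[of "\<lambda>(s, t). (t, s)"]) auto
  have sN: "Nrm n (MM C' \<delta>') A' Z' (MM C \<delta>) A Z f = swp ?N"
    by (auto simp: fun_eq_iff Nrm_swap[OF f, of _ A'])
  have "hsum (\<lambda>(s, t). sc (upow (1/2) (- s - 1) t) * ?N (p - s, q - t)) = hsum (\<lambda>t. sc (upow (1/2) (- p - 1) t) * dgn (1/2) ?N (q - t))"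
    by (rule dgn_conv[OF bd])
  also have "\<dots> = (delta (-1/4) (1/4) \<odot> in_v (shift (1/4) H)) p q f"
  proof -
    have "dgn (1/2) ?N r = shift (1/4) H r f" for r
    proof -
      have "MM (shift_terms (1/2) C @ C') (\<delta> + \<delta>') = MM (shift_terms (1/4) CH) \<delta>H"
        by (simp add: MM_def H(2,3))
      moreover have "PH n (shift_terms (1/2) A @ A') (shift_latt (1/2) Z @ Z') t f = PH n (shift_terms (1/4) AH) (shift_latt (1/4) ZH) t f" for t
        by (rule PH_cong) (use H(4-6) f in \<open>simp_all add: sg_append\<close>)
      ultimately show ?thesis unfolding dgn_Nrm[OF f] shift_vop[OF H(1) f] by simp
    qed
    then show ?thesis by (simp add: delta_in_v)
  qed
  finally have 3: "hsum (\<lambda>(s, t). sc (upow (1/2) (- s - 1) t) * ?N (p - s, q - t)) = (delta (-1/4) (1/4) \<odot> in_v (shift (1/4) H)) p q f" .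
  \<comment> \<open>The roles of u and v are exchanged, which turns the shift -1/2 into 1/2 and
    brings the sum into the form of \<open>dgn_conv\<close>.\<close>
  have "hsum (\<lambda>(s, t). sc (upow (- (1/2)) (- s - 1) t) * ?N (p - s, q - t)) = hsum (\<lambda>(s, t). sc (upow (1/2) (- s - 1) t) * swp ?N (q - s, p - t))"
    using hsum_reindex(2)[OF b, of "\<lambda>(s, t). sc (upow (- (1/2)) (- s - 1) t) * ?N (p - s, q - t)"]
    by (simp add: case_prod_unfold upow_dual[of "1/2"])
  also have "\<dots> = hsum (\<lambda>t. sc (upow (1/2) (- q - 1) t) * dgn (1/2) (swp ?N) (p - t))"
    by (rule dgn_conv) (simp_all add: ubd_swp vbd_swp bd)
  also have "\<dots> = (delta (1/4) (-1/4) \<odot> in_u (shift (1/4) K)) p q f"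
  proof -
    have "dgn (1/2) (swp ?N) r = shift (1/4) K r f" for r
    proof -
      have "MM (shift_terms (1/2) C' @ C) (\<delta>' + \<delta>) = MM (shift_terms (1/4) CK) \<delta>H"
        by (simp add: MM_def K(2) H(3)[symmetric] add.commute)
      moreover have "PH n (shift_terms (1/2) A' @ A) (shift_latt (1/2) Z' @ Z) t f = PH n (shift_terms (1/4) AK) (shift_latt (1/4) ZK) t f" for t
        by (rule PH_cong) (use K(3-5) f in \<open>simp_all add: sg_append\<close>)
      ultimately show ?thesis unfolding sN[symmetric] dgn_Nrm[OF f] shift_vop[OF K(1) f] by simp
    qed
    moreover have "shift (1/4) K r 0 = 0" for r
      unfolding shift_def by (simp add: A_endo_0[OF vop_endo[OF K(1), unfolded Fock_FQ] csub_RQ] scal_sc)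
    ultimately show ?thesis by (simp add: delta_in_u)
  qed
  finally have 4: "hsum (\<lambda>(s, t). sc (upow (- (1/2)) (- s - 1) t) * ?N (p - s, q - t)) = (delta (1/4) (-1/4) \<odot> in_u (shift (1/4) K)) p q f" .
  have "scal fps_X (comm (X p) (Y q) f) = hb * ?U (p, q) - hb * ?V (p, q)"
    by (simp add: scal_sc comm_def ev_def uv_def vu_def right_diff_distrib)
  also have "\<dots> = (gconv (inv_u (-1/2)) ?N (p, q) - gconv (inv_v (-1/2)) ?N (p, q)) - (gconv (inv_u (1/2)) ?N (p, q) - gconv (inv_v (1/2)) ?N (p, q))"
    unfolding 1 2 by simp
  also have "\<dots> = (delta (-1/4) (1/4) \<odot> in_v (shift (1/4) H) - delta (1/4) (-1/4) \<odot> in_u (shift (1/4) K)) p q f"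
    unfolding D using 3 4 by simp
  finally show "scal fps_X (comm (X p) (Y q) f) = (delta (-1/4) (1/4) \<odot> in_v (shift (1/4) H) - delta (1/4) (-1/4) \<odot> in_u (shift (1/4) K)) p q f" .
qed

section \<open>The relations, from the contractions\<close>

type_synonym dat = "terms \<times> vec \<times> terms \<times> latt"

definition vx :: "nat \<Rightarrow> series \<Rightarrow> dat \<Rightarrow> bool" where
  "vx n X = (\<lambda>(C, \<delta>, A, Z). vop n X C \<delta> A Z)"

text \<open>The data of the normally ordered product of D at u + s hbar and D' at u + t
  hbar.\<close>

definition comb :: "complex \<Rightarrow> dat \<Rightarrow> complex \<Rightarrow> dat \<Rightarrow> dat" where
  "comb s = (\<lambda>(C, \<delta>, A, Z) t (C', \<delta>', A', Z').
    (shift_terms s C @ shift_terms t C', \<delta> + \<delta>', shift_terms s A @ shift_terms t A', shift_latt s Z @ shift_latt t Z'))"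

definition okD :: "nat \<Rightarrow> dat \<Rightarrow> bool" where
  "okD n = (\<lambda>(C, \<delta>, A, Z). okC n C \<delta> \<and> intg n Z)"

text \<open>\<open>n1\<close>, \<open>p1\<close> are the contractions of \<open>D\<close> with \<open>D'\<close>, and \<open>n2\<close>, \<open>p2\<close> those in the other order.\<close>

definition lk :: "nat \<Rightarrow> dat \<Rightarrow> dat \<Rightarrow> complex list \<Rightarrow> complex list \<Rightarrow> complex list \<Rightarrow> complex list \<Rightarrow> bool" where
  "lk n = (\<lambda>(C, \<delta>, A, Z) (C', \<delta>', A', Z') n1 p1 n2 p2.
    ctr n A Z C' \<delta>' n1 p1 \<and> ctr n A' Z' C \<delta> n2 p2 \<and>
    sg n Z \<delta>' = sg n Z' \<delta> * (-1) ^ (length n2 + length p2) \<and> even (length n1 + length p1 + length n2 + length p2))"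

lemma prs_sum:
  "(\<Sum>(e, a, b)\<leftarrow>prs A C. F e a b) = (\<Sum>(x, i, a)\<leftarrow>A. \<Sum>(y, j, b)\<leftarrow>C. if i = j \<and> i \<noteq> 0 then F (x * y) a b else 0)"
    for F :: "complex \<Rightarrow> complex \<Rightarrow> complex \<Rightarrow> 'a::comm_monoid_add"
proof (induction A)
  case (Cons t A)
  obtain x i a where t: "t = (x, i, a)" by (cases t)
  have "(\<Sum>(e, a, b)\<leftarrow>prs [t] C. F e a b) = (\<Sum>(y, j, b)\<leftarrow>C. if i = j \<and> i \<noteq> 0 then F (x * y) a b else 0)"
    unfolding t by (induction C) (auto simp: prs_def)
  moreover have "prs (t # A) C = prs [t] C @ prs A C" by (simp add: prs_def)
  ultimately show ?case using Cons by (simp add: t)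
qed (simp add: prs_def)

lemma prs_append_right: "(\<Sum>(e, a, b)\<leftarrow>prs A (C @ C'). F e a b) = (\<Sum>(e, a, b)\<leftarrow>prs A C. F e a b) + (\<Sum>(e, a, b)\<leftarrow>prs A C'. F e a b)"
  for F :: "complex \<Rightarrow> complex \<Rightarrow> complex \<Rightarrow> 'a::comm_monoid_add"
  unfolding prs_sum by (induction A) (auto simp: add_ac)

lemma prs_append_left: "(\<Sum>(e, a, b)\<leftarrow>prs (A @ A') C. F e a b) = (\<Sum>(e, a, b)\<leftarrow>prs A C. F e a b) + (\<Sum>(e, a, b)\<leftarrow>prs A' C. F e a b)"
  for F :: "complex \<Rightarrow> complex \<Rightarrow> complex \<Rightarrow> 'a::comm_monoid_add"
  unfolding prs_sum by simp

lemma sum_shift_terms: "(\<Sum>(y, j, b)\<leftarrow>shift_terms s C. F y j b) = (\<Sum>(y, j, b)\<leftarrow>C. F y j (b + s))"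
  for F :: "complex \<Rightarrow> nat \<Rightarrow> complex \<Rightarrow> 'a::comm_monoid_add"
  by (induction C) (auto simp: shift_terms_def)

lemma prs_shift_right: "(\<Sum>(e, a, b)\<leftarrow>prs A (shift_terms s C). F e a b) = (\<Sum>(e, a, b)\<leftarrow>prs A C. F e a (b + s))"
  for F :: "complex \<Rightarrow> complex \<Rightarrow> complex \<Rightarrow> 'a::comm_monoid_add"
  unfolding prs_sum sum_shift_terms ..

lemma prs_shift_left: "(\<Sum>(e, a, b)\<leftarrow>prs (shift_terms s A) C. F e a b) = (\<Sum>(e, a, b)\<leftarrow>prs A C. F e (a + s) b)"
  for F :: "complex \<Rightarrow> complex \<Rightarrow> complex \<Rightarrow> 'a::comm_monoid_add"
  unfolding prs_sum sum_shift_terms ..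

text \<open>Contractions are additive over normally ordered products, and shifting the creation side
  by s moves each constant from c to c - s.\<close>

lemma ctr_comb_right:
  assumes "ctr n A Z C \<delta> neg pos" "ctr n A Z C' \<delta>' neg' pos'" "intg n Z" "\<delta> \<in> Q n" "\<delta>' \<in> Q n"
  shows "ctr n A Z (shift_terms s C @ shift_terms t C') (\<delta> + \<delta>')
    (map (\<lambda>c. c - s) neg @ map (\<lambda>c. c - t) neg') (map (\<lambda>c. c - s) pos @ map (\<lambda>c. c - t) pos')"
  unfolding ctr_def
proof (intro conjI allI)
  fix h :: "complex \<Rightarrow> fock fps"
  have 1: "(\<Sum>(e, a, b)\<leftarrow>prs A C. fps_const (cc e) * h (a - (b + s))) = (\<Sum>c\<leftarrow>neg. h (c - s)) - (\<Sum>c\<leftarrow>pos. h (c - s))"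
    using assms(1) unfolding ctr_def by (auto dest!: spec[of _ "\<lambda>c. h (c - s)"] simp: diff_diff_eq)
  have 2: "(\<Sum>(e, a, b)\<leftarrow>prs A C'. fps_const (cc e) * h (a - (b + t))) = (\<Sum>c\<leftarrow>neg'. h (c - t)) - (\<Sum>c\<leftarrow>pos'. h (c - t))"
    using assms(2) unfolding ctr_def by (auto dest!: spec[of _ "\<lambda>c. h (c - t)"] simp: diff_diff_eq)
  show "(\<Sum>(e, a, b)\<leftarrow>prs A (shift_terms s C @ shift_terms t C'). fps_const (cc e) * h (a - b))
    = (\<Sum>c\<leftarrow>map (\<lambda>c. c - s) neg @ map (\<lambda>c. c - t) neg'. h c) - (\<Sum>c\<leftarrow>map (\<lambda>c. c - s) pos @ map (\<lambda>c. c - t) pos'. h c)"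
    unfolding prs_append_right prs_shift_right 1 2 by (simp add: comp_def)
next
  fix g :: "complex \<Rightarrow> complex"
  have l: "(\<Sum>(\<sigma>, \<gamma>, a)\<leftarrow>Z. of_int (lev n \<gamma> (\<delta> + \<delta>')) * g a)
    = (\<Sum>(\<sigma>, \<gamma>, a)\<leftarrow>Z. of_int (lev n \<gamma> \<delta>) * g a) + (\<Sum>(\<sigma>, \<gamma>, a)\<leftarrow>Z. of_int (lev n \<gamma> \<delta>') * g a)"
    using assms(3) by (induction Z) (auto simp: intg_def lev_add assms(4,5) algebra_simps)
  have "(\<Sum>(e, a, b)\<leftarrow>prs A C. e * g a) + (\<Sum>(\<sigma>, \<gamma>, a)\<leftarrow>Z. of_int (lev n \<gamma> \<delta>) * g a) = 0"
    "(\<Sum>(e, a, b)\<leftarrow>prs A C'. e * g a) + (\<Sum>(\<sigma>, \<gamma>, a)\<leftarrow>Z. of_int (lev n \<gamma> \<delta>') * g a) = 0"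
    using assms(1,2) unfolding ctr_def by blast+
  then show "(\<Sum>(e, a, b)\<leftarrow>prs A (shift_terms s C @ shift_terms t C'). e * g a) + (\<Sum>(\<sigma>, \<gamma>, a)\<leftarrow>Z. of_int (lev n \<gamma> (\<delta> + \<delta>')) * g a) = 0"
    unfolding prs_append_right prs_shift_right l by (simp add: add_ac)
next
  show "mm n Z (\<delta> + \<delta>') = int (length (map (\<lambda>c. c - s) pos @ map (\<lambda>c. c - t) pos')) - int (length (map (\<lambda>c. c - s) neg @ map (\<lambda>c. c - t) neg'))"
    using assms(1,2) by (simp add: ctr_def intg_add(1)[OF assms(3-5)])
qed

text \<open>On the annihilation side a shift moves the constants the other way.\<close>

lemma ctr_comb_left:
  assumes "ctr n A Z C \<delta> neg pos" "ctr n A' Z' C \<delta> neg' pos'"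
  shows "ctr n (shift_terms s A @ shift_terms t A') (shift_latt s Z @ shift_latt t Z') C \<delta>
    (map (\<lambda>c. c + s) neg @ map (\<lambda>c. c + t) neg') (map (\<lambda>c. c + s) pos @ map (\<lambda>c. c + t) pos')"
  unfolding ctr_def
proof (intro conjI allI)
  fix h :: "complex \<Rightarrow> fock fps"
  have h: "(\<Sum>(e, a, b)\<leftarrow>prs A C. fps_const (cc e) * h (a + s - b)) = (\<Sum>c\<leftarrow>neg. h (c + s)) - (\<Sum>c\<leftarrow>pos. h (c + s))"
    if "ctr n A Z C \<delta> neg pos" for A Z neg pos s
    using that unfolding ctr_def by (auto dest!: spec[of _ "\<lambda>c. h (c + s)"] simp: algebra_simps)
  show "(\<Sum>(e, a, b)\<leftarrow>prs (shift_terms s A @ shift_terms t A') C. fps_const (cc e) * h (a - b))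
    = (\<Sum>c\<leftarrow>map (\<lambda>c. c + s) neg @ map (\<lambda>c. c + t) neg'. h c) - (\<Sum>c\<leftarrow>map (\<lambda>c. c + s) pos @ map (\<lambda>c. c + t) pos'. h c)"
    unfolding prs_append_left prs_shift_left h[OF assms(1)] h[OF assms(2)] by (simp add: comp_def)
next
  fix g :: "complex \<Rightarrow> complex"
  have l: "(\<Sum>(\<sigma>, \<gamma>, a)\<leftarrow>shift_latt s Z. of_int (lev n \<gamma> \<delta>) * g a) = (\<Sum>(\<sigma>, \<gamma>, a)\<leftarrow>Z. of_int (lev n \<gamma> \<delta>) * g (a + s))" for s Z
    by (simp add: shift_latt_def comp_def case_prod_unfold)
  have "(\<Sum>(e, a, b)\<leftarrow>prs A C. e * g (a + s)) + (\<Sum>(\<sigma>, \<gamma>, a)\<leftarrow>Z. of_int (lev n \<gamma> \<delta>) * g (a + s)) = 0"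
    "(\<Sum>(e, a, b)\<leftarrow>prs A' C. e * g (a + t)) + (\<Sum>(\<sigma>, \<gamma>, a)\<leftarrow>Z'. of_int (lev n \<gamma> \<delta>) * g (a + t)) = 0"
    using assms unfolding ctr_def by (auto dest!: spec[of _ "\<lambda>a. g (a + s)"] spec[of _ "\<lambda>a. g (a + t)"])
  then show "(\<Sum>(e, a, b)\<leftarrow>prs (shift_terms s A @ shift_terms t A') C. e * g a)
     + (\<Sum>(\<sigma>, \<gamma>, a)\<leftarrow>shift_latt s Z @ shift_latt t Z'. of_int (lev n \<gamma> \<delta>) * g a) = 0"
    unfolding prs_append_left prs_shift_left map_append sum_list.append l by (simp add: add_ac)
next
  show "mm n (shift_latt s Z @ shift_latt t Z') \<delta> = int (length (map (\<lambda>c. c + s) pos @ map (\<lambda>c. c + t) pos')) - int (length (map (\<lambda>c. c + s) neg @ map (\<lambda>c. c + t) neg'))"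
    using assms by (simp add: ctr_def mm_append)
qed

text \<open>The data determine only the difference of the two lists, so common numerators and
  denominators may be cancelled.\<close>

lemma ctr_cong:
  assumes "ctr n A Z C \<delta> neg pos"
    "\<And>h :: complex \<Rightarrow> fock fps. (\<Sum>c\<leftarrow>neg. h c) - (\<Sum>c\<leftarrow>pos. h c) = (\<Sum>c\<leftarrow>neg'. h c) - (\<Sum>c\<leftarrow>pos'. h c)"
    "length neg + length pos' = length neg' + length pos"
  shows "ctr n A Z C \<delta> neg' pos'"
  using assms(1,3) unfolding ctr_def assms(2) by auto

lemma lk_cong:
  assumes "lk n D D' n1 p1 n2 p2"
    "\<And>h :: complex \<Rightarrow> fock fps. (\<Sum>c\<leftarrow>n1. h c) - (\<Sum>c\<leftarrow>p1. h c) = (\<Sum>c\<leftarrow>n1'. h c) - (\<Sum>c\<leftarrow>p1'. h c)"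
    "\<And>h :: complex \<Rightarrow> fock fps. (\<Sum>c\<leftarrow>n2. h c) - (\<Sum>c\<leftarrow>p2. h c) = (\<Sum>c\<leftarrow>n2'. h c) - (\<Sum>c\<leftarrow>p2'. h c)"
    "length n1 + length p1' = length n1' + length p1" "length n2 + length p2' = length n2' + length p2"
  shows "lk n D D' n1' p1' n2' p2'"
proof -
  obtain C \<delta> A Z C' \<delta>' A' Z' where D: "D = (C, \<delta>, A, Z)" "D' = (C', \<delta>', A', Z')" by (cases D, cases D')
  have e: "even (length n1 + length p1) = even (length n1' + length p1')" "even (length n2 + length p2) = even (length n2' + length p2')"
    using assms(4,5) by presburger+
  have "(-1 :: complex) ^ (length n2 + length p2) = (-1) ^ (length n2' + length p2')"
    using e(2) by (simp add: minus_one_power_iff)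
  then show ?thesis
    using assms(1) ctr_cong[OF _ assms(2,4)] ctr_cong[OF _ assms(3,5)] e unfolding lk_def D by auto
qed

text \<open>The parity condition in \<open>lk\<close> allows the sign to be moved to the other
  order.\<close>

lemma lk_sym:
  assumes "lk n D D' n1 p1 n2 p2"
  shows "lk n D' D n2 p2 n1 p1"
proof -
  have "(-1 :: complex) ^ (length n1 + length p1) = (-1) ^ (length n2 + length p2)"
    using assms by (auto simp: lk_def case_prod_unfold minus_one_power_iff)
  moreover have "(-1 :: complex) ^ k * (-1) ^ k = 1" for k by (simp flip: power_mult_distrib)
  ultimately show ?thesis using assms by (auto simp: lk_def case_prod_unfold mult.assoc)
qed

lemma lk_comb:
  assumes "lk n D D1 n1 p1 n2 p2" "lk n D D2 n1' p1' n2' p2'" "okD n D" "okD n D1" "okD n D2"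
  shows "lk n D (comb s D1 t D2) (map (\<lambda>c. c - s) n1 @ map (\<lambda>c. c - t) n1') (map (\<lambda>c. c - s) p1 @ map (\<lambda>c. c - t) p1')
    (map (\<lambda>c. c + s) n2 @ map (\<lambda>c. c + t) n2') (map (\<lambda>c. c + s) p2 @ map (\<lambda>c. c + t) p2')"
proof -
  obtain C \<delta> A Z C' \<delta>' A' Z' C'' \<delta>'' A'' Z'' where D: "D = (C, \<delta>, A, Z)" "D1 = (C', \<delta>', A', Z')" "D2 = (C'', \<delta>'', A'', Z'')"
    by (cases D, cases D1, cases D2)
  have Z: "intg n Z" "\<delta>' \<in> Q n" "\<delta>'' \<in> Q n" using assms(3-5) by (auto simp: D okD_def okC_def)
  have c: "ctr n A Z C' \<delta>' n1 p1" "ctr n A Z C'' \<delta>'' n1' p1'" "ctr n A' Z' C \<delta> n2 p2" "ctr n A'' Z'' C \<delta> n2' p2'"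
    using assms(1,2) by (auto simp: lk_def D)
  show ?thesis
    using assms(1,2) ctr_comb_right[OF c(1,2) Z, of s t] ctr_comb_left[OF c(3,4), of s t]
    by (auto simp: lk_def D comb_def intg_add(2)[OF Z] sg_append power_add)
qed

lemma okD_comb: "okD n D \<Longrightarrow> okD n D' \<Longrightarrow> okD n (comb s D t D')"
  by (cases D; cases D') (auto simp: okD_def comb_def okC_def intg_def shift_terms_def shift_latt_def Q_add)

lemma lk_resolved:
  assumes l: "lk n D D' n1 p1 n2 p2" and X: "vx n X D" and Y: "vx n Y D'" and f: "f \<in> Fock n"
  obtains \<sigma> N where "resolved (ev (uv X Y) f) \<sigma> n1 p1 N" "resolved (ev (vu X Y) f) \<sigma> (map uminus n2) (map uminus p2) N"
    "ubd N" "vbd N"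
proof -
  obtain C \<delta> A Z C' \<delta>' A' Z' where D: "D = (C, \<delta>, A, Z)" "D' = (C', \<delta>', A', Z')" by (cases D, cases D')
  note v = X[unfolded vx_def D prod.case] Y[unfolded vx_def D prod.case]
  have c: "ctr n A Z C' \<delta>' n1 p1" "ctr n A' Z' C \<delta> n2 p2" and s: "sg n Z \<delta>' = sg n Z' \<delta> * (-1) ^ (length n2 + length p2)"
    using l by (auto simp: lk_def D)
  show ?thesis
    using that[OF resolved_uv[OF v c(1) f] _ Nrm_bd[OF f]] resolved_vu[OF v c(2) f] by (simp add: s)
qed

lemma vx_uv_vbd: "vx n X D \<Longrightarrow> vx n Y D' \<Longrightarrow> f \<in> Fock n \<Longrightarrow> vbd (ev (uv X Y) f)"
  and vx_vu_ubd: "vx n X D \<Longrightarrow> vx n Y D' \<Longrightarrow> f \<in> Fock n \<Longrightarrow> ubd (ev (vu X Y) f)"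
  by (cases D; cases D'; simp add: vx_def uv_vbd vu_ubd)+

lemma lk_exchange:
  assumes "lk n D D' n1 p1 n2 p2" "vx n X D" "vx n Y D'" "f \<in> Fock n"
    "LUs a = P' * LUs n1" "LUs b = Q' * LUs (map uminus n2)" "P' * LUs p1 = Q' * LUs (map uminus p2)"
  shows "act (LUs a) (ev (uv X Y) f) = act (LUs b) (ev (vu X Y) f)"
  by (rule lk_resolved[OF assms(1-4)], rule resolved_combine[OF _ _ assms(5-7)])

text \<open>Without denominators in the order vu, that product is a polynomial times the normally
  ordered one and therefore also starts in v; then \<open>rel_inv_u\<close> applies.\<close>

lemma lk_u:
  assumes l: "lk n D D' n1 p1 [] p2" and v: "vx n X D" "vx n Y D'"
    and P: "LUs [d] = P' * LUs n1" "P' * LUs p1 = LUs [c] * LUs (map uminus p2)"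
  shows "dmul_summable (Fock n) (inv_u c) (uv X Y) \<and> eq_on (Fock n) (vu X Y) (lin d \<odot> inv_u c \<odot> uv X Y)"
  unfolding dmul_summable_ev eq_on_ev
proof (intro conjI ballI allI)
  fix f e assume f: "f \<in> Fock n"
  note u = vx_uv_vbd[OF v f]
  show "hsummable (\<lambda>(s, t). sc (inv_u c s t) * ev (uv X Y) f (e - (s, t)))" by (rule inv_u_summable[OF u])
  have "vbd (ev (vu X Y) f)"
    by (rule lk_resolved[OF l v f]) (simp add: resolved_nil_bd)
  moreover have "act (LU c) (ev (vu X Y) f) = act (LU d) (ev (uv X Y) f)"
    using lk_exchange[OF l v f P(1) _ P(2), where b = "[c]"] by (simp add: LUs_def)
  ultimately show "ev (vu X Y) f = ev (lin d \<odot> inv_u c \<odot> uv X Y) f"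
    unfolding ev_lin unfolding ev_dmul by (rule rel_inv_u[OF u])
qed

text \<open>The mirror case: no denominators in the order uv, and division among families that start
  in u.\<close>

lemma lk_v:
  assumes l: "lk n D D' [] p1 n2 p2" and v: "vx n X D" "vx n Y D'"
    and P: "LUs [c] = P' * LUs (map uminus n2)" "LUs [d] * LUs p1 = P' * LUs (map uminus p2)"
  shows "dmul_summable (Fock n) (inv_v c) (uv X Y) \<and> eq_on (Fock n) (vu X Y) (lin d \<odot> inv_v c \<odot> uv X Y)"
  unfolding dmul_summable_ev eq_on_ev
proof (intro conjI ballI allI)
  fix f e assume f: "f \<in> Fock n"
  have u: "ubd (ev (uv X Y) f)"
    by (rule lk_resolved[OF l v f]) (simp add: resolved_nil_bd)
  show "hsummable (\<lambda>(s, t). sc (inv_v c s t) * ev (uv X Y) f (e - (s, t)))" by (rule inv_v_summable[OF u])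
  have "act (LU c) (ev (vu X Y) f) = act (LU d) (ev (uv X Y) f)"
    using lk_exchange[OF l v f _ P, where a = "[d]"] by (simp add: LUs_def)
  then show "ev (vu X Y) f = ev (lin d \<odot> inv_v c \<odot> uv X Y) f"
    unfolding ev_lin unfolding ev_dmul by (rule rel_inv_v[OF u vx_vu_ubd[OF v f]])
qed

lemma lk_u':
  assumes l: "lk n D D' n1 p1 [] p2" and v: "vx n X D" "vx n Y D'"
    and P: "LUs [c] = P' * LUs n1" "P' * LUs p1 = LUs [d] * LUs (map uminus p2)"
  shows "dmul_summable (Fock n) (inv_u c) (vu X Y) \<and> eq_on (Fock n) (uv X Y) (lin d \<odot> inv_u c \<odot> vu X Y)"
  unfolding dmul_summable_ev eq_on_ev
proof (intro conjI ballI allI)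
  fix f e assume f: "f \<in> Fock n"
  have u: "vbd (ev (vu X Y) f)"
    by (rule lk_resolved[OF l v f]) (simp add: resolved_nil_bd)
  show "hsummable (\<lambda>(s, t). sc (inv_u c s t) * ev (vu X Y) f (e - (s, t)))" by (rule inv_u_summable[OF u])
  have "act (LU c) (ev (uv X Y) f) = act (LU d) (ev (vu X Y) f)"
    using lk_exchange[OF l v f P(1) _ P(2), where b = "[d]"] by (simp add: LUs_def)
  then show "ev (uv X Y) f = ev (lin d \<odot> inv_u c \<odot> vu X Y) f"
    unfolding ev_lin unfolding ev_dmul by (rule rel_inv_u[OF u vx_uv_vbd[OF v f]])
qed

lemma lk_v':
  assumes l: "lk n D D' [] p1 n2 p2" and v: "vx n X D" "vx n Y D'"
    and P: "LUs [d] = P' * LUs (map uminus n2)" "LUs [c] * LUs p1 = P' * LUs (map uminus p2)"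
  shows "dmul_summable (Fock n) (inv_v c) (vu X Y) \<and> eq_on (Fock n) (uv X Y) (lin d \<odot> inv_v c \<odot> vu X Y)"
  unfolding dmul_summable_ev eq_on_ev
proof (intro conjI ballI allI)
  fix f e assume f: "f \<in> Fock n"
  note u = vx_vu_ubd[OF v f]
  show "hsummable (\<lambda>(s, t). sc (inv_v c s t) * ev (vu X Y) f (e - (s, t)))" by (rule inv_v_summable[OF u])
  have "ubd (ev (uv X Y) f)"
    by (rule lk_resolved[OF l v f]) (simp add: resolved_nil_bd)
  moreover have "act (LU c) (ev (uv X Y) f) = act (LU d) (ev (vu X Y) f)"
    using lk_exchange[OF l v f _ P, where a = "[c]"] by (simp add: LUs_def)
  ultimately show "ev (uv X Y) f = ev (lin d \<odot> inv_v c \<odot> vu X Y) f"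
    unfolding ev_lin unfolding ev_dmul by (rule rel_inv_v[OF u])
qed

lemma lk_lin1:
  assumes "lk n D D' n1 p1 n2 p2" "vx n X D" "vx n Y D'"
    "LUs [a] = P' * LUs n1" "LUs [b] = Q' * LUs (map uminus n2)" "P' * LUs p1 = Q' * LUs (map uminus p2)"
  shows "eq_on (Fock n) (lin a \<odot> uv X Y) (lin b \<odot> vu X Y)"
  using lk_exchange[OF assms(1-3) _ assms(4-6)] by (simp add: eq_on_ev ev_lin LUs_def)

lemma lk_lin2:
  assumes "lk n D D' n1 p1 n2 p2" "vx n X D" "vx n Y D'"
    "LUs [a, a'] = P' * LUs n1" "LUs [b, b'] = Q' * LUs (map uminus n2)" "P' * LUs p1 = Q' * LUs (map uminus p2)"
  shows "eq_on (Fock n) (lin a \<odot> lin a' \<odot> uv X Y) (lin b \<odot> lin b' \<odot> vu X Y)"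
  using lk_exchange[OF assms(1-3) _ assms(4-6)] by (simp add: eq_on_ev ev_lin LUs_def act_mult)

lemma lk_commute:
  assumes "lk n D D' n1 p1 n2 p2" "vx n X D" "vx n Y D'"
    "1 = P' * LUs n1" "1 = Q' * LUs (map uminus n2)" "P' * LUs p1 = Q' * LUs (map uminus p2)"
  shows "eq_on (Fock n) (uv X Y) (vu X Y)"
  using lk_exchange[of n D D' n1 p1 n2 p2 X Y _ "[]" P' "[]" Q'] assms by (simp add: eq_on_ev LUs_def)

section \<open>Currents as vertex operators\<close>

lemma ip_lin:
  "ip n (x + x') y = ip n x y + ip n x' y" "ip n x (y + y') = ip n x y + ip n x y'"
  "ip n (x - x') y = ip n x y - ip n x' y" "ip n x (y - y') = ip n x y - ip n x y'"
  "ip n (- x) y = - ip n x y" "ip n x (- y) = - ip n x y"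
  "ip n (\<lambda>k. c * x k) y = c * ip n x y" "ip n x (\<lambda>k. c * y k) = c * ip n x y"
  "ip n x 0 = 0" "ip n 0 y = 0"
  by (simp_all add: ip_def algebra_simps sum.distrib sum_subtractf sum_negf sum_distrib_left)

lemma ip_eps: "ip n (eps a) (eps b) = (if a = b \<and> 1 \<le> a \<and> a \<le> n + 4 then 1 else 0)"
proof -
  have "ip n (eps a) (eps b) = (\<Sum>k = 1..n + 4. if k = a then (if a = b then 1 else 0) else 0)"
    unfolding ip_def eps_def by (rule sum.cong) auto
  then show ?thesis by (simp add: sum.delta)
qed

lemma ip_alpha_alpha:
  assumes "i \<in> {1..n}" "j \<in> {1..n}"
  shows "ip n (alpha n i) (alpha n j) = (if i = j then (if i = n then 1 else 2) else if j = i + 1 \<or> i = j + 1 then -1 else 0)"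
  using assms by (auto simp: alpha_def ip_lin ip_eps)

lemma ip_alpha_beta:
  assumes "i \<in> {1..n}" "1 \<le> j"
  shows "ip n (alpha n i) (beta n j) = 0" "ip n (beta n j) (alpha n i) = 0"
  using assms by (auto simp: alpha_def beta_def ip_lin ip_eps)

lemma ip_beta_beta:
  assumes "i \<in> {1..4}" "j \<in> {1..4}"
  shows "ip n (beta n i) (beta n j) = (if i = j then (if i = 1 then 1 else 2) else 0)"
proof -
  have "sqrt 2 * (sqrt 2 * x) = 2 * x" for x by (simp flip: mult.assoc)
  then show ?thesis using assms by (auto simp: beta_def ip_lin ip_eps)
qed

lemma ip_Q_Ints:
  assumes "\<And>i. i \<in> {1..n} \<Longrightarrow> ip n \<gamma> (alpha n i) \<in> \<int>" "\<And>j. j \<in> {1..4} \<Longrightarrow> ip n \<gamma> (beta n j) \<in> \<int>" "\<beta> \<in> Q n"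
  shows "ip n \<gamma> \<beta> \<in> \<int>"
proof -
  obtain a b :: "nat \<Rightarrow> int" where
    "\<beta> = (\<lambda>k. (\<Sum>i = 1..n. of_int (a i) * alpha n i k) + (\<Sum>j = 1..4. of_int (b j) * beta n j k))"
    using assms(3) unfolding Q_def by blast
  then have "ip n \<gamma> \<beta> = (\<Sum>k = 1..n + 4. (\<Sum>i = 1..n. of_int (a i) * (\<gamma> k * alpha n i k)) + (\<Sum>j = 1..4. of_int (b j) * (\<gamma> k * beta n j k)))"
    unfolding ip_def by (intro sum.cong) (auto simp: distrib_left sum_distrib_left mult_ac)
  also have "\<dots> = (\<Sum>i = 1..n. of_int (a i) * ip n \<gamma> (alpha n i)) + (\<Sum>j = 1..4. of_int (b j) * ip n \<gamma> (beta n j))"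
    unfolding sum.distrib ip_def sum_distrib_left by (intro arg_cong2[where f = "(+)"] sum.swap)
  also have "\<dots> \<in> \<int>" by (intro Ints_add Ints_sum Ints_mult Ints_of_int assms)
  finally show ?thesis .
qed

lemma alpha_Ints: "i \<in> {1..n} \<Longrightarrow> \<beta> \<in> Q n \<Longrightarrow> ip n (alpha n i) \<beta> \<in> \<int>"
  by (rule ip_Q_Ints) (auto simp: ip_alpha_alpha ip_alpha_beta)

lemma beta_Ints: "i \<in> {1..4} \<Longrightarrow> \<beta> \<in> Q n \<Longrightarrow> ip n (beta n i) \<beta> \<in> \<int>"
  by (rule ip_Q_Ints) (auto simp: ip_beta_beta ip_alpha_beta)

lemma alpha_Q: "i \<in> {1..n} \<Longrightarrow> alpha n i \<in> Q n"
proof -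
  assume i: "i \<in> {1..n}"
  have "alpha n i k = (\<Sum>l = 1..n. of_int (if l = i then 1 else 0) * alpha n l k) + (\<Sum>j = 1..4. of_int 0 * beta n j k)" for k
  proof -
    have "(\<Sum>l = 1..n. of_int (if l = i then 1 else 0) * alpha n l k) = (\<Sum>l = 1..n. if l = i then alpha n i k else 0)"
      by (rule sum.cong) auto
    then show ?thesis using i by (simp add: sum.delta)
  qed
  then show ?thesis unfolding Q_def mem_Collect_eq
    by (intro exI[of _ "\<lambda>l. if l = i then 1 else 0"] exI[of _ "\<lambda>_. 0"]) auto
qed

lemma beta_Q: "i \<in> {1..4} \<Longrightarrow> beta n i \<in> Q n"
proof -
  assume i: "i \<in> {1..4}"
  have "beta n i k = (\<Sum>l = 1..n. of_int 0 * alpha n l k) + (\<Sum>j = 1..4. of_int (if j = i then 1 else 0) * beta n j k)" for k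
  proof -
    have "(\<Sum>l = 1..4. of_int (if l = i then 1 else 0) * beta n l k) = (\<Sum>l = 1..4. if l = i then beta n i k else 0)"
      by (rule sum.cong) auto
    then show ?thesis using i by (simp add: sum.delta)
  qed
  then show ?thesis unfolding Q_def mem_Collect_eq
    by (intro exI[of _ "\<lambda>_. 0"] exI[of _ "\<lambda>l. if l = i then 1 else 0"]) auto
qed

lemma Q_uminus: "\<beta> \<in> Q n \<Longrightarrow> - \<beta> \<in> Q n"
proof -
  assume "\<beta> \<in> Q n"
  then obtain a b :: "nat \<Rightarrow> int" where
    e: "\<beta> = (\<lambda>k. (\<Sum>i = 1..n. of_int (a i) * alpha n i k) + (\<Sum>j = 1..4. of_int (b j) * beta n j k))"
    unfolding Q_def by blast
  show ?thesis
    unfolding Q_def mem_Collect_eq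
    by (intro exI[of _ "\<lambda>i. - a i"] exI[of _ "\<lambda>j. - b j"]) (simp add: e fun_eq_iff sum_negf)
qed

lemma Q_0: "0 \<in> Q n"
  unfolding Q_def mem_Collect_eq by (intro exI[of _ "\<lambda>_. 0"]) (auto simp: fun_eq_iff)

section \<open>Zero modes, lattice translations and the normal form\<close>

lemma genZ_append:
  assumes "f \<in> Fock n"
  shows "(genZ n Z \<star> genZ n Z') p f = genZ n (Z @ Z') p f"
proof (rule Sec_eqI[where L = "Q n" and T = "(genZ n Z \<star> genZ n Z') p"])
  show "A_endo (FQ n (Q n)) ((genZ n Z \<star> genZ n Z') p)" by (rule FS_endo[OF FS_smult[OF FS_genZ FS_genZ]])
  show "A_endo (FQ n (Q n)) (genZ n (Z @ Z') p)" by (rule FS_endo[OF FS_genZ])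
  show "f \<in> FQ n (Q n)" using assms by (simp add: Fock_FQ)
  fix \<beta> f assume f: "f \<in> Sec n \<beta>"
  have g: "genZ n Z' q f \<in> Sec n \<beta>" for q by (rule FS_FQ[OF FS_genZ f])
  let ?k = "mm n Z \<beta>" and ?m = "mm n Z' \<beta>" and ?c = "cc (sg n Z \<beta>) * cc (sg n Z' \<beta>)"
  let ?h = "\<lambda>s. (if s \<le> ?k then fps_nth (zhat n Z \<beta>) (nat (?k - s)) else 0) * (if p - s \<le> ?m then fps_nth (zhat n Z' \<beta>) (nat (?m - (p - s))) else 0)"
  have fin: "hsummable ?h" by (rule hsum_finite(1)[of "{p - ?m..?k}"]) auto
  have "(genZ n Z \<star> genZ n Z') p f = hsum (\<lambda>s. (?c * f) * ?h s)"
    unfolding smult_def genZ_Sec[OF g] unfolding genZ_Sec[OF f] by (rule arg_cong[where f = hsum]) (auto simp: fun_eq_iff)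
  also have "\<dots> = (?c * f) * hsum ?h" by (rule hsum_mult(2)[OF fin])
  also have "\<dots> = genZ n (Z @ Z') p f"
  proof -
    have "zhat n (Z @ Z') \<beta> = zhat n Z \<beta> * zhat n Z' \<beta>" by (simp add: zhat_def)
    then show ?thesis unfolding conv_top by (simp add: genZ_Sec[OF f] mm_append sg_append cc_mult mult_ac)
  qed
  finally show "(genZ n Z \<star> genZ n Z') p f = genZ n (Z @ Z') p f" .
qed

text \<open>A zero mode orthogonal to \<delta> does not see the translation by \<delta>. In the
  currents each zero mode left of a translation is orthogonal to it, so all translations can be
  gathered on the left.\<close>

lemma genZ_El:
  assumes "\<And>\<sigma> \<gamma> a. (\<sigma>, \<gamma>, a) \<in> set Z \<Longrightarrow> ip n \<gamma> \<delta> = 0" "\<delta> \<in> Q n" "f \<in> Fock n"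
  shows "genZ n Z p (El \<delta> * f) = El \<delta> * genZ n Z p f"
proof (rule Sec_eqI[where L = "Q n" and T = "\<lambda>f. genZ n Z p (El \<delta> * f)"])
  have m: "A_endo (FQ n (Q n)) (\<lambda>f. El \<delta> * f)"
    by (rule A_endo_mult) (rule FQ_mult[OF El_Sec], auto intro: Q_add assms(2))
  note g = FS_endo[OF FS_genZ]
  show "A_endo (FQ n (Q n)) (\<lambda>f. genZ n Z p (El \<delta> * f))" by (rule A_endo_lincomb(7)[OF csub_RQ g m])
  show "A_endo (FQ n (Q n)) (\<lambda>f. El \<delta> * genZ n Z p f)" by (rule A_endo_lincomb(7)[OF csub_RQ m g])
  show "f \<in> FQ n (Q n)" using assms by (simp add: Fock_FQ)
  fix \<beta> f assume f: "f \<in> Sec n \<beta>"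
  have s: "El \<delta> * f \<in> Sec n (\<beta> + \<delta>)" using Sec_mult[OF El_Sec f, of \<delta>] by (simp add: add.commute)
  have "mm n Z (\<beta> + \<delta>) = mm n Z \<beta> \<and> sg n Z (\<beta> + \<delta>) = sg n Z \<beta> \<and> zhat n Z (\<beta> + \<delta>) = zhat n Z \<beta>"
    using assms(1)
  proof (induction Z)
    case (Cons z Z)
    obtain \<sigma> \<gamma> a where z: "z = (\<sigma>, \<gamma>, a)" by (cases z)
    have "lev n \<gamma> (\<beta> + \<delta>) = lev n \<gamma> \<beta>" using Cons.prems[of \<sigma> \<gamma> a] by (simp add: lev_def ip_add z)
    moreover have "mm n Z (\<beta> + \<delta>) = mm n Z \<beta> \<and> sg n Z (\<beta> + \<delta>) = sg n Z \<beta> \<and> zhat n Z (\<beta> + \<delta>) = zhat n Z \<beta>"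
    proof (rule Cons.IH)
      show "ip n \<gamma>' \<delta> = 0" if "(\<sigma>', \<gamma>', a') \<in> set Z" for \<sigma>' \<gamma>' a'
        by (rule Cons.prems[of \<sigma>' \<gamma>' a']) (use that in simp)
    qed
    moreover have "mm n (z # Z) b = lev n \<gamma> b + mm n Z b" "sg n (z # Z) b = \<sigma> powi lev n \<gamma> b * sg n Z b"
      "zhat n (z # Z) b = fb a (lev n \<gamma> b) * zhat n Z b" for b
      by (simp_all add: z mm_def sg_def zhat_def)
    ultimately show ?case by (simp only:)
  qed (simp add: mm_def sg_def zhat_def)
  then show "genZ n Z p (El \<delta> * f) = El \<delta> * genZ n Z p f"
    unfolding genZ_Sec[OF s] unfolding genZ_Sec[OF f] by (simp add: mult_ac)
qed

definition lat :: "nat \<Rightarrow> series \<Rightarrow> vec \<Rightarrow> latt \<Rightarrow> bool" where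
  "lat n T \<delta> Z \<longleftrightarrow> (\<forall>f\<in>Fock n. \<forall>p. T p f = El \<delta> * genZ n Z p f) \<and> intg n Z \<and> \<delta> \<in> Q n"

lemma genZ_Fock: "f \<in> Fock n \<Longrightarrow> genZ n Z p f \<in> Fock n"
  unfolding Fock_FQ by (rule FS_FQ[OF FS_genZ])

lemma zpow_genZ: "zpow n \<sigma> a \<gamma> = genZ n [(\<sigma>, \<gamma>, a)]"
proof (intro ext)
  fix p f
  have "zpow n \<sigma> a \<gamma> s 0 = 0" for s by (simp add: zpow_def diag_def fps_eq_iff)
  then have "hsum (\<lambda>s. zpow n \<sigma> a \<gamma> s (if p - s = 0 then f else 0)) = zpow n \<sigma> a \<gamma> p f"
    by (subst hsum_single(2)[of p]) auto
  then show "zpow n \<sigma> a \<gamma> p f = genZ n [(\<sigma>, \<gamma>, a)] p f"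
    by (simp add: genZ_simps smult_def const_series_def id_def)
qed

lemma lat_genZ: "intg n Z \<Longrightarrow> lat n (genZ n Z) 0 Z"
  by (simp add: lat_def Q_0)

lemma lat_smult:
  assumes S: "\<And>g s. g \<in> Fock n \<Longrightarrow> S s g = genZ n Z' s g" and T: "lat n T \<delta> Z"
    and Z': "intg n Z'" "\<And>\<sigma> \<gamma> a. (\<sigma>, \<gamma>, a) \<in> set Z' \<Longrightarrow> ip n \<gamma> \<delta> = 0"
  shows "lat n (S \<star> T) \<delta> (Z' @ Z)"
  unfolding lat_def
proof (intro conjI ballI allI)
  fix f p assume f: "f \<in> Fock n"
  have d: "\<delta> \<in> Q n" and Tf: "T q f = El \<delta> * genZ n Z q f" for q using T f by (auto simp: lat_def)
  have e: "El \<delta> * g \<in> Fock n" if "g \<in> Fock n" for g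
    using that unfolding Fock_FQ by (rule FQ_mult[OF El_Sec]) (auto intro: Q_add d)
  have "hsummable (\<lambda>s. genZ n Z' s (genZ n Z (p - s) f))"
    using hsum_Sigma(1)[OF FS_pair'[OF FS_genZ FS_genZ f[unfolded Fock_FQ]]] by blast
  then have "(S \<star> T) p f = El \<delta> * hsum (\<lambda>s. genZ n Z' s (genZ n Z (p - s) f))"
    by (simp add: smult_def Tf S e genZ_Fock f genZ_El[OF Z'(2) d] hsum_mult(2))
  then show "(S \<star> T) p f = El \<delta> * genZ n (Z' @ Z) p f"
    using genZ_append[OF f, of Z' Z p] by (simp add: smult_def)
next
  show "intg n (Z' @ Z)" "\<delta> \<in> Q n" using T Z'(1) by (auto simp: lat_def intg_def)
qed

lemma lat_zquot:
  assumes "lat n T \<delta> Z" "intg n [(1, \<gamma>, 1/2), (1, - \<gamma>, -1/2)]" "ip n \<gamma> \<delta> = 0"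
  shows "lat n (zquot n \<gamma> \<star> T) \<delta> ([(1, \<gamma>, 1/2), (1, - \<gamma>, -1/2)] @ Z)"
  by (rule lat_smult) (use assms genZ_append[of _ n "[(1, \<gamma>, 1/2)]" "[(1, - \<gamma>, -1/2)]"] in
    \<open>auto simp: zquot_def zpow_genZ ip_lin\<close>)

lemma lat_zpow:
  assumes "lat n T \<delta> Z" "intg n [(\<sigma>, \<gamma>, a)]" "ip n \<gamma> \<delta> = 0"
  shows "lat n (zpow n \<sigma> a \<gamma> \<star> T) \<delta> ((\<sigma>, \<gamma>, a) # Z)"
  using lat_smult[OF _ assms(1), of "zpow n \<sigma> a \<gamma>" "[(\<sigma>, \<gamma>, a)]"] assms(2,3) by (simp add: zpow_genZ)

lemma lat_ee:
  assumes "lat n T \<delta> Z" "\<gamma> \<in> Q n"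
  shows "lat n (ee \<gamma> \<star> T) (\<gamma> + \<delta>) Z"
proof -
  have "(ee \<gamma> \<star> T) p f = El \<gamma> * T p f" for p f
    unfolding smult_def by (subst hsum_single(2)[of 0]) (auto simp: const_series_def exp_lat_El)
  then show ?thesis using assms by (simp add: lat_def El_add mult.assoc Q_add)
qed

lemma sexp_lat:
  assumes "lat n T \<delta> Z" "f \<in> Fock n"
  shows "(sexp (genA A) \<star> T) p f = El \<delta> * PH n A Z p f"
proof -
  have e: "sexp (genA A) r (El \<delta> * g) = El \<delta> * sexp (genA A) r g" for r g
  proof -
    have "El \<delta> * phi (Aop A) k g = phi (Aop A) k (El \<delta> * g)" for k
      by (rule phi_hom[of "\<lambda>g. El \<delta> * g"]) (simp_all add: Aop_El mult.left_commute distrib_left)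
    then show ?thesis by (simp add: sexp_genA)
  qed
  have "hsummable (\<lambda>s. sexp (genA A) s (genZ n Z (p - s) f))"
    using hsum_Sigma(1)[OF FS_pair'[OF FS_genA FS_genZ assms(2)[unfolded Fock_FQ]]] by blast
  then show ?thesis
    using assms by (simp add: smult_def lat_def e PH_def hsum_mult(2))
qed

lemma vop_full:
  assumes V: "is_cre V (cfps C)" and W: "W = genA A" and T: "lat n T \<delta> Z" and ok: "\<forall>(y, i, b)\<in>set C. i \<le> n + 3"
  shows "vop n (sexp V \<star> sexp W \<star> T) C \<delta> A Z"
  unfolding vop_def
proof (intro conjI ballI allI)
  fix f p assume f: "f \<in> Fock n"
  have "sexp V s g = (if s < 0 then 0 else fps_nth (mexp (cfps C)) (nat s) * g)" for s g
    using is_cre_sexp[OF V cfps_00] by (simp add: is_cre_def)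
  then have "sexp V s (El \<delta> * g) = Mz (MM C \<delta>) s * g" for s g
    by (simp add: Mz_def MM_def mult.assoc)
  then have "(sexp V \<star> sexp W \<star> T) p f = hsum (\<lambda>s. Mz (MM C \<delta>) s * PH n A Z (p - s) f)"
    unfolding W smult_def[of "sexp V"] sexp_lat[OF T f] by simp
  also have "\<dots> = hsum (\<lambda>r. Mz (MM C \<delta>) (p - r) * PH n A Z r f)"
    by (subst hsum_reindex(2)[OF bij_minus, of _ p, symmetric]) simp
  finally show "(sexp V \<star> sexp W \<star> T) p f = hsum (\<lambda>r. Mz (MM C \<delta>) (p - r) * PH n A Z r f)" .
qed (use T ok in \<open>auto simp: lat_def okC_def\<close>)

lemma MM_nil: "Mz (MM [] \<delta>) s = (if s = 0 then El \<delta> else 0)"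
  by (auto simp: Mz_def MM_def cfps_def)

lemma vop_annihilation:
  assumes W: "W = genA A" and T: "lat n T \<delta> Z"
  shows "vop n (sexp W \<star> T) [] \<delta> A Z"
  unfolding vop_def
proof (intro conjI ballI allI)
  fix f p assume f: "f \<in> Fock n"
  show "(sexp W \<star> T) p f = hsum (\<lambda>r. Mz (MM [] \<delta>) (p - r) * PH n A Z r f)"
    unfolding W sexp_lat[OF T f] by (subst hsum_single(2)[of p]) (auto simp: MM_nil)
qed (use T in \<open>auto simp: lat_def okC_def\<close>)

lemma vop_creation:
  assumes V: "is_cre V (cfps C)" and ok: "\<forall>(y, i, b)\<in>set C. i \<le> n + 3"
  shows "vop n (sexp V) C 0 [] []"
  unfolding vop_def
proof (intro conjI ballI allI)
  fix f p assume f: "f \<in> Fock n"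
  show "sexp V p f = hsum (\<lambda>r. Mz (MM C 0) (p - r) * PH n [] [] r f)"
    using is_cre_sexp[OF V cfps_00] by (subst hsum_single(2)[of 0]) (auto simp: PH_nil[OF f] is_cre_def Mz_def MM_def)
qed (use ok in \<open>auto simp: okC_def Q_0 intg_def\<close>)

lemma vop_cong:
  assumes "vop n X C \<delta> A Z" "cfps C = cfps C'" "\<And>s f. Aop A s f = Aop A' s f"
    "\<And>\<beta> s. \<beta> \<in> Q n \<Longrightarrow> zs n Z \<beta> s = zs n Z' \<beta> s" "\<And>\<beta>. \<beta> \<in> Q n \<Longrightarrow> sg n Z \<beta> = sg n Z' \<beta>"
    "okC n C' \<delta>" "intg n Z'"
  shows "vop n X C' \<delta> A' Z'"
proof -
  have "MM C \<delta> = MM C' \<delta>" by (simp add: MM_def assms(2))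
  moreover have "PH n A Z p f = PH n A' Z' p f" if "f \<in> Fock n" for p f
    by (rule PH_cong) (use assms(3-5) that in auto)
  ultimately show ?thesis using assms(1,6,7) by (simp add: vop_def)
qed

section \<open>The contractions of the currents\<close>

text \<open>For j = 1 the entry with index j - 1 = 0 stands for a_{0,-k} = 0 and never
  contracts.\<close>

definition dE :: "nat \<Rightarrow> nat \<Rightarrow> dat" where
  "dE n j = (if j = n then
     ([(-1, n - 1, 1/4), (1, n + 1, -1/4), (1, n + 1, 3/4), (1, n + 2, -3/4), (1, n + 2, 3/4)],
      - beta n 1 + (beta n 2 + beta n 3), [(-1, n, -1/4), (-1, n + 1, -1/4), (-1, n + 2, 1/4)],
      [((-1) ^ (n - 1), alpha n n, -1/4), (1, beta n 2, -1/4), (1, beta n 3, 1/4)])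
   else ([(1, j, -1/4), (1, j, 3/4), (-1, j + 1, 1/4), (-1, j - 1, 1/4)], alpha n j, [(-1, j, -1/4)],
      [((-1) ^ (j - 1), if j = n - 1 then alpha n j + beta n 1 else alpha n j, -1/4)]))"

definition dF :: "nat \<Rightarrow> nat \<Rightarrow> dat" where
  "dF n j = (if j = n then
     ([(1, n - 1, -1/4), (-1, n + 1, 1/4), (-1, n + 1, -3/4), (-1, n + 3, -3/4), (-1, n + 3, 3/4)],
      beta n 1 + (- beta n 2 + beta n 4), [(1, n, 1/4), (1, n + 1, 1/4), (1, n + 3, -1/4)],
      [((-1) ^ (n - 1), - alpha n n, 1/4), (1, - beta n 2, 1/4), (1, beta n 4, -1/4)])
   else ([(-1, j, 1/4), (-1, j, -3/4), (1, j + 1, -1/4), (1, j - 1, -1/4)], - alpha n j, [(1, j, 1/4)],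
      [((-1) ^ (j - 1), if j = n - 1 then - alpha n j - beta n 1 else - alpha n j, 1/4)]))"

text \<open>The contraction table of an index pair. The mixed products share their lists, and every
  list serves both orders of multiplication.\<close>

definition bas :: "nat \<Rightarrow> nat \<Rightarrow> nat \<Rightarrow> complex list \<Rightarrow> complex list \<Rightarrow> complex list \<Rightarrow> complex list \<Rightarrow> complex list \<Rightarrow> complex list \<Rightarrow> bool" where
  "bas n i j en ep fn fp xn xp \<longleftrightarrow>
    lk n (dE n i) (dE n j) en ep en ep \<and> lk n (dF n i) (dF n j) fn fp fn fp \<and>
    lk n (dE n i) (dF n j) xn xp xn xp \<and> lk n (dF n i) (dE n j) xn xp xn xp"

lemma bas_sym: "bas n i j en ep fn fp xn xp \<Longrightarrow> bas n j i en ep fn fp xn xp"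
  by (auto simp: bas_def intro: lk_sym)

lemma sign_powi:
  "((-1 :: complex) ^ k) powi 2 = 1" "((-1 :: complex) ^ k) powi (- 2) = 1"
  "((-1 :: complex) ^ k) powi 1 = (-1) ^ k" "((-1 :: complex) ^ k) powi (- 1) = (-1) ^ k"
  "(- ((-1 :: complex) ^ k)) powi 2 = 1" "(- ((-1 :: complex) ^ k)) powi (- 2) = 1"
  "(- ((-1 :: complex) ^ k)) powi 1 = - ((-1) ^ k)" "(- ((-1 :: complex) ^ k)) powi (- 1) = - ((-1) ^ k)"
proof -
  have "(-1 :: complex) ^ k = 1 \<or> (-1 :: complex) ^ k = -1" by (cases "even k") auto
  then show "((-1 :: complex) ^ k) powi 2 = 1" "((-1 :: complex) ^ k) powi (- 2) = 1"
    "((-1 :: complex) ^ k) powi 1 = (-1) ^ k" "((-1 :: complex) ^ k) powi (- 1) = (-1) ^ k"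
    "(- ((-1 :: complex) ^ k)) powi 2 = 1" "(- ((-1 :: complex) ^ k)) powi (- 2) = 1"
    "(- ((-1 :: complex) ^ k)) powi 1 = - ((-1) ^ k)" "(- ((-1 :: complex) ^ k)) powi (- 1) = - ((-1) ^ k)"
    by (auto simp: power_int_def)
qed

lemma floor_m1: "\<lfloor>- 1 :: real\<rfloor> = - 1"
  by (simp add: floor_eq_iff)

lemmas dat_simps = floor_m1 ctr_def prs_def mm_def sg_def lev_def ip_lin ip_alpha_alpha ip_alpha_beta ip_beta_beta sign_powi cc_uminus

text \<open>Each constant is an annihilation shift minus a creation shift: -1/4 minus -1/4 or 3/4
  for E with E, and -1/4 minus 1/4 or -3/4 for E with F, where the coefficients put them among the
  denominators.\<close>

lemma bas_same:
  assumes "1 \<le> j" "j < n"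
  shows "bas n j j [] [0, -1] [] [0, 1] [1/2, -1/2] []"
proof -
  obtain k where k: "j = Suc k" using assms(1) by (cases j) auto
  have j: "j \<noteq> n" "j \<in> {1..n}" "1 \<le> (1 :: nat)" using assms by auto
  show ?thesis
    unfolding bas_def lk_def dE_def dF_def if_not_P[OF j(1)] prod.case
    using j unfolding k
    by (intro conjI; simp add: dat_simps flip: fps_const_neg)
qed

text \<open>For E with E the boson a_{n+1} contributes 0 and -1, as for a root of norm 2, and
  a_{n+2} contributes 1 and -1/2. Between the two orders 0 and the pair 1, -1 cancel, and -1/2
  remains, as the short root requires. In the mixed products only a_{n+1} contracts.\<close>

lemma bas_last:
  assumes "2 \<le> n"
  shows "bas n n n [] [0, -1, 1, -1/2] [] [0, 1, 1/2, -1] [1/2, -1/2] []"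
proof -
  obtain k where k: "n = Suc (Suc k)" using assms by (cases n; cases "n - 1") auto
  have j: "n \<in> {1..n}" "1 \<le> (1 :: nat)" using assms by auto
  show ?thesis
    unfolding bas_def lk_def dE_def dF_def if_P[OF refl] prod.case
    using j unfolding k
    by (intro conjI; simp add: dat_simps flip: fps_const_neg)
qed

text \<open>Neighbours contract through the terms with index i + 1 or i in the other creation part.
  In the mixed products the two shifts agree, hence the constant 0.\<close>

lemma bas_adjacent:
  assumes "1 \<le> i" "i + 1 < n"
  shows "bas n i (i + 1) [-1/2] [] [1/2] [] [] [0]"
proof -
  obtain k where k: "i = Suc k" using assms(1) by (cases i) auto
  have j: "i \<noteq> 0" "i \<noteq> n" "i + 1 \<noteq> n" "i \<noteq> n - 1" "i \<in> {1..n}" "i + 1 \<in> {1..n}" "1 \<le> (1 :: nat)" using assms by auto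
  show ?thesis
    unfolding bas_def lk_def dE_def dF_def if_not_P[OF j(2)] if_not_P[OF j(3)] if_not_P[OF j(4)] prod.case
    using j unfolding k
    by (intro conjI; simp add: dat_simps flip: fps_const_neg)
qed

text \<open>The lattice vector of E_n contains -\<beta>_1 in the place of \<alpha>_n; the extra
  \<beta>_1 in the zero mode of index n - 1 restores the pairing -1.\<close>

lemma bas_adjacent_last:
  assumes "2 \<le> n"
  shows "bas n (n - 1) n [-1/2] [] [1/2] [] [] [0]"
proof -
  obtain k where k: "n = Suc (Suc k)" using assms by (cases n; cases "n - 1") auto
  have j: "n - 1 \<noteq> n" using assms by auto
  show ?thesis
    unfolding bas_def lk_def dE_def dF_def if_not_P[OF j] if_P[OF refl] prod.case
    unfolding k
    by (intro conjI; simp add: dat_simps flip: fps_const_neg)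
qed

lemma bas_far:
  assumes "1 \<le> i" "i + 1 < j" "j < n"
  shows "bas n i j [] [] [] [] [] []"
proof -
  obtain m l where k: "i = Suc m" "j = Suc (Suc (Suc (m + l)))"
    using less_imp_Suc_add[OF assms(2)] assms(1) by (cases i) auto
  have j: "i \<noteq> n" "j \<noteq> n" "i \<noteq> n - 1" "i \<in> {1..n}" "j \<in> {1..n}" "1 \<le> (1 :: nat)" using assms by auto
  show ?thesis
    unfolding bas_def lk_def dE_def dF_def if_not_P[OF j(1)] if_not_P[OF j(2)] if_not_P[OF j(3)] prod.case
    using j unfolding k
    by (intro conjI; simp add: dat_simps flip: fps_const_neg)
qed

lemma bas_far_last:
  assumes "1 \<le> i" "i + 1 < n"
  shows "bas n i n [] [] [] [] [] []"
proof -
  obtain m l where k: "i = Suc m" "n = Suc (Suc (Suc (m + l)))"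
    using less_imp_Suc_add[OF assms(2)] assms(1) by (cases i) auto
  have j: "i \<noteq> n" "i \<noteq> n - 1" "i \<in> {1..n}" "n \<in> {1..n}" "1 \<le> (1 :: nat)" using assms by auto
  show ?thesis
    unfolding bas_def lk_def dE_def dF_def if_not_P[OF j(1)] if_not_P[OF j(2)] if_P[OF refl] prod.case
    using j unfolding k
    by (intro conjI; simp add: dat_simps flip: fps_const_neg)
qed

text \<open>H is described through E and F instead of its own formula, so that its contractions
  follow from \<open>lk_comb\<close>. The shifts are those that the delta functions of the
  commutator demand; \<open>Hpcur_vx\<close> and \<open>Hmcur_vx\<close> show agreement with the
  given series.\<close>

definition dHp :: "nat \<Rightarrow> nat \<Rightarrow> dat" where
  "dHp n j = comb (-1/4) (dE n j) (1/4) (dF n j)"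

definition dHm :: "nat \<Rightarrow> nat \<Rightarrow> dat" where
  "dHm n j = comb (1/4) (dE n j) (-1/4) (dF n j)"

lemma intg_simps: "intg n []" "intg n ((\<sigma>, \<gamma>, a) # Z) \<longleftrightarrow> \<sigma> \<noteq> 0 \<and> (\<forall>\<beta>\<in>Q n. ip n \<gamma> \<beta> \<in> \<int>) \<and> intg n Z"
  by (auto simp: intg_def)

lemma lev_lin:
  "ip n \<gamma> \<beta> \<in> \<int> \<Longrightarrow> lev n (- \<gamma>) \<beta> = - lev n \<gamma> \<beta>"
  "ip n \<gamma> \<beta> \<in> \<int> \<Longrightarrow> ip n \<gamma>' \<beta> \<in> \<int> \<Longrightarrow> lev n (\<gamma> + \<gamma>') \<beta> = lev n \<gamma> \<beta> + lev n \<gamma>' \<beta>"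
  "ip n \<gamma> \<beta> \<in> \<int> \<Longrightarrow> ip n \<gamma>' \<beta> \<in> \<int> \<Longrightarrow> lev n (\<gamma> - \<gamma>') \<beta> = lev n \<gamma> \<beta> - lev n \<gamma>' \<beta>"
  by (auto simp: lev_def ip_lin elim!: Ints_cases simp flip: of_int_add of_int_diff of_int_minus)

lemma Q_diff: "\<beta> \<in> Q n \<Longrightarrow> \<gamma> \<in> Q n \<Longrightarrow> \<beta> - \<gamma> \<in> Q n"
  using Q_add[OF _ Q_uminus, of \<beta> n \<gamma>] by simp

lemma okD_EF:
  assumes "j \<in> {1..n}" "2 \<le> n"
  shows "okD n (dE n j)" "okD n (dF n j)"
  using assms
  by (auto simp: okD_def okC_def dE_def dF_def intg_simps ip_lin alpha_Ints beta_Ints intro!: Q_add Q_diff Q_uminus alpha_Q beta_Q)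

lemma okD_H:
  assumes "j \<in> {1..n}" "2 \<le> n"
  shows "okD n (dHp n j)" "okD n (dHm n j)"
  unfolding dHp_def dHm_def by (intro okD_comb okD_EF assms)+

lemma lat_zpow0: "intg n [(\<sigma>, \<gamma>, a)] \<Longrightarrow> lat n (zpow n \<sigma> a \<gamma>) 0 [(\<sigma>, \<gamma>, a)]"
  unfolding zpow_genZ by (rule lat_genZ)

lemmas lat_data = intg_simps ip_lin alpha_Ints beta_Ints ip_alpha_beta ip_beta_beta ip_alpha_alpha
lemmas ann_data = an_genA genA_ops neg_terms_def

lemma Ecur_vx:
  assumes "j \<in> {1..n}" "2 \<le> n"
  shows "vx n (Ecur n j) (dE n j)"
proof (cases "j = n")
  case True
  have n: "n \<in> {1..n}" using assms by auto
  have "is_cre (- cr (n-1) (1/4) + (cr (n+1) (-1/4) + cr (n+1) (3/4)) + (cr (n+2) (-3/4) + cr (n+2) (3/4)))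
    (cfps ((neg_terms [(1, n - 1, 1/4)] @ ([(1, n + 1, -1/4)] @ [(1, n + 1, 3/4)])) @ ([(1, n + 2, -3/4)] @ [(1, n + 2, 3/4)])))"
    by (intro is_cre_terms)
  then have c: "is_cre (- cr (n-1) (1/4) + (cr (n+1) (-1/4) + cr (n+1) (3/4)) + (cr (n+2) (-3/4) + cr (n+2) (3/4)))
    (cfps [(-1, n - 1, 1/4), (1, n + 1, -1/4), (1, n + 1, 3/4), (1, n + 2, -3/4), (1, n + 2, 3/4)])"
    by (simp only: neg_terms_def list.map append.simps prod.case)
  have l: "lat n (ee (- beta n 1) \<star> zpow n ((-1)^(n-1)) (-1/4) (alpha n n) \<star> ee (beta n 2 + beta n 3) \<star> zpow n 1 (-1/4) (beta n 2) \<star> zpow n 1 (1/4) (beta n 3))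
    (- beta n 1 + ((beta n 2 + beta n 3) + 0)) [((-1) ^ (n - 1), alpha n n, -1/4), (1, beta n 2, -1/4), (1, beta n 3, 1/4)]"
    by (intro lat_ee lat_zpow lat_zpow0 Q_uminus Q_add beta_Q) (use n in \<open>auto simp: lat_data\<close>)
  show ?thesis
    unfolding vx_def True dE_def Ecur_def if_P[OF refl] prod.case
    by (rule vop_full[OF c _ l[unfolded add_0_right]]) (auto simp: ann_data)
next
  case False
  have j: "j \<in> {1..n}" "j < n" using assms False by auto
  have "is_cre ((cr j (-1/4) + cr j (3/4)) - (cr (j+1) (1/4) + cr (j-1) (1/4)))
    (cfps (([(1, j, -1/4)] @ [(1, j, 3/4)]) @ neg_terms ([(1, j + 1, 1/4)] @ [(1, j - 1, 1/4)])))"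
    by (intro is_cre_terms)
  then have c: "is_cre ((cr j (-1/4) + cr j (3/4)) - (cr (j+1) (1/4) + cr (j-1) (1/4)))
    (cfps [(1, j, -1/4), (1, j, 3/4), (-1, j + 1, 1/4), (-1, j - 1, 1/4)])"
    by (simp only: neg_terms_def list.map append.simps prod.case)
  have l: "lat n (ee (alpha n j) \<star> zpow n ((-1)^(j-1)) (-1/4) (if j = n - 1 then alpha n j + beta n 1 else alpha n j))
    (alpha n j + 0) [((-1) ^ (j - 1), if j = n - 1 then alpha n j + beta n 1 else alpha n j, -1/4)]"
    by (intro lat_ee lat_zpow0 alpha_Q) (use j in \<open>auto simp: lat_data\<close>)
  show ?thesis
    unfolding vx_def dE_def Ecur_def if_not_P[OF False] prod.case
    by (rule vop_full[OF c _ l[unfolded add_0_right]]) (use j in \<open>auto simp: ann_data\<close>)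
qed

lemma Fcur_vx:
  assumes "j \<in> {1..n}" "2 \<le> n"
  shows "vx n (Fcur n j) (dF n j)"
proof (cases "j = n")
  case True
  have n: "n \<in> {1..n}" using assms by auto
  have "is_cre (cr (n-1) (-1/4) - (cr (n+1) (1/4) + cr (n+1) (-3/4)) - (cr (n+3) (-3/4) + cr (n+3) (3/4)))
    (cfps (([(1, n - 1, -1/4)] @ neg_terms ([(1, n + 1, 1/4)] @ [(1, n + 1, -3/4)])) @ neg_terms ([(1, n + 3, -3/4)] @ [(1, n + 3, 3/4)])))"
    by (intro is_cre_terms)
  then have c: "is_cre (cr (n-1) (-1/4) - (cr (n+1) (1/4) + cr (n+1) (-3/4)) - (cr (n+3) (-3/4) + cr (n+3) (3/4)))
    (cfps [(1, n - 1, -1/4), (-1, n + 1, 1/4), (-1, n + 1, -3/4), (-1, n + 3, -3/4), (-1, n + 3, 3/4)])"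
    by (simp only: neg_terms_def list.map append.simps prod.case)
  have l: "lat n (ee (beta n 1) \<star> zpow n ((-1)^(n-1)) (1/4) (- alpha n n) \<star> ee (- beta n 2 + beta n 4) \<star> zpow n 1 (1/4) (- beta n 2) \<star> zpow n 1 (-1/4) (beta n 4))
    (beta n 1 + ((- beta n 2 + beta n 4) + 0)) [((-1) ^ (n - 1), - alpha n n, 1/4), (1, - beta n 2, 1/4), (1, beta n 4, -1/4)]"
    by (intro lat_ee lat_zpow lat_zpow0 Q_uminus Q_add beta_Q) (use n in \<open>auto simp: lat_data\<close>)
  show ?thesis
    unfolding vx_def True dF_def Fcur_def if_P[OF refl] prod.case
    by (rule vop_full[OF c _ l[unfolded add_0_right]]) (auto simp: ann_data)
next
  case False
  have j: "j \<in> {1..n}" "j < n" using assms False by auto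
  have "is_cre (- (cr j (1/4) + cr j (-3/4)) + (cr (j+1) (-1/4) + cr (j-1) (-1/4)))
    (cfps (neg_terms ([(1, j, 1/4)] @ [(1, j, -3/4)]) @ ([(1, j + 1, -1/4)] @ [(1, j - 1, -1/4)])))"
    by (intro is_cre_terms)
  then have c: "is_cre (- (cr j (1/4) + cr j (-3/4)) + (cr (j+1) (-1/4) + cr (j-1) (-1/4)))
    (cfps [(-1, j, 1/4), (-1, j, -3/4), (1, j + 1, -1/4), (1, j - 1, -1/4)])"
    by (simp only: neg_terms_def list.map append.simps prod.case)
  have l: "lat n (ee (- alpha n j) \<star> zpow n ((-1)^(j-1)) (1/4) (if j = n - 1 then - alpha n j - beta n 1 else - alpha n j))
    (- alpha n j + 0) [((-1) ^ (j - 1), if j = n - 1 then - alpha n j - beta n 1 else - alpha n j, 1/4)]"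
    by (intro lat_ee lat_zpow0 Q_uminus alpha_Q) (use j in \<open>auto simp: lat_data\<close>)
  show ?thesis
    unfolding vx_def dF_def Fcur_def if_not_P[OF False] prod.case
    by (rule vop_full[OF c _ l[unfolded add_0_right]]) (use j in \<open>auto simp: ann_data\<close>)
qed

lemmas cong_data = comb_def dE_def dF_def shift_terms_def shift_latt_def cfps_def Aop_def zs_def sg_def lev_lin ip_lin
  alpha_Ints beta_Ints cc_uminus power_int_minus power_int_add power_int_diff

text \<open>The data as they stand in the formula. For j < n the creation entries of E and F cancel,
  and H^+ consists of annihilation operators and zero modes.\<close>

lemma Hpcur_natural:
  assumes "j \<in> {1..n}" "2 \<le> n" "j < n"
  shows "vop n (Hpcur n j) [] 0 [(-1, j, -1/2), (1, j, 1/2)]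
    [(1, if j = n - 1 then - alpha n j - beta n 1 else - alpha n j, 1/2), (1, - (if j = n - 1 then - alpha n j - beta n 1 else - alpha n j), -1/2)]"
proof -
  let ?g = "if j = n - 1 then - alpha n j - beta n 1 else - alpha n j"
  have l: "lat n (zquot n ?g) 0 [(1, ?g, 1/2), (1, - ?g, -1/2)]"
    unfolding zquot_def by (intro lat_zpow lat_zpow0) (use assms in \<open>auto simp: lat_data\<close>)
  have j: "j \<noteq> n" using assms by simp
  show ?thesis
    unfolding Hpcur_def if_not_P[OF j] by (rule vop_annihilation[OF _ l]) (simp add: ann_data)
qed

lemma Hmcur_natural:
  assumes "j \<in> {1..n}" "2 \<le> n" "j < n"
  shows "vop n (Hmcur n j) [(-1, j, -1), (1, j, 1), (1, j + 1, -1/2), (1, j - 1, -1/2), (-1, j + 1, 1/2), (-1, j - 1, 1/2)] 0 [] []"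
proof -
  have "is_cre (- (cr j (-1) - cr j 1) + ((cr (j+1) (-1/2) + cr (j-1) (-1/2)) - (cr (j+1) (1/2) + cr (j-1) (1/2))))
    (cfps (neg_terms ([(1, j, -1)] @ neg_terms [(1, j, 1)]) @ (([(1, j + 1, -1/2)] @ [(1, j - 1, -1/2)]) @ neg_terms ([(1, j + 1, 1/2)] @ [(1, j - 1, 1/2)]))))"
    by (intro is_cre_terms)
  then have c: "is_cre (- (cr j (-1) - cr j 1) + ((cr (j+1) (-1/2) + cr (j-1) (-1/2)) - (cr (j+1) (1/2) + cr (j-1) (1/2))))
    (cfps [(-1, j, -1), (1, j, 1), (1, j + 1, -1/2), (1, j - 1, -1/2), (-1, j + 1, 1/2), (-1, j - 1, 1/2)])"
    by (simp only: neg_terms_def list.map append.simps prod.case minus_minus)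
  have j: "j \<noteq> n" using assms by simp
  show ?thesis
    unfolding Hmcur_def if_not_P[OF j] by (rule vop_creation[OF c]) (use assms in auto)
qed

lemma Hpcur_vx:
  assumes "j \<in> {1..n}" "2 \<le> n"
  shows "vx n (Hpcur n j) (dHp n j)"
proof (cases "j = n")
  case True
  have n: "n \<in> {1..n}" using assms by auto
  have "is_cre ((cr (n+2) (-1) + cr (n+2) (1/2)) - (cr (n+3) 1 + cr (n+3) (-1/2)))
    (cfps (([(1, n + 2, -1)] @ [(1, n + 2, 1/2)]) @ neg_terms ([(1, n + 3, 1)] @ [(1, n + 3, -1/2)])))"
    by (intro is_cre_terms)
  then have c: "is_cre ((cr (n+2) (-1) + cr (n+2) (1/2)) - (cr (n+3) 1 + cr (n+3) (-1/2)))
    (cfps [(1, n + 2, -1), (1, n + 2, 1/2), (-1, n + 3, 1), (-1, n + 3, -1/2)])"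
    by (simp only: neg_terms_def list.map append.simps prod.case)
  let ?Z = "[(1, - alpha n n - beta n 2, 1/2), (1, - (- alpha n n - beta n 2), -1/2)] @ [(1, beta n 3 + beta n 4, 0)]"
  have l: "lat n (zquot n (- alpha n n - beta n 2) \<star> ee (beta n 3 + beta n 4) \<star> zpow n 1 0 (beta n 3 + beta n 4))
    ((beta n 3 + beta n 4) + 0) ?Z"
    by (intro lat_zquot lat_ee lat_zpow0 Q_add beta_Q) (use n in \<open>auto simp: lat_data\<close>)
  have v: "vop n (Hpcur n n) [(1, n + 2, -1), (1, n + 2, 1/2), (-1, n + 3, 1), (-1, n + 3, -1/2)] (beta n 3 + beta n 4)
    [(1, n, 1/2), (1, n + 1, 1/2), (-1, n, -1/2), (-1, n + 1, -1/2), (1, n + 3, 0), (-1, n + 2, 0)] ?Z"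
    unfolding Hpcur_def if_P[OF refl] by (rule vop_full[OF c _ l[unfolded add_0_right]]) (auto simp: ann_data)
  obtain C \<delta> A Z where D: "dHp n n = (C, \<delta>, A, Z)" by (cases "dHp n n")
  have \<delta>: "\<delta> = beta n 3 + beta n 4" using D by (auto simp: dHp_def comb_def dE_def dF_def)
  have ok: "okC n C \<delta>" "intg n Z" using okD_H(1)[OF n assms(2)] by (simp_all add: D okD_def)
  \<comment> \<open>The composite data contain entries that cancel, and zero modes that the formula
    gathers, such as \<beta>_3 + \<beta>_4. They define the same operator, which is what
    \<open>vop_cong\<close> asks for.\<close>
  have "vop n (Hpcur n n) C (beta n 3 + beta n 4) A Z"
    by (rule vop_cong[OF v _ _ _ _ ok(1)[unfolded \<delta>] ok(2)])
       (use D n in \<open>auto simp: dHp_def cong_data algebra_simps simp flip: fps_const_neg\<close>)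
  then show ?thesis unfolding vx_def True D prod.case \<delta> .
next
  case False
  then have j: "j < n" using assms by auto
  note v = Hpcur_natural[OF assms j]
  obtain C \<delta> A Z where D: "dHp n j = (C, \<delta>, A, Z)" by (cases "dHp n j")
  have \<delta>: "\<delta> = 0" using D False by (auto simp: dHp_def comb_def dE_def dF_def)
  have ok: "okC n C \<delta>" "intg n Z" using okD_H(1)[OF assms] by (simp_all add: D okD_def)
  have "vop n (Hpcur n j) C 0 A Z"
    by (rule vop_cong[OF v _ _ _ _ ok(1)[unfolded \<delta>] ok(2)])
       (use D False assms j in \<open>auto simp: dHp_def cong_data algebra_simps simp flip: fps_const_neg\<close>)
  then show ?thesis unfolding vx_def D prod.case \<delta> .
qed

lemma Hmcur_vx:
  assumes "j \<in> {1..n}" "2 \<le> n"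
  shows "vx n (Hmcur n j) (dHm n j)"
proof (cases "j = n")
  case True
  have n: "n \<in> {1..n}" using assms by auto
  have "is_cre ((cr (n-1) (-1/2) - cr (n-1) (1/2)) - (cr (n+1) (-1) - cr (n+1) 1)
             + (cr (n+2) (-1/2) + cr (n+2) 1) - (cr (n+3) (1/2) + cr (n+3) (-1)))
    (cfps (((([(1, n - 1, -1/2)] @ neg_terms [(1, n - 1, 1/2)]) @ neg_terms ([(1, n + 1, -1)] @ neg_terms [(1, n + 1, 1)]))
      @ ([(1, n + 2, -1/2)] @ [(1, n + 2, 1)])) @ neg_terms ([(1, n + 3, 1/2)] @ [(1, n + 3, -1)])))"
    by (intro is_cre_terms)
  then have c: "is_cre ((cr (n-1) (-1/2) - cr (n-1) (1/2)) - (cr (n+1) (-1) - cr (n+1) 1)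
             + (cr (n+2) (-1/2) + cr (n+2) 1) - (cr (n+3) (1/2) + cr (n+3) (-1)))
    (cfps [(1, n - 1, -1/2), (-1, n - 1, 1/2), (-1, n + 1, -1), (1, n + 1, 1), (1, n + 2, -1/2), (1, n + 2, 1), (-1, n + 3, 1/2), (-1, n + 3, -1)])"
    by (simp only: neg_terms_def list.map append.simps prod.case minus_minus)
  let ?Z = "[(1, beta n 3, 1/2), (1, beta n 4, -1/2)]"
  have l: "lat n (ee (beta n 3 + beta n 4) \<star> zpow n 1 (1/2) (beta n 3) \<star> zpow n 1 (-1/2) (beta n 4)) ((beta n 3 + beta n 4) + 0) ?Z"
    by (intro lat_zpow lat_ee lat_zpow0 Q_add beta_Q) (use n in \<open>auto simp: lat_data\<close>)
  have v: "vop n (Hmcur n n) [(1, n - 1, -1/2), (-1, n - 1, 1/2), (-1, n + 1, -1), (1, n + 1, 1), (1, n + 2, -1/2), (1, n + 2, 1), (-1, n + 3, 1/2), (-1, n + 3, -1)]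
    (beta n 3 + beta n 4) [(-1, n + 2, 1/2), (1, n + 3, -1/2)] ?Z"
    unfolding Hmcur_def if_P[OF refl] by (rule vop_full[OF c _ l[unfolded add_0_right]]) (auto simp: ann_data)
  obtain C \<delta> A Z where D: "dHm n n = (C, \<delta>, A, Z)" by (cases "dHm n n")
  have \<delta>: "\<delta> = beta n 3 + beta n 4" using D by (auto simp: dHm_def comb_def dE_def dF_def)
  have ok: "okC n C \<delta>" "intg n Z" using okD_H(2)[OF n assms(2)] by (simp_all add: D okD_def)
  have "vop n (Hmcur n n) C (beta n 3 + beta n 4) A Z"
    by (rule vop_cong[OF v _ _ _ _ ok(1)[unfolded \<delta>] ok(2)])
       (use D n in \<open>auto simp: dHm_def cong_data algebra_simps simp flip: fps_const_neg\<close>)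
  then show ?thesis unfolding vx_def True D prod.case \<delta> .
next
  case False
  then have j: "j < n" using assms by auto
  note v = Hmcur_natural[OF assms j]
  obtain C \<delta> A Z where D: "dHm n j = (C, \<delta>, A, Z)" by (cases "dHm n j")
  have \<delta>: "\<delta> = 0" using D False by (auto simp: dHm_def comb_def dE_def dF_def)
  have ok: "okC n C \<delta>" "intg n Z" using okD_H(2)[OF assms] by (simp_all add: D okD_def)
  have "vop n (Hmcur n j) C 0 A Z"
    by (rule vop_cong[OF v _ _ _ _ ok(1)[unfolded \<delta>] ok(2)])
       (use D False assms j in \<open>auto simp: dHm_def cong_data algebra_simps simp flip: fps_const_neg\<close>)
  then show ?thesis unfolding vx_def D prod.case \<delta> .
qed

text \<open>The quadratic relations of one index pair for c = 1. The constant b is a parameter since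
  only four contraction patterns occur.\<close>

definition rels :: "nat \<Rightarrow> nat \<Rightarrow> nat \<Rightarrow> complex \<Rightarrow> bool" where
  "rels n i j b \<longleftrightarrow> (let S = Fock n; E = Ecur n; F = Fcur n; Hp = Hpcur n; Hm = Hmcur n; \<kappa> = 1 in
      eq_on S (uv (Hp i) (Hp j)) (vu (Hp i) (Hp j)) \<and>
      eq_on S (uv (Hm i) (Hm j)) (vu (Hm i) (Hm j)) \<and>
      eq_on S (lin (\<kappa>/2 - b) \<odot> lin (- \<kappa>/2 + b) \<odot> uv (Hp i) (Hm j))
              (lin (\<kappa>/2 + b) \<odot> lin (- \<kappa>/2 - b) \<odot> vu (Hp i) (Hm j)) \<and>
      eq_on S (lin (- \<kappa>/2 - b) \<odot> lin (\<kappa>/2 + b) \<odot> uv (Hm i) (Hp j))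
              (lin (- \<kappa>/2 + b) \<odot> lin (\<kappa>/2 - b) \<odot> vu (Hm i) (Hp j)) \<and>
      (dmul_summable S (inv_u (- \<kappa>/4 - b)) (uv (Hp i) (E j)) \<and>
      eq_on S (vu (Hp i) (E j)) (lin (- \<kappa>/4 + b) \<odot> inv_u (- \<kappa>/4 - b) \<odot> uv (Hp i) (E j))) \<and>
      (dmul_summable S (inv_v (\<kappa>/4 - b)) (uv (Hm i) (E j)) \<and>
      eq_on S (vu (Hm i) (E j)) (lin (\<kappa>/4 + b) \<odot> inv_v (\<kappa>/4 - b) \<odot> uv (Hm i) (E j))) \<and>
      (dmul_summable S (inv_u (\<kappa>/4 - b)) (vu (Hp i) (F j)) \<and>
      eq_on S (uv (Hp i) (F j)) (lin (\<kappa>/4 + b) \<odot> inv_u (\<kappa>/4 - b) \<odot> vu (Hp i) (F j))) \<and>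
      (dmul_summable S (inv_v (- \<kappa>/4 - b)) (vu (Hm i) (F j)) \<and>
      eq_on S (uv (Hm i) (F j)) (lin (- \<kappa>/4 + b) \<odot> inv_v (- \<kappa>/4 - b) \<odot> vu (Hm i) (F j))) \<and>
      eq_on S (lin b \<odot> uv (E i) (E j)) (lin (- b) \<odot> vu (E i) (E j)) \<and>
      eq_on S (lin (- b) \<odot> uv (F i) (F j)) (lin b \<odot> vu (F i) (F j)))"

text \<open>The lists collect shifted copies from the contraction table; cancellation is left to
  \<open>lk_cong\<close>.\<close>

lemma lk_H:
  assumes "bas n i j en ep fn fp xn xp" "i \<in> {1..n}" "j \<in> {1..n}" "2 \<le> n"
  shows
    "lk n (comb s (dE n i) t (dF n i)) (dE n j) (map (\<lambda>c. c + s) en @ map (\<lambda>c. c + t) xn) (map (\<lambda>c. c + s) ep @ map (\<lambda>c. c + t) xp)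
       (map (\<lambda>c. c - s) en @ map (\<lambda>c. c - t) xn) (map (\<lambda>c. c - s) ep @ map (\<lambda>c. c - t) xp)" (is ?E)
    "lk n (comb s (dE n i) t (dF n i)) (dF n j) (map (\<lambda>c. c + s) xn @ map (\<lambda>c. c + t) fn) (map (\<lambda>c. c + s) xp @ map (\<lambda>c. c + t) fp)
       (map (\<lambda>c. c - s) xn @ map (\<lambda>c. c - t) fn) (map (\<lambda>c. c - s) xp @ map (\<lambda>c. c - t) fp)" (is ?F)
    "lk n (comb s (dE n i) t (dF n i)) (comb s' (dE n j) t' (dF n j))
      (map (\<lambda>c. c - s') (map (\<lambda>c. c + s) en @ map (\<lambda>c. c + t) xn) @ map (\<lambda>c. c - t') (map (\<lambda>c. c + s) xn @ map (\<lambda>c. c + t) fn))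
      (map (\<lambda>c. c - s') (map (\<lambda>c. c + s) ep @ map (\<lambda>c. c + t) xp) @ map (\<lambda>c. c - t') (map (\<lambda>c. c + s) xp @ map (\<lambda>c. c + t) fp))
      (map (\<lambda>c. c + s') (map (\<lambda>c. c - s) en @ map (\<lambda>c. c - t) xn) @ map (\<lambda>c. c + t') (map (\<lambda>c. c - s) xn @ map (\<lambda>c. c - t) fn))
      (map (\<lambda>c. c + s') (map (\<lambda>c. c - s) ep @ map (\<lambda>c. c - t) xp) @ map (\<lambda>c. c + t') (map (\<lambda>c. c - s) xp @ map (\<lambda>c. c - t) fp))" (is ?H)
proof -
  note b = assms(1)[unfolded bas_def] and ok = okD_EF[OF assms(2,4)] okD_EF[OF assms(3,4)]
  show E: ?E using b by (intro lk_sym[OF lk_comb] lk_sym[of n "dE n i" "dE n j"] lk_sym[of n "dF n i" "dE n j"] ok) auto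
  show F: ?F using b by (intro lk_sym[OF lk_comb] lk_sym[of n "dE n i" "dF n j"] lk_sym[of n "dF n i" "dF n j"] ok) auto
  show ?H by (rule lk_comb[OF E F okD_comb[OF ok(1,2)] ok(3,4)])
qed

text \<open>The pattern of a long root with itself. After cancellation H^+ with H^+ carries no
  factor, while H^+ with H^- keeps denominators at 1/2, -1/2 and numerators at 3/2, -3/2 in one
  order only.\<close>

lemma rels_1:
  assumes b: "bas n i j [] [0, -1] [] [0, 1] [1/2, -1/2] []" and i: "i \<in> {1..n}" and j: "j \<in> {1..n}" and n: "2 \<le> n"
  shows "rels n i j (1)"
proof -
  note H = lk_H[OF b i j n]
  note vi = Ecur_vx[OF i n] Fcur_vx[OF i n] Hpcur_vx[OF i n, unfolded dHp_def] Hmcur_vx[OF i n, unfolded dHm_def]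
  note vj = Ecur_vx[OF j n] Fcur_vx[OF j n] Hpcur_vx[OF j n, unfolded dHp_def] Hmcur_vx[OF j n, unfolded dHm_def]
  have lPP: "lk n (comb (-1/4) (dE n i) (1/4) (dF n i)) (comb (-1/4) (dE n j) (1/4) (dF n j)) [] [] [] []"
    by (rule lk_cong[OF H(3)]) simp_all
  have lMM: "lk n (comb (1/4) (dE n i) (-1/4) (dF n i)) (comb (1/4) (dE n j) (-1/4) (dF n j)) [] [] [] []"
    by (rule lk_cong[OF H(3)]) simp_all
  have lPM: "lk n (comb (-1/4) (dE n i) (1/4) (dF n i)) (comb (1/4) (dE n j) (-1/4) (dF n j)) [1/2, -1/2] [3/2, -3/2] [] []"
    by (rule lk_cong[OF H(3)]) simp_all
  have lMP: "lk n (comb (1/4) (dE n i) (-1/4) (dF n i)) (comb (-1/4) (dE n j) (1/4) (dF n j)) [] [] [1/2, -1/2] [3/2, -3/2]"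
    by (rule lk_cong[OF H(3)]) simp_all
  have lPE: "lk n (comb (-1/4) (dE n i) (1/4) (dF n i)) (dE n j) [3/4] [-5/4] [] []"
    by (rule lk_cong[OF H(1)]) simp_all
  have lME: "lk n (comb (1/4) (dE n i) (-1/4) (dF n i)) (dE n j) [] [] [3/4] [-5/4]"
    by (rule lk_cong[OF H(1)]) simp_all
  have lPF: "lk n (comb (-1/4) (dE n i) (1/4) (dF n i)) (dF n j) [-3/4] [5/4] [] []"
    by (rule lk_cong[OF H(2)]) simp_all
  have lMF: "lk n (comb (1/4) (dE n i) (-1/4) (dF n i)) (dF n j) [] [] [-3/4] [5/4]"
    by (rule lk_cong[OF H(2)]) simp_all
  note u = LUs_def mult_ac
  show ?thesis
    unfolding rels_def Let_def
  proof (intro conjI)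
    show "eq_on (Fock n) (uv (Hpcur n i) (Hpcur n j)) (vu (Hpcur n i) (Hpcur n j))"
      by (rule lk_commute[OF lPP vi(3) vj(3), of 1 1]) (simp_all add: u)
    show "eq_on (Fock n) (uv (Hmcur n i) (Hmcur n j)) (vu (Hmcur n i) (Hmcur n j))"
      by (rule lk_commute[OF lMM vi(4) vj(4), of 1 1]) (simp_all add: u)
    \<comment> \<open>Here and below P' and Q' are the factors that complete the contractions to the
      two sides of the stated relation.\<close>
    show "eq_on (Fock n) (lin (1/2 - (1)) \<odot> lin (- 1/2 + (1)) \<odot> uv (Hpcur n i) (Hmcur n j)) (lin (1/2 + (1)) \<odot> lin (- 1/2 - (1)) \<odot> vu (Hpcur n i) (Hmcur n j))"
      by (rule lk_lin2[OF lPM vi(3) vj(4), where P' = "1" and Q' = "LUs [3/2, -3/2]"]) (simp_all add: u)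
    show "eq_on (Fock n) (lin (- 1/2 - (1)) \<odot> lin (1/2 + (1)) \<odot> uv (Hmcur n i) (Hpcur n j)) (lin (- 1/2 + (1)) \<odot> lin (1/2 - (1)) \<odot> vu (Hmcur n i) (Hpcur n j))"
      by (rule lk_lin2[OF lMP vi(4) vj(3), where P' = "LUs [-3/2, 3/2]" and Q' = "1"]) (simp_all add: u)
    have gPE: "dmul_summable (Fock n) (inv_u (- 1/4 - (1))) (uv (Hpcur n i) (Ecur n j)) \<and> eq_on (Fock n) (vu (Hpcur n i) (Ecur n j)) (lin (- 1/4 + (1)) \<odot> inv_u (- 1/4 - (1)) \<odot> uv (Hpcur n i) (Ecur n j))"
      by (rule lk_u[OF lPE vi(3) vj(1), where P' = "1"]) (simp_all add: u)
    show "dmul_summable (Fock n) (inv_u (- 1/4 - (1))) (uv (Hpcur n i) (Ecur n j))" "eq_on (Fock n) (vu (Hpcur n i) (Ecur n j)) (lin (- 1/4 + (1)) \<odot> inv_u (- 1/4 - (1)) \<odot> uv (Hpcur n i) (Ecur n j))"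
      using gPE by blast+
    have gME: "dmul_summable (Fock n) (inv_v (1/4 - (1))) (uv (Hmcur n i) (Ecur n j)) \<and> eq_on (Fock n) (vu (Hmcur n i) (Ecur n j)) (lin (1/4 + (1)) \<odot> inv_v (1/4 - (1)) \<odot> uv (Hmcur n i) (Ecur n j))"
      by (rule lk_v[OF lME vi(4) vj(1), where P' = "1"]) (simp_all add: u)
    show "dmul_summable (Fock n) (inv_v (1/4 - (1))) (uv (Hmcur n i) (Ecur n j))" "eq_on (Fock n) (vu (Hmcur n i) (Ecur n j)) (lin (1/4 + (1)) \<odot> inv_v (1/4 - (1)) \<odot> uv (Hmcur n i) (Ecur n j))"
      using gME by blast+
    have gPF: "dmul_summable (Fock n) (inv_u (1/4 - (1))) (vu (Hpcur n i) (Fcur n j)) \<and> eq_on (Fock n) (uv (Hpcur n i) (Fcur n j)) (lin (1/4 + (1)) \<odot> inv_u (1/4 - (1)) \<odot> vu (Hpcur n i) (Fcur n j))"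
      by (rule lk_u'[OF lPF vi(3) vj(2), where P' = "1"]) (simp_all add: u)
    show "dmul_summable (Fock n) (inv_u (1/4 - (1))) (vu (Hpcur n i) (Fcur n j))" "eq_on (Fock n) (uv (Hpcur n i) (Fcur n j)) (lin (1/4 + (1)) \<odot> inv_u (1/4 - (1)) \<odot> vu (Hpcur n i) (Fcur n j))"
      using gPF by blast+
    have gMF: "dmul_summable (Fock n) (inv_v (- 1/4 - (1))) (vu (Hmcur n i) (Fcur n j)) \<and> eq_on (Fock n) (uv (Hmcur n i) (Fcur n j)) (lin (- 1/4 + (1)) \<odot> inv_v (- 1/4 - (1)) \<odot> vu (Hmcur n i) (Fcur n j))"
      by (rule lk_v'[OF lMF vi(4) vj(2), where P' = "1"]) (simp_all add: u)
    show "dmul_summable (Fock n) (inv_v (- 1/4 - (1))) (vu (Hmcur n i) (Fcur n j))" "eq_on (Fock n) (uv (Hmcur n i) (Fcur n j)) (lin (- 1/4 + (1)) \<odot> inv_v (- 1/4 - (1)) \<odot> vu (Hmcur n i) (Fcur n j))"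
      using gMF by blast+
    show "eq_on (Fock n) (lin (1) \<odot> uv (Ecur n i) (Ecur n j)) (lin (- (1)) \<odot> vu (Ecur n i) (Ecur n j))"
      by (rule lk_lin1[OF conjunct1[OF b[unfolded bas_def]] vi(1) vj(1), where P' = "LUs [1]" and Q' = "LUs [-1]"]) (simp_all add: u)
    show "eq_on (Fock n) (lin (- (1)) \<odot> uv (Fcur n i) (Fcur n j)) (lin (1) \<odot> vu (Fcur n i) (Fcur n j))"
      by (rule lk_lin1[OF conjunct1[OF conjunct2[OF b[unfolded bas_def]]] vi(2) vj(2), where P' = "LUs [-1]" and Q' = "LUs [1]"]) (simp_all add: u)
  qed
qed

text \<open>The pattern of the short root with itself. The contractions of H retain numerators only,
  so the complementary factors absorb the whole relation; for H^+ with H^- one of its sides carries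
  (u - v)^2, because 1/2 - b = 0.\<close>

lemma rels_2:
  assumes b: "bas n i j [] [0, -1, 1, -1/2] [] [0, 1, 1/2, -1] [1/2, -1/2] []" and i: "i \<in> {1..n}" and j: "j \<in> {1..n}" and n: "2 \<le> n"
  shows "rels n i j (1/2)"
proof -
  note H = lk_H[OF b i j n]
  note vi = Ecur_vx[OF i n] Fcur_vx[OF i n] Hpcur_vx[OF i n, unfolded dHp_def] Hmcur_vx[OF i n, unfolded dHm_def]
  note vj = Ecur_vx[OF j n] Fcur_vx[OF j n] Hpcur_vx[OF j n, unfolded dHp_def] Hmcur_vx[OF j n, unfolded dHm_def]
  have lPP: "lk n (comb (-1/4) (dE n i) (1/4) (dF n i)) (comb (-1/4) (dE n j) (1/4) (dF n j)) [] [1, -1/2, 1/2, -1] [] [1, -1/2, 1/2, -1]"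
    by (rule lk_cong[OF H(3)]) simp_all
  have lMM: "lk n (comb (1/4) (dE n i) (-1/4) (dF n i)) (comb (1/4) (dE n j) (-1/4) (dF n j)) [] [1, -1/2, 1/2, -1] [] [1, -1/2, 1/2, -1]"
    by (rule lk_cong[OF H(3)]) simp_all
  have lPM: "lk n (comb (-1/4) (dE n i) (1/4) (dF n i)) (comb (1/4) (dE n j) (-1/4) (dF n j)) [] [-3/2, 3/2, -1, 1] [] [3/2, 0, 0, -3/2]"
    by (rule lk_cong[OF H(3)]) simp_all
  have lMP: "lk n (comb (1/4) (dE n i) (-1/4) (dF n i)) (comb (-1/4) (dE n j) (1/4) (dF n j)) [] [3/2, 0, 0, -3/2] [] [-3/2, 3/2, -1, 1]"
    by (rule lk_cong[OF H(3)]) simp_all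
  have lPE: "lk n (comb (-1/4) (dE n i) (1/4) (dF n i)) (dE n j) [] [-5/4, -3/4] [] [5/4, -1/4]"
    by (rule lk_cong[OF H(1)]) simp_all
  have lME: "lk n (comb (1/4) (dE n i) (-1/4) (dF n i)) (dE n j) [] [5/4, -1/4] [] [-5/4, -3/4]"
    by (rule lk_cong[OF H(1)]) simp_all
  have lPF: "lk n (comb (-1/4) (dE n i) (1/4) (dF n i)) (dF n j) [] [5/4, 3/4] [] [1/4, -5/4]"
    by (rule lk_cong[OF H(2)]) simp_all
  have lMF: "lk n (comb (1/4) (dE n i) (-1/4) (dF n i)) (dF n j) [] [1/4, -5/4] [] [5/4, 3/4]"
    by (rule lk_cong[OF H(2)]) simp_all
  note u = LUs_def mult_ac
  show ?thesis
    unfolding rels_def Let_def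
  proof (intro conjI)
    show "eq_on (Fock n) (uv (Hpcur n i) (Hpcur n j)) (vu (Hpcur n i) (Hpcur n j))"
      by (rule lk_commute[OF lPP vi(3) vj(3), of 1 1]) (simp_all add: u)
    show "eq_on (Fock n) (uv (Hmcur n i) (Hmcur n j)) (vu (Hmcur n i) (Hmcur n j))"
      by (rule lk_commute[OF lMM vi(4) vj(4), of 1 1]) (simp_all add: u)
    show "eq_on (Fock n) (lin (1/2 - (1/2)) \<odot> lin (- 1/2 + (1/2)) \<odot> uv (Hpcur n i) (Hmcur n j)) (lin (1/2 + (1/2)) \<odot> lin (- 1/2 - (1/2)) \<odot> vu (Hpcur n i) (Hmcur n j))"
      by (rule lk_lin2[OF lPM vi(3) vj(4), where P' = "LUs [0, 0]" and Q' = "LUs [1, -1]"]) (simp_all add: u)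
    show "eq_on (Fock n) (lin (- 1/2 - (1/2)) \<odot> lin (1/2 + (1/2)) \<odot> uv (Hmcur n i) (Hpcur n j)) (lin (- 1/2 + (1/2)) \<odot> lin (1/2 - (1/2)) \<odot> vu (Hmcur n i) (Hpcur n j))"
      by (rule lk_lin2[OF lMP vi(4) vj(3), where P' = "LUs [-1, 1]" and Q' = "LUs [0, 0]"]) (simp_all add: u)
    have gPE: "dmul_summable (Fock n) (inv_u (- 1/4 - (1/2))) (uv (Hpcur n i) (Ecur n j)) \<and> eq_on (Fock n) (vu (Hpcur n i) (Ecur n j)) (lin (- 1/4 + (1/2)) \<odot> inv_u (- 1/4 - (1/2)) \<odot> uv (Hpcur n i) (Ecur n j))"
      by (rule lk_u[OF lPE vi(3) vj(1), where P' = "LUs [1/4]"]) (simp_all add: u)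
    show "dmul_summable (Fock n) (inv_u (- 1/4 - (1/2))) (uv (Hpcur n i) (Ecur n j))" "eq_on (Fock n) (vu (Hpcur n i) (Ecur n j)) (lin (- 1/4 + (1/2)) \<odot> inv_u (- 1/4 - (1/2)) \<odot> uv (Hpcur n i) (Ecur n j))"
      using gPE by blast+
    have gME: "dmul_summable (Fock n) (inv_v (1/4 - (1/2))) (uv (Hmcur n i) (Ecur n j)) \<and> eq_on (Fock n) (vu (Hmcur n i) (Ecur n j)) (lin (1/4 + (1/2)) \<odot> inv_v (1/4 - (1/2)) \<odot> uv (Hmcur n i) (Ecur n j))"
      by (rule lk_v[OF lME vi(4) vj(1), where P' = "LUs [-1/4]"]) (simp_all add: u)
    show "dmul_summable (Fock n) (inv_v (1/4 - (1/2))) (uv (Hmcur n i) (Ecur n j))" "eq_on (Fock n) (vu (Hmcur n i) (Ecur n j)) (lin (1/4 + (1/2)) \<odot> inv_v (1/4 - (1/2)) \<odot> uv (Hmcur n i) (Ecur n j))"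
      using gME by blast+
    have gPF: "dmul_summable (Fock n) (inv_u (1/4 - (1/2))) (vu (Hpcur n i) (Fcur n j)) \<and> eq_on (Fock n) (uv (Hpcur n i) (Fcur n j)) (lin (1/4 + (1/2)) \<odot> inv_u (1/4 - (1/2)) \<odot> vu (Hpcur n i) (Fcur n j))"
      by (rule lk_u'[OF lPF vi(3) vj(2), where P' = "LUs [-1/4]"]) (simp_all add: u)
    show "dmul_summable (Fock n) (inv_u (1/4 - (1/2))) (vu (Hpcur n i) (Fcur n j))" "eq_on (Fock n) (uv (Hpcur n i) (Fcur n j)) (lin (1/4 + (1/2)) \<odot> inv_u (1/4 - (1/2)) \<odot> vu (Hpcur n i) (Fcur n j))"
      using gPF by blast+
    have gMF: "dmul_summable (Fock n) (inv_v (- 1/4 - (1/2))) (vu (Hmcur n i) (Fcur n j)) \<and> eq_on (Fock n) (uv (Hmcur n i) (Fcur n j)) (lin (- 1/4 + (1/2)) \<odot> inv_v (- 1/4 - (1/2)) \<odot> vu (Hmcur n i) (Fcur n j))"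
      by (rule lk_v'[OF lMF vi(4) vj(2), where P' = "LUs [1/4]"]) (simp_all add: u)
    show "dmul_summable (Fock n) (inv_v (- 1/4 - (1/2))) (vu (Hmcur n i) (Fcur n j))" "eq_on (Fock n) (uv (Hmcur n i) (Fcur n j)) (lin (- 1/4 + (1/2)) \<odot> inv_v (- 1/4 - (1/2)) \<odot> vu (Hmcur n i) (Fcur n j))"
      using gMF by blast+
    show "eq_on (Fock n) (lin (1/2) \<odot> uv (Ecur n i) (Ecur n j)) (lin (- (1/2)) \<odot> vu (Ecur n i) (Ecur n j))"
      by (rule lk_lin1[OF conjunct1[OF b[unfolded bas_def]] vi(1) vj(1), where P' = "LUs [1/2]" and Q' = "LUs [-1/2]"]) (simp_all add: u)
    show "eq_on (Fock n) (lin (- (1/2)) \<odot> uv (Fcur n i) (Fcur n j)) (lin (1/2) \<odot> vu (Fcur n i) (Fcur n j))"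
      by (rule lk_lin1[OF conjunct1[OF conjunct2[OF b[unfolded bas_def]]] vi(2) vj(2), where P' = "LUs [-1/2]" and Q' = "LUs [1/2]"]) (simp_all add: u)
  qed
qed

text \<open>The pattern of neighbouring indices, where E with E and F with F have a denominator and
  no numerator.\<close>

lemma rels_3:
  assumes b: "bas n i j [-1/2] [] [1/2] [] [] [0]" and i: "i \<in> {1..n}" and j: "j \<in> {1..n}" and n: "2 \<le> n"
  shows "rels n i j (- (1/2))"
proof -
  note H = lk_H[OF b i j n]
  note vi = Ecur_vx[OF i n] Fcur_vx[OF i n] Hpcur_vx[OF i n, unfolded dHp_def] Hmcur_vx[OF i n, unfolded dHm_def]
  note vj = Ecur_vx[OF j n] Fcur_vx[OF j n] Hpcur_vx[OF j n, unfolded dHp_def] Hmcur_vx[OF j n, unfolded dHm_def]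
  have lPP: "lk n (comb (-1/4) (dE n i) (1/4) (dF n i)) (comb (-1/4) (dE n j) (1/4) (dF n j)) [] [] [] []"
    by (rule lk_cong[OF H(3)]) simp_all
  have lMM: "lk n (comb (1/4) (dE n i) (-1/4) (dF n i)) (comb (1/4) (dE n j) (-1/4) (dF n j)) [] [] [] []"
    by (rule lk_cong[OF H(3)]) simp_all
  have lPM: "lk n (comb (-1/4) (dE n i) (1/4) (dF n i)) (comb (1/4) (dE n j) (-1/4) (dF n j)) [1, -1] [0, 0] [] []"
    by (rule lk_cong[OF H(3)]) simp_all
  have lMP: "lk n (comb (1/4) (dE n i) (-1/4) (dF n i)) (comb (-1/4) (dE n j) (1/4) (dF n j)) [] [] [1, -1] [0, 0]"
    by (rule lk_cong[OF H(3)]) simp_all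
  have lPE: "lk n (comb (-1/4) (dE n i) (1/4) (dF n i)) (dE n j) [-3/4] [1/4] [] []"
    by (rule lk_cong[OF H(1)]) simp_all
  have lME: "lk n (comb (1/4) (dE n i) (-1/4) (dF n i)) (dE n j) [] [] [-3/4] [1/4]"
    by (rule lk_cong[OF H(1)]) simp_all
  have lPF: "lk n (comb (-1/4) (dE n i) (1/4) (dF n i)) (dF n j) [3/4] [-1/4] [] []"
    by (rule lk_cong[OF H(2)]) simp_all
  have lMF: "lk n (comb (1/4) (dE n i) (-1/4) (dF n i)) (dF n j) [] [] [3/4] [-1/4]"
    by (rule lk_cong[OF H(2)]) simp_all
  note u = LUs_def mult_ac
  show ?thesis
    unfolding rels_def Let_def
  proof (intro conjI)
    show "eq_on (Fock n) (uv (Hpcur n i) (Hpcur n j)) (vu (Hpcur n i) (Hpcur n j))"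
      by (rule lk_commute[OF lPP vi(3) vj(3), of 1 1]) (simp_all add: u)
    show "eq_on (Fock n) (uv (Hmcur n i) (Hmcur n j)) (vu (Hmcur n i) (Hmcur n j))"
      by (rule lk_commute[OF lMM vi(4) vj(4), of 1 1]) (simp_all add: u)
    show "eq_on (Fock n) (lin (1/2 - (- (1/2))) \<odot> lin (- 1/2 + (- (1/2))) \<odot> uv (Hpcur n i) (Hmcur n j)) (lin (1/2 + (- (1/2))) \<odot> lin (- 1/2 - (- (1/2))) \<odot> vu (Hpcur n i) (Hmcur n j))"
      by (rule lk_lin2[OF lPM vi(3) vj(4), where P' = "1" and Q' = "LUs [0, 0]"]) (simp_all add: u)
    show "eq_on (Fock n) (lin (- 1/2 - (- (1/2))) \<odot> lin (1/2 + (- (1/2))) \<odot> uv (Hmcur n i) (Hpcur n j)) (lin (- 1/2 + (- (1/2))) \<odot> lin (1/2 - (- (1/2))) \<odot> vu (Hmcur n i) (Hpcur n j))"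
      by (rule lk_lin2[OF lMP vi(4) vj(3), where P' = "LUs [0, 0]" and Q' = "1"]) (simp_all add: u)
    have gPE: "dmul_summable (Fock n) (inv_u (- 1/4 - (- (1/2)))) (uv (Hpcur n i) (Ecur n j)) \<and> eq_on (Fock n) (vu (Hpcur n i) (Ecur n j)) (lin (- 1/4 + (- (1/2))) \<odot> inv_u (- 1/4 - (- (1/2))) \<odot> uv (Hpcur n i) (Ecur n j))"
      by (rule lk_u[OF lPE vi(3) vj(1), where P' = "1"]) (simp_all add: u)
    show "dmul_summable (Fock n) (inv_u (- 1/4 - (- (1/2)))) (uv (Hpcur n i) (Ecur n j))" "eq_on (Fock n) (vu (Hpcur n i) (Ecur n j)) (lin (- 1/4 + (- (1/2))) \<odot> inv_u (- 1/4 - (- (1/2))) \<odot> uv (Hpcur n i) (Ecur n j))"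
      using gPE by blast+
    have gME: "dmul_summable (Fock n) (inv_v (1/4 - (- (1/2)))) (uv (Hmcur n i) (Ecur n j)) \<and> eq_on (Fock n) (vu (Hmcur n i) (Ecur n j)) (lin (1/4 + (- (1/2))) \<odot> inv_v (1/4 - (- (1/2))) \<odot> uv (Hmcur n i) (Ecur n j))"
      by (rule lk_v[OF lME vi(4) vj(1), where P' = "1"]) (simp_all add: u)
    show "dmul_summable (Fock n) (inv_v (1/4 - (- (1/2)))) (uv (Hmcur n i) (Ecur n j))" "eq_on (Fock n) (vu (Hmcur n i) (Ecur n j)) (lin (1/4 + (- (1/2))) \<odot> inv_v (1/4 - (- (1/2))) \<odot> uv (Hmcur n i) (Ecur n j))"
      using gME by blast+
    have gPF: "dmul_summable (Fock n) (inv_u (1/4 - (- (1/2)))) (vu (Hpcur n i) (Fcur n j)) \<and> eq_on (Fock n) (uv (Hpcur n i) (Fcur n j)) (lin (1/4 + (- (1/2))) \<odot> inv_u (1/4 - (- (1/2))) \<odot> vu (Hpcur n i) (Fcur n j))"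
      by (rule lk_u'[OF lPF vi(3) vj(2), where P' = "1"]) (simp_all add: u)
    show "dmul_summable (Fock n) (inv_u (1/4 - (- (1/2)))) (vu (Hpcur n i) (Fcur n j))" "eq_on (Fock n) (uv (Hpcur n i) (Fcur n j)) (lin (1/4 + (- (1/2))) \<odot> inv_u (1/4 - (- (1/2))) \<odot> vu (Hpcur n i) (Fcur n j))"
      using gPF by blast+
    have gMF: "dmul_summable (Fock n) (inv_v (- 1/4 - (- (1/2)))) (vu (Hmcur n i) (Fcur n j)) \<and> eq_on (Fock n) (uv (Hmcur n i) (Fcur n j)) (lin (- 1/4 + (- (1/2))) \<odot> inv_v (- 1/4 - (- (1/2))) \<odot> vu (Hmcur n i) (Fcur n j))"
      by (rule lk_v'[OF lMF vi(4) vj(2), where P' = "1"]) (simp_all add: u)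
    show "dmul_summable (Fock n) (inv_v (- 1/4 - (- (1/2)))) (vu (Hmcur n i) (Fcur n j))" "eq_on (Fock n) (uv (Hmcur n i) (Fcur n j)) (lin (- 1/4 + (- (1/2))) \<odot> inv_v (- 1/4 - (- (1/2))) \<odot> vu (Hmcur n i) (Fcur n j))"
      using gMF by blast+
    show "eq_on (Fock n) (lin (- (1/2)) \<odot> uv (Ecur n i) (Ecur n j)) (lin (- (- (1/2))) \<odot> vu (Ecur n i) (Ecur n j))"
      by (rule lk_lin1[OF conjunct1[OF b[unfolded bas_def]] vi(1) vj(1), where P' = "1" and Q' = "1"]) (simp_all add: u)
    show "eq_on (Fock n) (lin (- (- (1/2))) \<odot> uv (Fcur n i) (Fcur n j)) (lin (- (1/2)) \<odot> vu (Fcur n i) (Fcur n j))"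
      by (rule lk_lin1[OF conjunct1[OF conjunct2[OF b[unfolded bas_def]]] vi(2) vj(2), where P' = "1" and Q' = "1"]) (simp_all add: u)
  qed
qed

text \<open>The pattern of distant indices: nothing contracts, and b = 0 puts the same factors on
  both sides of each relation.\<close>

lemma rels_4:
  assumes b: "bas n i j [] [] [] [] [] []" and i: "i \<in> {1..n}" and j: "j \<in> {1..n}" and n: "2 \<le> n"
  shows "rels n i j (0)"
proof -
  note H = lk_H[OF b i j n]
  note vi = Ecur_vx[OF i n] Fcur_vx[OF i n] Hpcur_vx[OF i n, unfolded dHp_def] Hmcur_vx[OF i n, unfolded dHm_def]
  note vj = Ecur_vx[OF j n] Fcur_vx[OF j n] Hpcur_vx[OF j n, unfolded dHp_def] Hmcur_vx[OF j n, unfolded dHm_def]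
  have lPP: "lk n (comb (-1/4) (dE n i) (1/4) (dF n i)) (comb (-1/4) (dE n j) (1/4) (dF n j)) [] [] [] []"
    by (rule lk_cong[OF H(3)]) simp_all
  have lMM: "lk n (comb (1/4) (dE n i) (-1/4) (dF n i)) (comb (1/4) (dE n j) (-1/4) (dF n j)) [] [] [] []"
    by (rule lk_cong[OF H(3)]) simp_all
  have lPM: "lk n (comb (-1/4) (dE n i) (1/4) (dF n i)) (comb (1/4) (dE n j) (-1/4) (dF n j)) [] [] [] []"
    by (rule lk_cong[OF H(3)]) simp_all
  have lMP: "lk n (comb (1/4) (dE n i) (-1/4) (dF n i)) (comb (-1/4) (dE n j) (1/4) (dF n j)) [] [] [] []"
    by (rule lk_cong[OF H(3)]) simp_all
  have lPE: "lk n (comb (-1/4) (dE n i) (1/4) (dF n i)) (dE n j) [] [] [] []"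
    by (rule lk_cong[OF H(1)]) simp_all
  have lME: "lk n (comb (1/4) (dE n i) (-1/4) (dF n i)) (dE n j) [] [] [] []"
    by (rule lk_cong[OF H(1)]) simp_all
  have lPF: "lk n (comb (-1/4) (dE n i) (1/4) (dF n i)) (dF n j) [] [] [] []"
    by (rule lk_cong[OF H(2)]) simp_all
  have lMF: "lk n (comb (1/4) (dE n i) (-1/4) (dF n i)) (dF n j) [] [] [] []"
    by (rule lk_cong[OF H(2)]) simp_all
  note u = LUs_def mult_ac
  show ?thesis
    unfolding rels_def Let_def
  proof (intro conjI)
    show "eq_on (Fock n) (uv (Hpcur n i) (Hpcur n j)) (vu (Hpcur n i) (Hpcur n j))"
      by (rule lk_commute[OF lPP vi(3) vj(3), of 1 1]) (simp_all add: u)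
    show "eq_on (Fock n) (uv (Hmcur n i) (Hmcur n j)) (vu (Hmcur n i) (Hmcur n j))"
      by (rule lk_commute[OF lMM vi(4) vj(4), of 1 1]) (simp_all add: u)
    show "eq_on (Fock n) (lin (1/2 - (0)) \<odot> lin (- 1/2 + (0)) \<odot> uv (Hpcur n i) (Hmcur n j)) (lin (1/2 + (0)) \<odot> lin (- 1/2 - (0)) \<odot> vu (Hpcur n i) (Hmcur n j))"
      by (rule lk_lin2[OF lPM vi(3) vj(4), where P' = "LUs [1/2, -1/2]" and Q' = "LUs [1/2, -1/2]"]) (simp_all add: u)
    show "eq_on (Fock n) (lin (- 1/2 - (0)) \<odot> lin (1/2 + (0)) \<odot> uv (Hmcur n i) (Hpcur n j)) (lin (- 1/2 + (0)) \<odot> lin (1/2 - (0)) \<odot> vu (Hmcur n i) (Hpcur n j))"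
      by (rule lk_lin2[OF lMP vi(4) vj(3), where P' = "LUs [-1/2, 1/2]" and Q' = "LUs [-1/2, 1/2]"]) (simp_all add: u)
    have gPE: "dmul_summable (Fock n) (inv_u (- 1/4 - (0))) (uv (Hpcur n i) (Ecur n j)) \<and> eq_on (Fock n) (vu (Hpcur n i) (Ecur n j)) (lin (- 1/4 + (0)) \<odot> inv_u (- 1/4 - (0)) \<odot> uv (Hpcur n i) (Ecur n j))"
      by (rule lk_u[OF lPE vi(3) vj(1), where P' = "LUs [-1/4]"]) (simp_all add: u)
    show "dmul_summable (Fock n) (inv_u (- 1/4 - (0))) (uv (Hpcur n i) (Ecur n j))" "eq_on (Fock n) (vu (Hpcur n i) (Ecur n j)) (lin (- 1/4 + (0)) \<odot> inv_u (- 1/4 - (0)) \<odot> uv (Hpcur n i) (Ecur n j))"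
      using gPE by blast+
    have gME: "dmul_summable (Fock n) (inv_v (1/4 - (0))) (uv (Hmcur n i) (Ecur n j)) \<and> eq_on (Fock n) (vu (Hmcur n i) (Ecur n j)) (lin (1/4 + (0)) \<odot> inv_v (1/4 - (0)) \<odot> uv (Hmcur n i) (Ecur n j))"
      by (rule lk_v[OF lME vi(4) vj(1), where P' = "LUs [1/4]"]) (simp_all add: u)
    show "dmul_summable (Fock n) (inv_v (1/4 - (0))) (uv (Hmcur n i) (Ecur n j))" "eq_on (Fock n) (vu (Hmcur n i) (Ecur n j)) (lin (1/4 + (0)) \<odot> inv_v (1/4 - (0)) \<odot> uv (Hmcur n i) (Ecur n j))"
      using gME by blast+
    have gPF: "dmul_summable (Fock n) (inv_u (1/4 - (0))) (vu (Hpcur n i) (Fcur n j)) \<and> eq_on (Fock n) (uv (Hpcur n i) (Fcur n j)) (lin (1/4 + (0)) \<odot> inv_u (1/4 - (0)) \<odot> vu (Hpcur n i) (Fcur n j))"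
      by (rule lk_u'[OF lPF vi(3) vj(2), where P' = "LUs [1/4]"]) (simp_all add: u)
    show "dmul_summable (Fock n) (inv_u (1/4 - (0))) (vu (Hpcur n i) (Fcur n j))" "eq_on (Fock n) (uv (Hpcur n i) (Fcur n j)) (lin (1/4 + (0)) \<odot> inv_u (1/4 - (0)) \<odot> vu (Hpcur n i) (Fcur n j))"
      using gPF by blast+
    have gMF: "dmul_summable (Fock n) (inv_v (- 1/4 - (0))) (vu (Hmcur n i) (Fcur n j)) \<and> eq_on (Fock n) (uv (Hmcur n i) (Fcur n j)) (lin (- 1/4 + (0)) \<odot> inv_v (- 1/4 - (0)) \<odot> vu (Hmcur n i) (Fcur n j))"
      by (rule lk_v'[OF lMF vi(4) vj(2), where P' = "LUs [-1/4]"]) (simp_all add: u)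
    show "dmul_summable (Fock n) (inv_v (- 1/4 - (0))) (vu (Hmcur n i) (Fcur n j))" "eq_on (Fock n) (uv (Hmcur n i) (Fcur n j)) (lin (- 1/4 + (0)) \<odot> inv_v (- 1/4 - (0)) \<odot> vu (Hmcur n i) (Fcur n j))"
      using gMF by blast+
    show "eq_on (Fock n) (lin (0) \<odot> uv (Ecur n i) (Ecur n j)) (lin (- (0)) \<odot> vu (Ecur n i) (Ecur n j))"
      by (rule lk_lin1[OF conjunct1[OF b[unfolded bas_def]] vi(1) vj(1), where P' = "LUs [0]" and Q' = "LUs [0]"]) (simp_all add: u)
    show "eq_on (Fock n) (lin (- (0)) \<odot> uv (Fcur n i) (Fcur n j)) (lin (0) \<odot> vu (Fcur n i) (Fcur n j))"
      by (rule lk_lin1[OF conjunct1[OF conjunct2[OF b[unfolded bas_def]]] vi(2) vj(2), where P' = "LUs [0]" and Q' = "LUs [0]"]) (simp_all add: u)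
  qed
qed

lemma bas_all:
  assumes "i \<in> {1..n}" "j \<in> {1..n}" "2 \<le> n"
  obtains "i = j" "i < n" "bas n i j [] [0, -1] [] [0, 1] [1/2, -1/2] []"
  | "i = n" "j = n" "bas n i j [] [0, -1, 1, -1/2] [] [0, 1, 1/2, -1] [1/2, -1/2] []"
  | "i \<noteq> j" "j = i + 1 \<or> i = j + 1" "bas n i j [-1/2] [] [1/2] [] [] [0]"
  | "i \<noteq> j" "\<not> (j = i + 1 \<or> i = j + 1)" "bas n i j [] [] [] [] [] []"
proof -
  have adj: "bas n k (k + 1) [-1/2] [] [1/2] [] [] [0]" if "1 \<le> k" "k + 1 \<le> n" for k
  proof (cases "k + 1 = n")
    case True
    then show ?thesis using bas_adjacent_last[OF assms(3)] by auto
  next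
    case False
    then show ?thesis using bas_adjacent[of k n] that by auto
  qed
  have far: "bas n k l [] [] [] [] [] []" if "1 \<le> k" "k + 1 < l" "l \<le> n" for k l
    using bas_far[of k l n] bas_far_last[of k n] that by (cases "l = n") auto
  consider "i = j" "i < n" | "i = n" "j = n" | "j = i + 1" | "i = j + 1" | "i + 1 < j" | "j + 1 < i"
    using assms by force
  then show ?thesis
  proof cases
    case 1
    then show ?thesis using that(1) bas_same[of i n] assms by auto
  next
    case 2
    then show ?thesis using that(2) bas_last[OF assms(3)] by auto
  next
    case 3
    then show ?thesis using that(3) adj[of i] assms by auto
  next
    case 4
    then show ?thesis using that(3) bas_sym[OF adj[of j]] assms by auto
  next
    case 5
    then show ?thesis using that(4) far[of i j] assms by auto
  next
    case 6
    then show ?thesis using that(4) bas_sym[OF far[of j i]] assms by auto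
  qed
qed

lemma B_value:
  assumes "i \<in> {1..n}" "j \<in> {1..n}"
  shows "B n i j = (if i = j then (if i = n then 1/2 else 1) else if j = i + 1 \<or> i = j + 1 then - (1/2) else 0)"
  using assms by (auto simp: B_def ip_alpha_alpha)

lemma rels_all:
  assumes "i \<in> {1..n}" "j \<in> {1..n}" "2 \<le> n"
  shows "rels n i j (B n i j)"
proof (rule bas_all[OF assms])
  assume "i = j" "i < n" "bas n i j [] [0, -1] [] [0, 1] [1/2, -1/2] []"
  then show ?thesis using rels_1[of n i j] assms by (simp add: B_value)
next
  assume "i = n" "j = n" "bas n i j [] [0, -1, 1, -1/2] [] [0, 1, 1/2, -1] [1/2, -1/2] []"
  then show ?thesis using rels_2[of n i j] assms by (simp add: B_value)
next
  assume "i \<noteq> j" "j = i + 1 \<or> i = j + 1" "bas n i j [-1/2] [] [1/2] [] [] [0]"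
  then show ?thesis using rels_3[of n i j] assms by (simp add: B_value)
next
  assume "i \<noteq> j" "\<not> (j = i + 1 \<or> i = j + 1)" "bas n i j [] [] [] [] [] []"
  then show ?thesis using rels_4[of n i j] assms by (simp add: B_value)
qed

section \<open>Commutator and Serre relations of the currents\<close>

lemma shift_shift:
  "shift_terms a (shift_terms b C) = shift_terms (b + a) C" "shift_terms 0 C = C"
  "shift_latt a (shift_latt b Z) = shift_latt (b + a) Z" "shift_latt 0 Z = Z"
  "shift_terms a (C @ C') = shift_terms a C @ shift_terms a C'" "shift_latt a (Z @ Z') = shift_latt a Z @ shift_latt a Z'"
  by (auto simp: shift_terms_def shift_latt_def add.assoc)

lemma EF_same:
  assumes l: "lk n D D' [1/2, -1/2] [] [1/2, -1/2] []" and X: "vx n X D" and Y: "vx n Y D'"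
    and H: "vx n H (comb (1/4) D (-1/4) D')" and K: "vx n K (comb (-1/4) D (1/4) D')"
    and s: "sg n (snd (snd (snd D))) (fst (snd D')) = 1"
  shows "eq_on (Fock n) (\<lambda>p q f. scal fps_X (comm (X p) (Y q) f))
    (delta (-1/4) (1/4) \<odot> in_v (shift (1/4) H) - delta (1/4) (-1/4) \<odot> in_u (shift (1/4) K))"
proof -
  obtain C \<delta> A Z C' \<delta>' A' Z' where D: "D = (C, \<delta>, A, Z)" "D' = (C', \<delta>', A', Z')" by (cases D, cases D')
  have c: "ctr n A Z C' \<delta>' [1/2, -1/2] []" "ctr n A' Z' C \<delta> [1/2, -1/2] []" "sg n Z \<delta>' = 1" "sg n Z' \<delta> = 1"
    using l s by (simp_all add: lk_def D)
  note v = X[unfolded vx_def D prod.case] Y[unfolded vx_def D prod.case]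
    H[unfolded vx_def D comb_def prod.case] K[unfolded vx_def D comb_def prod.case]
  show ?thesis
    by (rule EF_relation[OF v(1,2) c(1,3,2,4) v(3) _ refl _ _ _ v(4)])
       (simp_all add: shift_shift cfps_append Aop_simps zs_append sg_append add.commute mult.commute)
qed

lemma EF_sign:
  assumes "i \<in> {1..n}" "2 \<le> n"
  shows "sg n (snd (snd (snd (dE n i)))) (fst (snd (dF n i))) = 1"
proof (cases "i = n")
  case True
  then show ?thesis using assms by (simp add: dE_def dF_def dat_simps)
next
  case False
  then show ?thesis using assms by (simp add: dE_def dF_def dat_simps)
qed

lemma EF_all:
  assumes "i \<in> {1..n}" "j \<in> {1..n}" "2 \<le> n"
  shows "eq_on (Fock n) (\<lambda>p q f. scal fps_X (comm (Ecur n i p) (Fcur n j q) f))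
        (if i = j then
           delta (- 1/4) (1/4) \<odot> in_v (shift (1/4) (Hmcur n i))
           - delta (1/4) (- 1/4) \<odot> in_u (shift (1/4) (Hpcur n i))
         else 0)"
proof -
  have same: ?thesis if "i = j" "lk n (dE n i) (dF n j) [1/2, -1/2] [] [1/2, -1/2] []"
    using EF_same[OF that(2)[folded that(1)] Ecur_vx[OF assms(1,3)] Fcur_vx[OF assms(1,3)]
      Hmcur_vx[OF assms(1,3), unfolded dHm_def] Hpcur_vx[OF assms(1,3), unfolded dHp_def] EF_sign[OF assms(1,3)]] that(1)
    by simp
  \<comment> \<open>The list p will be empty or [0]. In both cases negating its constants changes
    nothing, so the two orders agree without any factor.\<close>
  have diff: ?thesis if "i \<noteq> j" "lk n (dE n i) (dF n j) [] p [] p" "LUs p = LUs (map uminus p)" for p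
  proof -
    have "eq_on (Fock n) (uv (Ecur n i) (Fcur n j)) (vu (Ecur n i) (Fcur n j))"
      by (rule lk_commute[OF that(2) Ecur_vx[OF assms(1,3)] Fcur_vx[OF assms(2,3)], of 1 1]) (simp_all add: LUs_def that(3)[unfolded LUs_def])
    then show ?thesis using that(1) by (simp add: eq_on_def uv_def vu_def comm_def scal_sc)
  qed
  show ?thesis
  proof (rule bas_all[OF assms])
    assume "i = j" and b: "bas n i j [] [0, -1] [] [0, 1] [1/2, -1/2] []"
    have "lk n (dE n i) (dF n j) [1/2, -1/2] [] [1/2, -1/2] []" using b unfolding bas_def by blast
    then show ?thesis by (rule same[OF \<open>i = j\<close>])
  next
    assume "i = n" "j = n" and b: "bas n i j [] [0, -1, 1, -1/2] [] [0, 1, 1/2, -1] [1/2, -1/2] []"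
    then have "i = j" by simp
    moreover have "lk n (dE n i) (dF n j) [1/2, -1/2] [] [1/2, -1/2] []" using b unfolding bas_def by blast
    ultimately show ?thesis by (rule same)
  next
    assume "i \<noteq> j" and b: "bas n i j [-1/2] [] [1/2] [] [] [0]"
    have "lk n (dE n i) (dF n j) [] [0] [] [0]" using b unfolding bas_def by blast
    then show ?thesis by (rule diff[OF \<open>i \<noteq> j\<close>]) simp
  next
    assume "i \<noteq> j" and b: "bas n i j [] [] [] [] [] []"
    have "lk n (dE n i) (dF n j) [] [] [] []" using b unfolding bas_def by blast
    then show ?thesis by (rule diff[OF \<open>i \<noteq> j\<close>]) simp
  qed
qed

lemma serre1: "serre 1 X Y p q f = X (p 1) (Y q f) - Y q (X (p 1) f)"
proof -
  have "{\<sigma>. \<sigma> permutes {1..1}} = {id :: nat \<Rightarrow> nat}"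
    by (auto simp: permutes_sing)
  then show ?thesis by (simp add: serre_def comm_def upt_rec)
qed

lemma serre_all:
  assumes i: "i \<in> {1..n}" and j: "j \<in> {1..n}" and n: "2 \<le> n" and ij: "i \<noteq> j" and f: "f \<in> Fock n"
  shows "serre (nat (1 - cartan n i j)) (Ecur n i) (Ecur n j) p q f = 0"
    "serre (nat (1 - cartan n i j)) (Fcur n i) (Fcur n j) p q f = 0"
proof -
  obtain C \<delta> A Z C' \<delta>' A' Z' where E: "dE n i = (C, \<delta>, A, Z)" "dE n j = (C', \<delta>', A', Z')" by (cases "dE n i", cases "dE n j")
  obtain D \<epsilon> G V D' \<epsilon>' G' V' where F: "dF n i = (D, \<epsilon>, G, V)" "dF n j = (D', \<epsilon>', G', V')" by (cases "dF n i", cases "dF n j")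
  note vE = Ecur_vx[OF i n, unfolded vx_def E prod.case] Ecur_vx[OF j n, unfolded vx_def E prod.case]
  note vF = Fcur_vx[OF i n, unfolded vx_def F prod.case] Fcur_vx[OF j n, unfolded vx_def F prod.case]
  \<comment> \<open>Both diagonal patterns have no denominators for E with E and F with F, as
    \<open>serre_pair\<close> requires.\<close>
  obtain ep fp xn where b: "bas n i i [] ep [] fp xn []" by (rule bas_all[OF i i n]) auto
  have pos: "ctr n A Z C \<delta> [] ep" "ctr n G V D \<epsilon> [] fp"
    using b by (auto simp: bas_def lk_def E F)
  have rE: "act (LU (B n i k)) (ev (uv (Ecur n i) (Ecur n k)) g) = act (LU (- B n i k)) (ev (vu (Ecur n i) (Ecur n k)) g)"
    and rF: "act (LU (- B n i k)) (ev (uv (Fcur n i) (Fcur n k)) g) = act (LU (B n i k)) (ev (vu (Fcur n i) (Fcur n k)) g)"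
    if "k \<in> {1..n}" "g \<in> Fock n" for k g
    using rels_all[OF i that(1) n] that(2) by (auto simp: rels_def Let_def eq_on_ev ev_lin)
  \<comment> \<open>For E the constants of exchange are B_ij with the other current and B_ii with
    itself, and \<open>serre_pair\<close> takes the negative of the latter. For F both signs are
    reversed.\<close>
  have SE: "serre_pair n (Ecur n i) C \<delta> A Z (Ecur n j) C' \<delta>' A' Z' (B n i j) (- B n i i) ep f" if "B n i j \<noteq> 0"
    by (rule serre_pair.intro[OF vE pos(1) _ _ that f], erule rE[OF j], unfold minus_minus, erule rE[OF i])
  have SF: "serre_pair n (Fcur n i) D \<epsilon> G V (Fcur n j) D' \<epsilon>' G' V' (- B n i j) (B n i i) fp f" if "B n i j \<noteq> 0"
    by (rule serre_pair.intro[OF vF pos(2) _ _ _ f], unfold minus_minus, erule rF[OF j], erule rF[OF i], simp add: that)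
  show "serre (nat (1 - cartan n i j)) (Ecur n i) (Ecur n j) p q f = 0"
    "serre (nat (1 - cartan n i j)) (Fcur n i) (Fcur n j) p q f = 0"
  proof -
    \<comment> \<open>For i = n the self-constant is 1/2 in absolute value, so r = d and the
      relation has three letters. For another index next to j it is 1, so r = 2 d and there are two
      letters.\<close>
    consider "j = i + 1 \<or> i = j + 1" "i = n" | "j = i + 1 \<or> i = j + 1" "i \<noteq> n" | "\<not> (j = i + 1 \<or> i = j + 1)" by blast
    then have "serre (nat (1 - cartan n i j)) (Ecur n i) (Ecur n j) p q f = 0 \<and>
      serre (nat (1 - cartan n i j)) (Fcur n i) (Fcur n j) p q f = 0"
    proof cases
      case 1
      then have v: "B n i j = - (1/2)" "B n i i = 1/2" "nat (1 - cartan n i j) = 3" using ij unfolding B_value[OF i j] B_value[OF i i] cartan_def by auto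
      show ?thesis
        unfolding v(3) by (intro conjI serre_pair.serre3[OF SE] serre_pair.serre3[OF SF]) (simp_all add: v(1,2))
    next
      case 2
      then have v: "B n i j = - (1/2)" "B n i i = 1" "nat (1 - cartan n i j) = 2" using ij unfolding B_value[OF i j] B_value[OF i i] cartan_def by auto
      show ?thesis
        unfolding v(3) by (intro conjI serre_pair.serre2[OF SE] serre_pair.serre2[OF SF]) (simp_all add: v(1,2))
    next
      case 3
      then have m: "nat (1 - cartan n i j) = 1" using ij by (auto simp: cartan_def)
      have b: "bas n i j [] [] [] [] [] []" by (rule bas_all[OF i j n]) (use 3 ij in auto)
      have "eq_on (Fock n) (uv (Ecur n i) (Ecur n j)) (vu (Ecur n i) (Ecur n j))"
        by (rule lk_commute[OF _ Ecur_vx[OF i n] Ecur_vx[OF j n], of "[]" "[]" "[]" "[]" 1 1]) (use b in \<open>simp_all add: bas_def LUs_def\<close>)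
      moreover have "eq_on (Fock n) (uv (Fcur n i) (Fcur n j)) (vu (Fcur n i) (Fcur n j))"
        by (rule lk_commute[OF _ Fcur_vx[OF i n] Fcur_vx[OF j n], of "[]" "[]" "[]" "[]" 1 1]) (use b in \<open>simp_all add: bas_def LUs_def\<close>)
      ultimately show ?thesis using f unfolding m serre1 by (simp add: eq_on_def uv_def vu_def)
    qed
    then show "serre (nat (1 - cartan n i j)) (Ecur n i) (Ecur n j) p q f = 0"
      "serre (nat (1 - cartan n i j)) (Fcur n i) (Fcur n j) p q f = 0" by blast+
  qed
qed

lemma vx_endo: "vx n X D \<Longrightarrow> A_endo (Fock n) (X p)"
  by (cases D) (simp add: vx_def vop_endo)

lemma relations_hold:
  assumes "2 \<le> n"
  shows "DY_relations 1 n (Fock n) (Ecur n) (Fcur n) (Hpcur n) (Hmcur n)"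
  unfolding DY_relations_def
proof (intro conjI ballI allI)
  fix i j assume i: "i \<in> {1..n}" and j: "j \<in> {1..n}"
  note r = rels_all[OF i j assms, unfolded rels_def Let_def] and s = serre_all[OF i j assms] and e = EF_all[OF i j assms]
  show "let b = B n i j in
      eq_on (Fock n) (uv (Hpcur n i) (Hpcur n j)) (vu (Hpcur n i) (Hpcur n j)) \<and>
      eq_on (Fock n) (uv (Hmcur n i) (Hmcur n j)) (vu (Hmcur n i) (Hmcur n j)) \<and>

      eq_on (Fock n) (lin (1/2 - b) \<odot> lin (- 1/2 + b) \<odot> uv (Hpcur n i) (Hmcur n j))
              (lin (1/2 + b) \<odot> lin (- 1/2 - b) \<odot> vu (Hpcur n i) (Hmcur n j)) \<and>
      eq_on (Fock n) (lin (- 1/2 - b) \<odot> lin (1/2 + b) \<odot> uv (Hmcur n i) (Hpcur n j))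
              (lin (- 1/2 + b) \<odot> lin (1/2 - b) \<odot> vu (Hmcur n i) (Hpcur n j)) \<and>

      dmul_summable (Fock n) (inv_u (- 1/4 - b)) (uv (Hpcur n i) (Ecur n j)) \<and>
      eq_on (Fock n) (vu (Hpcur n i) (Ecur n j)) (lin (- 1/4 + b) \<odot> inv_u (- 1/4 - b) \<odot> uv (Hpcur n i) (Ecur n j)) \<and>
      dmul_summable (Fock n) (inv_v (1/4 - b)) (uv (Hmcur n i) (Ecur n j)) \<and>
      eq_on (Fock n) (vu (Hmcur n i) (Ecur n j)) (lin (1/4 + b) \<odot> inv_v (1/4 - b) \<odot> uv (Hmcur n i) (Ecur n j)) \<and>

      dmul_summable (Fock n) (inv_u (1/4 - b)) (vu (Hpcur n i) (Fcur n j)) \<and>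
      eq_on (Fock n) (uv (Hpcur n i) (Fcur n j)) (lin (1/4 + b) \<odot> inv_u (1/4 - b) \<odot> vu (Hpcur n i) (Fcur n j)) \<and>
      dmul_summable (Fock n) (inv_v (- 1/4 - b)) (vu (Hmcur n i) (Fcur n j)) \<and>
      eq_on (Fock n) (uv (Hmcur n i) (Fcur n j)) (lin (- 1/4 + b) \<odot> inv_v (- 1/4 - b) \<odot> vu (Hmcur n i) (Fcur n j)) \<and>

      eq_on (Fock n) (lin b \<odot> uv (Ecur n i) (Ecur n j)) (lin (- b) \<odot> vu (Ecur n i) (Ecur n j)) \<and>
      eq_on (Fock n) (lin (- b) \<odot> uv (Fcur n i) (Fcur n j)) (lin b \<odot> vu (Fcur n i) (Fcur n j)) \<and>

      (i \<noteq> j \<longrightarrow> (let m = nat (1 - cartan n i j) in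
         \<forall>p q. \<forall>f\<in>Fock n. serre m (Ecur n i) (Ecur n j) p q f = 0 \<and> serre m (Fcur n i) (Fcur n j) p q f = 0)) \<and>

      eq_on (Fock n) (\<lambda>p q f. scal fps_X (comm (Ecur n i p) (Fcur n j q) f))
        (if i = j then
           delta (- 1/4) (1/4) \<odot> in_v (shift (1/4) (Hmcur n i))
           - delta (1/4) (- 1/4) \<odot> in_u (shift (1/4) (Hpcur n i))
         else 0)"
    unfolding Let_def using r s e by blast
qed (rule vx_endo[OF Ecur_vx[OF _ assms]] vx_endo[OF Fcur_vx[OF _ assms]] vx_endo[OF Hpcur_vx[OF _ assms]] vx_endo[OF Hmcur_vx[OF _ assms]], assumption)+


section \<open>The normalization of $H_i^\pm$\<close>

text \<open>The sector argument for a congruence modulo hbar in place of an equality of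
  operators.\<close>

lemma Sec_nth_0:
  assumes T: "A_endo (FQ n L) T" and S: "\<And>\<beta> f. \<beta> \<in> L \<Longrightarrow> f \<in> Sec n \<beta> \<Longrightarrow> fps_nth (T f) 0 = 0" and f: "f \<in> FQ n L"
  shows "fps_nth (T f) 0 = 0"
proof -
  let ?x = "fps_nth f 0"
  let ?s = "\<lambda>k. fps_const (Poly_Mapping.single k (Poly_Mapping.lookup ?x k))"
  have x: "?x \<in> RQ n L" using f by (simp add: cset_def)
  have m: "?s k \<in> Sec n (snd k)" "snd k \<in> L" if "k \<in> Poly_Mapping.keys ?x" for k
    using that x by (auto simp: RQ_def cset_def)
  have m': "?s k \<in> FQ n L" if "k \<in> Poly_Mapping.keys ?x" for k
    by (rule Sec_FQ[OF m(2,1)[OF that]])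
  have "fps_const ?x = (\<Sum>k\<in>Poly_Mapping.keys ?x. ?s k)"
    by (subst (1) poly_mapping_sum_singles[of ?x]) (rule fps_ext, simp add: fps_sum_nth)
  then have "T (fps_const ?x) = (\<Sum>k\<in>Poly_Mapping.keys ?x. T (?s k))"
    using A_endo_sum[OF T csub_RQ m'] by simp
  then have "fps_nth (T (fps_const ?x)) 0 = 0"
    using S[OF m(2,1)] by (simp add: fps_sum_nth)
  moreover have "fps_nth (T f) 0 = fps_nth (T (fps_const ?x)) 0"
    by (rule A_endo_nth_cong[OF T csub_RQ f cset_const[OF csub_RQ x], of 0]) auto
  ultimately show ?thesis by simp
qed

lemma hb_shift: "fps_nth w 0 = 0 \<Longrightarrow> hb * fps_shift 1 w = w"
  by (rule fps_ext) auto

lemma hb_cancel: "hb * v = hb * w \<Longrightarrow> v = w"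
proof (rule fps_ext)
  fix N
  assume "hb * v = hb * w"
  then have "fps_nth (hb * v) (Suc N) = fps_nth (hb * w) (Suc N)" by simp
  then show "fps_nth v N = fps_nth w N" by simp
qed

text \<open>Division by hbar preserves A-linearity, since hbar can be cancelled.\<close>

lemma endo_shift:
  assumes T: "A_endo (Fock n) T" and z: "\<And>f. f \<in> Fock n \<Longrightarrow> fps_nth (T f) 0 = 0"
  shows "A_endo (Fock n) (\<lambda>f. fps_shift 1 (T f))"
proof (rule A_endoI)
  fix f assume f: "f \<in> Fock n"
  then have "T f \<in> Fock n" by (rule A_endoD(1)[OF T])
  then show "fps_shift 1 (T f) \<in> Fock n" by (simp add: Fock_FQ cset_def)
  fix c
  have c: "sc c * f \<in> Fock n" using f unfolding Fock_FQ by (rule cset_sc[OF csub_RQ])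
  show "fps_shift 1 (T (sc c * f)) = sc c * fps_shift 1 (T f)"
  proof (rule hb_cancel)
    have "hb * fps_shift 1 (T (sc c * f)) = T (sc c * f)" by (rule hb_shift[OF z[OF c]])
    also have "\<dots> = sc c * T f" by (rule A_endoD(3)[OF T f])
    also have "\<dots> = sc c * (hb * fps_shift 1 (T f))" unfolding hb_shift[OF z[OF f]] ..
    also have "\<dots> = hb * (sc c * fps_shift 1 (T f))" by (rule mult.left_commute)
    finally show "hb * fps_shift 1 (T (sc c * f)) = hb * (sc c * fps_shift 1 (T f))" .
  qed
next
  fix f g assume "f \<in> Fock n" "g \<in> Fock n"
  then show "fps_shift 1 (T (f + g)) = fps_shift 1 (T f) + fps_shift 1 (T g)"
    by (simp add: A_endoD(2)[OF T] fps_shift_add)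
qed

lemma phi_nth_0:
  assumes "\<And>s g. 1 \<le> s \<Longrightarrow> fps_nth (Bs s g) 0 = 0" "0 < r"
  shows "fps_nth (phi Bs r g) 0 = 0"
proof -
  have "(\<Sum>s = 1..r. fps_nth (Bs s (phi Bs (r - s) g)) 0) = 0"
    by (rule sum.neutral) (auto intro: assms)
  then show ?thesis using assms(2) by (subst phi.simps) (simp add: fps_sum_nth)
qed

text \<open>The annihilation entries at -1/2 and 1/2 have opposite coefficients and agree modulo
  hbar, so each Newton operator with s >= 1 is divisible by hbar and only the coefficient r = 0
  survives. The zero modes of \<gamma> and -\<gamma> cancel in degree, which places that coefficient
  at u^0 with sign 1.\<close>

lemma Hpcur_values:
  assumes j: "j \<in> {1..n}" "2 \<le> n" "j < n" and f: "f \<in> Fock n"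
  shows "0 < p \<Longrightarrow> Hpcur n j p f = 0" "Hpcur n j 0 f = f" "p < 0 \<Longrightarrow> fps_nth (Hpcur n j p f) 0 = 0"
proof -
  define \<gamma> where "\<gamma> = (if j = n - 1 then - alpha n j - beta n 1 else - alpha n j)"
  define A :: terms where "A = [(-1, j, -1/2), (1, j, 1/2)]"
  define Z :: latt where "Z = [(1, \<gamma>, 1/2), (1, - \<gamma>, -1/2)]"
  note v = Hpcur_natural[OF j, folded \<gamma>_def, folded A_def Z_def]
  have H: "Hpcur n j p f = PH n A Z p f" if "f \<in> Fock n" for p f
    unfolding vopD(1)[OF v that] by (subst hsum_single(2)[of p]) (auto simp: MM_nil)
  have ig: "ip n \<gamma> \<beta> \<in> \<int>" if "\<beta> \<in> Q n" for \<beta> using vopD(3)[OF v] that by (auto simp: intg_simps Z_def)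
  have m: "mm n Z \<beta> = 0" "sg n Z \<beta> = 1" if "\<beta> \<in> Q n" for \<beta>
  proof -
    have "lev n (- \<gamma>) \<beta> = - lev n \<gamma> \<beta>" by (rule lev_lin(1)[OF ig[OF that]])
    then show "mm n Z \<beta> = 0" "sg n Z \<beta> = 1" by (simp_all only: Z_def mm_def sg_def list.map prod.case sum_list.Cons sum_list.Nil prod_list.Cons prod_list.Nil power_int_1_left) simp_all
  qed
  have b0: "fps_nth (Bop n A Z \<beta> s g) 0 = 0" if "1 \<le> s" for \<beta> s g
  proof -
    have a: "fps_nth (Aop1 j a s g) 0 = fps_nth (dd j s g) 0" for a
    proof -
      have "fps_nth (Aop1 j a s g) 0 = (\<Sum>k = 1..s. if k = s then fps_nth (dd j s g) 0 else 0)"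
        unfolding Aop1_def fps_sum_nth by (rule sum.cong) (auto simp: fps_mult_nth cc_def fps_X_power_nth)
      then show ?thesis using that by (simp add: sum.delta)
    qed
    have "fps_nth (cc z * hb ^ s * g) 0 = 0" for z
      using that by (simp add: fps_mult_nth cc_def fps_X_power_nth)
    then show ?thesis by (simp add: Bop_def A_def Aop_simps cc_uminus a)
  qed
  have p0: "fps_nth (phi (Bop n A Z \<beta>) r g) 0 = 0" if "0 < r" for \<beta> r g
    by (rule phi_nth_0[OF b0 that])
  note e = endo_PH[unfolded Fock_FQ]
  note ff = f[unfolded Fock_FQ]
  show "0 < p \<Longrightarrow> Hpcur n j p f = 0"
    unfolding H[OF f]
    by (rule Sec_eqI[OF e A_endo_lincomb(1)[OF csub_RQ] _ ff]) (simp add: PH_Sec m)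
  show "Hpcur n j 0 f = f"
    unfolding H[OF f]
    by (rule Sec_eqI[OF e A_endo_lincomb(2)[OF csub_RQ] _ ff]) (simp add: PH_Sec m)
  show "p < 0 \<Longrightarrow> fps_nth (Hpcur n j p f) 0 = 0"
    unfolding H[OF f] by (rule Sec_nth_0[OF e _ ff]) (simp add: PH_Sec m p0)
qed

text \<open>Modulo hbar a shift of the variable is invisible.\<close>

lemma crE_nth_0: "fps_nth (fps_nth (crE i b) p) 0 = fps_nth (fps_nth (crE i b') p) 0"
proof -
  have "fps_nth (sc (upow b (int k) (int p)) * av i k) 0 = fps_nth (sc (upow b' (int k) (int p)) * av i k) 0" for k
    by (auto simp: fps_mult_nth sc_def upow_nth)
  then have t: "fps_nth (if k = 0 then 0 else cc (1 / of_nat k) * (sc (upow b (int k) (int p)) * av i k)) 0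
      = fps_nth (if k = 0 then 0 else cc (1 / of_nat k) * (sc (upow b' (int k) (int p)) * av i k)) 0" for k
    by (simp add: fps_mult_nth)
  show ?thesis by (simp only: crE_def fps_nth_Abs_fps hsum_def t)
qed

lemma mexp_nth_0:
  assumes "\<And>p. fps_nth (fps_nth c p) 0 = 0"
  shows "fps_nth (fps_nth (mexp c) p) 0 = (if p = 0 then 1 else 0)"
proof -
  have z: "fps_nth (fps_nth (c ^ Suc m) p) 0 = 0" for m p
    by (simp add: fps_mult_nth[of c] fps_sum_nth assms)
  have "fps_nth (cc (1 / fact m) * fps_nth (c ^ m) p) 0 = (if m = 0 then (if p = 0 then 1 else 0) else 0)" for m
    using z[of "m - 1" p] by (cases m) (simp_all add: fps_mult_nth fps_one_nth)
  then show ?thesis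
    unfolding mexp_nth hsum_def fps_nth_Abs_fps by (simp add: Sum_any.delta)
qed

text \<open>Modulo hbar the creation entries cancel in pairs, and the exponential reduces to
  1.\<close>

lemma Hmcur_values:
  assumes j: "j \<in> {1..n}" "2 \<le> n" "j < n" and f: "f \<in> Fock n"
  shows "p < 0 \<Longrightarrow> Hmcur n j p f = 0" "fps_nth (Hmcur n j p f - (if p = 0 then f else 0)) 0 = 0"
proof -
  let ?C = "[(-1, j, -1), (1, j, 1), (1, j + 1, -1/2), (1, j - 1, -1/2), (-1, j + 1, 1/2), (-1, j - 1, 1/2)] :: terms"
  have H: "Hmcur n j p f = Mz (MM ?C 0) p * f" for p
    unfolding vopD(1)[OF Hmcur_natural[OF j] f] by (subst hsum_single(2)[of 0]) (auto simp: PH_nil[OF f])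
  show "p < 0 \<Longrightarrow> Hmcur n j p f = 0" by (simp add: H Mz_def)
  have e: "fps_nth (fps_nth (crE i b) p) 0 = fps_nth (fps_nth (crE i 0) p) 0" for i b p by (rule crE_nth_0)
  have "fps_nth (fps_nth (cfps ?C) p) 0 = 0" for p
    by (simp add: cfps_def cc_uminus e[of _ "-1"] e[of _ 1] e[of _ "1/2"] e[of _ "-1/2"] e[of _ "- (1/2)"])
  from mexp_nth_0[OF this] show "fps_nth (Hmcur n j p f - (if p = 0 then f else 0)) 0 = 0"
    by (auto simp: H Mz_def MM_def fps_mult_nth)
qed

lemma normalized_H:
  assumes j: "j \<in> {1..n}" "2 \<le> n" "j < n"
  shows "normalized (Fock n) (Hpcur n j) (Hmcur n j)"
proof -
  define R where "R p f = Hmcur n j p f - (if p = 0 then f else 0)" for p f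
  \<comment> \<open>Both series are 1 plus a multiple of hbar, and h is that multiple; the minus
    sign for negative r is the one in the normalization of H^-.\<close>
  define h where "h r f = (if 0 \<le> r then fps_shift 1 (Hpcur n j (- r - 1) f) else - fps_shift 1 (R (- r - 1) f))" for r :: int and f
  have id: "A_endo (Fock n) (\<lambda>f. if p = 0 then f else 0)" for p :: int
    unfolding Fock_FQ using A_endo_lincomb(1,2)[OF csub_RQ] by (cases "p = 0") simp_all
  have R: "A_endo (Fock n) (R p)" for p
    unfolding R_def[abs_def] using A_endo_lincomb(4)[OF csub_RQ vx_endo[OF Hmcur_vx[OF j(1,2)], unfolded Fock_FQ] id[unfolded Fock_FQ]]
    by (simp add: Fock_FQ)
  have endo: "A_endo (Fock n) (h r)" for r
  proof (cases "0 \<le> r")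
    case True
    have "A_endo (Fock n) (\<lambda>f. fps_shift 1 (Hpcur n j (- r - 1) f))"
      by (rule endo_shift[OF vx_endo[OF Hpcur_vx[OF j(1,2)]]]) (rule Hpcur_values(3)[OF j], use True in auto)
    then show ?thesis using True by (simp add: h_def[abs_def])
  next
    case False
    have "A_endo (Fock n) (\<lambda>f. fps_shift 1 (R (- r - 1) f))"
      by (rule endo_shift[OF R]) (simp only: R_def Hmcur_values(2)[OF j])
    then have "A_endo (Fock n) (\<lambda>f. - fps_shift 1 (R (- r - 1) f))"
      unfolding Fock_FQ by (rule A_endo_lincomb(5)[OF csub_RQ])
    then show ?thesis using False by (simp add: h_def[abs_def])
  qed
  have "Hpcur n j p f = (if p = 0 then f else 0) + (if p < 0 then scal fps_X (h (- p - 1) f) else 0) \<and>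
        Hmcur n j p f = (if p = 0 then f else 0) - (if p \<ge> 0 then scal fps_X (h (- p - 1) f) else 0)" if f: "f \<in> Fock n" for p f
  proof
    show "Hpcur n j p f = (if p = 0 then f else 0) + (if p < 0 then scal fps_X (h (- p - 1) f) else 0)"
    proof (cases p "0 :: int" rule: linorder_cases)
      case less
      then show ?thesis using hb_shift[OF Hpcur_values(3)[OF j f less]] by (simp add: h_def scal_sc)
    qed (use Hpcur_values(1,2)[OF j f] in auto)
    have "hb * fps_shift 1 (R p f) = R p f" unfolding R_def by (rule hb_shift[OF Hmcur_values(2)[OF j f]])
    then show "Hmcur n j p f = (if p = 0 then f else 0) - (if p \<ge> 0 then scal fps_X (h (- p - 1) f) else 0)"
      using Hmcur_values(1)[OF j f, of p] by (cases "0 \<le> p") (auto simp: h_def scal_sc R_def)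
  qed
  then show ?thesis unfolding normalized_def by (intro exI[of _ h]) (simp add: endo)
qed

theorem theorem7p1:
  fixes n :: nat
  assumes "n \<ge> 2"
  shows "DY_relations 1 n (Fock n) (Ecur n) (Fcur n) (Hpcur n) (Hmcur n) \<and>
         (\<forall>i\<in>{1..<n}. normalized (Fock n) (Hpcur n i) (Hmcur n i))"
  using relations_hold[OF assms] normalized_H[OF _ assms] by simp

end
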